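(* Let $B=(B_m,g_B)$ and $F=(F_k,g_F)$ be two pseudo-Riemannian manifolds of dimensions $m\ge 3$ and $k\ge 1$. Put $\overline{\mu}:=-\frac{k}{m-2}$ and $\overline{\mu}_\pm:=\overline{\mu}\pm\sqrt{\overline{\mu}^2-\overline{\mu}}$. Let $\mu\in\mathbb{R}\setminus\{0,1,\overline{\mu},\overline{\mu}_+,\overline{\mu}_-\}$ and $\psi\in C^\infty_{>0}(B)$. Then the Ricci tensor $\mathrm{Ric}$ of $B\times F$ with the metric $\psi^{2\mu}g_B+\psi^2g_F$ satisfies: $$\mathrm{Ric}=\mathrm{Ric}_B+\beta^{H}\frac{1}{\psi^{1/\alpha^{H}}}\mathrm{H}_B^{\psi^{1/\alpha^{H}}}-\beta^{\Delta}\frac{1}{\psi^{1/\alpha^{\Delta}}}\left(\Delta_B\psi^{1/\alpha^{\Delta}}\right)g_B\quad\text{on }\mathfrak{L}(B)\times\mathfrak{L}(B),$$ $$\mathrm{Ric}=0\quad\text{on }\mathfrak{L}(B)\times\mathfrak{L}(F),$$ $$\mathrm{Ric}=\mathrm{Ric}_F-\frac{1}{\psi^{2(\mu-1)}}\frac{\beta^{\Delta}}{\mu}\frac{1}{\psi^{1/\alpha^{\Delta}}}\left(\Delta_B\psi^{1/\alpha^{\Delta}}\right)g_F\quad\text{on }\mathfrak{L}(F)\times\mathfrak{L}(F),$$ where $$\alpha^{\Delta}=\frac{1}{(m-2)\mu+k},\qquad \beta^{\Delta}=\frac{\mu}{(m-2)\mu+k},$$ $$\alpha^{H}=\frac{-[(m-2)\mu+k]}{\mu[(m-2)\mu+k]+k(\mu-1)},\qquad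 \beta^{H}=\frac{[(m-2)\mu+k]^2}{\mu[(m-2)\mu+k]+k(\mu-1)}.$$
   Context: $C^\infty_{>0}(B)$ is the set of smooth positive functions on $B$. $\mathfrak{L}(B)$ and $\mathfrak{L}(F)$ denote the sets of lifts to $B\times F$ of vector fields on $B$ and on $F$, respectively; functions, metrics and tensors on $B$, $F$ are identified with their pullbacks to $B\times F$. $\mathrm{Ric}_B$, $\mathrm{Ric}_F$ are the Ricci tensors of $(B,g_B)$ and $(F,g_F)$. $\mathrm{H}_B^{v}=\nabla^B(\nabla^B v)$ is the Hessian of $v\in C^\infty(B)$, i.e. $\mathrm{H}_B^v(X,Y)=XYv-(\nabla^B_XY)v$, and $\Delta_B v$ is its $g_B$-trace (Laplace–Beltrami operator). Sign convention: $R(X,Y)Z=\nabla_X\nabla_YZ-\nabla_Y\nabla_XZ-\nabla_{[X,Y]}Z$, $\mathrm{Ric}(X,Y)=\sum_i h(E_i,E_i)\,h(R(E_i,Y)X,E_i)$ for an orthonormal frame $\{E_i\}$ of a pseudo-Riemannian metric $h$. *)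

theory Defs
  imports "HOL-Analysis.Analysis"
begin

section \<open>Smooth functions on open subsets of Euclidean spaces\<close>

fun Ck_on :: "nat \<Rightarrow> 'e::euclidean_space set \<Rightarrow> ('e \<Rightarrow> 'c::real_normed_vector) \<Rightarrow> bool" where
  "Ck_on 0 S f \<longleftrightarrow> continuous_on S f"
| "Ck_on (Suc n) S f \<longleftrightarrow>
     (\<forall>x\<in>S. f differentiable (at x)) \<and> (\<forall>v. Ck_on n S (\<lambda>x. frechet_derivative f (at x) v))"

definition Cinf_on :: "'e::euclidean_space set \<Rightarrow> ('e \<Rightarrow> 'c::real_normed_vector) \<Rightarrow> bool" where
  "Cinf_on S f \<longleftrightarrow> open S \<and> (\<forall>n. Ck_on n S f)"


section \<open>Smooth manifolds\<close>

text \<open>A chart is a pair of its domain and its coordinate map (which is irrelevant outside the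
  domain). The dimension of the manifold is the dimension of the model space \<^typ>\<open>'e\<close>.\<close>

record ('a, 'e) mfd =
  mtop :: "'a topology"
  atlas :: "('a set \<times> ('a \<Rightarrow> 'e)) set"

abbreviation points :: "('a, 'e) mfd \<Rightarrow> 'a set" where
  "points M \<equiv> topspace (mtop M)"

definition smooth_manifold :: "('a, 'e::euclidean_space) mfd \<Rightarrow> bool" where
  "smooth_manifold M \<longleftrightarrow>
     Hausdorff_space (mtop M) \<and> second_countable (mtop M) \<and>
     (\<Union>(U, \<phi>)\<in>atlas M. U) = points M \<and>
     (\<forall>(U, \<phi>)\<in>atlas M. openin (mtop M) U \<and> open (\<phi> ` U) \<and>
        homeomorphic_map (subtopology (mtop M) U) (top_of_set (\<phi> ` U)) \<phi>) \<and>
     (\<forall>(U, \<phi>)\<in>atlas M. \<forall>(V, \<xi>)\<in>atlas M. Cinf_on (\<xi> ` (U \<inter> V)) (\<phi> \<circ> inv_into V \<xi>))"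

definition smooth_fun :: "('a, 'e::euclidean_space) mfd \<Rightarrow> 'a set \<Rightarrow> ('a \<Rightarrow> real) \<Rightarrow> bool" where
  "smooth_fun M U f \<longleftrightarrow> openin (mtop M) U \<and>
     (\<forall>(V, \<phi>)\<in>atlas M. Cinf_on (\<phi> ` (U \<inter> V)) (f \<circ> inv_into V \<phi>))"

definition smooth_near :: "('a, 'e::euclidean_space) mfd \<Rightarrow> 'a \<Rightarrow> ('a \<Rightarrow> real) \<Rightarrow> bool" where
  "smooth_near M p f \<longleftrightarrow> (\<exists>U. p \<in> U \<and> smooth_fun M U f)"


section \<open>Tangent vectors and vector fields\<close>

text \<open>Tangent vectors at \<open>p\<close> act on the functions that are smooth near \<open>p\<close>. To make them
  extensional they are set to 0 on all other functions.\<close>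

type_synonym 'a tvec = "('a \<Rightarrow> real) \<Rightarrow> real"

definition coord_tvec :: "('a, 'e::euclidean_space) mfd \<Rightarrow> 'a set \<times> ('a \<Rightarrow> 'e) \<Rightarrow> 'a \<Rightarrow> 'e \<Rightarrow> 'a tvec" where
  "coord_tvec M c p u = (\<lambda>f. if smooth_near M p f
     then frechet_derivative (f \<circ> inv_into (fst c) (snd c)) (at (snd c p)) u else 0)"

definition tangent_space :: "('a, 'e::euclidean_space) mfd \<Rightarrow> 'a \<Rightarrow> 'a tvec set" where
  "tangent_space M p = {coord_tvec M c p u | c u. c \<in> atlas M \<and> p \<in> fst c}"

text \<open>Vector fields on an open set \<open>U\<close>; the values outside \<open>U\<close> are irrelevant.\<close>

definition vector_field :: "('a, 'e::euclidean_space) mfd \<Rightarrow> 'a set \<Rightarrow> ('a \<Rightarrow> 'a tvec) \<Rightarrow> bool" where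
  "vector_field M U X \<longleftrightarrow> openin (mtop M) U \<and>
     (\<forall>p\<in>U. X p \<in> tangent_space M p) \<and>
     (\<forall>V f. V \<subseteq> U \<and> smooth_fun M V f \<longrightarrow> smooth_fun M V (\<lambda>p. X p f))"

definition lie_bracket ::
  "('a, 'e::euclidean_space) mfd \<Rightarrow> ('a \<Rightarrow> 'a tvec) \<Rightarrow> ('a \<Rightarrow> 'a tvec) \<Rightarrow> 'a \<Rightarrow> 'a tvec" where
  "lie_bracket M X Y = (\<lambda>p f. if smooth_near M p f
     then X p (\<lambda>q. Y q f) - Y p (\<lambda>q. X q f) else 0)"

definition tangent_map ::
  "('b, 'n::euclidean_space) mfd \<Rightarrow> ('a \<Rightarrow> 'b) \<Rightarrow> 'a \<Rightarrow> 'a tvec \<Rightarrow> 'b tvec" where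
  "tangent_map N h p v = (\<lambda>f. if smooth_near N (h p) f then v (f \<circ> h) else 0)"


section \<open>Pseudo-Riemannian metrics and the Levi-Civita connection\<close>

type_synonym 'a metric = "'a \<Rightarrow> 'a tvec \<Rightarrow> 'a tvec \<Rightarrow> real"

definition orthonormal_at ::
  "('a, 'e::euclidean_space) mfd \<Rightarrow> 'a metric \<Rightarrow> 'a \<Rightarrow> (nat \<Rightarrow> 'a tvec) \<Rightarrow> bool" where
  "orthonormal_at M g p e \<longleftrightarrow>
     (\<forall>i<DIM('e). e i \<in> tangent_space M p) \<and>
     (\<forall>i<DIM('e). \<forall>j<DIM('e). \<bar>g p (e i) (e j)\<bar> = (if i = j then 1 else 0))"

text \<open>The last conjunct says that the metric has constant index \<open>\<nu>\<close>.\<close>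

definition pseudo_riemannian_metric :: "('a, 'e::euclidean_space) mfd \<Rightarrow> 'a metric \<Rightarrow> bool" where
  "pseudo_riemannian_metric M g \<longleftrightarrow>
     (\<forall>p\<in>points M. \<forall>u\<in>tangent_space M p. \<forall>v\<in>tangent_space M p. \<forall>w\<in>tangent_space M p. \<forall>a b.
        g p (\<lambda>f. a * u f + b * v f) w = a * g p u w + b * g p v w) \<and>
     (\<forall>p\<in>points M. \<forall>u\<in>tangent_space M p. \<forall>v\<in>tangent_space M p. g p u v = g p v u) \<and>
     (\<forall>p\<in>points M. \<forall>u\<in>tangent_space M p.
        (\<forall>v\<in>tangent_space M p. g p u v = 0) \<longrightarrow> u = (\<lambda>f. 0)) \<and>
     (\<forall>U X Y. vector_field M U X \<and> vector_field M U Y \<longrightarrow>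
        smooth_fun M U (\<lambda>p. g p (X p) (Y p))) \<and>
     (\<exists>\<nu>. \<forall>p\<in>points M. \<exists>e. orthonormal_at M g p e \<and>
        card {i. i < DIM('e) \<and> g p (e i) (e i) = -1} = \<nu>)"

definition pseudo_riemannian_manifold :: "('a, 'e::euclidean_space) mfd \<Rightarrow> 'a metric \<Rightarrow> bool" where
  "pseudo_riemannian_manifold M g \<longleftrightarrow> smooth_manifold M \<and> pseudo_riemannian_metric M g"

type_synonym 'a connection = "('a \<Rightarrow> 'a tvec) \<Rightarrow> ('a \<Rightarrow> 'a tvec) \<Rightarrow> 'a \<Rightarrow> 'a tvec"

text \<open>Connections act on the vector fields on arbitrary open sets (as they do on local frames):
  \<open>D X Y\<close> is \<open>\<nabla>\<^sub>X Y\<close> on every open set on which \<open>X\<close> and \<open>Y\<close> are vector fields.\<close>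

definition affine_connection :: "('a, 'e::euclidean_space) mfd \<Rightarrow> 'a connection \<Rightarrow> bool" where
  "affine_connection M D \<longleftrightarrow>
     (\<forall>U X Y. vector_field M U X \<and> vector_field M U Y \<longrightarrow> vector_field M U (D X Y)) \<and>
     (\<forall>U X Y Z a b. vector_field M U X \<and> vector_field M U Y \<and> vector_field M U Z \<and>
        smooth_fun M U a \<and> smooth_fun M U b \<longrightarrow>
        (\<forall>p\<in>U. D (\<lambda>q f. a q * X q f + b q * Y q f) Z p
              = (\<lambda>f. a p * D X Z p f + b p * D Y Z p f))) \<and>
     (\<forall>U X Y Z. vector_field M U X \<and> vector_field M U Y \<and> vector_field M U Z \<longrightarrow>
        (\<forall>p\<in>U. D X (\<lambda>q f. Y q f + Z q f) p = (\<lambda>f. D X Y p f + D X Z p f))) \<and>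
     (\<forall>U X Y a. vector_field M U X \<and> vector_field M U Y \<and> smooth_fun M U a \<longrightarrow>
        (\<forall>p\<in>U. D X (\<lambda>q f. a q * Y q f) p = (\<lambda>f. X p a * Y p f + a p * D X Y p f)))"

definition is_levi_civita :: "('a, 'e::euclidean_space) mfd \<Rightarrow> 'a metric \<Rightarrow> 'a connection \<Rightarrow> bool" where
  "is_levi_civita M g D \<longleftrightarrow> affine_connection M D \<and>
     (\<forall>U X Y. vector_field M U X \<and> vector_field M U Y \<longrightarrow>
        (\<forall>p\<in>U. (\<lambda>f. D X Y p f - D Y X p f) = lie_bracket M X Y p)) \<and>
     (\<forall>U X Y Z. vector_field M U X \<and> vector_field M U Y \<and> vector_field M U Z \<longrightarrow>
        (\<forall>p\<in>U. X p (\<lambda>q. g q (Y q) (Z q)) = g p (D X Y p) (Z p) + g p (Y p) (D X Z p)))"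

text \<open>For a pseudo-Riemannian metric the Levi-Civita connection exists, and its values on vector
  fields are unique; the choice only concerns arguments that are not vector fields.\<close>

definition levi_civita :: "('a, 'e::euclidean_space) mfd \<Rightarrow> 'a metric \<Rightarrow> 'a connection" where
  "levi_civita M g = (SOME D. is_levi_civita M g D)"


section \<open>Curvature, Hessian and Laplacian\<close>

definition riemann :: "('a, 'e::euclidean_space) mfd \<Rightarrow> 'a metric \<Rightarrow>
    ('a \<Rightarrow> 'a tvec) \<Rightarrow> ('a \<Rightarrow> 'a tvec) \<Rightarrow> ('a \<Rightarrow> 'a tvec) \<Rightarrow> 'a \<Rightarrow> 'a tvec" where
  "riemann M g X Y Z = (let D = levi_civita M g in
     (\<lambda>p f. D X (D Y Z) p f - D Y (D X Z) p f - D (lie_bracket M X Y) Z p f))"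

definition orthonormal_frame ::
  "('a, 'e::euclidean_space) mfd \<Rightarrow> 'a metric \<Rightarrow> 'a set \<Rightarrow> (nat \<Rightarrow> 'a \<Rightarrow> 'a tvec) \<Rightarrow> bool" where
  "orthonormal_frame M g U E \<longleftrightarrow>
     (\<forall>i<DIM('e). vector_field M U (E i)) \<and> (\<forall>q\<in>U. orthonormal_at M g q (\<lambda>i. E i q))"

text \<open>An arbitrary local orthonormal frame around \<open>p\<close>; the traces formed with it below do not depend on the
  choice.\<close>

definition frame_near :: "('a, 'e::euclidean_space) mfd \<Rightarrow> 'a metric \<Rightarrow> 'a \<Rightarrow> nat \<Rightarrow> 'a \<Rightarrow> 'a tvec" where
  "frame_near M g p = (SOME E. \<exists>U. openin (mtop M) U \<and> p \<in> U \<and> orthonormal_frame M g U E)"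

definition ricci :: "('a, 'e::euclidean_space) mfd \<Rightarrow> 'a metric \<Rightarrow>
    ('a \<Rightarrow> 'a tvec) \<Rightarrow> ('a \<Rightarrow> 'a tvec) \<Rightarrow> 'a \<Rightarrow> real" where
  "ricci M g X Y p = (let E = frame_near M g p in
     \<Sum>i<DIM('e). g p (E i p) (E i p) * g p (riemann M g (E i) Y X p) (E i p))"

definition hessian :: "('a, 'e::euclidean_space) mfd \<Rightarrow> 'a metric \<Rightarrow> ('a \<Rightarrow> real) \<Rightarrow>
    ('a \<Rightarrow> 'a tvec) \<Rightarrow> ('a \<Rightarrow> 'a tvec) \<Rightarrow> 'a \<Rightarrow> real" where
  "hessian M g v X Y p = X p (\<lambda>q. Y q v) - levi_civita M g X Y p v"

definition laplacian :: "('a, 'e::euclidean_space) mfd \<Rightarrow> 'a metric \<Rightarrow> ('a \<Rightarrow> real) \<Rightarrow> 'a \<Rightarrow> real" where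
  "laplacian M g v p = (let E = frame_near M g p in
     \<Sum>i<DIM('e). g p (E i p) (E i p) * hessian M g v (E i) (E i) p)"


section \<open>Product manifolds and lifts\<close>

definition prod_mfd :: "('b, 'm) mfd \<Rightarrow> ('f, 'k) mfd \<Rightarrow> ('b \<times> 'f, 'm \<times> 'k) mfd" where
  "prod_mfd B F = \<lparr>mtop = prod_topology (mtop B) (mtop F),
     atlas = {(U \<times> V, map_prod \<phi> \<xi>) | U \<phi> V \<xi>. (U, \<phi>) \<in> atlas B \<and> (V, \<xi>) \<in> atlas F}\<rparr>"

text \<open>The metric \<open>\<psi>\<^sup>2\<^sup>\<mu> g\<^sub>B + \<psi>\<^sup>2 g\<^sub>F\<close>, where all objects are pulled back along the projections.\<close>

definition warped_metric :: "('b, 'm::euclidean_space) mfd \<Rightarrow> 'b metric \<Rightarrow>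
    ('f, 'k::euclidean_space) mfd \<Rightarrow> 'f metric \<Rightarrow> ('b \<Rightarrow> real) \<Rightarrow> real \<Rightarrow> ('b \<times> 'f) metric" where
  "warped_metric B gB F gF \<psi> \<mu> = (\<lambda>z v w.
     \<psi> (fst z) powr (2 * \<mu>) * gB (fst z) (tangent_map B fst z v) (tangent_map B fst z w)
     + (\<psi> (fst z))\<^sup>2 * gF (snd z) (tangent_map F snd z v) (tangent_map F snd z w))"

text \<open>The lift of a vector field is tangent to the slices \<open>B \<times> {q}\<close> (respectively \<open>{p} \<times> F\<close>).\<close>

definition lift_fst :: "('b, 'm::euclidean_space) mfd \<Rightarrow> ('f, 'k::euclidean_space) mfd \<Rightarrow>
    ('b \<Rightarrow> 'b tvec) \<Rightarrow> 'b \<times> 'f \<Rightarrow> ('b \<times> 'f) tvec" where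
  "lift_fst B F X = (\<lambda>(p, q). tangent_map (prod_mfd B F) (\<lambda>x. (x, q)) p (X p))"

definition lift_snd :: "('b, 'm::euclidean_space) mfd \<Rightarrow> ('f, 'k::euclidean_space) mfd \<Rightarrow>
    ('f \<Rightarrow> 'f tvec) \<Rightarrow> 'b \<times> 'f \<Rightarrow> ('b \<times> 'f) tvec" where
  "lift_snd B F V = (\<lambda>(p, q). tangent_map (prod_mfd B F) (\<lambda>y. (p, y)) q (V q))"

end

theory Submission
  imports Defs
begin

text \<open>With \<open>L = ln \<psi>\<close>, the metric is \<open>exp (2 L) * (exp (2 (\<mu> - 1) L) g\<^sub>B + g\<^sub>F)\<close>: up to a conformal factor it is a
  direct product, whose base is itself conformal to \<open>g\<^sub>B\<close>. In dimension \<open>n\<close> the metric \<open>exp (2 \<sigma>) g\<close> has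
  the Ricci tensor \<open>Ric - (n - 2) (H\<^sub>\<sigma> - d\<sigma> d\<sigma>) - (\<Delta>\<sigma> + (n - 2) |d\<sigma>|\<^sup>2) g\<close>. This is applied twice, with
  \<open>\<sigma> = (\<mu> - 1) L\<close> on \<open>B\<close> and \<open>\<sigma> = L\<close> on \<open>B \<times> F\<close>; for a direct product all curvature terms mixing
  the two factors vanish. The result involves \<open>H\<^sub>L\<close>, \<open>\<Delta>L\<close> and terms quadratic in \<open>dL\<close>, and the
  exponents \<open>s\<close> of the statement are those for which \<open>\<psi>\<^sup>s = exp (s L)\<close> absorbs the quadratic terms, by
  \<open>H(\<psi>\<^sup>s) = \<psi>\<^sup>s (s H\<^sub>L + s\<^sup>2 dL dL)\<close>.\<close>

section \<open>Calculus of smooth functions\<close>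

text \<open>The detour through a direct product keeps every step to one change of metric; a direct
  computation would mix both connections, both dimensions and the derivatives of L at once. With A =
  (m - 2) \<mu> + k and D = \<mu> A + k (\<mu> - 1), the terms added to the Ricci tensor of the base
  are -A H_L + D dL dL - \<mu> (\<Delta>L + A |dL|^2) g_B. Matching ratios forces s = A in the
  Laplacian term, and s = -D / A with weight A^2 / D in the Hessian term. The excluded value
  \<mu>bar is the zero of A, and \<mu>bar_plus, \<mu>bar_minus are the zeros of D. The main obstacle
  lies below these formulas. Connection and frames come from choice operators and act on fields that
  are meaningful only on some open set. So the connection must be shown to exist, to be determined
  and local, and the traces to be independent of the frame, which needs smooth orthonormal frames in
  indefinite signature. Moreover the warped metric equals the conformal one only over the points of
  the manifold, so that equality has to be carried through the choices.\<close>

lemma Ck_on_subset: "Ck_on n S f \<Longrightarrow> T \<subseteq> S \<Longrightarrow> Ck_on n T f"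
  by (induction n arbitrary: f) (auto intro: continuous_on_subset)

text \<open>Openness makes agreement on \<open>S\<close> enough: \<open>frechet_derivative\<close>
  at a point sees a neighbourhood, and at each order the directional derivatives agree on the same
  \<open>S\<close> again.\<close>

lemma Ck_on_cong:
  assumes "open S" "Ck_on n S f" "\<And>x. x \<in> S \<Longrightarrow> f x = g x"
  shows "Ck_on n S g"
  using assms(2,3)
proof (induction n arbitrary: f g)
  case 0
  then show ?case by (simp cong: continuous_on_cong)
next
  case (Suc n)
  have "g differentiable (at x)" if "x \<in> S" for x
  proof -
    have "f differentiable (at x)"
      using Suc.prems(1) that by simp
    then obtain f' where "(f has_derivative f') (at x)"
      by (auto simp: differentiable_def)
    then have "(g has_derivative f') (at x)"
      using has_derivative_transform_within_open[OF _ assms(1) that] Suc.prems(2) by blast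
    then show ?thesis
      by (auto simp: differentiable_def)
  qed
  moreover have "Ck_on n S (\<lambda>x. frechet_derivative g (at x) v)" for v
  proof (rule Suc.IH)
    show "Ck_on n S (\<lambda>x. frechet_derivative f (at x) v)"
      using Suc.prems(1) by simp
    show "frechet_derivative f (at x) v = frechet_derivative g (at x) v" if "x \<in> S" for x
    proof -
      have "f differentiable (at x)"
        using Suc.prems(1) that by simp
      then show ?thesis
        using frechet_derivative_transform_within_open[OF _ assms(1) that] Suc.prems(2) by metis
    qed
  qed
  ultimately show ?case by simp
qed

text \<open>The directional derivatives in the recursion do not refer to the set, so the
  neighbourhood found for \<open>f\<close> at order \<open>Suc n\<close> also serves for its
  derivatives at order \<open>n\<close>.\<close>

lemma Ck_on_local:
  assumes "\<And>x. x \<in> S \<Longrightarrow> \<exists>T. open T \<and> x \<in> T \<and> Ck_on n T f"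
  shows "Ck_on n S f"
  using assms
proof (induction n arbitrary: f)
  case 0
  have "continuous (at x) f" if "x \<in> S" for x
  proof -
    obtain T where "open T" "x \<in> T" "Ck_on 0 T f"
      using 0[OF \<open>x \<in> S\<close>] by blast
    then show ?thesis
      using continuous_on_eq_continuous_at by auto
  qed
  then show ?case by (simp add: continuous_at_imp_continuous_on)
next
  case (Suc n)
  show ?case
  proof (unfold Ck_on.simps, intro conjI allI ballI)
    fix x assume "x \<in> S"
    then obtain T where T: "x \<in> T" "Ck_on (Suc n) T f"
      using Suc.prems by blast
    then show "f differentiable (at x)"
      by simp
  next
    show "Ck_on n S (\<lambda>x. frechet_derivative f (at x) v)" for v
    proof (rule Suc.IH)
      fix x assume "x \<in> S"
      then obtain T where "open T" "x \<in> T" "Ck_on (Suc n) T f"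
        using Suc.prems by blast
      then show "\<exists>T. open T \<and> x \<in> T \<and> Ck_on n T (\<lambda>x. frechet_derivative f (at x) v)"
        by (intro exI[of _ T]) simp
    qed
  qed
qed

lemma Ck_on_lower: "Ck_on (Suc n) S f \<Longrightarrow> Ck_on n S f"
proof (induction n arbitrary: f)
  case 0
  then show ?case
    by (auto intro!: continuous_at_imp_continuous_on differentiable_imp_continuous_within)
qed simp

text \<open>By uniqueness of derivatives, any derivative produced by the usual rules may replace
  \<open>frechet_derivative\<close> in the recursion; the closure proofs for sums, products and
  compositions pass through this.\<close>

lemma Ck_on_SucI:
  assumes "open S" "\<And>x. x \<in> S \<Longrightarrow> (f has_derivative f' x) (at x)"
    and "\<And>v. Ck_on n S (\<lambda>x. f' x v)"
  shows "Ck_on (Suc n) S f"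
proof -
  have "f' x = frechet_derivative f (at x)" if "x \<in> S" for x
    using assms(2)[OF that] by (rule frechet_derivative_at)
  then have "Ck_on n S (\<lambda>x. frechet_derivative f (at x) v)" for v
    by (intro Ck_on_cong[OF assms(1) assms(3)[of v]]) simp
  then show ?thesis
    using assms(2) by (auto simp: differentiable_def)
qed

lemma Ck_on_SucD:
  assumes "Ck_on (Suc n) S f"
  shows "x \<in> S \<Longrightarrow> (f has_derivative frechet_derivative f (at x)) (at x)"
    and "Ck_on n S (\<lambda>x. frechet_derivative f (at x) v)"
  using assms by (auto simp: frechet_derivative_works[symmetric])

section \<open>Closure of finite differentiability under algebra and composition\<close>

lemma Ck_on_const: "open S \<Longrightarrow> Ck_on n S (\<lambda>x. c)"
  by (induction n arbitrary: c) auto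

lemma Ck_on_add:
  "open S \<Longrightarrow> Ck_on n S f \<Longrightarrow> Ck_on n S g \<Longrightarrow> Ck_on n S (\<lambda>x. f x + g x)"
proof (induction n arbitrary: f g)
  case (Suc n)
  show ?case
  proof (rule Ck_on_SucI[OF Suc.prems(1)])
    show "((\<lambda>x. f x + g x) has_derivative
        (\<lambda>v. frechet_derivative f (at x) v + frechet_derivative g (at x) v)) (at x)" if "x \<in> S" for x
      by (intro has_derivative_add Ck_on_SucD(1)[OF Suc.prems(2) that] Ck_on_SucD(1)[OF Suc.prems(3) that])
    show "Ck_on n S (\<lambda>x. frechet_derivative f (at x) v + frechet_derivative g (at x) v)" for v
      by (rule Suc.IH[OF Suc.prems(1) Ck_on_SucD(2)[OF Suc.prems(2)] Ck_on_SucD(2)[OF Suc.prems(3)]])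
  qed
qed (auto intro: continuous_intros)

lemma Ck_on_linear:
  "open S \<Longrightarrow> bounded_linear L \<Longrightarrow> Ck_on n S f \<Longrightarrow> Ck_on n S (\<lambda>x. L (f x))"
proof (induction n arbitrary: f)
  case (Suc n)
  show ?case
  proof (rule Ck_on_SucI[OF Suc.prems(1)])
    show "((\<lambda>x. L (f x)) has_derivative (\<lambda>v. L (frechet_derivative f (at x) v))) (at x)"
      if "x \<in> S" for x
      by (intro bounded_linear.has_derivative[OF Suc.prems(2)] Ck_on_SucD(1)[OF Suc.prems(3) that])
    show "Ck_on n S (\<lambda>x. L (frechet_derivative f (at x) v))" for v
      by (rule Suc.IH[OF Suc.prems(1,2) Ck_on_SucD(2)[OF Suc.prems(3)]])
  qed
qed (auto intro: bounded_linear.continuous_on)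

lemma Ck_on_scaleR:
  "open S \<Longrightarrow> Ck_on n S f \<Longrightarrow> Ck_on n S g \<Longrightarrow> Ck_on n S (\<lambda>x. f x *\<^sub>R g x)"
proof (induction n arbitrary: f g)
  case (Suc n)
  show ?case
  proof (rule Ck_on_SucI)
    show "((\<lambda>x. f x *\<^sub>R g x) has_derivative
        (\<lambda>v. f x *\<^sub>R frechet_derivative g (at x) v + frechet_derivative f (at x) v *\<^sub>R g x)) (at x)"
      if "x \<in> S" for x
      by (intro has_derivative_scaleR Ck_on_SucD(1)[OF Suc.prems(2) that] Ck_on_SucD(1)[OF Suc.prems(3) that])
    show "Ck_on n S (\<lambda>x. f x *\<^sub>R frechet_derivative g (at x) v + frechet_derivative f (at x) v *\<^sub>R g x)"
      for v
      by (intro Ck_on_add[OF Suc.prems(1)] Suc.IH[OF Suc.prems(1)] Ck_on_SucD(2)[OF Suc.prems(2)]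
          Ck_on_SucD(2)[OF Suc.prems(3)] Ck_on_lower[OF Suc.prems(2)] Ck_on_lower[OF Suc.prems(3)])
  qed (rule Suc.prems)
qed (auto intro: continuous_intros)

lemma Ck_on_sum:
  "open S \<Longrightarrow> (\<And>i. i \<in> I \<Longrightarrow> Ck_on n S (f i)) \<Longrightarrow> Ck_on n S (\<lambda>x. \<Sum>i\<in>I. f i x)"
  by (induction I rule: infinite_finite_induct) (auto simp: Ck_on_const Ck_on_add)

text \<open>Induction on the order with \<open>h\<close> fixed and \<open>f\<close> varying: the
  derivative of the composition involves the partial derivatives of \<open>f\<close>, composed with
  the same \<open>h\<close> and one order lower.\<close>

lemma Ck_on_compose:
  fixes h :: "'a::euclidean_space \<Rightarrow> 'b::euclidean_space"
  assumes "open S" "open T" "h ` S \<subseteq> T"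
  shows "Ck_on n S h \<Longrightarrow> Ck_on n T f \<Longrightarrow> Ck_on n S (\<lambda>x. f (h x))"
proof (induction n arbitrary: f)
  case 0
  then show ?case
    using assms(3) continuous_on_compose2[of T f S h] by simp
next
  case (Suc n)
  let ?Df = "\<lambda>y. frechet_derivative f (at y)" and ?Dh = "\<lambda>x. frechet_derivative h (at x)"
  \<comment> \<open>Expanding the inner derivative in the basis leaves products of a scalar function
    with a partial derivative of \<open>f\<close> at \<open>h x\<close>; these are covered by the
    closure rules and the induction hypothesis.\<close>
  let ?D = "\<lambda>x v. \<Sum>b\<in>Basis. (?Dh x v \<bullet> b) *\<^sub>R ?Df (h x) b"
  have "((\<lambda>x. f (h x)) has_derivative ?D x) (at x)" if "x \<in> S" for x
  proof -
    have f: "(f has_derivative ?Df (h x)) (at (h x))" and h: "(h has_derivative ?Dh x) (at x)"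
      using Ck_on_SucD(1)[OF Suc.prems(1) that] Ck_on_SucD(1)[OF Suc.prems(2)] assms(3) that by auto
    have lin: "linear (?Df (h x))"
      using f has_derivative_linear by blast
    have "?Df (h x) (?Dh x v) = ?D x v" for v
    proof -
      have "?Df (h x) (?Dh x v) = ?Df (h x) (\<Sum>b\<in>Basis. (?Dh x v \<bullet> b) *\<^sub>R b)"
        by (simp only: euclidean_representation)
      also have "\<dots> = ?D x v"
        by (simp only: linear_sum[OF lin] linear_cmul[OF lin])
      finally show ?thesis .
    qed
    then show ?thesis
      using has_derivative_compose[OF h f] by simp
  qed
  moreover have "Ck_on n S (\<lambda>x. ?D x v)" for v
    by (intro Ck_on_sum Ck_on_scaleR assms(1) Suc.IH Ck_on_lower[OF Suc.prems(1)]
        Ck_on_linear[OF _ bounded_linear_inner_left] Ck_on_SucD(2)[OF Suc.prems(1)]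
        Ck_on_SucD(2)[OF Suc.prems(2)])
  ultimately show ?case
    using assms(1) by (intro Ck_on_SucI)
qed

section \<open>Infinitely differentiable functions\<close>

lemma Cinf_on_open: "Cinf_on S f \<Longrightarrow> open S"
  by (simp add: Cinf_on_def)

lemma Cinf_on_cong: "Cinf_on S f \<Longrightarrow> (\<And>x. x \<in> S \<Longrightarrow> f x = g x) \<Longrightarrow> Cinf_on S g"
  unfolding Cinf_on_def using Ck_on_cong by blast

lemma Cinf_on_subset: "Cinf_on S f \<Longrightarrow> open T \<Longrightarrow> T \<subseteq> S \<Longrightarrow> Cinf_on T f"
  unfolding Cinf_on_def using Ck_on_subset by blast

lemma Cinf_on_local:
  assumes "open S" "\<And>x. x \<in> S \<Longrightarrow> \<exists>T. x \<in> T \<and> Cinf_on T f"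
  shows "Cinf_on S f"
  unfolding Cinf_on_def using assms Ck_on_local by (metis Cinf_on_def)

lemma Cinf_on_const: "open S \<Longrightarrow> Cinf_on S (\<lambda>x. c)"
  by (simp add: Cinf_on_def Ck_on_const)

lemma Cinf_on_add: "Cinf_on S f \<Longrightarrow> Cinf_on S g \<Longrightarrow> Cinf_on S (\<lambda>x. f x + g x)"
  by (simp add: Cinf_on_def Ck_on_add)

lemma Cinf_on_scaleR: "Cinf_on S f \<Longrightarrow> Cinf_on S g \<Longrightarrow> Cinf_on S (\<lambda>x. f x *\<^sub>R g x)"
  by (simp add: Cinf_on_def Ck_on_scaleR)

lemma Cinf_on_mult:
  fixes f g :: "'e::euclidean_space \<Rightarrow> real"
  shows "Cinf_on S f \<Longrightarrow> Cinf_on S g \<Longrightarrow> Cinf_on S (\<lambda>x. f x * g x)"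
  using Cinf_on_scaleR[of S f g] by simp

lemma Cinf_on_linear: "bounded_linear L \<Longrightarrow> Cinf_on S f \<Longrightarrow> Cinf_on S (\<lambda>x. L (f x))"
  by (simp add: Cinf_on_def Ck_on_linear)

lemma Cinf_on_ident: "open S \<Longrightarrow> Cinf_on S (\<lambda>x. x)"
proof -
  assume S: "open S"
  have "Ck_on n S (\<lambda>x. x)" for n
  proof (cases n)
    case (Suc m)
    then show ?thesis
      using Ck_on_SucI[OF S, of "\<lambda>x. x" "\<lambda>x v. v" m] by (simp add: Ck_on_const[OF S])
  qed auto
  then show ?thesis
    using S by (simp add: Cinf_on_def)
qed

lemma Cinf_on_bounded_linear: "bounded_linear L \<Longrightarrow> open S \<Longrightarrow> Cinf_on S L"
  using Cinf_on_linear[OF _ Cinf_on_ident] by blast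

lemma Cinf_on_compose:
  fixes h :: "'a::euclidean_space \<Rightarrow> 'b::euclidean_space"
  assumes "Cinf_on S h" "Cinf_on T f" "h ` S \<subseteq> T"
  shows "Cinf_on S (\<lambda>x. f (h x))"
  using assms Ck_on_compose unfolding Cinf_on_def by blast

lemma Cinf_on_has_derivative:
  "Cinf_on S f \<Longrightarrow> x \<in> S \<Longrightarrow> (f has_derivative frechet_derivative f (at x)) (at x)"
  unfolding Cinf_on_def using Ck_on_SucD(1) by blast

lemma Cinf_on_derivative:
  "Cinf_on S f \<Longrightarrow> Cinf_on S (\<lambda>x. frechet_derivative f (at x) v)"
  unfolding Cinf_on_def using Ck_on_SucD(2) by blast

text \<open>The derivative may be expressed through \<open>f\<close> itself, as for
  \<open>exp\<close> and \<open>inverse\<close>: order \<open>n\<close> of \<open>f\<close> yields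
  order \<open>n\<close> of \<open>f'\<close>, hence order \<open>Suc n\<close> of
  \<open>f\<close>.\<close>

lemma Cinf_on_derivI:
  fixes f :: "real \<Rightarrow> real"
  assumes "open S" "\<And>x. x \<in> S \<Longrightarrow> (f has_real_derivative f' x) (at x)"
    and "\<And>n. Ck_on n S f \<Longrightarrow> Ck_on n S f'"
  shows "Cinf_on S f"
proof -
  have "Ck_on n S f" for n
  proof (induction n)
    case 0
    then show ?case
      using assms(2) by (auto intro!: continuous_at_imp_continuous_on DERIV_isCont)
  next
    case (Suc n)
    show ?case
    proof (rule Ck_on_SucI[OF assms(1)])
      show "(f has_derivative (\<lambda>v. f' x *\<^sub>R v)) (at x)" if "x \<in> S" for x
        using assms(2)[OF that] by (simp add: has_field_derivative_def)
      show "Ck_on n S (\<lambda>x. f' x *\<^sub>R v)" for v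
        by (rule Ck_on_scaleR[OF assms(1) assms(3)[OF Suc] Ck_on_const[OF assms(1)]])
    qed
  qed
  then show ?thesis
    using assms(1) by (simp add: Cinf_on_def)
qed

lemma Cinf_on_exp: "Cinf_on UNIV (exp :: real \<Rightarrow> real)"
  by (rule Cinf_on_derivI[where f' = exp]) (auto intro: derivative_intros)

lemma Cinf_on_inverse: "Cinf_on {0<..} (inverse :: real \<Rightarrow> real)"
proof (rule Cinf_on_derivI[where f' = "\<lambda>x. (- 1) *\<^sub>R (inverse x *\<^sub>R inverse x)"])
  show "(inverse has_real_derivative (- 1) *\<^sub>R (inverse x *\<^sub>R inverse x)) (at x)"
    if "x \<in> {0<..}" for x :: real
    using that by (auto intro!: derivative_eq_intros simp: power2_eq_square)
next
  show "Ck_on n {0<..} (\<lambda>x::real. (- 1) *\<^sub>R (inverse x *\<^sub>R inverse x))"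
    if "Ck_on n {0<..} (inverse :: real \<Rightarrow> real)" for n
    by (intro Ck_on_scaleR Ck_on_const that open_greaterThan)
qed auto

lemma Cinf_on_ln: "Cinf_on {0<..} (ln :: real \<Rightarrow> real)"
proof (rule Cinf_on_derivI[where f' = inverse])
  show "(ln has_real_derivative inverse x) (at x)" if "x \<in> {0<..}" for x :: real
    using that by (auto intro!: derivative_eq_intros simp: inverse_eq_divide)
qed (use Cinf_on_inverse in \<open>auto simp: Cinf_on_def\<close>)

text \<open>Two applications of the mean value theorem to the second difference of \<open>f\<close> at \<open>x\<close>.\<close>

lemma second_difference_mean_value:
  fixes f :: "'e::euclidean_space \<Rightarrow> real"
  assumes "0 < h" and box: "\<And>s t. 0 \<le> s \<Longrightarrow> s \<le> h \<Longrightarrow> 0 \<le> t \<Longrightarrow> t \<le> h \<Longrightarrow> x + s *\<^sub>R u + t *\<^sub>R v \<in> S"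
    and f: "Cinf_on S f"
  shows "\<exists>s t. 0 \<le> s \<and> s \<le> h \<and> 0 \<le> t \<and> t \<le> h \<and>
    f (x + h *\<^sub>R u + h *\<^sub>R v) - f (x + h *\<^sub>R u) - (f (x + h *\<^sub>R v) - f x) =
    h\<^sup>2 * frechet_derivative (\<lambda>y. frechet_derivative f (at y) u) (at (x + s *\<^sub>R u + t *\<^sub>R v)) v"
proof -
  let ?Df = "\<lambda>y. frechet_derivative f (at y)"
  let ?DDf = "\<lambda>y. frechet_derivative (\<lambda>y. ?Df y u) (at y)"
  define D where "D = (\<lambda>s. f (x + s *\<^sub>R u + h *\<^sub>R v) - f (x + s *\<^sub>R u))"
  have line: "((\<lambda>s. g (a + s *\<^sub>R w)) has_real_derivative frechet_derivative g (at (a + s *\<^sub>R w)) w) (at s)"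
    if "Cinf_on S g" "a + s *\<^sub>R w \<in> S" for g a w s
  proof -
    have g: "(g has_derivative frechet_derivative g (at (a + s *\<^sub>R w))) (at (a + s *\<^sub>R w))"
      using that by (rule Cinf_on_has_derivative)
    have "((\<lambda>s. a + s *\<^sub>R w) has_derivative (\<lambda>r. r *\<^sub>R w)) (at s)"
      by (auto intro!: derivative_eq_intros)
    from has_derivative_compose[OF this g] show ?thesis
      using linear_cmul[OF has_derivative_linear[OF g]]
      by (simp add: has_field_derivative_def mult_commute_abs)
  qed
  have "\<exists>s. 0 < s \<and> s < h \<and> D h - D 0 = (h - 0) * (?Df (x + s *\<^sub>R u + h *\<^sub>R v) u - ?Df (x + s *\<^sub>R u) u)"
  proof (rule MVT2[OF \<open>0 < h\<close>])
    fix s assume s: "0 \<le> s" "s \<le> h"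
    have "x + s *\<^sub>R u + h *\<^sub>R v \<in> S" "x + s *\<^sub>R u \<in> S"
      using box[OF s, of h] box[OF s, of 0] \<open>0 < h\<close> by auto
    then show "(D has_real_derivative ?Df (x + s *\<^sub>R u + h *\<^sub>R v) u - ?Df (x + s *\<^sub>R u) u) (at s)"
      unfolding D_def using line[OF f, of "x + h *\<^sub>R v" s u] line[OF f, of x s u]
      by (intro DERIV_diff) (simp_all add: algebra_simps)
  qed
  then obtain s where s: "0 < s" "s < h"
    "D h - D 0 = h * (?Df (x + s *\<^sub>R u + h *\<^sub>R v) u - ?Df (x + s *\<^sub>R u) u)"
    by auto
  have "\<exists>t. 0 < t \<and> t < h \<and> ?Df (x + s *\<^sub>R u + h *\<^sub>R v) u - ?Df (x + s *\<^sub>R u + 0 *\<^sub>R v) u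
      = (h - 0) * ?DDf (x + s *\<^sub>R u + t *\<^sub>R v) v"
    by (rule MVT2[OF \<open>0 < h\<close>, of "\<lambda>t. ?Df (x + s *\<^sub>R u + t *\<^sub>R v) u"])
      (use s in \<open>auto intro!: line Cinf_on_derivative f box\<close>)
  then obtain t where "0 < t" "t < h" "?Df (x + s *\<^sub>R u + h *\<^sub>R v) u - ?Df (x + s *\<^sub>R u) u
      = h * ?DDf (x + s *\<^sub>R u + t *\<^sub>R v) v"
    by auto
  with s show ?thesis
    by (intro exI[of _ s] exI[of _ t]) (simp add: D_def power2_eq_square)
qed

text \<open>The second difference of \<open>f\<close> over a small parallelogram is symmetric in
  \<open>u\<close> and \<open>v\<close>. It is \<open>h\<^sup>2\<close> times a mixed derivative,
  taken in either order at some nearby point, so the two mixed derivatives share values arbitrarily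
  close to \<open>x\<close>, and continuity makes them equal there.\<close>

lemma second_derivative_symmetric:
  fixes f :: "'e::euclidean_space \<Rightarrow> real"
  assumes f: "Cinf_on S f" and x: "x \<in> S"
  shows "frechet_derivative (\<lambda>y. frechet_derivative f (at y) u) (at x) v =
    frechet_derivative (\<lambda>y. frechet_derivative f (at y) v) (at x) u"
proof -
  define P where "P = (\<lambda>u v y. frechet_derivative (\<lambda>y. frechet_derivative f (at y) u) (at y) v)"
  have cont: "isCont (P u v) x" for u v
  proof -
    have "Cinf_on S (P u v)"
      unfolding P_def by (intro Cinf_on_derivative f)
    then have "continuous_on S (P u v)" "open S"
      unfolding Cinf_on_def by (auto dest: spec[of _ 0])
    then show ?thesis
      using x continuous_on_eq_continuous_at by blast
  qed
  have "\<bar>P u v x - P v u x\<bar> < e" if "0 < e" for e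
  proof -
    obtain d0 where d0: "d0 > 0" "ball x d0 \<subseteq> S"
      using f x Cinf_on_open open_contains_ball by blast
    have "\<exists>d>0. \<forall>y\<in>ball x d. \<bar>P u v y - P u v x\<bar> < e / 2" for u v
      using cont[of u v] that unfolding continuous_at_eps_delta
      by (metis dist_commute dist_real_def half_gt_zero mem_ball)
    then obtain d1 d2 where d: "d1 > 0" "d2 > 0"
      and d1: "\<And>y. y \<in> ball x d1 \<Longrightarrow> \<bar>P u v y - P u v x\<bar> < e / 2"
      and d2: "\<And>y. y \<in> ball x d2 \<Longrightarrow> \<bar>P v u y - P v u x\<bar> < e / 2"
      by metis
    define r where "r = min d0 (min d1 d2)"
    \<comment> \<open>With this side length every point of the parallelogram stays within distance
      \<open>r\<close> of \<open>x\<close>; the summand 1 keeps the denominator positive when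
      \<open>u\<close> and \<open>v\<close> vanish.\<close>
    define h where "h = r / (1 + norm u + norm v)"
    have r: "r > 0" "r \<le> d0" "r \<le> d1" "r \<le> d2"
      using d0 d by (auto simp: r_def)
    have h: "0 < h"
      unfolding h_def using r by (intro divide_pos_pos add_pos_nonneg) auto
    have ball: "x + s *\<^sub>R u + t *\<^sub>R v \<in> ball x r" if "0 \<le> s" "s \<le> h" "0 \<le> t" "t \<le> h" for s t
    proof -
      have "norm (s *\<^sub>R u + t *\<^sub>R v) \<le> s * norm u + t * norm v"
        using that norm_triangle_ineq[of "s *\<^sub>R u" "t *\<^sub>R v"] by simp
      also have "\<dots> \<le> h * norm u + h * norm v"
        using that by (intro add_mono mult_right_mono) auto
      also have "\<dots> < h * (1 + norm u + norm v)"
        using h by (simp add: algebra_simps)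
      also have "\<dots> = r"
      proof -
        have "1 + norm u + norm v \<noteq> 0"
          by (smt (verit) norm_ge_zero)
        then show ?thesis
          by (simp add: h_def)
      qed
      finally show ?thesis
        by (simp add: dist_norm algebra_simps norm_minus_commute)
    qed
    have "x + s *\<^sub>R v + t *\<^sub>R u \<in> ball x r" if "0 \<le> s" "s \<le> h" "0 \<le> t" "t \<le> h" for s t
      using ball[of t s] that by (simp add: algebra_simps)
    note ball' = this
    have S: "ball x r \<subseteq> S"
      using d0 r by auto
    obtain s t where st: "0 \<le> s" "s \<le> h" "0 \<le> t" "t \<le> h"
      "f (x + h *\<^sub>R u + h *\<^sub>R v) - f (x + h *\<^sub>R u) - (f (x + h *\<^sub>R v) - f x) = h\<^sup>2 * P u v (x + s *\<^sub>R u + t *\<^sub>R v)"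
      using second_difference_mean_value[OF h _ f, of x u v] ball S unfolding P_def by blast
    obtain s' t' where st': "0 \<le> s'" "s' \<le> h" "0 \<le> t'" "t' \<le> h"
      "f (x + h *\<^sub>R v + h *\<^sub>R u) - f (x + h *\<^sub>R v) - (f (x + h *\<^sub>R u) - f x) = h\<^sup>2 * P v u (x + s' *\<^sub>R v + t' *\<^sub>R u)"
      using second_difference_mean_value[OF h _ f, of x v u] ball' S unfolding P_def by blast
    \<comment> \<open>Both sides are the second difference over one parallelogram, whose four
      corners do not depend on the order of \<open>u\<close> and \<open>v\<close>.\<close>
    have "h\<^sup>2 * P u v (x + s *\<^sub>R u + t *\<^sub>R v) = h\<^sup>2 * P v u (x + s' *\<^sub>R v + t' *\<^sub>R u)"
    proof -
      have eq: "x + h *\<^sub>R v + h *\<^sub>R u = x + h *\<^sub>R u + h *\<^sub>R v"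
        by (simp add: algebra_simps)
      show ?thesis
        using st(5) st'(5)[unfolded eq] by linarith
    qed
    then have eq: "P u v (x + s *\<^sub>R u + t *\<^sub>R v) = P v u (x + s' *\<^sub>R v + t' *\<^sub>R u)"
      using h by simp
    have "\<bar>P u v (x + s *\<^sub>R u + t *\<^sub>R v) - P u v x\<bar> < e / 2"
      using ball[of s t] st r by (intro d1) auto
    moreover have "\<bar>P v u (x + s' *\<^sub>R v + t' *\<^sub>R u) - P v u x\<bar> < e / 2"
      using ball'[of s' t'] st' r by (intro d2) auto
    ultimately show ?thesis
      using eq by linarith
  qed
  then have "P u v x - P v u x = 0"
    by (metis abs_ge_zero less_irrefl zero_less_abs_iff)
  then show ?thesis
    by (simp add: P_def)
qed

section \<open>Smooth functions on manifolds\<close>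

locale smooth_mfd =
  fixes M :: "('a, 'e::euclidean_space) mfd"
  assumes smooth_manifold: "smooth_manifold M"
begin

lemma chart_openin: "(V, \<phi>) \<in> atlas M \<Longrightarrow> openin (mtop M) V"
  using smooth_manifold unfolding smooth_manifold_def by blast

lemma chart_homeomorphic:
  "(V, \<phi>) \<in> atlas M \<Longrightarrow> homeomorphic_map (subtopology (mtop M) V) (top_of_set (\<phi> ` V)) \<phi>"
  using smooth_manifold unfolding smooth_manifold_def by blast

lemma chart_image_open: "(V, \<phi>) \<in> atlas M \<Longrightarrow> open (\<phi> ` V)"
  using smooth_manifold unfolding smooth_manifold_def by blast

lemma chart_transition:
  "(V, \<phi>) \<in> atlas M \<Longrightarrow> (W, \<xi>) \<in> atlas M \<Longrightarrow> Cinf_on (\<xi> ` (V \<inter> W)) (\<phi> \<circ> inv_into W \<xi>)"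
  using smooth_manifold unfolding smooth_manifold_def by blast

lemma chart_exists: "p \<in> points M \<Longrightarrow> \<exists>V \<phi>. (V, \<phi>) \<in> atlas M \<and> p \<in> V"
  using smooth_manifold unfolding smooth_manifold_def by blast

lemma chart_points: "(V, \<phi>) \<in> atlas M \<Longrightarrow> p \<in> V \<Longrightarrow> p \<in> points M"
  using chart_openin openin_subset by blast

lemma chart_inj: "(V, \<phi>) \<in> atlas M \<Longrightarrow> inj_on \<phi> V"
  using homeomorphic_imp_injective_map[OF chart_homeomorphic] openin_subset[OF chart_openin]
  by (metis inf.absorb_iff2 topspace_subtopology)

lemma chart_inv: "(V, \<phi>) \<in> atlas M \<Longrightarrow> p \<in> V \<Longrightarrow> inv_into V \<phi> (\<phi> p) = p"
  using chart_inj by simp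

lemma chart_open_image:
  assumes "(V, \<phi>) \<in> atlas M" "openin (mtop M) U"
  shows "open (\<phi> ` (U \<inter> V))"
proof -
  have "openin (subtopology (mtop M) V) (U \<inter> V)"
    using assms(2) openin_subtopology by blast
  then have "openin (top_of_set (\<phi> ` V)) (\<phi> ` (U \<inter> V))"
    using homeomorphic_imp_open_map[OF chart_homeomorphic[OF assms(1)]] by (simp add: open_map_def)
  then show ?thesis
    using chart_image_open[OF assms(1)] openin_open_eq by blast
qed

lemma chart_openin_preimage:
  assumes "(V, \<phi>) \<in> atlas M" "open T"
  shows "openin (mtop M) {p \<in> V. \<phi> p \<in> T}"
proof -
  have "openin (subtopology (mtop M) V) {p \<in> topspace (subtopology (mtop M) V). \<phi> p \<in> T \<inter> \<phi> ` V}"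
    using homeomorphic_imp_continuous_map[OF chart_homeomorphic[OF assms(1)]] assms(2)
    by (intro openin_continuous_map_preimage[where Y = "top_of_set (\<phi> ` V)"])
      (auto simp: openin_open)
  then have "openin (mtop M) {p \<in> topspace (subtopology (mtop M) V). \<phi> p \<in> T \<inter> \<phi> ` V}"
    using chart_openin[OF assms(1)] openin_trans_full by blast
  also have "{p \<in> topspace (subtopology (mtop M) V). \<phi> p \<in> T \<inter> \<phi> ` V} = {p \<in> V. \<phi> p \<in> T}"
    using chart_points[OF assms(1)] by auto
  finally show ?thesis .
qed

text \<open>One chart suffices: the expression of \<open>f\<close> in any other chart is the given
  one composed with a transition map, which is smooth.\<close>

lemma smooth_nearI_chart:
  assumes c: "(V, \<phi>) \<in> atlas M" and p: "p \<in> V" "\<phi> p \<in> T" and f: "Cinf_on T (f \<circ> inv_into V \<phi>)"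
  shows "smooth_near M p f"
proof -
  define W where "W = {q \<in> V. \<phi> q \<in> T}"
  have W: "openin (mtop M) W" "W \<subseteq> V"
    using chart_openin_preimage[OF c Cinf_on_open[OF f]] by (auto simp: W_def)
  have "Cinf_on (\<xi> ` (W \<inter> V')) (f \<circ> inv_into V' \<xi>)" if c': "(V', \<xi>) \<in> atlas M" for V' \<xi>
  proof -
    have "Cinf_on (\<xi> ` (W \<inter> V')) (\<phi> \<circ> inv_into V' \<xi>)"
      using chart_open_image[OF c' W(1)] W(2)
      by (intro Cinf_on_subset[OF chart_transition[OF c c']]) auto
    moreover have "(\<phi> \<circ> inv_into V' \<xi>) ` \<xi> ` (W \<inter> V') \<subseteq> T"
      using chart_inv[OF c'] by (auto simp: W_def)
    ultimately have "Cinf_on (\<xi> ` (W \<inter> V')) (\<lambda>x. (f \<circ> inv_into V \<phi>) ((\<phi> \<circ> inv_into V' \<xi>) x))"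
      by (intro Cinf_on_compose[OF _ f])
    then show ?thesis
      by (rule Cinf_on_cong) (use chart_inv[OF c'] chart_inv[OF c] W in auto)
  qed
  then have "smooth_fun M W f"
    using W unfolding smooth_fun_def by blast
  then show ?thesis
    using p unfolding smooth_near_def by (intro exI[of _ W]) (simp add: W_def)
qed

lemma smooth_nearD_chart:
  assumes "(V, \<phi>) \<in> atlas M" "p \<in> V" "smooth_near M p f"
  obtains T where "\<phi> p \<in> T" "T \<subseteq> \<phi> ` V" "Cinf_on T (f \<circ> inv_into V \<phi>)"
proof -
  obtain U where U: "p \<in> U" "smooth_fun M U f"
    using assms(3) unfolding smooth_near_def by blast
  then have "Cinf_on (\<phi> ` (U \<inter> V)) (f \<circ> inv_into V \<phi>)"
    using assms(1) unfolding smooth_fun_def by blast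
  then show ?thesis
    using that[of "\<phi> ` (U \<inter> V)"] assms(2) U by blast
qed

lemma smooth_near_points: "smooth_near M p f \<Longrightarrow> p \<in> points M"
  unfolding smooth_near_def smooth_fun_def using openin_subset by blast

text \<open>Smoothness is local, so the closure rules below can be stated at a single point by
  \<open>smooth_near\<close>, without tracking the open sets.\<close>

lemma smooth_fun_iff: "smooth_fun M U f \<longleftrightarrow> openin (mtop M) U \<and> (\<forall>p\<in>U. smooth_near M p f)"
proof (intro iffI conjI ballI; (elim conjE)?)
  assume U: "openin (mtop M) U" and f: "\<forall>p\<in>U. smooth_near M p f"
  have "Cinf_on (\<phi> ` (U \<inter> V)) (f \<circ> inv_into V \<phi>)" if c: "(V, \<phi>) \<in> atlas M" for V \<phi>
  proof (rule Cinf_on_local[OF chart_open_image[OF c U]])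
    fix x assume "x \<in> \<phi> ` (U \<inter> V)"
    then obtain p where "x = \<phi> p" "p \<in> U" "p \<in> V"
      by blast
    then show "\<exists>T. x \<in> T \<and> Cinf_on T (f \<circ> inv_into V \<phi>)"
      using smooth_nearD_chart[OF c] f by metis
  qed
  then show "smooth_fun M U f"
    using U unfolding smooth_fun_def by blast
qed (auto simp: smooth_near_def smooth_fun_def)

section \<open>Germs of functions at a point\<close>

lemma eventually_nhdsin_open: "openin (mtop M) W \<Longrightarrow> p \<in> W \<Longrightarrow> \<forall>\<^sub>F q in nhdsin (mtop M) p. q \<in> W"
  unfolding eventually_nhdsin by blast

lemma eventually_nhdsinE:
  assumes "\<forall>\<^sub>F q in nhdsin (mtop M) p. P q" "p \<in> points M"
  obtains W where "openin (mtop M) W" "p \<in> W" "\<And>q. q \<in> W \<Longrightarrow> P q"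
  using assms unfolding eventually_nhdsin by blast

lemma smooth_near_eventually: "smooth_near M p f \<Longrightarrow> \<forall>\<^sub>F q in nhdsin (mtop M) p. smooth_near M q f"
  unfolding smooth_near_def smooth_fun_def eventually_nhdsin by blast

lemma smooth_near_cong:
  assumes "smooth_near M p f" "\<forall>\<^sub>F q in nhdsin (mtop M) p. f q = g q"
  shows "smooth_near M p g"
proof -
  obtain V \<phi> where c: "(V, \<phi>) \<in> atlas M" "p \<in> V"
    using chart_exists[OF smooth_near_points[OF assms(1)]] by blast
  obtain T where T: "\<phi> p \<in> T" "T \<subseteq> \<phi> ` V" "Cinf_on T (f \<circ> inv_into V \<phi>)"
    using smooth_nearD_chart[OF c assms(1)] .
  obtain W where W: "openin (mtop M) W" "p \<in> W" "\<And>q. q \<in> W \<Longrightarrow> f q = g q"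
    using eventually_nhdsinE[OF assms(2) smooth_near_points[OF assms(1)]] by metis
  have "Cinf_on (T \<inter> \<phi> ` (W \<inter> V)) (f \<circ> inv_into V \<phi>)"
    using T chart_open_image[OF c(1) W(1)] Cinf_on_open[OF T(3)]
    by (intro Cinf_on_subset[OF T(3)]) auto
  then have "Cinf_on (T \<inter> \<phi> ` (W \<inter> V)) (g \<circ> inv_into V \<phi>)"
    by (rule Cinf_on_cong) (use W(3) chart_inv[OF c(1)] in auto)
  then show ?thesis
    by (rule smooth_nearI_chart[OF c, rotated]) (use T(1) W(2) c(2) in simp)
qed

lemma smooth_near_cong_iff:
  assumes "\<forall>\<^sub>F q in nhdsin (mtop M) p. f q = g q"
  shows "smooth_near M p f \<longleftrightarrow> smooth_near M p g"
proof -
  have "\<forall>\<^sub>F q in nhdsin (mtop M) p. g q = f q"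
    using assms by (rule eventually_mono) simp
  then show ?thesis
    using smooth_near_cong assms by metis
qed

lemma smooth_near_const: "p \<in> points M \<Longrightarrow> smooth_near M p (\<lambda>q. c)"
proof -
  assume "p \<in> points M"
  then obtain V \<phi> where c: "(V, \<phi>) \<in> atlas M" "p \<in> V"
    using chart_exists by blast
  show ?thesis
    using c by (intro smooth_nearI_chart[OF c, of "\<phi> ` V"])
      (simp_all add: o_def Cinf_on_const chart_image_open)
qed

lemma smooth_near_binop:
  assumes "smooth_near M p f" "smooth_near M p g"
    and "\<And>T F G. Cinf_on T F \<Longrightarrow> Cinf_on T G \<Longrightarrow> Cinf_on T (\<lambda>x::'e. h (F x) (G x))"
  shows "smooth_near M p (\<lambda>q. h (f q) (g q))"
proof -
  obtain V \<phi> where c: "(V, \<phi>) \<in> atlas M" "p \<in> V"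
    using chart_exists[OF smooth_near_points[OF assms(1)]] by blast
  obtain S where S: "\<phi> p \<in> S" "Cinf_on S (f \<circ> inv_into V \<phi>)"
    using smooth_nearD_chart[OF c assms(1)] by metis
  obtain T where T: "\<phi> p \<in> T" "Cinf_on T (g \<circ> inv_into V \<phi>)"
    using smooth_nearD_chart[OF c assms(2)] by metis
  have "open (S \<inter> T)"
    using S T Cinf_on_open by blast
  then have "Cinf_on (S \<inter> T) (\<lambda>x. h ((f \<circ> inv_into V \<phi>) x) ((g \<circ> inv_into V \<phi>) x))"
    by (intro assms(3) Cinf_on_subset[OF S(2)] Cinf_on_subset[OF T(2)]) auto
  then show ?thesis
    using S T by (intro smooth_nearI_chart[OF c, of "S \<inter> T"]) (auto simp: o_def)
qed

lemma smooth_near_add: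
  "smooth_near M p f \<Longrightarrow> smooth_near M p g \<Longrightarrow> smooth_near M p (\<lambda>q. f q + g q)"
  by (erule smooth_near_binop, assumption) (rule Cinf_on_add)

lemma smooth_near_mult:
  "smooth_near M p f \<Longrightarrow> smooth_near M p g \<Longrightarrow> smooth_near M p (\<lambda>q. f q * g q)"
  by (erule smooth_near_binop, assumption) (rule Cinf_on_mult)

lemma smooth_near_diff:
  assumes "smooth_near M p f" "smooth_near M p g"
  shows "smooth_near M p (\<lambda>q. f q - g q)"
  using smooth_near_add[OF assms(1) smooth_near_mult[OF smooth_near_const[of p "-1"] assms(2)]]
    smooth_near_points[OF assms(1)] by simp

lemma smooth_near_sum:
  assumes "p \<in> points M" "\<And>i. i \<in> I \<Longrightarrow> smooth_near M p (f i)"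
  shows "smooth_near M p (\<lambda>q. \<Sum>i\<in>I. f i q)"
  using assms(2)
  by (induction I rule: infinite_finite_induct) (auto simp: smooth_near_const assms(1) smooth_near_add)

text \<open>Smooth functions are continuous. This is used to keep the square of a vector field away
  from zero near a point during orthonormalisation.\<close>

lemma smooth_near_preimage:
  assumes f: "smooth_near M p f" and "f p \<in> T" "open T"
  shows "\<forall>\<^sub>F q in nhdsin (mtop M) p. f q \<in> T"
proof -
  obtain V \<phi> where c: "(V, \<phi>) \<in> atlas M" "p \<in> V"
    using chart_exists[OF smooth_near_points[OF f]] by blast
  obtain S where S: "\<phi> p \<in> S" "Cinf_on S (f \<circ> inv_into V \<phi>)"
    using smooth_nearD_chart[OF c f] by metis
  have "continuous_on S (f \<circ> inv_into V \<phi>)" "open S"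
    using S(2) unfolding Cinf_on_def by (auto dest: spec[of _ 0])
  then have "open (S \<inter> (f \<circ> inv_into V \<phi>) -` T)"
    using \<open>open T\<close> by (simp add: continuous_open_preimage)
  from chart_openin_preimage[OF c(1) this]
  have "openin (mtop M) {q \<in> V. \<phi> q \<in> S \<inter> (f \<circ> inv_into V \<phi>) -` T}" (is "openin _ ?W") .
  moreover have "p \<in> ?W"
    using c S(1) assms(2) chart_inv[OF c] by simp
  ultimately have "\<forall>\<^sub>F q in nhdsin (mtop M) p. q \<in> ?W"
    by (rule eventually_nhdsin_open)
  then show ?thesis
    by (rule eventually_mono) (use chart_inv[OF c(1)] in auto)
qed

lemma smooth_near_compose:
  assumes f: "smooth_near M p f" and "Cinf_on T h" "f p \<in> T"
  shows "smooth_near M p (\<lambda>q. h (f q))"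
proof -
  obtain V \<phi> where c: "(V, \<phi>) \<in> atlas M" "p \<in> V"
    using chart_exists[OF smooth_near_points[OF f]] by blast
  obtain S where S: "\<phi> p \<in> S" "Cinf_on S (f \<circ> inv_into V \<phi>)"
    using smooth_nearD_chart[OF c f] by metis
  have "continuous_on S (f \<circ> inv_into V \<phi>)" "open S" "open T"
    using S(2) assms(2) unfolding Cinf_on_def by (auto dest: spec[of _ 0])
  then have "open (S \<inter> (f \<circ> inv_into V \<phi>) -` T)" (is "open ?S")
    by (simp add: continuous_open_preimage)
  then have "Cinf_on ?S (\<lambda>x. h ((f \<circ> inv_into V \<phi>) x))"
    by (intro Cinf_on_compose[OF Cinf_on_subset[OF S(2)] assms(2)]) auto
  then show ?thesis
    using S c(2) assms(3) chart_inv[OF c]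
    by (intro smooth_nearI_chart[OF c, of ?S]) (auto simp: o_def)
qed

lemma smooth_near_coord:
  assumes "(V, \<phi>) \<in> atlas M" "p \<in> V"
  shows "smooth_near M p (\<lambda>q. \<phi> q \<bullet> u)"
proof (rule smooth_nearI_chart[OF assms, of "\<phi> ` V"])
  have "Cinf_on (\<phi> ` V) (\<lambda>x. x \<bullet> u)"
    using bounded_linear_inner_left chart_image_open[OF assms(1)] by (rule Cinf_on_bounded_linear)
  then show "Cinf_on (\<phi> ` V) ((\<lambda>q. \<phi> q \<bullet> u) \<circ> inv_into V \<phi>)"
    by (rule Cinf_on_cong) (use chart_inv[OF assms(1)] in auto)
qed (use assms in auto)

section \<open>Tangent vectors\<close>

lemma coord_tvec_has_derivative:
  assumes "(V, \<phi>) \<in> atlas M" "p \<in> V" "smooth_near M p f"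
  shows "((f \<circ> inv_into V \<phi>) has_derivative (\<lambda>u. coord_tvec M (V, \<phi>) p u f)) (at (\<phi> p))"
proof -
  obtain T where "\<phi> p \<in> T" "Cinf_on T (f \<circ> inv_into V \<phi>)"
    using smooth_nearD_chart[OF assms] by metis
  then show ?thesis
    using assms(3) by (simp add: coord_tvec_def Cinf_on_has_derivative)
qed

lemma coord_tvec_eqI:
  assumes "(V, \<phi>) \<in> atlas M" "p \<in> V" "smooth_near M p f"
    and "((f \<circ> inv_into V \<phi>) has_derivative D) (at (\<phi> p))"
  shows "coord_tvec M (V, \<phi>) p u f = D u"
  using has_derivative_unique[OF coord_tvec_has_derivative[OF assms(1-3)] assms(4)] by metis

lemma coord_tvec_nonsmooth: "\<not> smooth_near M p f \<Longrightarrow> coord_tvec M c p u f = 0"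
  by (simp add: coord_tvec_def)

lemma coord_tvec_linear:
  assumes "(V, \<phi>) \<in> atlas M" "p \<in> V"
  shows "coord_tvec M (V, \<phi>) p (a *\<^sub>R u + b *\<^sub>R v) f
    = a * coord_tvec M (V, \<phi>) p u f + b * coord_tvec M (V, \<phi>) p v f"
proof (cases "smooth_near M p f")
  case True
  note lin = has_derivative_linear[OF coord_tvec_has_derivative[OF assms True]]
  show ?thesis
    using linear_add[OF lin] linear_cmul[OF lin] by simp
qed (simp add: coord_tvec_nonsmooth)

lemma coord_tvec_sum:
  assumes "(V, \<phi>) \<in> atlas M" "p \<in> V"
  shows "coord_tvec M (V, \<phi>) p (\<Sum>i\<in>I. a i *\<^sub>R u i) f = (\<Sum>i\<in>I. a i * coord_tvec M (V, \<phi>) p (u i) f)"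
proof (cases "smooth_near M p f")
  case True
  note lin = has_derivative_linear[OF coord_tvec_has_derivative[OF assms True]]
  show ?thesis
    by (simp add: linear_sum[OF lin] linear_cmul[OF lin])
qed (simp add: coord_tvec_nonsmooth)

lemma coord_tvec_cong:
  assumes c: "(V, \<phi>) \<in> atlas M" "p \<in> V" and fg: "\<forall>\<^sub>F q in nhdsin (mtop M) p. f q = g q"
  shows "coord_tvec M (V, \<phi>) p u f = coord_tvec M (V, \<phi>) p u g"
proof (cases "smooth_near M p f")
  case True
  obtain W where W: "openin (mtop M) W" "p \<in> W" "\<And>q. q \<in> W \<Longrightarrow> f q = g q"
    using eventually_nhdsinE[OF fg chart_points[OF c]] by metis
  have "((g \<circ> inv_into V \<phi>) has_derivative (\<lambda>u. coord_tvec M (V, \<phi>) p u f)) (at (\<phi> p))"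
    by (rule has_derivative_transform_within_open[OF coord_tvec_has_derivative[OF c True]
          chart_open_image[OF c(1) W(1)]])
      (use W c chart_inv[OF c(1)] in auto)
  then show ?thesis
    using coord_tvec_eqI[OF c] smooth_near_cong[OF True fg] by metis
next
  case False
  then have "\<not> smooth_near M p g"
    using smooth_near_cong_iff[OF fg] by blast
  with False show ?thesis
    by (simp add: coord_tvec_nonsmooth)
qed

text \<open>The chain rule: components of a tangent vector change by the derivative of the
  transition map. Hence the tangent space, defined by means of all charts, is the range of any
  single one of them.\<close>

lemma coord_tvec_change:
  assumes c: "(V, \<phi>) \<in> atlas M" "p \<in> V" and c': "(W, \<xi>) \<in> atlas M" "p \<in> W"
  shows "coord_tvec M (V, \<phi>) p u
    = coord_tvec M (W, \<xi>) p (frechet_derivative (\<xi> \<circ> inv_into V \<phi>) (at (\<phi> p)) u)"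
proof
  fix f
  show "coord_tvec M (V, \<phi>) p u f
    = coord_tvec M (W, \<xi>) p (frechet_derivative (\<xi> \<circ> inv_into V \<phi>) (at (\<phi> p)) u) f"
  proof (cases "smooth_near M p f")
    case True
    have tr: "Cinf_on (\<phi> ` (W \<inter> V)) (\<xi> \<circ> inv_into V \<phi>)"
      by (rule chart_transition[OF c'(1) c(1)])
    have p: "\<phi> p \<in> \<phi> ` (W \<inter> V)" "(\<xi> \<circ> inv_into V \<phi>) (\<phi> p) = \<xi> p"
      using c c' chart_inv[OF c] by auto
    have "((\<lambda>x. (f \<circ> inv_into W \<xi>) ((\<xi> \<circ> inv_into V \<phi>) x)) has_derivative
      (\<lambda>u. coord_tvec M (W, \<xi>) p (frechet_derivative (\<xi> \<circ> inv_into V \<phi>) (at (\<phi> p)) u) f)) (at (\<phi> p))"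
      by (rule has_derivative_compose[OF Cinf_on_has_derivative[OF tr p(1)]])
        (unfold p(2), rule coord_tvec_has_derivative[OF c' True])
    then have "((f \<circ> inv_into V \<phi>) has_derivative
      (\<lambda>u. coord_tvec M (W, \<xi>) p (frechet_derivative (\<xi> \<circ> inv_into V \<phi>) (at (\<phi> p)) u) f)) (at (\<phi> p))"
      by (rule has_derivative_transform_within_open[OF _ Cinf_on_open[OF tr] p(1)])
        (use chart_inv[OF c(1)] chart_inv[OF c'(1)] in auto)
    then show ?thesis
      using coord_tvec_eqI[OF c True] by metis
  qed (simp add: coord_tvec_nonsmooth)
qed

lemma tangent_space_chart:
  assumes "(V, \<phi>) \<in> atlas M" "p \<in> V"
  shows "tangent_space M p = range (coord_tvec M (V, \<phi>) p)"
proof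
  show "tangent_space M p \<subseteq> range (coord_tvec M (V, \<phi>) p)"
  proof
    fix v assume "v \<in> tangent_space M p"
    then obtain c u where "c \<in> atlas M" "p \<in> fst c" "v = coord_tvec M c p u"
      unfolding tangent_space_def by blast
    then show "v \<in> range (coord_tvec M (V, \<phi>) p)"
      using coord_tvec_change[of "fst c" "snd c" p V \<phi> u] assms by simp
  qed
  show "range (coord_tvec M (V, \<phi>) p) \<subseteq> tangent_space M p"
    using assms unfolding tangent_space_def by force
qed

lemma tangent_spaceE:
  assumes "v \<in> tangent_space M p"
  obtains V \<phi> u where "(V, \<phi>) \<in> atlas M" "p \<in> V" "v = coord_tvec M (V, \<phi>) p u"
  using assms unfolding tangent_space_def by fastforce

lemma tangent_space_points: "v \<in> tangent_space M p \<Longrightarrow> p \<in> points M"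
  by (erule tangent_spaceE) (rule chart_points)

lemma tangent_lin:
  assumes "u \<in> tangent_space M p" "v \<in> tangent_space M p"
  shows "(\<lambda>f. a * u f + b * v f) \<in> tangent_space M p"
proof -
  obtain V \<phi> where c: "(V, \<phi>) \<in> atlas M" "p \<in> V"
    using tangent_spaceE[OF assms(1)] by metis
  then obtain x y where "u = coord_tvec M (V, \<phi>) p x" "v = coord_tvec M (V, \<phi>) p y"
    using assms tangent_space_chart[OF c] by auto
  then have "(\<lambda>f. a * u f + b * v f) = coord_tvec M (V, \<phi>) p (a *\<^sub>R x + b *\<^sub>R y)"
    using coord_tvec_linear[OF c] by auto
  then show ?thesis
    using tangent_space_chart[OF c] by auto
qed

lemma tangent_zero: "p \<in> points M \<Longrightarrow> (\<lambda>f. 0) \<in> tangent_space M p"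
proof -
  assume "p \<in> points M"
  then obtain V \<phi> where c: "(V, \<phi>) \<in> atlas M" "p \<in> V"
    using chart_exists by blast
  then have "coord_tvec M (V, \<phi>) p 0 \<in> tangent_space M p"
    using tangent_space_chart[OF c] by auto
  from tangent_lin[OF this this, of 0 0] show ?thesis
    by simp
qed

lemma tangent_sum:
  assumes "p \<in> points M" "\<And>i. i \<in> I \<Longrightarrow> u i \<in> tangent_space M p"
  shows "(\<lambda>f. \<Sum>i\<in>I. a i * u i f) \<in> tangent_space M p"
  using assms(2)
proof (induction I rule: infinite_finite_induct)
  case (insert i I)
  then show ?case
    using tangent_lin[of "u i" p "\<lambda>f. \<Sum>i\<in>I. a i * u i f" "a i" 1] by auto
qed (auto simp: tangent_zero assms(1))

section \<open>Tangent vectors as derivations\<close>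

context
  fixes p v assumes v: "v \<in> tangent_space M p"
begin

text \<open>Because of the default value 0, two tangent vectors at a point are equal as soon as they
  agree on the functions that are smooth near it.\<close>

lemma tvec_nonsmooth: "\<not> smooth_near M p f \<Longrightarrow> v f = 0"
  using tangent_spaceE[OF v] coord_tvec_nonsmooth by metis

lemma tvec_cong: "\<forall>\<^sub>F q in nhdsin (mtop M) p. f q = g q \<Longrightarrow> v f = v g"
  by (rule tangent_spaceE[OF v]) (simp add: coord_tvec_cong)

lemma tvec_const: "v (\<lambda>q. c) = 0"
proof -
  obtain V \<phi> u where c': "(V, \<phi>) \<in> atlas M" "p \<in> V" "v = coord_tvec M (V, \<phi>) p u"
    using tangent_spaceE[OF v] .
  have "(\<lambda>q. c) \<circ> inv_into V \<phi> = (\<lambda>x. c)"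
    by auto
  then show ?thesis
    using coord_tvec_eqI[OF c'(1,2) smooth_near_const[OF chart_points[OF c'(1,2)]], of c "\<lambda>_. 0" u]
    by (simp add: c'(3))
qed

lemma tvec_add:
  assumes "smooth_near M p f" "smooth_near M p g"
  shows "v (\<lambda>q. f q + g q) = v f + v g"
proof -
  obtain V \<phi> u where c: "(V, \<phi>) \<in> atlas M" "p \<in> V" "v = coord_tvec M (V, \<phi>) p u"
    using tangent_spaceE[OF v] .
  have "((\<lambda>q. f q + g q) \<circ> inv_into V \<phi> has_derivative
      (\<lambda>u. coord_tvec M (V, \<phi>) p u f + coord_tvec M (V, \<phi>) p u g)) (at (\<phi> p))"
    using has_derivative_add[OF coord_tvec_has_derivative[OF c(1,2) assms(1)]
        coord_tvec_has_derivative[OF c(1,2) assms(2)]] by (simp add: o_def)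
  then show ?thesis
    using coord_tvec_eqI[OF c(1,2) smooth_near_add[OF assms]] by (simp add: c(3))
qed

lemma tvec_mult:
  assumes "smooth_near M p f" "smooth_near M p g"
  shows "v (\<lambda>q. f q * g q) = v f * g p + f p * v g"
proof -
  obtain V \<phi> u where c: "(V, \<phi>) \<in> atlas M" "p \<in> V" "v = coord_tvec M (V, \<phi>) p u"
    using tangent_spaceE[OF v] .
  have "((\<lambda>q. f q * g q) \<circ> inv_into V \<phi> has_derivative
      (\<lambda>u. f p * coord_tvec M (V, \<phi>) p u g + coord_tvec M (V, \<phi>) p u f * g p)) (at (\<phi> p))"
    using has_derivative_mult[OF coord_tvec_has_derivative[OF c(1,2) assms(1)]
        coord_tvec_has_derivative[OF c(1,2) assms(2)]] chart_inv[OF c(1,2)] by (simp add: o_def)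
  then show ?thesis
    using coord_tvec_eqI[OF c(1,2) smooth_near_mult[OF assms]] by (simp add: c(3))
qed

lemma tvec_cmult: "smooth_near M p f \<Longrightarrow> v (\<lambda>q. c * f q) = c * v f"
  using tvec_mult[OF smooth_near_const[of p c]] tangent_space_points[OF v] tvec_const by simp

lemma tvec_sum:
  assumes "\<And>i. i \<in> I \<Longrightarrow> smooth_near M p (f i)"
  shows "v (\<lambda>q. \<Sum>i\<in>I. f i q) = (\<Sum>i\<in>I. v (f i))"
  using assms
proof (induction I rule: infinite_finite_induct)
  case (insert i I)
  then show ?case
    using tvec_add[of "f i" "\<lambda>q. \<Sum>i\<in>I. f i q"] smooth_near_sum[of p I f] tangent_space_points[OF v]
    by simp
qed (simp_all add: tvec_const)

lemma tvec_compose: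
  assumes f: "smooth_near M p f" and h: "Cinf_on T h" "f p \<in> T" "(h has_real_derivative h') (at (f p))"
  shows "v (\<lambda>q. h (f q)) = h' * v f"
proof -
  obtain V \<phi> u where c: "(V, \<phi>) \<in> atlas M" "p \<in> V" "v = coord_tvec M (V, \<phi>) p u"
    using tangent_spaceE[OF v] .
  have "((\<lambda>x. h ((f \<circ> inv_into V \<phi>) x)) has_derivative (\<lambda>u. h' * coord_tvec M (V, \<phi>) p u f)) (at (\<phi> p))"
    using h(3) chart_inv[OF c(1,2)] unfolding has_field_derivative_def
    by (intro has_derivative_compose[OF coord_tvec_has_derivative[OF c(1,2) f]]) simp
  then show ?thesis
    using coord_tvec_eqI[OF c(1,2) smooth_near_compose[OF f h(1,2)]] by (simp add: c(3) o_def)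
qed

text \<open>A component of \<open>v\<close> is recovered by applying \<open>v\<close> to the
  corresponding coordinate function. This allows components to be treated as smooth functions when
  \<open>v\<close> varies in a vector field.\<close>

lemma tvec_expand:
  assumes c: "(V, \<phi>) \<in> atlas M" "p \<in> V"
  shows "v f = (\<Sum>i\<in>Basis. v (\<lambda>q. \<phi> q \<bullet> i) * coord_tvec M (V, \<phi>) p i f)"
proof -
  obtain u where u: "v = coord_tvec M (V, \<phi>) p u"
    using v tangent_space_chart[OF c] by auto
  have "v (\<lambda>q. \<phi> q \<bullet> i) = u \<bullet> i" for i
  proof -
    have "((\<lambda>q. \<phi> q \<bullet> i) \<circ> inv_into V \<phi> has_derivative (\<lambda>u. u \<bullet> i)) (at (\<phi> p))"
    proof (rule has_derivative_transform_within_open[OF _ chart_image_open[OF c(1)]])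
      show "((\<lambda>x. x \<bullet> i) has_derivative (\<lambda>u. u \<bullet> i)) (at (\<phi> p))"
        by (auto intro!: derivative_eq_intros)
    qed (use c chart_inv[OF c(1)] in auto)
    then show ?thesis
      using coord_tvec_eqI[OF c smooth_near_coord[OF c]] u by metis
  qed
  moreover have "coord_tvec M (V, \<phi>) p (\<Sum>i\<in>Basis. (u \<bullet> i) *\<^sub>R i) f
      = (\<Sum>i\<in>Basis. (u \<bullet> i) * coord_tvec M (V, \<phi>) p i f)"
    by (rule coord_tvec_sum[OF c])
  ultimately show ?thesis
    by (simp add: u euclidean_representation)
qed

end

section \<open>Vector fields\<close>

lemma vector_field_open: "vector_field M U X \<Longrightarrow> openin (mtop M) U"
  by (simp add: vector_field_def)

lemma vector_field_tangent: "vector_field M U X \<Longrightarrow> p \<in> U \<Longrightarrow> X p \<in> tangent_space M p"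
  by (simp add: vector_field_def)

lemma openin_points: "openin (mtop M) U \<Longrightarrow> p \<in> U \<Longrightarrow> p \<in> points M"
  using openin_subset by blast

lemma vector_field_smooth:
  assumes "vector_field M U X" "p \<in> U" "smooth_near M p f"
  shows "smooth_near M p (\<lambda>q. X q f)"
proof -
  obtain W where W: "p \<in> W" "smooth_fun M W f"
    using assms(3) unfolding smooth_near_def by blast
  then have "smooth_fun M (W \<inter> U) f"
    using vector_field_open[OF assms(1)] by (auto simp: smooth_fun_iff)
  then have "smooth_fun M (W \<inter> U) (\<lambda>q. X q f)"
    using assms(1) unfolding vector_field_def by blast
  then show ?thesis
    using W assms(2) unfolding smooth_near_def by blast
qed

lemma vector_fieldI:
  assumes "openin (mtop M) U" "\<And>p. p \<in> U \<Longrightarrow> X p \<in> tangent_space M p"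
    and "\<And>p f. p \<in> U \<Longrightarrow> smooth_near M p f \<Longrightarrow> smooth_near M p (\<lambda>q. X q f)"
  shows "vector_field M U X"
  using assms unfolding vector_field_def smooth_fun_iff by blast

lemma vector_field_subset:
  assumes "vector_field M U X" "openin (mtop M) W" "W \<subseteq> U"
  shows "vector_field M W X"
  using assms vector_field_tangent[OF assms(1)] vector_field_smooth[OF assms(1)]
  by (intro vector_fieldI) auto

lemma vector_field_cong:
  assumes X: "vector_field M U X" and eq: "\<And>p. p \<in> U \<Longrightarrow> X p = Y p"
  shows "vector_field M U Y"
proof (rule vector_fieldI[OF vector_field_open[OF X]])
  show "Y p \<in> tangent_space M p" if "p \<in> U" for p
    using vector_field_tangent[OF X that] eq[OF that] by simp
  show "smooth_near M p (\<lambda>q. Y q f)" if "p \<in> U" "smooth_near M p f" for p f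
    by (rule smooth_near_cong[OF vector_field_smooth[OF X that]
          eventually_mono[OF eventually_nhdsin_open[OF vector_field_open[OF X] that(1)]]])
      (simp add: eq)
qed

lemma vector_field_local:
  assumes "openin (mtop M) U" "\<And>p. p \<in> U \<Longrightarrow> \<exists>W. p \<in> W \<and> vector_field M W X"
  shows "vector_field M U X"
proof (rule vector_fieldI[OF assms(1)])
  fix p assume p: "p \<in> U"
  then obtain W where W: "p \<in> W" "vector_field M W X"
    using assms(2) by blast
  show "X p \<in> tangent_space M p"
    using vector_field_tangent[OF W(2,1)] .
  show "smooth_near M p (\<lambda>q. X q f)" if "smooth_near M p f" for f
    using vector_field_smooth[OF W(2,1) that] .
qed

lemma vector_field_lin:
  assumes X: "vector_field M U X" and Y: "vector_field M U Y"
    and a: "\<And>p. p \<in> U \<Longrightarrow> smooth_near M p a" and b: "\<And>p. p \<in> U \<Longrightarrow> smooth_near M p b"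
  shows "vector_field M U (\<lambda>q f. a q * X q f + b q * Y q f)"
  by (rule vector_fieldI[OF vector_field_open[OF X]])
    (auto intro!: tangent_lin smooth_near_add smooth_near_mult a b
      intro: vector_field_tangent[OF X] vector_field_tangent[OF Y]
        vector_field_smooth[OF X] vector_field_smooth[OF Y])

lemma vector_field_add:
  assumes X: "vector_field M U X" and Y: "vector_field M U Y"
  shows "vector_field M U (\<lambda>q f. X q f + Y q f)"
  using vector_field_lin[OF X Y smooth_near_const smooth_near_const, of 1 1]
    openin_points[OF vector_field_open[OF X]] by simp

lemma vector_field_diff:
  assumes X: "vector_field M U X" and Y: "vector_field M U Y"
  shows "vector_field M U (\<lambda>q f. X q f - Y q f)"
  using vector_field_lin[OF X Y smooth_near_const smooth_near_const, of 1 "-1"]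
    openin_points[OF vector_field_open[OF X]] by simp

lemma vector_field_scale:
  assumes X: "vector_field M U X" and a: "\<And>p. p \<in> U \<Longrightarrow> smooth_near M p a"
  shows "vector_field M U (\<lambda>q f. a q * X q f)"
  using vector_field_lin[OF X X a smooth_near_const, of 0]
    openin_points[OF vector_field_open[OF X]] by simp

lemma vector_field_zero: "openin (mtop M) U \<Longrightarrow> vector_field M U (\<lambda>q f. 0)"
  by (rule vector_fieldI) (auto intro: tangent_zero smooth_near_const openin_points)

lemma vector_field_sum:
  assumes U: "openin (mtop M) U" and X: "\<And>i. i \<in> I \<Longrightarrow> vector_field M U (X i)"
    and a: "\<And>i p. i \<in> I \<Longrightarrow> p \<in> U \<Longrightarrow> smooth_near M p (a i)"
  shows "vector_field M U (\<lambda>q f. \<Sum>i\<in>I. a i q * X i q f)"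
proof (rule vector_fieldI[OF U])
  show "(\<lambda>f. \<Sum>i\<in>I. a i p * X i p f) \<in> tangent_space M p" if "p \<in> U" for p
    by (rule tangent_sum[OF openin_points[OF U that] vector_field_tangent[OF X that]])
  show "smooth_near M p (\<lambda>q. \<Sum>i\<in>I. a i q * X i q f)" if "p \<in> U" "smooth_near M p f" for p f
    by (intro smooth_near_sum openin_points[OF U] smooth_near_mult a that vector_field_smooth[OF X])
qed

lemma vector_field_coord:
  assumes c: "(V, \<phi>) \<in> atlas M"
  shows "vector_field M V (\<lambda>q. coord_tvec M (V, \<phi>) q u)"
proof (rule vector_fieldI[OF chart_openin[OF c]])
  fix p assume p: "p \<in> V"
  show "coord_tvec M (V, \<phi>) p u \<in> tangent_space M p"
    using tangent_space_chart[OF c p] by blast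
  fix f assume f: "smooth_near M p f"
  obtain T where T: "\<phi> p \<in> T" "T \<subseteq> \<phi> ` V" "Cinf_on T (f \<circ> inv_into V \<phi>)"
    using smooth_nearD_chart[OF c p f] .
  show "smooth_near M p (\<lambda>q. coord_tvec M (V, \<phi>) q u f)"
  proof (rule smooth_nearI_chart[OF c p T(1)])
    show "Cinf_on T ((\<lambda>q. coord_tvec M (V, \<phi>) q u f) \<circ> inv_into V \<phi>)"
    proof (rule Cinf_on_cong[OF Cinf_on_derivative[OF T(3), of u]])
      fix x assume x: "x \<in> T"
      then obtain q where q: "x = \<phi> q" "q \<in> V"
        using T(2) by blast
      then have "smooth_near M q f"
        using smooth_nearI_chart[OF c _ _ T(3)] x by blast
      then show "frechet_derivative (f \<circ> inv_into V \<phi>) (at x) u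
          = ((\<lambda>q. coord_tvec M (V, \<phi>) q u f) \<circ> inv_into V \<phi>) x"
        using q chart_inv[OF c] by (simp add: coord_tvec_def)
    qed
  qed
qed

text \<open>The extension has constant components in a chart.\<close>

lemma tangent_extend:
  assumes "v \<in> tangent_space M p"
  obtains W X where "p \<in> W" "vector_field M W X" "X p = v"
  using tangent_spaceE[OF assms] vector_field_coord by metis

lemma vector_field_expand:
  assumes X: "vector_field M U X" and c: "(V, \<phi>) \<in> atlas M" and q: "q \<in> U" "q \<in> V"
  shows "X q f = (\<Sum>i\<in>Basis. X q (\<lambda>q. \<phi> q \<bullet> i) * coord_tvec M (V, \<phi>) q i f)"
  by (rule tvec_expand[OF vector_field_tangent[OF X q(1)] c q(2)])

text \<open>In the chart both sides are second directional derivatives of the local expression of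
  \<open>f\<close>, which are symmetric.\<close>

lemma coord_tvec_commute:
  assumes c: "(V, \<phi>) \<in> atlas M" and p: "p \<in> V" and f: "smooth_near M p f"
  shows "coord_tvec M (V, \<phi>) p u (\<lambda>q. coord_tvec M (V, \<phi>) q v f)
    = coord_tvec M (V, \<phi>) p v (\<lambda>q. coord_tvec M (V, \<phi>) q u f)"
proof -
  obtain T where T: "\<phi> p \<in> T" "T \<subseteq> \<phi> ` V" "Cinf_on T (f \<circ> inv_into V \<phi>)"
    using smooth_nearD_chart[OF c p f] .
  have "coord_tvec M (V, \<phi>) p u (\<lambda>q. coord_tvec M (V, \<phi>) q v f)
    = frechet_derivative (\<lambda>x. frechet_derivative (f \<circ> inv_into V \<phi>) (at x) v) (at (\<phi> p)) u" for u v
  proof (rule coord_tvec_eqI[OF c p vector_field_smooth[OF vector_field_coord[OF c] p f]])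
    show "((\<lambda>q. coord_tvec M (V, \<phi>) q v f) \<circ> inv_into V \<phi> has_derivative
      frechet_derivative (\<lambda>x. frechet_derivative (f \<circ> inv_into V \<phi>) (at x) v) (at (\<phi> p))) (at (\<phi> p))"
    proof (rule has_derivative_transform_within_open[OF
          Cinf_on_has_derivative[OF Cinf_on_derivative[OF T(3)] T(1)] Cinf_on_open[OF T(3)] T(1)])
      fix x assume x: "x \<in> T"
      then obtain q where q: "x = \<phi> q" "q \<in> V"
        using T(2) by blast
      then have "smooth_near M q f"
        using smooth_nearI_chart[OF c _ _ T(3)] x by blast
      then show "frechet_derivative (f \<circ> inv_into V \<phi>) (at x) v
          = ((\<lambda>q. coord_tvec M (V, \<phi>) q v f) \<circ> inv_into V \<phi>) x"
        using q chart_inv[OF c] by (simp add: coord_tvec_def)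
    qed
  qed
  then show ?thesis
    using second_derivative_symmetric[OF T(3,1)] by simp
qed

section \<open>The Lie bracket\<close>

lemma lie_bracket_apply:
  "smooth_near M p f \<Longrightarrow> lie_bracket M X Y p f = X p (\<lambda>q. Y q f) - Y p (\<lambda>q. X q f)"
  by (simp add: lie_bracket_def)

text \<open>The composition of two fields has a first order and a second order part. Exchanging
  \<open>X\<close> and \<open>Y\<close> preserves the second order part by
  \<open>coord_tvec_commute\<close>, so it drops out of the bracket; this is why the bracket is a
  tangent vector.\<close>

lemma iterated_expand:
  assumes X: "vector_field M U X" and Y: "vector_field M U Y"
    and c: "(V, \<phi>) \<in> atlas M" and p: "p \<in> U" "p \<in> V" and f: "smooth_near M p f"
  shows "X p (\<lambda>q. Y q f) = (\<Sum>i\<in>Basis. X p (\<lambda>q. Y q (\<lambda>q. \<phi> q \<bullet> i)) * coord_tvec M (V, \<phi>) p i f)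
    + (\<Sum>i\<in>Basis. \<Sum>j\<in>Basis. X p (\<lambda>q. \<phi> q \<bullet> j) * Y p (\<lambda>q. \<phi> q \<bullet> i) *
        coord_tvec M (V, \<phi>) p j (\<lambda>q. coord_tvec M (V, \<phi>) q i f))"
proof -
  let ?d = "coord_tvec M (V, \<phi>)" and ?x = "\<lambda>i q. \<phi> q \<bullet> i"
  note Xp = vector_field_tangent[OF X p(1)]
  have sY: "smooth_near M p (\<lambda>q. Y q (?x i))" for i
    by (rule vector_field_smooth[OF Y p(1) smooth_near_coord[OF c p(2)]])
  have sd: "smooth_near M p (\<lambda>q. ?d q i f)" for i
    by (rule vector_field_smooth[OF vector_field_coord[OF c] p(2) f])
  have "\<forall>\<^sub>F q in nhdsin (mtop M) p. q \<in> U \<inter> V"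
    using p vector_field_open[OF X] chart_openin[OF c] by (intro eventually_nhdsin_open) auto
  then have "\<forall>\<^sub>F q in nhdsin (mtop M) p. Y q f = (\<Sum>i\<in>Basis. Y q (?x i) * ?d q i f)"
    by (rule eventually_mono) (use vector_field_expand[OF Y c] in blast)
  then have "X p (\<lambda>q. Y q f) = X p (\<lambda>q. \<Sum>i\<in>Basis. Y q (?x i) * ?d q i f)"
    by (rule tvec_cong[OF Xp])
  also have "\<dots> = (\<Sum>i\<in>Basis. X p (\<lambda>q. Y q (?x i)) * ?d p i f + Y p (?x i) * X p (\<lambda>q. ?d q i f))"
    by (simp add: tvec_sum[OF Xp smooth_near_mult[OF sY sd]] tvec_mult[OF Xp sY sd])
  also have "\<dots> = (\<Sum>i\<in>Basis. X p (\<lambda>q. Y q (?x i)) * ?d p i f)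
    + (\<Sum>i\<in>Basis. Y p (?x i) * (\<Sum>j\<in>Basis. X p (?x j) * ?d p j (\<lambda>q. ?d q i f)))"
    by (simp add: sum.distrib vector_field_expand[OF X c p, symmetric])
  finally show ?thesis
    by (simp add: sum_distrib_left mult_ac)
qed

lemma lie_bracket_expand:
  assumes X: "vector_field M U X" and Y: "vector_field M U Y"
    and c: "(V, \<phi>) \<in> atlas M" and p: "p \<in> U" "p \<in> V"
  shows "lie_bracket M X Y p f
    = (\<Sum>i\<in>Basis. (X p (\<lambda>q. Y q (\<lambda>q. \<phi> q \<bullet> i)) - Y p (\<lambda>q. X q (\<lambda>q. \<phi> q \<bullet> i))) * coord_tvec M (V, \<phi>) p i f)"
proof (cases "smooth_near M p f")
  case True
  let ?d = "coord_tvec M (V, \<phi>)" and ?x = "\<lambda>i q. \<phi> q \<bullet> i"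
  \<comment> \<open>Renaming the two summation indices and commuting the coordinate derivatives
    identifies the second order parts.\<close>
  have "(\<Sum>i\<in>Basis. \<Sum>j\<in>Basis. Y p (?x j) * X p (?x i) * ?d p j (\<lambda>q. ?d q i f))
    = (\<Sum>i\<in>Basis. \<Sum>j\<in>Basis. X p (?x j) * Y p (?x i) * ?d p j (\<lambda>q. ?d q i f))"
    by (subst sum.swap) (simp add: coord_tvec_commute[OF c p(2) True] mult_ac)
  then show ?thesis
    using iterated_expand[OF X Y c p True] iterated_expand[OF Y X c p True]
    by (simp add: lie_bracket_apply[OF True] left_diff_distrib sum_subtractf)
qed (simp add: lie_bracket_def coord_tvec_nonsmooth)

lemma lie_bracket_tangent:
  assumes "vector_field M U X" "vector_field M U Y" "p \<in> U"
  shows "lie_bracket M X Y p \<in> tangent_space M p"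
proof -
  have p: "p \<in> points M"
    using assms vector_field_open openin_points by blast
  then obtain V \<phi> where c: "(V, \<phi>) \<in> atlas M" "p \<in> V"
    using chart_exists by blast
  have "lie_bracket M X Y p
    = (\<lambda>f. \<Sum>i\<in>Basis. (X p (\<lambda>q. Y q (\<lambda>q. \<phi> q \<bullet> i)) - Y p (\<lambda>q. X q (\<lambda>q. \<phi> q \<bullet> i))) * coord_tvec M (V, \<phi>) p i f)"
    using lie_bracket_expand[OF assms(1,2) c(1) assms(3) c(2)] by blast
  also have "\<dots> \<in> tangent_space M p"
    by (rule tangent_sum[OF p]) (use tangent_space_chart[OF c] in blast)
  finally show ?thesis .
qed

lemma vector_field_lie_bracket:
  assumes X: "vector_field M U X" and Y: "vector_field M U Y"
  shows "vector_field M U (lie_bracket M X Y)"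
proof (rule vector_fieldI[OF vector_field_open[OF X] lie_bracket_tangent[OF X Y]])
  fix p f assume p: "p \<in> U" and f: "smooth_near M p f"
  have "smooth_near M p (\<lambda>q. X q (\<lambda>r. Y r f) - Y q (\<lambda>r. X r f))"
    by (intro smooth_near_diff vector_field_smooth[OF X p] vector_field_smooth[OF Y p] f)
  then show "smooth_near M p (\<lambda>q. lie_bracket M X Y q f)"
    by (rule smooth_near_cong)
      (rule eventually_mono[OF smooth_near_eventually[OF f]], simp add: lie_bracket_apply)
qed

lemma lie_bracket_cong:
  assumes "vector_field M U X" "vector_field M U Y" "p \<in> U"
    and "\<And>q. q \<in> U \<Longrightarrow> X q = X' q" "\<And>q. q \<in> U \<Longrightarrow> Y q = Y' q"
  shows "lie_bracket M X Y p = lie_bracket M X' Y' p"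
proof
  fix f
  have ev: "\<forall>\<^sub>F q in nhdsin (mtop M) p. q \<in> U"
    using vector_field_open[OF assms(1)] assms(3) by (rule eventually_nhdsin_open)
  have "X p (\<lambda>q. Y q f) = X p (\<lambda>q. Y' q f)"
    by (rule tvec_cong[OF vector_field_tangent[OF assms(1,3)] eventually_mono[OF ev]])
      (simp add: assms(5))
  moreover have "Y p (\<lambda>q. X q f) = Y p (\<lambda>q. X' q f)"
    by (rule tvec_cong[OF vector_field_tangent[OF assms(2,3)] eventually_mono[OF ev]])
      (simp add: assms(4))
  ultimately show "lie_bracket M X Y p f = lie_bracket M X' Y' p f"
    using assms(4,5)[OF assms(3)] by (simp add: lie_bracket_def)
qed

lemma lie_bracket_antisym: "lie_bracket M Y X p = (\<lambda>f. - lie_bracket M X Y p f)"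
  by (auto simp: lie_bracket_def)

lemma lie_bracket_add:
  assumes "vector_field M U X" "vector_field M U Y" "vector_field M U Z" "p \<in> U"
  shows "lie_bracket M X (\<lambda>q f. Y q f + Z q f) p
    = (\<lambda>f. lie_bracket M X Y p f + lie_bracket M X Z p f)"
proof
  fix f show "lie_bracket M X (\<lambda>q f. Y q f + Z q f) p f = lie_bracket M X Y p f + lie_bracket M X Z p f"
    using tvec_add[OF vector_field_tangent[OF assms(1,4)] vector_field_smooth[OF assms(2,4)]
        vector_field_smooth[OF assms(3,4)], of f f]
    by (simp add: lie_bracket_def)
qed

lemma lie_bracket_scale:
  assumes X: "vector_field M U X" and Y: "vector_field M U Y" and p: "p \<in> U" and a: "smooth_near M p a"
  shows "lie_bracket M X (\<lambda>q f. a q * Y q f) p = (\<lambda>f. X p a * Y p f + a p * lie_bracket M X Y p f)"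
proof
  fix f
  show "lie_bracket M X (\<lambda>q f. a q * Y q f) p f = X p a * Y p f + a p * lie_bracket M X Y p f"
  proof (cases "smooth_near M p f")
    case True
    then show ?thesis
      using tvec_mult[OF vector_field_tangent[OF X p] a vector_field_smooth[OF Y p True]]
      by (simp add: lie_bracket_apply algebra_simps)
  next
    case False
    then show ?thesis
      using tvec_nonsmooth[OF vector_field_tangent[OF Y p]] by (simp add: lie_bracket_def)
  qed
qed

end

section \<open>Metrics and orthonormal frames\<close>

text \<open>Nondegeneracy is contained in the existence of orthonormal bases.\<close>

locale metric_mfd = smooth_mfd M for M :: "('a, 'e::euclidean_space) mfd" +
  fixes g :: "'a metric"
  assumes metric_lin: "u \<in> tangent_space M p \<Longrightarrow> v \<in> tangent_space M p \<Longrightarrow> w \<in> tangent_space M p \<Longrightarrow>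
      g p (\<lambda>f. a * u f + b * v f) w = a * g p u w + b * g p v w"
    and metric_sym: "u \<in> tangent_space M p \<Longrightarrow> v \<in> tangent_space M p \<Longrightarrow> g p u v = g p v u"
    and metric_smooth: "vector_field M U X \<Longrightarrow> vector_field M U Y \<Longrightarrow> p \<in> U \<Longrightarrow>
      smooth_near M p (\<lambda>q. g q (X q) (Y q))"
    and metric_orthonormal: "p \<in> points M \<Longrightarrow> \<exists>e. orthonormal_at M g p e"

lemma pseudo_riemannian_metric_mfd:
  assumes "pseudo_riemannian_manifold M g"
  shows "metric_mfd M g"
proof -
  interpret smooth_mfd M
    using assms by unfold_locales (simp add: pseudo_riemannian_manifold_def)
  have g: "pseudo_riemannian_metric M g"
    using assms by (simp add: pseudo_riemannian_manifold_def)
  show ?thesis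
  proof unfold_locales
    fix u v w p a b
    assume T: "u \<in> tangent_space M p" "v \<in> tangent_space M p" "w \<in> tangent_space M p"
    then have "p \<in> points M"
      using tangent_space_points by blast
    then show "g p (\<lambda>f. a * u f + b * v f) w = a * g p u w + b * g p v w"
      using g T unfolding pseudo_riemannian_metric_def by blast
  next
    fix u v p
    assume T: "u \<in> tangent_space M p" "v \<in> tangent_space M p"
    then have "p \<in> points M"
      using tangent_space_points by blast
    then show "g p u v = g p v u"
      using g T unfolding pseudo_riemannian_metric_def by blast
  next
    fix U X Y p
    assume "vector_field M U X" "vector_field M U Y" "p \<in> U"
    then show "smooth_near M p (\<lambda>q. g q (X q) (Y q))"
      using g unfolding pseudo_riemannian_metric_def smooth_fun_iff by blast
  next
    show "p \<in> points M \<Longrightarrow> \<exists>e. orthonormal_at M g p e" for p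
      using g unfolding pseudo_riemannian_metric_def by blast
  qed
qed

text \<open>Half of the right-hand side of the Koszul formula: the value that metric compatibility
  and vanishing torsion force on the inner product of \<open>\<nabla>\<^sub>X Y\<close> with
  \<open>Z\<close>.\<close>

definition koszul :: "('a, 'e::euclidean_space) mfd \<Rightarrow> 'a metric \<Rightarrow>
    ('a \<Rightarrow> 'a tvec) \<Rightarrow> ('a \<Rightarrow> 'a tvec) \<Rightarrow> ('a \<Rightarrow> 'a tvec) \<Rightarrow> 'a \<Rightarrow> real" where
  "koszul M g X Y Z p = (X p (\<lambda>q. g q (Y q) (Z q)) + Y p (\<lambda>q. g q (Z q) (X q)) - Z p (\<lambda>q. g q (X q) (Y q))
     + g p (lie_bracket M X Y p) (Z p) - g p (lie_bracket M Y Z p) (X p) + g p (lie_bracket M Z X p) (Y p)) / 2"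

text \<open>The inner product of the gradients of \<open>u\<close> and \<open>v\<close>, written as
  the trace of du dv, so that independence of the frame is an instance of the general statement on
  traces.\<close>

definition gradient_inner ::
  "('a, 'e::euclidean_space) mfd \<Rightarrow> 'a metric \<Rightarrow> ('a \<Rightarrow> real) \<Rightarrow> ('a \<Rightarrow> real) \<Rightarrow> 'a \<Rightarrow> real" where
  "gradient_inner M g u v p = (let E = frame_near M g p in
     \<Sum>i<DIM('e). g p (E i p) (E i p) * (E i p u * E i p v))"

context metric_mfd
begin

lemma metric_lin2:
  assumes "u \<in> tangent_space M p" "v \<in> tangent_space M p" "w \<in> tangent_space M p"
  shows "g p w (\<lambda>f. a * u f + b * v f) = a * g p w u + b * g p w v"
  using metric_lin[OF assms] metric_sym[OF assms(3) tangent_lin[OF assms(1,2)]]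
    metric_sym[OF assms(3,1)] metric_sym[OF assms(3,2)] by simp

lemma metric_add:
  assumes "u \<in> tangent_space M p" "v \<in> tangent_space M p" "w \<in> tangent_space M p"
  shows "g p (\<lambda>f. u f + v f) w = g p u w + g p v w" "g p w (\<lambda>f. u f + v f) = g p w u + g p w v"
  using metric_lin[OF assms, of 1 1] metric_lin2[OF assms, of 1 1] by simp_all

lemma metric_scale:
  assumes "u \<in> tangent_space M p" "w \<in> tangent_space M p"
  shows "g p (\<lambda>f. a * u f) w = a * g p u w" "g p w (\<lambda>f. a * u f) = a * g p w u"
  using metric_lin[OF assms(1,1,2), of a 0] metric_lin2[OF assms(1,1,2), of a 0] by simp_all

lemma metric_diff:
  assumes "u \<in> tangent_space M p" "v \<in> tangent_space M p" "w \<in> tangent_space M p"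
  shows "g p (\<lambda>f. u f - v f) w = g p u w - g p v w" "g p w (\<lambda>f. u f - v f) = g p w u - g p w v"
  using metric_lin[OF assms, of 1 "-1"] metric_lin2[OF assms, of 1 "-1"] by simp_all

lemma metric_minus:
  assumes "u \<in> tangent_space M p" "w \<in> tangent_space M p"
  shows "g p (\<lambda>f. - u f) w = - g p u w" "g p w (\<lambda>f. - u f) = - g p w u"
  using metric_scale[OF assms, of "-1"] by simp_all

lemma metric_zero:
  assumes "w \<in> tangent_space M p"
  shows "g p (\<lambda>f. 0) w = 0" "g p w (\<lambda>f. 0) = 0"
  using metric_scale[OF assms assms, of 0] by simp_all

lemma metric_sum:
  assumes w: "w \<in> tangent_space M p" and u: "\<And>i. i \<in> I \<Longrightarrow> u i \<in> tangent_space M p"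
  shows "g p (\<lambda>f. \<Sum>i\<in>I. a i * u i f) w = (\<Sum>i\<in>I. a i * g p (u i) w)"
  using u
proof (induction I rule: infinite_finite_induct)
  case (insert i I)
  have "(\<lambda>f. \<Sum>i\<in>I. a i * u i f) \<in> tangent_space M p"
    using insert.prems by (intro tangent_sum tangent_space_points[OF w]) auto
  then show ?case
    using insert metric_lin[of "u i" p "\<lambda>f. \<Sum>i\<in>I. a i * u i f" w "a i" 1] w by simp
qed (simp_all add: metric_zero[OF w])

lemma orthonormal_atD:
  assumes "orthonormal_at M g p e"
  shows "i < DIM('e) \<Longrightarrow> e i \<in> tangent_space M p"
    and "i < DIM('e) \<Longrightarrow> j < DIM('e) \<Longrightarrow> i \<noteq> j \<Longrightarrow> g p (e i) (e j) = 0"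
    and "i < DIM('e) \<Longrightarrow> g p (e i) (e i) * g p (e i) (e i) = 1"
proof -
  show "i < DIM('e) \<Longrightarrow> e i \<in> tangent_space M p"
    using assms unfolding orthonormal_at_def by blast
  show "i < DIM('e) \<Longrightarrow> j < DIM('e) \<Longrightarrow> i \<noteq> j \<Longrightarrow> g p (e i) (e j) = 0"
    using assms unfolding orthonormal_at_def by (metis abs_eq_0)
  assume "i < DIM('e)"
  then have "\<bar>g p (e i) (e i)\<bar> = 1"
    using assms unfolding orthonormal_at_def by simp
  then show "g p (e i) (e i) * g p (e i) (e i) = 1"
    by (metis abs_mult_self_eq mult_1)
qed

text \<open>Writing \<open>e i\<close> in a chart, the coefficient map \<open>L\<close> is a left inverse of the combination
  map \<open>R\<close>; as both act on \<open>'e\<close>, \<open>R\<close> is onto.\<close>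

lemma orthonormal_expand:
  assumes e: "orthonormal_at M g p e" and v: "v \<in> tangent_space M p"
  shows "v = (\<lambda>f. \<Sum>i<DIM('e). (g p (e i) (e i) * g p v (e i)) * e i f)"
proof -
  obtain V \<phi> where c: "(V, \<phi>) \<in> atlas M" "p \<in> V"
    using tangent_spaceE[OF v] by metis
  let ?d = "coord_tvec M (V, \<phi>) p"
  note eT = orthonormal_atD(1)[OF e]
  have "\<forall>i. \<exists>x. i < DIM('e) \<longrightarrow> e i = ?d x"
    using eT tangent_space_chart[OF c] by (metis imageE)
  then obtain x where x: "\<And>i. i < DIM('e) \<Longrightarrow> e i = ?d (x i)"
    by metis
  obtain b :: "nat \<Rightarrow> 'e" where "bij_betw b {0..<DIM('e)} Basis"
    using ex_bij_betw_nat_finite[OF finite_Basis] by blast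
  then have b: "bij_betw b {..<DIM('e)} Basis"
    by (simp add: atLeast0LessThan)
  define R where "R = (\<lambda>y. \<Sum>i<DIM('e). (y \<bullet> b i) *\<^sub>R x i)"
  have dR: "?d (R y) f = (\<Sum>i<DIM('e). (y \<bullet> b i) * e i f)" for y f
    unfolding R_def using x by (simp add: coord_tvec_sum[OF c])
  have coeff: "g p (?d (R y)) (e j) = (y \<bullet> b j) * g p (e j) (e j)" if j: "j < DIM('e)" for y j
  proof -
    have "g p (?d (R y)) (e j) = g p (\<lambda>f. \<Sum>i<DIM('e). (y \<bullet> b i) * e i f) (e j)"
      using dR by presburger
    also have "\<dots> = (\<Sum>i<DIM('e). (y \<bullet> b i) * g p (e i) (e j))"
      by (intro metric_sum eT j) simp
    also have "\<dots> = (\<Sum>i<DIM('e). if i = j then (y \<bullet> b j) * g p (e j) (e j) else 0)"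
      using orthonormal_atD(2)[OF e] j by (intro sum.cong) auto
    finally show ?thesis
      using j by simp
  qed
  have "linear R"
    unfolding R_def by (intro linear_compose_sum ballI linearI)
      (simp_all add: inner_add_left scaleR_add_left)
  moreover have "inj R"
  proof (rule injI)
    fix y z assume "R y = R z"
    then have "(y \<bullet> b j) * g p (e j) (e j) = (z \<bullet> b j) * g p (e j) (e j)" if "j < DIM('e)" for j
      using coeff[OF that] by metis
    moreover have "g p (e j) (e j) \<noteq> 0" if "j < DIM('e)" for j
      using orthonormal_atD(3)[OF e that] by auto
    ultimately have "y \<bullet> b j = z \<bullet> b j" if "j < DIM('e)" for j
      using that by simp
    moreover have "\<exists>j<DIM('e). c = b j" if "c \<in> Basis" for c
      using bij_betw_imp_surj_on[OF b] that by (metis (no_types) imageE lessThan_iff)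
    ultimately show "y = z"
      by (metis euclidean_eqI)
  qed
  ultimately have "surj R"
    using linear_injective_imp_surjective by blast
  then obtain y where y: "v = ?d (R y)"
    using v tangent_space_chart[OF c] by (metis imageE surjD)
  show ?thesis
  proof
    fix f
    have "g p (e i) (e i) * g p v (e i) = y \<bullet> b i" if "i < DIM('e)" for i
      using coeff[OF that] orthonormal_atD(3)[OF e that] by (simp add: y)
    then show "v f = (\<Sum>i<DIM('e). (g p (e i) (e i) * g p v (e i)) * e i f)"
      using dR by (simp add: y)
  qed
qed

lemma orthonormal_inner_expand:
  assumes e: "orthonormal_at M g p e" and u: "u \<in> tangent_space M p" and v: "v \<in> tangent_space M p"
  shows "g p u v = (\<Sum>i<DIM('e). g p (e i) (e i) * g p u (e i) * g p (e i) v)"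
proof -
  have "g p u v = g p (\<lambda>f. \<Sum>i<DIM('e). (g p (e i) (e i) * g p u (e i)) * e i f) v"
    using orthonormal_expand[OF e u] by simp
  also have "\<dots> = (\<Sum>i<DIM('e). (g p (e i) (e i) * g p u (e i)) * g p (e i) v)"
    by (intro metric_sum v orthonormal_atD(1)[OF e]) simp
  finally show ?thesis .
qed

lemma tangent_eqI:
  assumes "orthonormal_at M g p e" "u \<in> tangent_space M p" "v \<in> tangent_space M p"
    and "\<And>i. i < DIM('e) \<Longrightarrow> g p u (e i) = g p v (e i)"
  shows "u = v"
  by (subst orthonormal_expand[OF assms(1,2)], subst orthonormal_expand[OF assms(1,3)])
    (simp add: assms(4))

lemma orthonormal_frameD:
  assumes "orthonormal_frame M g U E"
  shows "i < DIM('e) \<Longrightarrow> vector_field M U (E i)" "q \<in> U \<Longrightarrow> orthonormal_at M g q (\<lambda>i. E i q)"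
  using assms unfolding orthonormal_frame_def by auto

lemma orthonormal_frame_subset:
  "orthonormal_frame M g U E \<Longrightarrow> openin (mtop M) W \<Longrightarrow> W \<subseteq> U \<Longrightarrow> orthonormal_frame M g W E"
  unfolding orthonormal_frame_def using vector_field_subset by blast

text \<open>In indefinite signature the usual process can meet a null vector and stop. Starting from
  vectors that are already orthonormal at \<open>p\<close> avoids this: the new field, made
  orthogonal to the earlier ones, still equals \<open>e k\<close> at \<open>p\<close>, so its square
  is 1 or -1 there and keeps its sign on a smaller neighbourhood, where it can be
  normalised.\<close>

lemma gram_schmidt:
  assumes e: "orthonormal_at M g p e" and p: "p \<in> points M" and "k \<le> DIM('e)"
  shows "\<exists>U E. openin (mtop M) U \<and> p \<in> U \<and> (\<forall>i<k. vector_field M U (E i) \<and> E i p = e i) \<and>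
    (\<forall>q\<in>U. \<forall>i<k. \<forall>j<k. \<bar>g q (E i q) (E j q)\<bar> = (if i = j then 1 else 0))"
  using \<open>k \<le> DIM('e)\<close>
proof (induction k)
  case 0
  show ?case
    using p by (intro exI[of _ "points M"]) simp
next
  case (Suc k)
  then obtain U E where U: "openin (mtop M) U" "p \<in> U"
    and E_all: "\<forall>i<k. vector_field M U (E i) \<and> E i p = e i"
    and orth_all: "\<forall>q\<in>U. \<forall>i<k. \<forall>j<k. \<bar>g q (E i q) (E j q)\<bar> = (if i = j then 1 else 0)"
    using Suc.IH[OF Suc_leD[OF Suc.prems]] by (elim exE conjE) (rule that)
  have E: "vector_field M U (E i)" "E i p = e i" if "i < k" for i
    using E_all that by blast+
  have orth: "\<bar>g q (E i q) (E j q)\<bar> = (if i = j then 1 else 0)" if "q \<in> U" "i < k" "j < k" for q i j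
    using orth_all that by blast
  obtain V C where C: "p \<in> V" "vector_field M V C" "C p = e k"
    using tangent_extend[OF orthonormal_atD(1)[OF e, of k]] Suc.prems by (metis Suc_le_lessD)
  define W where "W = U \<inter> V"
  have W: "openin (mtop M) W" "p \<in> W" "W \<subseteq> U"
    using U C vector_field_open[OF C(2)] by (auto simp: W_def)
  have E': "vector_field M W (E i)" if "i < k" for i
    using vector_field_subset[OF E(1)[OF that]] W by blast
  have C': "vector_field M W C"
    using vector_field_subset[OF C(2)] W by (simp add: W_def)
  \<comment> \<open>The projection on \<open>E i\<close> carries the sign
    \<open>g q (E i q) (E i q)\<close>, since the fields may have square -1.\<close>
  define F where "F = (\<lambda>q f. C q f - (\<Sum>i<k. (g q (E i q) (E i q) * g q (C q) (E i q)) * E i q f))"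
  have F: "vector_field M W F"
    unfolding F_def using E' C'
    by (intro vector_field_diff vector_field_sum smooth_near_mult metric_smooth[of W] W) auto
  have FE: "g q (F q) (E j q) = 0" if "q \<in> W" "j < k" for q j
  proof -
    have T: "E i q \<in> tangent_space M q" if "i < k" for i
      using vector_field_tangent[OF E'] that \<open>q \<in> W\<close> by blast
    have orth': "g q (E i q) (E j q) = (if i = j then g q (E j q) (E j q) else 0)" if "i < k" for i
      using orth[of q i j] that \<open>j < k\<close> \<open>q \<in> W\<close> W(3) by auto
    have one: "g q (E j q) (E j q) * g q (E j q) (E j q) = 1"
      using orth[of q j j] that W(3) by (metis abs_mult_self_eq mult_1 subsetD)
    have "(\<lambda>f. \<Sum>i<k. (g q (E i q) (E i q) * g q (C q) (E i q)) * E i q f) \<in> tangent_space M q"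
      using T by (intro tangent_sum openin_points[OF W(1)] that) auto
    then have "g q (F q) (E j q) = g q (C q) (E j q)
        - g q (\<lambda>f. \<Sum>i<k. (g q (E i q) (E i q) * g q (C q) (E i q)) * E i q f) (E j q)"
      unfolding F_def using T that vector_field_tangent[OF C'] by (intro metric_diff) auto
    also have "g q (\<lambda>f. \<Sum>i<k. (g q (E i q) (E i q) * g q (C q) (E i q)) * E i q f) (E j q)
        = (\<Sum>i<k. (g q (E i q) (E i q) * g q (C q) (E i q)) * g q (E i q) (E j q))"
      using T that by (intro metric_sum) auto
    also have "(\<Sum>i<k. (g q (E i q) (E i q) * g q (C q) (E i q)) * g q (E i q) (E j q))
        = (\<Sum>i<k. if i = j then g q (C q) (E j q) * (g q (E j q) (E j q) * g q (E j q) (E j q)) else 0)"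
    proof (intro sum.cong refl)
      fix i assume "i \<in> {..<k}"
      then show "(g q (E i q) (E i q) * g q (C q) (E i q)) * g q (E i q) (E j q)
        = (if i = j then g q (C q) (E j q) * (g q (E j q) (E j q) * g q (E j q) (E j q)) else 0)"
        using orth'[of i] by (cases "i = j") simp_all
    qed
    finally show ?thesis
      using that one by simp
  qed
  have Fp: "F p = e k"
  proof
    fix f
    have "(\<Sum>i<k. (g p (E i p) (E i p) * g p (C p) (E i p)) * E i p f) = 0"
      using E(2) C(3) orthonormal_atD(2)[OF e, of k] Suc.prems by (intro sum.neutral) auto
    then show "F p f = e k f"
      by (simp add: F_def C(3))
  qed
  \<comment> \<open>The sign of the new vector. Multiplying by it makes the square of
    \<open>F\<close> equal to 1 at \<open>p\<close>, hence positive nearby, so that its logarithm is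
    available.\<close>
  define \<epsilon> where "\<epsilon> = g p (e k) (e k)"
  have \<epsilon>: "\<epsilon> * \<epsilon> = 1"
    unfolding \<epsilon>_def using orthonormal_atD(3)[OF e, of k] Suc.prems by simp
  have smF: "smooth_near M q (\<lambda>q. \<epsilon> * g q (F q) (F q))" if "q \<in> W" for q
    by (intro smooth_near_mult smooth_near_const metric_smooth[OF F F that] openin_points[OF W(1) that])
  have ev: "\<forall>\<^sub>F q in nhdsin (mtop M) p. \<epsilon> * g q (F q) (F q) \<in> {0<..}"
    by (rule smooth_near_preimage[OF smF[OF W(2)]]) (simp_all add: Fp \<epsilon>_def[symmetric] \<epsilon>)
  obtain W' where W': "openin (mtop M) W'" "p \<in> W'" "\<forall>q\<in>W'. \<epsilon> * g q (F q) (F q) \<in> {0<..}"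
    using ev p unfolding eventually_nhdsin by blast
  define N where "N = W \<inter> W'"
  have N: "openin (mtop M) N" "p \<in> N" "N \<subseteq> W" "N \<subseteq> U"
    using W W' by (auto simp: N_def)
  \<comment> \<open>The inverse square root of the positive function above, in the form exp and ln
    whose smoothness is known; its value at \<open>p\<close> is 1.\<close>
  define c where "c = (\<lambda>q. exp (- (1/2) * ln (\<epsilon> * g q (F q) (F q))))"
  have smc: "smooth_near M q c" if "q \<in> N" for q
  proof -
    have "smooth_near M q (\<lambda>q. ln (\<epsilon> * g q (F q) (F q)))"
      using that W'(3) by (intro smooth_near_compose[OF smF Cinf_on_ln]) (auto simp: N_def)
    then show ?thesis
      unfolding c_def using openin_points[OF N(1) that]
      by (intro smooth_near_compose[OF smooth_near_mult[OF smooth_near_const] Cinf_on_exp]) auto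
  qed
  have cc: "c q * c q * g q (F q) (F q) = \<epsilon>" if "q \<in> N" for q
  proof -
    have pos: "0 < \<epsilon> * g q (F q) (F q)"
      using that W'(3) by (simp add: N_def)
    have "c q * c q = exp (- ln (\<epsilon> * g q (F q) (F q)))"
      by (simp add: c_def flip: exp_add)
    also have "\<dots> = 1 / (\<epsilon> * g q (F q) (F q))"
      using pos by (simp add: exp_minus inverse_eq_divide)
    finally have "c q * c q * (\<epsilon> * g q (F q) (F q)) = 1"
      using less_imp_neq[OF pos] by (simp only: times_divide_eq_left mult_1 divide_self_if) simp
    then show ?thesis
      using \<epsilon> by algebra
  qed
  define E2 where "E2 = E(k := (\<lambda>q f. c q * F q f))"
  have Ek: "vector_field M N (\<lambda>q f. c q * F q f)"
    by (rule vector_field_scale[OF vector_field_subset[OF F N(1,3)] smc])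
  have "vector_field M N (E2 i) \<and> E2 i p = e i" if "i < Suc k" for i
  proof (cases "i = k")
    case True
    have "c p = 1"
      by (simp add: c_def Fp \<epsilon>_def[symmetric] \<epsilon>)
    then show ?thesis
      using Ek True Fp by (simp add: E2_def)
  next
    case False
    then have "i < k"
      using that by simp
    then show ?thesis
      using vector_field_subset[OF E'[OF \<open>i < k\<close>] N(1,3)] E(2) by (simp add: E2_def)
  qed
  moreover have "\<bar>g q (E2 i q) (E2 j q)\<bar> = (if i = j then 1 else 0)"
    if q: "q \<in> N" and "i < Suc k" "j < Suc k" for q i j
  proof -
    have FT: "F q \<in> tangent_space M q"
      using vector_field_tangent[OF F] q N by blast
    have ET: "E i q \<in> tangent_space M q" if "i < k" for i
      using vector_field_tangent[OF E'[OF that]] q N by blast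
    have "\<bar>c q * (c q * g q (F q) (F q))\<bar> = 1"
      using cc[OF q] \<epsilon> by (auto simp: mult.assoc square_eq_1_iff)
    then have kk: "\<bar>g q (\<lambda>f. c q * F q f) (\<lambda>f. c q * F q f)\<bar> = 1"
      using FT tangent_lin[OF FT FT, of "c q" 0] by (simp add: metric_scale)
    have "g q (F q) (E i q) = 0" "g q (E i q) (F q) = 0" if "i < k" for i
      using FE[of q i] that q N metric_sym[OF FT ET[OF that]] by auto
    then have "g q (\<lambda>f. c q * F q f) (E i q) = 0" "g q (E i q) (\<lambda>f. c q * F q f) = 0" if "i < k" for i
      using FT ET[OF that] that by (simp_all add: metric_scale)
    then show ?thesis
      using kk orth[of q i j] that N by (auto simp: E2_def less_Suc_eq)
  qed
  ultimately show ?case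
    using N by blast
qed

lemma frame_exists:
  assumes p: "p \<in> points M"
  shows "\<exists>E U. openin (mtop M) U \<and> p \<in> U \<and> orthonormal_frame M g U E"
proof -
  obtain e where "orthonormal_at M g p e"
    using metric_orthonormal[OF p] by blast
  from gram_schmidt[OF this p order.refl] obtain U E
    where U: "openin (mtop M) U" "p \<in> U" "\<And>i. i < DIM('e) \<Longrightarrow> vector_field M U (E i)"
    "\<forall>q\<in>U. \<forall>i<DIM('e). \<forall>j<DIM('e). \<bar>g q (E i q) (E j q)\<bar> = (if i = j then 1 else 0)"
    by auto
  then have "orthonormal_frame M g U E"
    unfolding orthonormal_frame_def orthonormal_at_def using vector_field_tangent[OF U(3)] by simp
  with U show ?thesis
    by blast
qed

lemma frame_near:
  assumes "p \<in> points M"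
  obtains U where "openin (mtop M) U" "p \<in> U" "orthonormal_frame M g U (frame_near M g p)"
  using someI_ex[OF frame_exists[OF assms]] unfolding frame_near_def by blast

lemma frame_expand:
  assumes E: "orthonormal_frame M g U E" and X: "vector_field M U X" and q: "q \<in> U"
  shows "X q = (\<lambda>f. \<Sum>i<DIM('e). (g q (E i q) (E i q) * g q (X q) (E i q)) * E i q f)"
  by (rule orthonormal_expand[OF orthonormal_frameD(2)[OF E q] vector_field_tangent[OF X q]])

section \<open>The Levi-Civita connection\<close>

lemma tvec_metric_cong:
  assumes "v \<in> tangent_space M p" "openin (mtop M) U" "p \<in> U" "\<And>q. q \<in> U \<Longrightarrow> F q = G q"
  shows "v F = v G"
  by (rule tvec_cong[OF assms(1) eventually_mono[OF eventually_nhdsin_open[OF assms(2,3)]]])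
    (rule assms(4))

section \<open>Identities for the Koszul expression\<close>

context
  fixes U p X Y Z
  assumes X: "vector_field M U X" and Y: "vector_field M U Y" and Z: "vector_field M U Z" and p: "p \<in> U"
begin

private lemma U: "openin (mtop M) U"
  by (rule vector_field_open[OF X])

private lemma tangents:
  "X p \<in> tangent_space M p" "Y p \<in> tangent_space M p" "Z p \<in> tangent_space M p"
  "lie_bracket M X Y p \<in> tangent_space M p" "lie_bracket M X Z p \<in> tangent_space M p"
  "lie_bracket M Y Z p \<in> tangent_space M p" "lie_bracket M Y X p \<in> tangent_space M p"
  "lie_bracket M Z X p \<in> tangent_space M p" "lie_bracket M Z Y p \<in> tangent_space M p"
  using X Y Z p by (auto intro: vector_field_tangent lie_bracket_tangent)

private lemma deriv_sym:
  assumes "v \<in> tangent_space M p" "vector_field M U S" "vector_field M U T"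
  shows "v (\<lambda>q. g q (S q) (T q)) = v (\<lambda>q. g q (T q) (S q))"
  by (rule tvec_metric_cong[OF assms(1) U p])
    (rule metric_sym[OF vector_field_tangent[OF assms(2)] vector_field_tangent[OF assms(3)]])

text \<open>Up to symmetry of \<open>g\<close>, every term except the one with the bracket of
  \<open>X\<close> and \<open>Y\<close> is symmetric in these fields or is exchanged with another
  term. Later this identity also carries properties from the second slot to the first.\<close>

lemma koszul_torsion: "koszul M g X Y Z p - koszul M g Y X Z p = g p (lie_bracket M X Y p) (Z p)"
proof -
  have "g p (lie_bracket M Y X p) (Z p) = - g p (lie_bracket M X Y p) (Z p)"
    "g p (lie_bracket M Z Y p) (X p) = - g p (lie_bracket M Y Z p) (X p)"
    "g p (lie_bracket M X Z p) (Y p) = - g p (lie_bracket M Z X p) (Y p)"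
    using tangents by (simp_all add: metric_minus lie_bracket_antisym[of Y X]
        lie_bracket_antisym[of Z Y] lie_bracket_antisym[of X Z])
  then show ?thesis
    unfolding koszul_def using deriv_sym[OF tangents(1) Y Z] deriv_sym[OF tangents(2) Z X]
      deriv_sym[OF tangents(3) X Y] by (simp add: field_simps)
qed

text \<open>Exchanging \<open>Y\<close> and \<open>Z\<close> reverses the sign of all terms but the
  first, up to pairing them off. Later this identity also carries properties from the second slot to
  the third.\<close>

lemma koszul_metric: "koszul M g X Y Z p + koszul M g X Z Y p = X p (\<lambda>q. g q (Y q) (Z q))"
proof -
  have "g p (lie_bracket M Y X p) (Z p) = - g p (lie_bracket M X Y p) (Z p)"
    "g p (lie_bracket M Z Y p) (X p) = - g p (lie_bracket M Y Z p) (X p)"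
    "g p (lie_bracket M X Z p) (Y p) = - g p (lie_bracket M Z X p) (Y p)"
    using tangents by (simp_all add: metric_minus lie_bracket_antisym[of Y X]
        lie_bracket_antisym[of Z Y] lie_bracket_antisym[of X Z])
  then show ?thesis
    unfolding koszul_def using deriv_sym[OF tangents(1) Y Z] deriv_sym[OF tangents(2) Z X]
      deriv_sym[OF tangents(3) X Y] by (simp add: field_simps)
qed

lemma koszul_add2:
  assumes Y': "vector_field M U Y'"
  shows "koszul M g X (\<lambda>q f. Y q f + Y' q f) Z p = koszul M g X Y Z p + koszul M g X Y' Z p"
proof -
  have "X p (\<lambda>q. g q (\<lambda>f. Y q f + Y' q f) (Z q)) = X p (\<lambda>q. g q (Y q) (Z q) + g q (Y' q) (Z q))"
    using vector_field_tangent[OF Y] vector_field_tangent[OF Y'] vector_field_tangent[OF Z]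
    by (intro tvec_metric_cong[OF tangents(1) U p] metric_add)
  moreover have "Z p (\<lambda>q. g q (X q) (\<lambda>f. Y q f + Y' q f)) = Z p (\<lambda>q. g q (X q) (Y q) + g q (X q) (Y' q))"
    using vector_field_tangent[OF Y] vector_field_tangent[OF Y'] vector_field_tangent[OF X]
    by (intro tvec_metric_cong[OF tangents(3) U p] metric_add)
  moreover have "lie_bracket M X (\<lambda>q f. Y q f + Y' q f) p
      = (\<lambda>f. lie_bracket M X Y p f + lie_bracket M X Y' p f)"
    by (rule lie_bracket_add[OF X Y Y' p])
  moreover have "lie_bracket M (\<lambda>q f. Y q f + Y' q f) Z p
      = (\<lambda>f. lie_bracket M Y Z p f + lie_bracket M Y' Z p f)"
    using lie_bracket_add[OF Z Y Y' p]
    by (simp add: lie_bracket_antisym[of _ Z])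
  moreover note vector_field_tangent[OF Y' p] lie_bracket_tangent[OF X Y' p] lie_bracket_tangent[OF Y' Z p]
  ultimately show ?thesis
    unfolding koszul_def using tangents
      tvec_add[OF tangents(1) metric_smooth[OF Y Z p] metric_smooth[OF Y' Z p]]
      tvec_add[OF tangents(3) metric_smooth[OF X Y p] metric_smooth[OF X Y' p]]
    by (simp add: metric_add field_simps)
qed

text \<open>Four terms differentiate \<open>a\<close>: the one with \<open>X p a\<close> occurs
  twice, from the derivative and from the bracket, while the two with \<open>Z p a\<close> have
  opposite signs and cancel.\<close>

lemma koszul_scale2:
  assumes a: "\<And>q. q \<in> U \<Longrightarrow> smooth_near M q a"
  shows "koszul M g X (\<lambda>q f. a q * Y q f) Z p = X p a * g p (Y p) (Z p) + a p * koszul M g X Y Z p"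
proof -
  have "X p (\<lambda>q. g q (\<lambda>f. a q * Y q f) (Z q)) = X p (\<lambda>q. a q * g q (Y q) (Z q))"
    using vector_field_tangent[OF Y] vector_field_tangent[OF Z]
    by (intro tvec_metric_cong[OF tangents(1) U p] metric_scale)
  moreover have "Z p (\<lambda>q. g q (X q) (\<lambda>f. a q * Y q f)) = Z p (\<lambda>q. a q * g q (X q) (Y q))"
    using vector_field_tangent[OF Y] vector_field_tangent[OF X]
    by (intro tvec_metric_cong[OF tangents(3) U p] metric_scale)
  moreover have "lie_bracket M X (\<lambda>q f. a q * Y q f) p = (\<lambda>f. X p a * Y p f + a p * lie_bracket M X Y p f)"
    by (rule lie_bracket_scale[OF X Y p a[OF p]])
  moreover have "lie_bracket M (\<lambda>q f. a q * Y q f) Z p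
      = (\<lambda>f. (- Z p a) * Y p f + a p * lie_bracket M Y Z p f)"
    using lie_bracket_scale[OF Z Y p a[OF p]]
    by (simp add: lie_bracket_antisym[of _ Z])
  moreover have "g p (Y p) (X p) = g p (X p) (Y p)"
    using tangents metric_sym by blast
  ultimately show ?thesis
    unfolding koszul_def using tangents
      tvec_mult[OF tangents(1) a[OF p] metric_smooth[OF Y Z p]]
      tvec_mult[OF tangents(3) a[OF p] metric_smooth[OF X Y p]]
    by (simp only: metric_lin metric_scale) (simp add: field_simps)
qed

lemma koszul_cong:
  assumes eq: "\<And>q. q \<in> U \<Longrightarrow> X q = X' q" "\<And>q. q \<in> U \<Longrightarrow> Y q = Y' q" "\<And>q. q \<in> U \<Longrightarrow> Z q = Z' q"
  shows "koszul M g X Y Z p = koszul M g X' Y' Z' p"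
proof -
  have "X p (\<lambda>q. g q (Y q) (Z q)) = X p (\<lambda>q. g q (Y' q) (Z' q))"
    "Y p (\<lambda>q. g q (Z q) (X q)) = Y p (\<lambda>q. g q (Z' q) (X' q))"
    "Z p (\<lambda>q. g q (X q) (Y q)) = Z p (\<lambda>q. g q (X' q) (Y' q))"
    by (rule tvec_metric_cong[OF _ U p]; simp add: tangents eq)+
  moreover have "lie_bracket M X Y p = lie_bracket M X' Y' p"
    by (rule lie_bracket_cong[OF X Y p eq(1,2)])
  moreover have "lie_bracket M Y Z p = lie_bracket M Y' Z' p"
    by (rule lie_bracket_cong[OF Y Z p eq(2,3)])
  moreover have "lie_bracket M Z X p = lie_bracket M Z' X' p"
    by (rule lie_bracket_cong[OF Z X p eq(3,1)])
  ultimately show ?thesis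
    unfolding koszul_def using eq[OF p] by simp
qed

end

text \<open>Obtained from additivity in the second slot: by \<open>koszul_metric\<close> the two
  slots differ by a sign and a derivative of the metric, and that derivative is itself
  additive.\<close>

lemma koszul_add3:
  assumes "vector_field M U X" "vector_field M U Y" "vector_field M U Z" "vector_field M U Z'" "p \<in> U"
  shows "koszul M g X Y (\<lambda>q f. Z q f + Z' q f) p = koszul M g X Y Z p + koszul M g X Y Z' p"
proof -
  have ZZ: "vector_field M U (\<lambda>q f. Z q f + Z' q f)"
    using assms by (intro vector_field_add)
  have "X p (\<lambda>q. g q (Y q) (\<lambda>f. Z q f + Z' q f)) = X p (\<lambda>q. g q (Y q) (Z q) + g q (Y q) (Z' q))"
    using assms vector_field_open
    by (intro tvec_metric_cong[of "X p" p U] metric_add) (auto intro: vector_field_tangent)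
  then show ?thesis
    using koszul_metric[OF assms(1,2) ZZ assms(5)] koszul_metric[OF assms(1,2,3,5)]
      koszul_metric[OF assms(1,2,4,5)] koszul_add2[OF assms(1,3,2,5,4)]
      tvec_add[OF vector_field_tangent[OF assms(1,5)] metric_smooth[OF assms(2,3,5)] metric_smooth[OF assms(2,4,5)]]
    by simp
qed

text \<open>The derivative of \<open>a\<close> in \<open>koszul_metric\<close> cancels the one from
  the second slot. The expression is therefore a tensor in its third argument, so it can be
  represented as an inner product with a vector.\<close>

lemma koszul_scale3:
  assumes "vector_field M U X" "vector_field M U Y" "vector_field M U Z" "p \<in> U"
    and a: "\<And>q. q \<in> U \<Longrightarrow> smooth_near M q a"
  shows "koszul M g X Y (\<lambda>q f. a q * Z q f) p = a p * koszul M g X Y Z p"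
proof -
  have aZ: "vector_field M U (\<lambda>q f. a q * Z q f)"
    using assms by (intro vector_field_scale)
  have "X p (\<lambda>q. g q (Y q) (\<lambda>f. a q * Z q f)) = X p (\<lambda>q. a q * g q (Y q) (Z q))"
    using assms vector_field_open
    by (intro tvec_metric_cong[of "X p" p U] metric_scale) (auto intro: vector_field_tangent)
  then show ?thesis
    using koszul_metric[OF assms(1,2) aZ assms(4)] koszul_metric[OF assms(1,2,3,4)]
      koszul_scale2[OF assms(1,3,2,4) a] metric_sym[OF vector_field_tangent[OF assms(3,4)] vector_field_tangent[OF assms(2,4)]]
      tvec_mult[OF vector_field_tangent[OF assms(1,4)] a[OF assms(4)] metric_smooth[OF assms(2,3,4)]]
    by algebra
qed

text \<open>By \<open>koszul_torsion\<close> the first slot equals the second up to a bracket, and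
  the bracket contributes \<open>- Y p a\<close> and \<open>- Y p b\<close>, which remove the
  derivatives from the Leibniz rule.\<close>

lemma koszul_lin1:
  assumes X: "vector_field M U X" and X': "vector_field M U X'" and Y: "vector_field M U Y"
    and Z: "vector_field M U Z" and p: "p \<in> U"
    and a: "\<And>q. q \<in> U \<Longrightarrow> smooth_near M q a" and b: "\<And>q. q \<in> U \<Longrightarrow> smooth_near M q b"
  shows "koszul M g (\<lambda>q f. a q * X q f + b q * X' q f) Y Z p = a p * koszul M g X Y Z p + b p * koszul M g X' Y Z p"
proof -
  have aX: "vector_field M U (\<lambda>q f. a q * X q f)" and bX: "vector_field M U (\<lambda>q f. b q * X' q f)"
    using assms by (auto intro: vector_field_scale)
  have L: "lie_bracket M (\<lambda>q f. a q * X q f + b q * X' q f) Y p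
    = (\<lambda>f. ((- Y p a) * X p f + a p * lie_bracket M X Y p f) + ((- Y p b) * X' p f + b p * lie_bracket M X' Y p f))"
    using lie_bracket_add[OF Y aX bX p] lie_bracket_scale[OF Y X p a[OF p]] lie_bracket_scale[OF Y X' p b[OF p]]
    by (simp add: lie_bracket_antisym[of _ Y] algebra_simps)
  note T = vector_field_tangent[OF X p] vector_field_tangent[OF X' p] vector_field_tangent[OF Y p]
    vector_field_tangent[OF Z p] lie_bracket_tangent[OF X Y p] lie_bracket_tangent[OF X' Y p]
  have "g p (lie_bracket M (\<lambda>q f. a q * X q f + b q * X' q f) Y p) (Z p)
    = - Y p a * g p (X p) (Z p) + a p * g p (lie_bracket M X Y p) (Z p)
      + (- Y p b * g p (X' p) (Z p) + b p * g p (lie_bracket M X' Y p) (Z p))"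
    unfolding L using T by (simp only: metric_add metric_lin tangent_lin)
  then show ?thesis
    using koszul_torsion[OF vector_field_lin[OF X X' a b] Y Z p] koszul_torsion[OF X Y Z p]
      koszul_torsion[OF X' Y Z p] koszul_add2[OF Y aX Z p bX] koszul_scale2[OF Y X Z p a]
      koszul_scale2[OF Y X' Z p b]
    by algebra
qed

lemma koszul_sum3:
  assumes X: "vector_field M U X" and Y: "vector_field M U Y" and p: "p \<in> U"
    and Z: "\<And>i. i \<in> I \<Longrightarrow> vector_field M U (Z i)"
    and a: "\<And>i q. i \<in> I \<Longrightarrow> q \<in> U \<Longrightarrow> smooth_near M q (a i)"
  shows "koszul M g X Y (\<lambda>q f. \<Sum>i\<in>I. a i q * Z i q f) p = (\<Sum>i\<in>I. a i p * koszul M g X Y (Z i) p)"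
  using Z a
proof (induction I rule: infinite_finite_induct)
  case (insert i I)
  have "vector_field M U (\<lambda>q f. \<Sum>i\<in>I. a i q * Z i q f)" "vector_field M U (\<lambda>q f. a i q * Z i q f)"
    using insert.prems vector_field_open[OF X] by (auto intro!: vector_field_sum vector_field_scale)
  then have "koszul M g X Y (\<lambda>q f. a i q * Z i q f + (\<Sum>i\<in>I. a i q * Z i q f)) p
    = koszul M g X Y (\<lambda>q f. a i q * Z i q f) p + koszul M g X Y (\<lambda>q f. \<Sum>i\<in>I. a i q * Z i q f) p"
    by (intro koszul_add3[OF X Y _ _ p])
  also have "koszul M g X Y (\<lambda>q f. a i q * Z i q f) p = a i p * koszul M g X Y (Z i) p"
    using insert.prems by (intro koszul_scale3[OF X Y _ p]) auto
  also have "koszul M g X Y (\<lambda>q f. \<Sum>i\<in>I. a i q * Z i q f) p = (\<Sum>i\<in>I. a i p * koszul M g X Y (Z i) p)"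
    using insert by blast
  finally show ?case
    using insert.hyps by simp
next
  case (infinite I)
  then show ?case
    using koszul_scale3[OF X Y X p, of "\<lambda>_. 0"] openin_points[OF vector_field_open[OF X]]
    by (simp add: smooth_near_const)
next
  case empty
  show ?case
    using koszul_scale3[OF X Y X p, of "\<lambda>_. 0"] openin_points[OF vector_field_open[OF X]]
    by (simp add: smooth_near_const)
qed

section \<open>Existence of the Levi-Civita connection\<close>

lemma frame_coeff_smooth:
  assumes "orthonormal_frame M g U E" "vector_field M U X" "q \<in> U" "i < DIM('e)"
  shows "smooth_near M q (\<lambda>q. g q (E i q) (E i q) * g q (X q) (E i q))"
  using orthonormal_frameD(1)[OF assms(1,4)] assms(2,3) by (intro smooth_near_mult metric_smooth)

lemma koszul_expand3:
  assumes E: "orthonormal_frame M g U E" and X: "vector_field M U X" and Y: "vector_field M U Y"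
    and Z: "vector_field M U Z" and p: "p \<in> U"
  shows "koszul M g X Y Z p = (\<Sum>i<DIM('e). (g p (E i p) (E i p) * g p (Z p) (E i p)) * koszul M g X Y (E i) p)"
proof -
  let ?Z = "\<lambda>q f. \<Sum>i<DIM('e). (g q (E i q) (E i q) * g q (Z q) (E i q)) * E i q f"
  have "koszul M g X Y Z p = koszul M g X Y ?Z p"
    by (rule koszul_cong[OF X Y Z p]) (use frame_expand[OF E Z] in auto)
  also have "\<dots> = (\<Sum>i<DIM('e). (g p (E i p) (E i p) * g p (Z p) (E i p)) * koszul M g X Y (E i) p)"
    by (rule koszul_sum3[OF X Y p])
      (use orthonormal_frameD(1)[OF E] frame_coeff_smooth[OF E Z] in auto)
  finally show ?thesis .
qed

text \<open>The vector dual to the Koszul expression, assembled from its components in a frame. The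
  frame is chosen anew at each point, so regularity is not visible here; 0 is a default for
  arguments that are not fields on a common domain around \<open>p\<close>.\<close>

definition koszul_connection :: "'a connection" where
  "koszul_connection X Y p = (if \<exists>U. p \<in> U \<and> vector_field M U X \<and> vector_field M U Y
     then (let E = frame_near M g p in
       (\<lambda>f. \<Sum>i<DIM('e). (g p (E i p) (E i p) * koszul M g X Y (E i) p) * E i p f))
     else (\<lambda>f. 0))"

text \<open>Expanding the test field in the same frame shows that the pairing holds for every
  \<open>Z\<close>. From here on the chosen frame no longer matters.\<close>

lemma koszul_connection_tangent_koszul:
  assumes X: "vector_field M U X" and Y: "vector_field M U Y" and p: "p \<in> U"
  shows "koszul_connection X Y p \<in> tangent_space M p"
    and "vector_field M U Z \<Longrightarrow> g p (koszul_connection X Y p) (Z p) = koszul M g X Y Z p"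
proof -
  have pM: "p \<in> points M"
    using openin_points vector_field_open[OF X] p by blast
  define E where "E = frame_near M g p"
  obtain W' where W': "openin (mtop M) W'" "p \<in> W'" "orthonormal_frame M g W' E"
    using frame_near[OF pM] unfolding E_def by metis
  define W where "W = U \<inter> W'"
  have W: "openin (mtop M) W" "p \<in> W" "W \<subseteq> U" "orthonormal_frame M g W E"
    using W' p vector_field_open[OF X] orthonormal_frame_subset[OF W'(3), of W] by (auto simp: W_def)
  have K: "koszul_connection X Y p
    = (\<lambda>f. \<Sum>i<DIM('e). (g p (E i p) (E i p) * koszul M g X Y (E i) p) * E i p f)"
    using assms by (auto simp: koszul_connection_def E_def[symmetric] Let_def)
  note ET = vector_field_tangent[OF orthonormal_frameD(1)[OF W(4)] W(2)]
  show "koszul_connection X Y p \<in> tangent_space M p"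
    unfolding K using ET by (intro tangent_sum pM) auto
  assume Z: "vector_field M U Z"
  note sub = vector_field_subset[OF _ W(1,3)]
  have ZT: "Z p \<in> tangent_space M p"
    using vector_field_tangent[OF Z p] .
  have "g p (koszul_connection X Y p) (Z p)
    = (\<Sum>i<DIM('e). (g p (E i p) (E i p) * koszul M g X Y (E i) p) * g p (E i p) (Z p))"
    unfolding K using ET by (intro metric_sum ZT) auto
  also have "\<dots> = koszul M g X Y Z p"
    unfolding koszul_expand3[OF W(4) sub[OF X] sub[OF Y] sub[OF Z] W(2)]
    by (intro sum.cong) (use metric_sym[OF ET ZT] in auto)
  finally show "g p (koszul_connection X Y p) (Z p) = koszul M g X Y Z p" .
qed

text \<open>Nondegeneracy in the form in which it is used: the identities at hand involve
  \<open>koszul\<close>, which takes fields and not vectors, and a test field may only live on a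
  smaller neighbourhood.\<close>

lemma tangent_field_eqI:
  assumes "u \<in> tangent_space M p" "v \<in> tangent_space M p" and U: "openin (mtop M) U" "p \<in> U"
    and eq: "\<And>W Z. openin (mtop M) W \<Longrightarrow> p \<in> W \<Longrightarrow> W \<subseteq> U \<Longrightarrow> vector_field M W Z \<Longrightarrow> g p u (Z p) = g p v (Z p)"
  shows "u = v"
proof -
  obtain E W where W: "openin (mtop M) W" "p \<in> W" "orthonormal_frame M g W E"
    using frame_exists tangent_space_points[OF assms(1)] by blast
  have E: "orthonormal_frame M g (U \<inter> W) E"
    using orthonormal_frame_subset[OF W(3)] U W by auto
  show ?thesis
  proof (rule tangent_eqI[OF orthonormal_frameD(2)[OF W(3,2)] assms(1,2)])
    show "g p u (E i p) = g p v (E i p)" if "i < DIM('e)" for i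
      using eq[OF _ _ _ orthonormal_frameD(1)[OF E that]] U W by blast
  qed
qed

text \<open>The frames in the definition vary with the point without any regularity. Near a given
  point the values are therefore expanded again in one fixed frame, where the coefficients are
  visibly smooth.\<close>

lemma koszul_connection_field:
  assumes X: "vector_field M U X" and Y: "vector_field M U Y"
  shows "vector_field M U (koszul_connection X Y)"
proof (rule vector_field_local[OF vector_field_open[OF X]])
  fix p assume p: "p \<in> U"
  have pM: "p \<in> points M"
    using openin_points vector_field_open[OF X] p by blast
  obtain E W' where W': "openin (mtop M) W'" "p \<in> W'" "orthonormal_frame M g W' E"
    using frame_exists[OF pM] by blast
  define W where "W = U \<inter> W'"
  have W: "openin (mtop M) W" "p \<in> W" "W \<subseteq> U" "orthonormal_frame M g W E"
    using W' p vector_field_open[OF X] orthonormal_frame_subset[OF W'(3), of W] by (auto simp: W_def)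
  note X' = vector_field_subset[OF X W(1,3)] and Y' = vector_field_subset[OF Y W(1,3)]
  note E = orthonormal_frameD(1)[OF W(4)]
  have "vector_field M W (\<lambda>q f. \<Sum>i<DIM('e). (g q (E i q) (E i q) * koszul M g X Y (E i) q) * E i q f)"
  proof (rule vector_field_sum[OF W(1)])
    fix i q assume i: "i \<in> {..<DIM('e)}" and q: "q \<in> W"
    have Ei: "vector_field M W (E i)"
      using E i by simp
    note fields = X' Y' Ei vector_field_lie_bracket[OF X' Y'] vector_field_lie_bracket[OF Y' Ei]
      vector_field_lie_bracket[OF Ei X']
    have "smooth_near M q (koszul M g X Y (E i))"
      unfolding koszul_def divide_inverse
      by (intro smooth_near_mult smooth_near_add smooth_near_diff smooth_near_const
          openin_points[OF W(1) q] vector_field_smooth[OF X' q] vector_field_smooth[OF Y' q]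
          vector_field_smooth[OF Ei q] metric_smooth[OF _ _ q] fields)
    then show "smooth_near M q (\<lambda>q. g q (E i q) (E i q) * koszul M g X Y (E i) q)"
      by (rule smooth_near_mult[OF metric_smooth[OF Ei Ei q]])
  qed (use E in auto)
  then have "vector_field M W (koszul_connection X Y)"
  proof (rule vector_field_cong)
    fix q assume q: "q \<in> W"
    have "koszul_connection X Y q
      = (\<lambda>f. \<Sum>i<DIM('e). (g q (E i q) (E i q) * g q (koszul_connection X Y q) (E i q)) * E i q f)"
      by (rule orthonormal_expand[OF orthonormal_frameD(2)[OF W(4) q]
            koszul_connection_tangent_koszul(1)[OF X' Y' q]])
    also have "\<dots> = (\<lambda>f. \<Sum>i<DIM('e). (g q (E i q) (E i q) * koszul M g X Y (E i) q) * E i q f)"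
      using koszul_connection_tangent_koszul(2)[OF X' Y' q E] by simp
    finally show "(\<lambda>f. \<Sum>i<DIM('e). (g q (E i q) (E i q) * koszul M g X Y (E i) q) * E i q f)
      = koszul_connection X Y q" ..
  qed
  then show "\<exists>W. p \<in> W \<and> vector_field M W (koszul_connection X Y)"
    using W(2) by blast
qed

text \<open>Each axiom, paired with a test field, becomes one of the identities for
  \<open>koszul\<close>; nondegeneracy then removes the test field.\<close>

lemma is_levi_civita_koszul_connection: "is_levi_civita M g koszul_connection"
  unfolding is_levi_civita_def affine_connection_def
proof (intro conjI allI impI ballI; (elim conjE)?)
  fix U X Y assume "vector_field M U X" "vector_field M U Y"
  then show "vector_field M U (koszul_connection X Y)"
    by (rule koszul_connection_field)
next
  fix U X Y Z a b p
  assume X: "vector_field M U X" and Y: "vector_field M U Y" and Z: "vector_field M U Z"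
    and a: "smooth_fun M U a" and b: "smooth_fun M U b" and p: "p \<in> U"
  have ab: "\<And>q. q \<in> U \<Longrightarrow> smooth_near M q a" "\<And>q. q \<in> U \<Longrightarrow> smooth_near M q b"
    using a b by (auto simp: smooth_fun_iff)
  note L = vector_field_lin[OF X Y ab]
  note T = koszul_connection_tangent_koszul(1)[OF X Z p] koszul_connection_tangent_koszul(1)[OF Y Z p]
  show "koszul_connection (\<lambda>q f. a q * X q f + b q * Y q f) Z p
    = (\<lambda>f. a p * koszul_connection X Z p f + b p * koszul_connection Y Z p f)"
  proof (rule tangent_field_eqI[OF koszul_connection_tangent_koszul(1)[OF L Z p] tangent_lin[OF T]
        vector_field_open[OF X] p])
    fix W N assume W: "openin (mtop M) W" "p \<in> W" "W \<subseteq> U" and N: "vector_field M W N"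
    note s = vector_field_subset[OF _ W(1,3)]
    have ab': "\<And>q. q \<in> W \<Longrightarrow> smooth_near M q a" "\<And>q. q \<in> W \<Longrightarrow> smooth_near M q b"
      using ab W by auto
    show "g p (koszul_connection (\<lambda>q f. a q * X q f + b q * Y q f) Z p) (N p)
      = g p (\<lambda>f. a p * koszul_connection X Z p f + b p * koszul_connection Y Z p f) (N p)"
      using koszul_lin1[OF s[OF X] s[OF Y] s[OF Z] N W(2) ab']
        metric_lin[OF T vector_field_tangent[OF N W(2)]]
        koszul_connection_tangent_koszul(2)[OF s[OF L] s[OF Z] W(2) N]
        koszul_connection_tangent_koszul(2)[OF s[OF X] s[OF Z] W(2) N]
        koszul_connection_tangent_koszul(2)[OF s[OF Y] s[OF Z] W(2) N]
      by simp
  qed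
next
  fix U X Y Z p
  assume X: "vector_field M U X" and Y: "vector_field M U Y" and Z: "vector_field M U Z" and p: "p \<in> U"
  note L = vector_field_add[OF Y Z]
  note T = koszul_connection_tangent_koszul(1)[OF X Y p] koszul_connection_tangent_koszul(1)[OF X Z p]
  have T': "(\<lambda>f. koszul_connection X Y p f + koszul_connection X Z p f) \<in> tangent_space M p"
    using tangent_lin[OF T, of 1 1] by simp
  show "koszul_connection X (\<lambda>q f. Y q f + Z q f) p
    = (\<lambda>f. koszul_connection X Y p f + koszul_connection X Z p f)"
  proof (rule tangent_field_eqI[OF koszul_connection_tangent_koszul(1)[OF X L p] T'
        vector_field_open[OF X] p])
    fix W N assume W: "openin (mtop M) W" "p \<in> W" "W \<subseteq> U" and N: "vector_field M W N"
    note s = vector_field_subset[OF _ W(1,3)]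
    show "g p (koszul_connection X (\<lambda>q f. Y q f + Z q f) p) (N p)
      = g p (\<lambda>f. koszul_connection X Y p f + koszul_connection X Z p f) (N p)"
      using koszul_add2[OF s[OF X] s[OF Y] N W(2) s[OF Z]]
        metric_add(1)[OF T vector_field_tangent[OF N W(2)]]
        koszul_connection_tangent_koszul(2)[OF s[OF X] s[OF L] W(2) N]
        koszul_connection_tangent_koszul(2)[OF s[OF X] s[OF Y] W(2) N]
        koszul_connection_tangent_koszul(2)[OF s[OF X] s[OF Z] W(2) N]
      by simp
  qed
next
  fix U X Y a p
  assume X: "vector_field M U X" and Y: "vector_field M U Y" and a: "smooth_fun M U a" and p: "p \<in> U"
  have a': "\<And>q. q \<in> U \<Longrightarrow> smooth_near M q a"
    using a by (auto simp: smooth_fun_iff)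
  note L = vector_field_scale[OF Y a']
  note T = vector_field_tangent[OF Y p] koszul_connection_tangent_koszul(1)[OF X Y p]
  show "koszul_connection X (\<lambda>q f. a q * Y q f) p
    = (\<lambda>f. X p a * Y p f + a p * koszul_connection X Y p f)"
  proof (rule tangent_field_eqI[OF koszul_connection_tangent_koszul(1)[OF X L p] tangent_lin[OF T]
        vector_field_open[OF X] p])
    fix W N assume W: "openin (mtop M) W" "p \<in> W" "W \<subseteq> U" and N: "vector_field M W N"
    note s = vector_field_subset[OF _ W(1,3)]
    show "g p (koszul_connection X (\<lambda>q f. a q * Y q f) p) (N p)
      = g p (\<lambda>f. X p a * Y p f + a p * koszul_connection X Y p f) (N p)"
      using koszul_scale2[OF s[OF X] s[OF Y] N W(2), of a] a' W(3)
        metric_lin[OF T vector_field_tangent[OF N W(2)]]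
        koszul_connection_tangent_koszul(2)[OF s[OF X] s[OF L] W(2) N]
        koszul_connection_tangent_koszul(2)[OF s[OF X] s[OF Y] W(2) N]
      by auto
  qed
next
  fix U X Y p
  assume X: "vector_field M U X" and Y: "vector_field M U Y" and p: "p \<in> U"
  note T = koszul_connection_tangent_koszul(1)[OF X Y p] koszul_connection_tangent_koszul(1)[OF Y X p]
  have T': "(\<lambda>f. koszul_connection X Y p f - koszul_connection Y X p f) \<in> tangent_space M p"
    using tangent_lin[OF T, of 1 "-1"] by simp
  show "(\<lambda>f. koszul_connection X Y p f - koszul_connection Y X p f) = lie_bracket M X Y p"
  proof (rule tangent_field_eqI[OF T' lie_bracket_tangent[OF X Y p] vector_field_open[OF X] p])
    fix W N assume W: "openin (mtop M) W" "p \<in> W" "W \<subseteq> U" and N: "vector_field M W N"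
    note s = vector_field_subset[OF _ W(1,3)]
    show "g p (\<lambda>f. koszul_connection X Y p f - koszul_connection Y X p f) (N p)
      = g p (lie_bracket M X Y p) (N p)"
      using koszul_torsion[OF s[OF X] s[OF Y] N W(2)]
        metric_diff(1)[OF T vector_field_tangent[OF N W(2)]]
        koszul_connection_tangent_koszul(2)[OF s[OF X] s[OF Y] W(2) N]
        koszul_connection_tangent_koszul(2)[OF s[OF Y] s[OF X] W(2) N]
      by simp
  qed
next
  fix U X Y Z p
  assume X: "vector_field M U X" and Y: "vector_field M U Y" and Z: "vector_field M U Z" and p: "p \<in> U"
  show "X p (\<lambda>q. g q (Y q) (Z q)) = g p (koszul_connection X Y p) (Z p) + g p (Y p) (koszul_connection X Z p)"
    using koszul_metric[OF X Y Z p] koszul_connection_tangent_koszul[OF X Y p]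
      koszul_connection_tangent_koszul[OF X Z p] Y Z
      metric_sym[OF vector_field_tangent[OF Y p]] by simp
qed

section \<open>Rules for the Levi-Civita connection and its uniqueness\<close>

abbreviation (input) lc :: "'a connection" where
  "lc \<equiv> levi_civita M g"

lemma is_levi_civita: "is_levi_civita M g lc"
  unfolding levi_civita_def by (rule someI[of "is_levi_civita M g", OF is_levi_civita_koszul_connection])

lemmas is_levi_civita_unfolded = is_levi_civita[unfolded is_levi_civita_def affine_connection_def]

lemma lc_field: "vector_field M U X \<Longrightarrow> vector_field M U Y \<Longrightarrow> vector_field M U (lc X Y)"
  by (rule is_levi_civita_unfolded[THEN conjunct1, THEN conjunct1, rule_format, OF conjI])

lemma lc_lin1:
  assumes "vector_field M U X" "vector_field M U Y" "vector_field M U Z" "p \<in> U"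
    and "\<And>q. q \<in> U \<Longrightarrow> smooth_near M q a" "\<And>q. q \<in> U \<Longrightarrow> smooth_near M q b"
  shows "lc (\<lambda>q f. a q * X q f + b q * Y q f) Z p = (\<lambda>f. a p * lc X Z p f + b p * lc Y Z p f)"
proof -
  have "smooth_fun M U a" "smooth_fun M U b"
    using assms vector_field_open[OF assms(1)] by (simp_all add: smooth_fun_iff)
  then show ?thesis
    by (intro is_levi_civita_unfolded[THEN conjunct1, THEN conjunct2, THEN conjunct1, rule_format, of U]
        conjI assms)
qed

lemma lc_add2:
  assumes "vector_field M U X" "vector_field M U Y" "vector_field M U Z" "p \<in> U"
  shows "lc X (\<lambda>q f. Y q f + Z q f) p = (\<lambda>f. lc X Y p f + lc X Z p f)"
  by (intro is_levi_civita_unfolded[THEN conjunct1, THEN conjunct2, THEN conjunct2, THEN conjunct1,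
        rule_format, of U] conjI assms)

lemma lc_scale2:
  assumes "vector_field M U X" "vector_field M U Y" "p \<in> U" "\<And>q. q \<in> U \<Longrightarrow> smooth_near M q a"
  shows "lc X (\<lambda>q f. a q * Y q f) p = (\<lambda>f. X p a * Y p f + a p * lc X Y p f)"
proof -
  have "smooth_fun M U a"
    using assms vector_field_open[OF assms(1)] by (simp add: smooth_fun_iff)
  then show ?thesis
    by (intro is_levi_civita_unfolded[THEN conjunct1, THEN conjunct2, THEN conjunct2, THEN conjunct2,
          rule_format, of U] conjI assms(1-3))
qed

lemma lc_torsion:
  assumes "vector_field M U X" "vector_field M U Y" "p \<in> U"
  shows "lie_bracket M X Y p = (\<lambda>f. lc X Y p f - lc Y X p f)"
  by (rule is_levi_civita_unfolded[THEN conjunct2, THEN conjunct1, rule_format, of U, symmetric])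
    (intro conjI assms)+

lemma lc_metric:
  assumes "vector_field M U X" "vector_field M U Y" "vector_field M U Z" "p \<in> U"
  shows "X p (\<lambda>q. g q (Y q) (Z q)) = g p (lc X Y p) (Z p) + g p (Y p) (lc X Z p)"
  by (rule is_levi_civita_unfolded[THEN conjunct2, THEN conjunct2, rule_format, of U])
    (intro conjI assms)+

text \<open>Metric compatibility for the three cyclic orders of the fields, combined with vanishing
  torsion, determines the pairing. Thus the choice in \<open>levi_civita\<close> has no influence on
  values at fields.\<close>

lemma lc_koszul:
  assumes X: "vector_field M U X" and Y: "vector_field M U Y" and Z: "vector_field M U Z" and p: "p \<in> U"
  shows "g p (lc X Y p) (Z p) = koszul M g X Y Z p"
proof -
  note T = vector_field_tangent[OF X p] vector_field_tangent[OF Y p] vector_field_tangent[OF Z p]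
    vector_field_tangent[OF lc_field[OF X Y] p] vector_field_tangent[OF lc_field[OF Y X] p]
    vector_field_tangent[OF lc_field[OF X Z] p] vector_field_tangent[OF lc_field[OF Z X] p]
    vector_field_tangent[OF lc_field[OF Y Z] p] vector_field_tangent[OF lc_field[OF Z Y] p]
  have "g p (Y p) (lc X Z p) = g p (lc X Z p) (Y p)" "g p (Z p) (lc Y X p) = g p (lc Y X p) (Z p)"
    "g p (X p) (lc Z Y p) = g p (lc Z Y p) (X p)"
    by (intro metric_sym T)+
  moreover have "g p (lie_bracket M X Y p) (Z p) = g p (lc X Y p) (Z p) - g p (lc Y X p) (Z p)"
    "g p (lie_bracket M Y Z p) (X p) = g p (lc Y Z p) (X p) - g p (lc Z Y p) (X p)"
    "g p (lie_bracket M Z X p) (Y p) = g p (lc Z X p) (Y p) - g p (lc X Z p) (Y p)"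
    using T by (simp_all only: lc_torsion[OF X Y p] lc_torsion[OF Y Z p] lc_torsion[OF Z X p] metric_diff)
  ultimately show ?thesis
    unfolding koszul_def lc_metric[OF X Y Z p] lc_metric[OF Y Z X p] lc_metric[OF Z X Y p] by simp
qed

text \<open>Locality of the connection. It is essential because fields are total functions with
  arbitrary values off their domain, and because identities such as those for lifts or conformal
  changes hold on an open set only.\<close>

lemma lc_cong:
  assumes X: "vector_field M U X" and Y: "vector_field M U Y" and p: "p \<in> U"
    and eq: "\<And>q. q \<in> U \<Longrightarrow> X q = X' q" "\<And>q. q \<in> U \<Longrightarrow> Y q = Y' q"
  shows "lc X Y p = lc X' Y' p"
proof -
  note X' = vector_field_cong[OF X eq(1)] and Y' = vector_field_cong[OF Y eq(2)]
  show ?thesis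
  proof (rule tangent_field_eqI[OF vector_field_tangent[OF lc_field[OF X Y] p]
        vector_field_tangent[OF lc_field[OF X' Y'] p] vector_field_open[OF X] p])
    fix W Z assume W: "openin (mtop M) W" "p \<in> W" "W \<subseteq> U" and Z: "vector_field M W Z"
    note s = vector_field_subset[OF _ W(1,3)]
    show "g p (lc X Y p) (Z p) = g p (lc X' Y' p) (Z p)"
      using lc_koszul[OF s[OF X] s[OF Y] Z W(2)] lc_koszul[OF s[OF X'] s[OF Y'] Z W(2)]
        koszul_cong[OF s[OF X] s[OF Y] Z W(2), of X' Y' Z] eq W(3) by auto
  qed
qed

section \<open>Traces\<close>

text \<open>Tensoriality at \<open>p\<close>, phrased for fields because Hessian and curvature take
  fields. Linearity over functions makes the value depend on the fields at \<open>p\<close> alone;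
  the last clause ignores what they are outside \<open>U\<close>.\<close>

definition tensor2 :: "'a set \<Rightarrow> 'a \<Rightarrow> (('a \<Rightarrow> 'a tvec) \<Rightarrow> ('a \<Rightarrow> 'a tvec) \<Rightarrow> real) \<Rightarrow> bool" where
  "tensor2 U p T \<longleftrightarrow>
     (\<forall>X X' Y a b. vector_field M U X \<longrightarrow> vector_field M U X' \<longrightarrow> vector_field M U Y \<longrightarrow>
        (\<forall>q\<in>U. smooth_near M q a \<and> smooth_near M q b) \<longrightarrow>
        T (\<lambda>q f. a q * X q f + b q * X' q f) Y = a p * T X Y + b p * T X' Y \<and>
        T Y (\<lambda>q f. a q * X q f + b q * X' q f) = a p * T Y X + b p * T Y X') \<and>
     (\<forall>X X' Y Y'. vector_field M U X \<longrightarrow> vector_field M U Y \<longrightarrow>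
        (\<forall>q\<in>U. X q = X' q \<and> Y q = Y' q) \<longrightarrow> T X Y = T X' Y')"

lemma tensor2_lin:
  assumes "tensor2 U p T" "vector_field M U X" "vector_field M U X'" "vector_field M U Y"
    and "\<And>q. q \<in> U \<Longrightarrow> smooth_near M q a" "\<And>q. q \<in> U \<Longrightarrow> smooth_near M q b"
  shows "T (\<lambda>q f. a q * X q f + b q * X' q f) Y = a p * T X Y + b p * T X' Y"
    and "T Y (\<lambda>q f. a q * X q f + b q * X' q f) = a p * T Y X + b p * T Y X'"
  using assms(1)[unfolded tensor2_def, THEN conjunct1, rule_format, of X X' Y a b] assms(2-) by auto

lemma tensor2_cong:
  assumes "tensor2 U p T" "vector_field M U X" "vector_field M U Y"
    and "\<And>q. q \<in> U \<Longrightarrow> X q = X' q" "\<And>q. q \<in> U \<Longrightarrow> Y q = Y' q"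
  shows "T X Y = T X' Y'"
  using assms(1)[unfolded tensor2_def, THEN conjunct2, rule_format, of X Y X' Y'] assms(2-) by auto

lemma tensor2_swap:
  assumes T: "tensor2 U p T"
  shows "tensor2 U p (\<lambda>X Y. T Y X)"
  unfolding tensor2_def
proof (intro conjI allI impI)
  fix X X' Y a b
  assume fields: "vector_field M U X" "vector_field M U X'" "vector_field M U Y"
    and "\<forall>q\<in>U. smooth_near M q a \<and> smooth_near M q b"
  then have ab: "\<And>q. q \<in> U \<Longrightarrow> smooth_near M q a" "\<And>q. q \<in> U \<Longrightarrow> smooth_near M q b"
    by auto
  show "T Y (\<lambda>q f. a q * X q f + b q * X' q f) = a p * T Y X + b p * T Y X'"
    by (rule tensor2_lin(2)[OF T fields ab])
  show "T (\<lambda>q f. a q * X q f + b q * X' q f) Y = a p * T X Y + b p * T X' Y"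
    by (rule tensor2_lin(1)[OF T fields ab])
next
  fix X X' Y Y'
  assume "vector_field M U X" "vector_field M U Y" "\<forall>q\<in>U. X q = X' q \<and> Y q = Y' q"
  then show "T Y X = T Y' X'"
    by (intro tensor2_cong[OF T]) auto
qed

lemma tensor2_sum1:
  assumes T: "tensor2 U p T" and Y: "vector_field M U Y"
    and X: "\<And>i. i \<in> I \<Longrightarrow> vector_field M U (X i)"
    and a: "\<And>i q. i \<in> I \<Longrightarrow> q \<in> U \<Longrightarrow> smooth_near M q (a i)"
  shows "T (\<lambda>q f. \<Sum>i\<in>I. a i q * X i q f) Y = (\<Sum>i\<in>I. a i p * T (X i) Y)"
proof -
  have U: "openin (mtop M) U"
    by (rule vector_field_open[OF Y])
  have const: "smooth_near M q (\<lambda>_. c)" if "q \<in> U" for q c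
    using smooth_near_const openin_points[OF U that] by blast
  have zero: "T (\<lambda>q f. 0) Y = 0"
    using tensor2_lin(1)[OF T Y Y Y const const, of 0 0] by simp
  show ?thesis
    using X a
  proof (induction I rule: infinite_finite_induct)
    case (insert i I)
    have "vector_field M U (\<lambda>q f. \<Sum>i\<in>I. a i q * X i q f)"
      using insert.prems U by (intro vector_field_sum) auto
    then have "T (\<lambda>q f. a i q * X i q f + 1 * (\<Sum>i\<in>I. a i q * X i q f)) Y
      = a i p * T (X i) Y + 1 * T (\<lambda>q f. \<Sum>i\<in>I. a i q * X i q f) Y"
      using insert.prems by (intro tensor2_lin(1)[OF T _ _ Y _ const]) auto
    then show ?case
      using insert by simp
  qed (simp_all add: zero)
qed

lemma tensor2_expand:
  assumes T: "tensor2 U p T" and E: "orthonormal_frame M g U E"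
    and X: "vector_field M U X" and Y: "vector_field M U Y"
  shows "T X Y = (\<Sum>i<DIM('e). (g p (E i p) (E i p) * g p (X p) (E i p)) * T (E i) Y)"
proof -
  have "T X Y = T (\<lambda>q f. \<Sum>i<DIM('e). (g q (E i q) (E i q) * g q (X q) (E i q)) * E i q f) Y"
    by (rule tensor2_cong[OF T X Y frame_expand[OF E X] refl])
  also have "\<dots> = (\<Sum>i<DIM('e). (g p (E i p) (E i p) * g p (X p) (E i p)) * T (E i) Y)"
    by (rule tensor2_sum1[OF T Y])
      (use orthonormal_frameD(1)[OF E] frame_coeff_smooth[OF E X] in auto)
  finally show ?thesis .
qed

text \<open>The matrix between two orthonormal frames is orthogonal with respect to the signs.
  Expanding one frame in the other on both slots of \<open>T\<close> produces exactly the products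
  of matrix entries that this orthogonality sums up.\<close>

lemma trace_frame_independent:
  assumes T: "tensor2 U p T" and p: "p \<in> U"
    and E: "orthonormal_frame M g U E" and E': "orthonormal_frame M g U E'"
  shows "(\<Sum>i<DIM('e). g p (E i p) (E i p) * T (E i) (E i))
    = (\<Sum>i<DIM('e). g p (E' i p) (E' i p) * T (E' i) (E' i))"
proof -
  let ?n = "DIM('e)"
  define s where "s = (\<lambda>i. g p (E i p) (E i p))"
  define s' where "s' = (\<lambda>i. g p (E' i p) (E' i p))"
  define c where "c = (\<lambda>j i. g p (E' j p) (E i p))"
  note F = orthonormal_frameD(1)[OF E] and F' = orthonormal_frameD(1)[OF E']
  note o = orthonormal_frameD(2)[OF E p] and o' = orthonormal_frameD(2)[OF E' p]
  have exp: "T (E' j) (E' j) = (\<Sum>i<?n. \<Sum>l<?n. (s i * c j i) * (s l * c j l) * T (E i) (E l))"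
    if j: "j < ?n" for j
  proof -
    have "T (E' j) (E' j) = (\<Sum>i<?n. (s i * c j i) * T (E i) (E' j))"
      unfolding s_def c_def by (rule tensor2_expand[OF T E F'[OF j] F'[OF j]])
    also have "\<dots> = (\<Sum>i<?n. (s i * c j i) * (\<Sum>l<?n. (s l * c j l) * T (E i) (E l)))"
      unfolding s_def c_def
      using tensor2_expand[OF tensor2_swap[OF T] E F'[OF j] F] by (intro sum.cong refl) simp
    finally show ?thesis
      by (simp add: sum_distrib_left mult.assoc)
  qed
  \<comment> \<open>The inner product of two vectors of the first frame, computed by expansion in
    the second one.\<close>
  have orth: "(\<Sum>j<?n. s' j * c j i * c j l) = (if i = l then s i else 0)" if i: "i < ?n" and l: "l < ?n" for i l
  proof -
    note Ti = vector_field_tangent[OF F[OF i] p] and Tl = vector_field_tangent[OF F[OF l] p]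
    have "g p (E i p) (E l p) = (\<Sum>j<?n. s' j * g p (E i p) (E' j p) * g p (E' j p) (E l p))"
      unfolding s'_def by (rule orthonormal_inner_expand[OF o' Ti Tl])
    also have "\<dots> = (\<Sum>j<?n. s' j * c j i * c j l)"
      unfolding c_def using metric_sym[OF Ti vector_field_tangent[OF F' p]] by (intro sum.cong) auto
    finally show ?thesis
      using orthonormal_atD(2)[OF o i l] by (auto simp: s_def)
  qed
  have "(\<Sum>j<?n. s' j * T (E' j) (E' j))
    = (\<Sum>j<?n. \<Sum>i<?n. \<Sum>l<?n. s' j * ((s i * c j i) * (s l * c j l) * T (E i) (E l)))"
    by (simp add: exp sum_distrib_left)
  also have "\<dots> = (\<Sum>i<?n. \<Sum>l<?n. \<Sum>j<?n. s' j * ((s i * c j i) * (s l * c j l) * T (E i) (E l)))"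
    by (subst sum.swap, rule sum.cong[OF refl], rule sum.swap)
  also have "\<dots> = (\<Sum>i<?n. \<Sum>l<?n. s i * s l * T (E i) (E l) * (\<Sum>j<?n. s' j * c j i * c j l))"
    by (intro sum.cong refl) (simp add: sum_distrib_left mult_ac)
  also have "\<dots> = (\<Sum>i<?n. \<Sum>l<?n. if i = l then s i * (s i * s i) * T (E i) (E i) else 0)"
    by (intro sum.cong refl) (simp only: orth lessThan_iff, simp)
  also have "\<dots> = (\<Sum>i<?n. s i * T (E i) (E i))"
    using orthonormal_atD(3)[OF o] by (simp add: s_def)
  finally show ?thesis
    by (simp add: s_def s'_def)
qed

text \<open>The chosen frame is orthonormal on a neighbourhood of its own, so the comparison takes
  place on the intersection with \<open>U\<close>; hence tensoriality is required on all smaller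
  neighbourhoods.\<close>

lemma trace_frame_near:
  assumes T: "\<And>W. openin (mtop M) W \<Longrightarrow> p \<in> W \<Longrightarrow> W \<subseteq> U \<Longrightarrow> tensor2 W p T"
    and p: "p \<in> U" and E: "orthonormal_frame M g U E" and U: "openin (mtop M) U"
  shows "(\<Sum>i<DIM('e). g p (frame_near M g p i p) (frame_near M g p i p) * T (frame_near M g p i) (frame_near M g p i))
    = (\<Sum>i<DIM('e). g p (E i p) (E i p) * T (E i) (E i))"
proof -
  obtain W where W: "openin (mtop M) W" "p \<in> W" "orthonormal_frame M g W (frame_near M g p)"
    using frame_near openin_points[OF U p] by metis
  have UW: "openin (mtop M) (U \<inter> W)" "p \<in> U \<inter> W" "U \<inter> W \<subseteq> U"
    using U W p by auto
  show ?thesis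
    by (rule trace_frame_independent[OF T[OF UW] UW(2) orthonormal_frame_subset[OF W(3) UW(1)]
          orthonormal_frame_subset[OF E UW(1,3)]]) simp
qed

lemma sum_sign_one:
  assumes "orthonormal_at M g p e"
  shows "(\<Sum>i<DIM('e). g p (e i) (e i) * g p (e i) (e i)) = real DIM('e)"
  using orthonormal_atD(3)[OF assms] by simp

section \<open>Hessian, Laplacian and curvature\<close>

lemma hessian_cong:
  assumes X: "vector_field M U X" and Y: "vector_field M U Y" and p: "p \<in> U"
    and eq: "\<And>q. q \<in> U \<Longrightarrow> X q = X' q" "\<And>q. q \<in> U \<Longrightarrow> Y q = Y' q"
  shows "hessian M g v X Y p = hessian M g v X' Y' p"
proof -
  have "X p (\<lambda>q. Y q v) = X p (\<lambda>q. Y' q v)"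
    by (rule tvec_metric_cong[OF vector_field_tangent[OF X p] vector_field_open[OF X] p]) (simp add: eq)
  then show ?thesis
    using lc_cong[OF X Y p eq] eq(1)[OF p] by (simp add: hessian_def)
qed

lemma hessian_fun_cong:
  assumes X: "vector_field M U X" and Y: "vector_field M U Y" and p: "p \<in> U"
    and eq: "\<And>q. q \<in> U \<Longrightarrow> v q = w q"
  shows "hessian M g v X Y p = hessian M g w X Y p"
proof -
  note U = vector_field_open[OF X]
  have "Y q v = Y q w" if "q \<in> U" for q
    by (rule tvec_metric_cong[OF vector_field_tangent[OF Y that] U that]) (rule eq)
  then have "X p (\<lambda>q. Y q v) = X p (\<lambda>q. Y q w)"
    by (intro tvec_metric_cong[OF vector_field_tangent[OF X p] U p])
  moreover have "lc X Y p v = lc X Y p w"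
    by (rule tvec_metric_cong[OF vector_field_tangent[OF lc_field[OF X Y] p] U p]) (rule eq)
  ultimately show ?thesis
    by (simp add: hessian_def)
qed

lemma hessian_sym:
  assumes X: "vector_field M U X" and Y: "vector_field M U Y" and p: "p \<in> U" and v: "smooth_near M p v"
  shows "hessian M g v X Y p = hessian M g v Y X p"
  using fun_cong[OF lc_torsion[OF X Y p], of v] by (simp add: hessian_def lie_bracket_apply[OF v])

text \<open>Linearity over functions is immediate in the first slot, where no function is
  differentiated; symmetry, that is vanishing torsion, carries it to the second.\<close>

lemma hessian_tensor2:
  assumes p: "p \<in> U" and v: "smooth_near M p v"
  shows "tensor2 U p (\<lambda>X Y. hessian M g v X Y p)"
proof -
  have lin: "hessian M g v (\<lambda>q f. a q * X q f + b q * X' q f) Y p = a p * hessian M g v X Y p + b p * hessian M g v X' Y p"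
    if "vector_field M U X" "vector_field M U X'" "vector_field M U Y"
      "\<And>q. q \<in> U \<Longrightarrow> smooth_near M q a" "\<And>q. q \<in> U \<Longrightarrow> smooth_near M q b" for X X' Y a b
    unfolding hessian_def using fun_cong[OF lc_lin1[OF that(1-3) p that(4,5)], of v]
    by (simp add: algebra_simps)
  show ?thesis
    unfolding tensor2_def
  proof (intro conjI allI impI)
    fix X X' Y a b
    assume fields: "vector_field M U X" "vector_field M U X'" "vector_field M U Y"
      and "\<forall>q\<in>U. smooth_near M q a \<and> smooth_near M q b"
    then have ab: "\<And>q. q \<in> U \<Longrightarrow> smooth_near M q a" "\<And>q. q \<in> U \<Longrightarrow> smooth_near M q b"
      by auto
    show "hessian M g v (\<lambda>q f. a q * X q f + b q * X' q f) Y p = a p * hessian M g v X Y p + b p * hessian M g v X' Y p"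
      by (rule lin[OF fields ab])
    then show "hessian M g v Y (\<lambda>q f. a q * X q f + b q * X' q f) p = a p * hessian M g v Y X p + b p * hessian M g v Y X' p"
      using hessian_sym[OF vector_field_lin[OF fields(1,2) ab] fields(3) p v]
        hessian_sym[OF fields(1,3) p v] hessian_sym[OF fields(2,3) p v] by simp
  next
    fix X X' Y Y'
    assume "vector_field M U X" "vector_field M U Y" "\<forall>q\<in>U. X q = X' q \<and> Y q = Y' q"
    then show "hessian M g v X Y p = hessian M g v X' Y' p"
      by (intro hessian_cong[OF _ _ p]) auto
  qed
qed

lemma laplacian_frame:
  assumes U: "openin (mtop M) U" "p \<in> U" and E: "orthonormal_frame M g U E" and v: "smooth_near M p v"
  shows "laplacian M g v p = (\<Sum>i<DIM('e). g p (E i p) (E i p) * hessian M g v (E i) (E i) p)"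
  unfolding laplacian_def Let_def
  by (rule trace_frame_near[OF hessian_tensor2[OF _ v] U(2) E U(1)])

lemma gradient_tensor2:
  assumes "p \<in> U"
  shows "tensor2 U p (\<lambda>X Y. X p u * Y p v)"
  unfolding tensor2_def using assms by (auto simp: algebra_simps)

lemma gradient_inner_frame:
  assumes U: "openin (mtop M) U" "p \<in> U" and E: "orthonormal_frame M g U E"
  shows "gradient_inner M g u v p = (\<Sum>i<DIM('e). g p (E i p) (E i p) * (E i p u * E i p v))"
  unfolding gradient_inner_def Let_def
  by (rule trace_frame_near[OF gradient_tensor2 U(2) E U(1)])

section \<open>Curvature and its trace\<close>

lemma riemann_field:
  assumes X: "vector_field M U X" and Y: "vector_field M U Y" and Z: "vector_field M U Z"
  shows "vector_field M U (riemann M g X Y Z)"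
  unfolding riemann_def Let_def
  by (intro vector_field_diff lc_field vector_field_lie_bracket assms)

lemma riemann_cong1:
  assumes X: "vector_field M U X" and Y: "vector_field M U Y" and Z: "vector_field M U Z" and p: "p \<in> U"
    and eq: "\<And>q. q \<in> U \<Longrightarrow> X q = X' q"
  shows "riemann M g X Y Z p = riemann M g X' Y Z p"
proof -
  have "lc X (lc Y Z) p = lc X' (lc Y Z) p"
    by (rule lc_cong[OF X lc_field[OF Y Z] p eq refl])
  moreover have "lc Y (lc X Z) p = lc Y (lc X' Z) p"
    by (rule lc_cong[OF Y lc_field[OF X Z] p refl lc_cong[OF X Z _ eq refl]])
  moreover have "lc (lie_bracket M X Y) Z p = lc (lie_bracket M X' Y) Z p"
    by (rule lc_cong[OF vector_field_lie_bracket[OF X Y] Z p lie_bracket_cong[OF X Y _ eq refl] refl])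
  ultimately show ?thesis
    by (simp add: riemann_def Let_def)
qed

lemma lie_bracket_lin1:
  assumes X: "vector_field M U X" and X': "vector_field M U X'" and Y: "vector_field M U Y" and p: "p \<in> U"
    and a: "\<And>q. q \<in> U \<Longrightarrow> smooth_near M q a" and b: "\<And>q. q \<in> U \<Longrightarrow> smooth_near M q b"
  shows "lie_bracket M (\<lambda>q f. a q * X q f + b q * X' q f) Y p
    = (\<lambda>f. (a p * lie_bracket M X Y p f + b p * lie_bracket M X' Y p f) + ((- Y p a) * X p f + (- Y p b) * X' p f))"
  using lie_bracket_add[OF Y vector_field_scale[OF X a] vector_field_scale[OF X' b] p]
    lie_bracket_scale[OF Y X p a[OF p]] lie_bracket_scale[OF Y X' p b[OF p]]
  by (simp add: lie_bracket_antisym[of _ Y] algebra_simps)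

lemma lc_add1:
  assumes "vector_field M U X" "vector_field M U Y" "vector_field M U Z" "p \<in> U"
  shows "lc (\<lambda>q f. X q f + Y q f) Z p = (\<lambda>f. lc X Z p f + lc Y Z p f)"
  using lc_lin1[OF assms smooth_near_const smooth_near_const, of 1 1]
    openin_points[OF vector_field_open[OF assms(1)]] by simp

text \<open>Derivatives of the coefficients arise in two places, in the outer derivative along
  \<open>Y\<close> and in the bracket with \<open>Y\<close>. They occur there with coefficients that
  cancel in the curvature.\<close>

lemma riemann_lin1:
  assumes Z: "vector_field M U Z" and Z': "vector_field M U Z'" and Y: "vector_field M U Y"
    and X: "vector_field M U X" and p: "p \<in> U"
    and a: "\<And>q. q \<in> U \<Longrightarrow> smooth_near M q a" and b: "\<And>q. q \<in> U \<Longrightarrow> smooth_near M q b"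
  shows "riemann M g (\<lambda>q f. a q * Z q f + b q * Z' q f) Y X p
    = (\<lambda>f. a p * riemann M g Z Y X p f + b p * riemann M g Z' Y X p f)"
proof
  fix f
  let ?L = "\<lambda>q f. a q * Z q f + b q * Z' q f"
  have L: "vector_field M U ?L"
    by (rule vector_field_lin[OF Z Z' a b])
  have 1: "lc ?L (lc Y X) p f = a p * lc Z (lc Y X) p f + b p * lc Z' (lc Y X) p f"
    by (simp only: lc_lin1[OF Z Z' lc_field[OF Y X] p a b])
  note aD = vector_field_scale[OF lc_field[OF Z X] a] and bD = vector_field_scale[OF lc_field[OF Z' X] b]
  have "lc Y (lc ?L X) p = lc Y (\<lambda>q f. a q * lc Z X q f + b q * lc Z' X q f) p"
    by (rule lc_cong[OF Y lc_field[OF L X] p refl]) (rule lc_lin1[OF Z Z' X _ a b])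
  then have 2: "lc Y (lc ?L X) p f = (Y p a * lc Z X p f + a p * lc Y (lc Z X) p f)
      + (Y p b * lc Z' X p f + b p * lc Y (lc Z' X) p f)"
    by (simp only: lc_add2[OF Y aD bD p] lc_scale2[OF Y lc_field[OF Z X] p a]
        lc_scale2[OF Y lc_field[OF Z' X] p b])
  have Ya: "smooth_near M q (\<lambda>q. - Y q a)" "smooth_near M q (\<lambda>q. - Y q b)" if "q \<in> U" for q
    using smooth_near_diff[OF smooth_near_const vector_field_smooth[OF Y that a[OF that]], of 0]
      smooth_near_diff[OF smooth_near_const vector_field_smooth[OF Y that b[OF that]], of 0]
      openin_points[OF vector_field_open[OF Y] that] by simp_all
  note BZ = vector_field_lie_bracket[OF Z Y] and BZ' = vector_field_lie_bracket[OF Z' Y]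
  have "lc (lie_bracket M ?L Y) X p = lc (\<lambda>q f. (a q * lie_bracket M Z Y q f + b q * lie_bracket M Z' Y q f)
      + ((- Y q a) * Z q f + (- Y q b) * Z' q f)) X p"
    by (rule lc_cong[OF vector_field_lie_bracket[OF L Y] X p _ refl])
      (rule lie_bracket_lin1[OF Z Z' Y _ a b])
  then have 3: "lc (lie_bracket M ?L Y) X p f
    = (a p * lc (lie_bracket M Z Y) X p f + b p * lc (lie_bracket M Z' Y) X p f)
      + ((- Y p a) * lc Z X p f + (- Y p b) * lc Z' X p f)"
    by (simp only: lc_add1[OF vector_field_lin[OF BZ BZ' a b] vector_field_lin[OF Z Z' Ya] X p]
        lc_lin1[OF BZ BZ' X p a b] lc_lin1[OF Z Z' X p Ya])
  show "riemann M g ?L Y X p f = a p * riemann M g Z Y X p f + b p * riemann M g Z' Y X p f"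
    unfolding riemann_def Let_def 1 2 3 by (simp add: algebra_simps)
qed

text \<open>The two slots that the Ricci tensor contracts, the first argument of the curvature and
  the vector it is paired with.\<close>

lemma riemann_tensor2:
  assumes Y: "vector_field M U Y" and X: "vector_field M U X" and p: "p \<in> U"
  shows "tensor2 U p (\<lambda>Z W. g p (riemann M g Z Y X p) (W p))"
  unfolding tensor2_def
proof (intro conjI allI impI)
  fix Z Z' W a b
  assume fields: "vector_field M U Z" "vector_field M U Z'" "vector_field M U W"
    and "\<forall>q\<in>U. smooth_near M q a \<and> smooth_near M q b"
  then have ab: "\<And>q. q \<in> U \<Longrightarrow> smooth_near M q a" "\<And>q. q \<in> U \<Longrightarrow> smooth_near M q b"
    by auto
  note T = vector_field_tangent[OF riemann_field[OF _ Y X] p] vector_field_tangent[OF _ p]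
  have "riemann M g (\<lambda>q f. a q * Z q f + b q * Z' q f) Y X p
    = (\<lambda>f. a p * riemann M g Z Y X p f + b p * riemann M g Z' Y X p f)"
    by (rule riemann_lin1[OF fields(1,2) Y X p ab])
  then show "g p (riemann M g (\<lambda>q f. a q * Z q f + b q * Z' q f) Y X p) (W p)
    = a p * g p (riemann M g Z Y X p) (W p) + b p * g p (riemann M g Z' Y X p) (W p)"
    by (simp only:) (intro metric_lin T fields)
  show "g p (riemann M g W Y X p) (\<lambda>f. a p * Z p f + b p * Z' p f)
    = a p * g p (riemann M g W Y X p) (Z p) + b p * g p (riemann M g W Y X p) (Z' p)"
    by (intro metric_lin2 T fields)
next
  fix Z W Z' W'
  assume "vector_field M U Z" "vector_field M U Z'" "\<forall>q\<in>U. Z q = W q \<and> Z' q = W' q"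
  then show "g p (riemann M g Z Y X p) (Z' p) = g p (riemann M g W Y X p) (W' p)"
    using riemann_cong1[OF _ Y X p, of Z W] p by simp
qed

lemma ricci_frame:
  assumes X: "vector_field M U X" and Y: "vector_field M U Y" and p: "p \<in> U" and E: "orthonormal_frame M g U E"
  shows "ricci M g X Y p = (\<Sum>i<DIM('e). g p (E i p) (E i p) * g p (riemann M g (E i) Y X p) (E i p))"
  unfolding ricci_def Let_def
  by (rule trace_frame_near[OF riemann_tensor2 p E vector_field_open[OF X]])
    (auto intro: vector_field_subset[OF X] vector_field_subset[OF Y])

end

section \<open>Conformal changes of the metric\<close>

definition conformal :: "('a \<Rightarrow> real) \<Rightarrow> 'a metric \<Rightarrow> 'a metric" where
  "conformal \<sigma> g = (\<lambda>p u v. exp (2 * \<sigma> p) * g p u v)"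

locale conformal_mfd = metric_mfd M g for M :: "('a, 'e::euclidean_space) mfd" and g :: "'a metric" +
  fixes \<sigma> :: "'a \<Rightarrow> real"
  assumes factor_smooth: "p \<in> points M \<Longrightarrow> smooth_near M p \<sigma>"
begin

lemma exp_factor_smooth: "p \<in> points M \<Longrightarrow> smooth_near M p (\<lambda>q. exp (c * \<sigma> q))"
  by (intro smooth_near_compose[OF smooth_near_mult[OF smooth_near_const factor_smooth] Cinf_on_exp]) auto

lemma exp_factor_deriv:
  assumes "v \<in> tangent_space M p"
  shows "v (\<lambda>q. exp (c * \<sigma> q)) = exp (c * \<sigma> p) * (c * v \<sigma>)"
proof -
  have p: "p \<in> points M"
    using assms tangent_space_points by blast
  have "v (\<lambda>q. exp (c * \<sigma> q)) = exp (c * \<sigma> p) * v (\<lambda>q. c * \<sigma> q)"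
    by (rule tvec_compose[OF assms smooth_near_mult[OF smooth_near_const[OF p] factor_smooth[OF p]] Cinf_on_exp])
      (auto intro: DERIV_exp)
  then show ?thesis
    using tvec_cmult[OF assms factor_smooth[OF p]] by simp
qed

lemma conformal_orthonormal_at:
  assumes e: "orthonormal_at M g p e"
  shows "orthonormal_at M (conformal \<sigma> g) p (\<lambda>i f. exp (- \<sigma> p) * e i f)"
  unfolding orthonormal_at_def
proof (intro conjI allI impI)
  note T = orthonormal_atD(1)[OF e]
  have T': "(\<lambda>f. exp (- \<sigma> p) * e i f) \<in> tangent_space M p" if "i < DIM('e)" for i
    using tangent_lin[OF T[OF that] T[OF that], of "exp (- \<sigma> p)" 0] by simp
  show "i < DIM('e) \<Longrightarrow> (\<lambda>f. exp (- \<sigma> p) * e i f) \<in> tangent_space M p" for i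
    by (rule T')
  fix i j assume i: "i < DIM('e)" and j: "j < DIM('e)"
  have "conformal \<sigma> g p (\<lambda>f. exp (- \<sigma> p) * e i f) (\<lambda>f. exp (- \<sigma> p) * e j f)
      = exp (2 * \<sigma> p) * (exp (- \<sigma> p) * (exp (- \<sigma> p) * g p (e i) (e j)))"
    unfolding conformal_def using T T' i j by (simp add: metric_scale)
  also have "\<dots> = (exp (2 * \<sigma> p) * exp (- \<sigma> p) * exp (- \<sigma> p)) * g p (e i) (e j)"
    by simp
  also have "exp (2 * \<sigma> p) * exp (- \<sigma> p) * exp (- \<sigma> p) = 1"
    by (simp flip: exp_add)
  finally show "\<bar>conformal \<sigma> g p (\<lambda>f. exp (- \<sigma> p) * e i f) (\<lambda>f. exp (- \<sigma> p) * e j f)\<bar> = (if i = j then 1 else 0)"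
    using e i j by (simp add: orthonormal_at_def)
qed

sublocale conf: metric_mfd M "conformal \<sigma> g"
proof unfold_locales
  show "conformal \<sigma> g p (\<lambda>f. a * u f + b * v f) w = a * conformal \<sigma> g p u w + b * conformal \<sigma> g p v w"
    if "u \<in> tangent_space M p" "v \<in> tangent_space M p" "w \<in> tangent_space M p" for u p v w a b
    by (simp add: conformal_def metric_lin[OF that] algebra_simps)
  show "conformal \<sigma> g p u v = conformal \<sigma> g p v u"
    if "u \<in> tangent_space M p" "v \<in> tangent_space M p" for u p v
    by (simp add: conformal_def metric_sym[OF that])
  show "smooth_near M p (\<lambda>q. conformal \<sigma> g q (X q) (Y q))"
    if "vector_field M U X" "vector_field M U Y" "p \<in> U" for U X Y p
    unfolding conformal_def using openin_points[OF vector_field_open[OF that(1)] that(3)]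
    by (intro smooth_near_mult exp_factor_smooth metric_smooth[OF that])
  show "\<exists>e. orthonormal_at M (conformal \<sigma> g) p e" if "p \<in> points M" for p
    using metric_orthonormal[OF that] conformal_orthonormal_at by blast
qed

lemma conformal_deriv:
  assumes v: "v \<in> tangent_space M p" and X: "vector_field M U X" and Y: "vector_field M U Y" and p: "p \<in> U"
  shows "v (\<lambda>q. conformal \<sigma> g q (X q) (Y q))
    = exp (2 * \<sigma> p) * (2 * v \<sigma> * g p (X p) (Y p) + v (\<lambda>q. g q (X q) (Y q)))"
proof -
  have "p \<in> points M"
    using v tangent_space_points by blast
  then have "v (\<lambda>q. exp (2 * \<sigma> q) * g q (X q) (Y q))
    = exp (2 * \<sigma> p) * (2 * v \<sigma>) * g p (X p) (Y p) + exp (2 * \<sigma> p) * v (\<lambda>q. g q (X q) (Y q))"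
    using tvec_mult[OF v exp_factor_smooth metric_smooth[OF X Y p], of 2] exp_factor_deriv[OF v, of 2]
    by simp
  then show ?thesis
    unfolding conformal_def by (simp add: distrib_left)
qed

text \<open>Brackets do not involve the metric, so apart from the common factor only the three
  derivative terms change, each by twice a derivative of \<sigma> times an inner product.\<close>

lemma koszul_conformal:
  assumes X: "vector_field M U X" and Y: "vector_field M U Y" and Z: "vector_field M U Z" and p: "p \<in> U"
  shows "koszul M (conformal \<sigma> g) X Y Z p = exp (2 * \<sigma> p) * (koszul M g X Y Z p
    + X p \<sigma> * g p (Y p) (Z p) + Y p \<sigma> * g p (X p) (Z p) - Z p \<sigma> * g p (X p) (Y p))"
  unfolding koszul_def conformal_deriv[OF vector_field_tangent[OF X p] Y Z p]
    conformal_deriv[OF vector_field_tangent[OF Y p] Z X p]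
    conformal_deriv[OF vector_field_tangent[OF Z p] X Y p]
    metric_sym[OF vector_field_tangent[OF Z p] vector_field_tangent[OF X p]]
  by (simp add: conformal_def field_simps)

section \<open>Connection and curvature of a conformal metric\<close>

context
  fixes U E
  assumes E: "orthonormal_frame M g U E" and U: "openin (mtop M) U"
begin

text \<open>The differential of \<sigma> with its index raised, in terms of the fixed frame: the
  connection has to be applied to it, so it must be a smooth field on the whole of
  \<open>U\<close>.\<close>

definition gradient :: "'a \<Rightarrow> 'a tvec" where
  "gradient = (\<lambda>q f. \<Sum>i<DIM('e). (g q (E i q) (E i q) * E i q \<sigma>) * E i q f)"

lemma gradient_field: "vector_field M U gradient"
  unfolding gradient_def
proof (rule vector_field_sum[OF U])
  show "vector_field M U (E i)" if "i \<in> {..<DIM('e)}" for i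
    using orthonormal_frameD(1)[OF E] that by simp
  show "smooth_near M q (\<lambda>q. g q (E i q) (E i q) * E i q \<sigma>)" if i: "i \<in> {..<DIM('e)}" and q: "q \<in> U" for i q
  proof -
    have Ei: "vector_field M U (E i)"
      using orthonormal_frameD(1)[OF E] i by simp
    show ?thesis
      by (intro smooth_near_mult metric_smooth[OF Ei Ei q]
          vector_field_smooth[OF Ei q factor_smooth[OF openin_points[OF U q]]])
  qed
qed

lemma gradient_metric:
  assumes q: "q \<in> U" and v: "v \<in> tangent_space M q"
  shows "g q (gradient q) v = v \<sigma>"
proof -
  note T = vector_field_tangent[OF orthonormal_frameD(1)[OF E] q]
  have "g q (gradient q) v = (\<Sum>i<DIM('e). (g q (E i q) (E i q) * E i q \<sigma>) * g q (E i q) v)"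
    unfolding gradient_def using T by (intro metric_sum v) auto
  also have "\<dots> = (\<Sum>i<DIM('e). (g q (E i q) (E i q) * g q v (E i q)) * E i q \<sigma>)"
    by (intro sum.cong refl) (use metric_sym[OF T v] in auto)
  also have "\<dots> = v \<sigma>"
    using orthonormal_expand[OF orthonormal_frameD(2)[OF E q] v] by metis
  finally show ?thesis .
qed

text \<open>Differentiate the defining property of the gradient and use metric compatibility: the
  Hessian is the derivative of the gradient with its index lowered.\<close>

lemma gradient_hessian:
  assumes Z: "vector_field M U Z" and T: "vector_field M U T" and p: "p \<in> U"
  shows "g p (lc Z gradient p) (T p) = hessian M g \<sigma> Z T p"
proof -
  have "Z p (\<lambda>q. g q (gradient q) (T q)) = Z p (\<lambda>q. T q \<sigma>)"
    by (rule tvec_metric_cong[OF vector_field_tangent[OF Z p] U p])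
      (rule gradient_metric[OF _ vector_field_tangent[OF T]])
  then show ?thesis
    using lc_metric[OF Z gradient_field T p] gradient_metric[OF p vector_field_tangent[OF lc_field[OF Z T] p]]
    by (simp add: hessian_def)
qed

text \<open>Read off from \<open>koszul_conformal\<close> by nondegeneracy, since the factor
  \<open>exp (2 * \<sigma> p)\<close> is common to both sides. The sum is bracketed and signed as
  \<open>lc_add2\<close> and \<open>lc_scale2\<close> require when it is differentiated
  again.\<close>

lemma lc_conformal:
  assumes X: "vector_field M U X" and Y: "vector_field M U Y" and p: "p \<in> U"
  shows "conf.lc X Y p
    = (\<lambda>f. lc X Y p f + ((X p \<sigma> * Y p f + Y p \<sigma> * X p f) + (- g p (X p) (Y p)) * gradient p f))"
proof -
  note T = vector_field_tangent[OF X p] vector_field_tangent[OF Y p] vector_field_tangent[OF lc_field[OF X Y] p]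
    vector_field_tangent[OF gradient_field p]
  have S: "(\<lambda>f. X p \<sigma> * Y p f + Y p \<sigma> * X p f) \<in> tangent_space M p"
    by (rule tangent_lin[OF T(2,1)])
  have S': "(\<lambda>f. (X p \<sigma> * Y p f + Y p \<sigma> * X p f) + (- g p (X p) (Y p)) * gradient p f) \<in> tangent_space M p"
    using tangent_lin[OF S T(4), of 1 "- g p (X p) (Y p)"] by simp
  have W: "(\<lambda>f. lc X Y p f + ((X p \<sigma> * Y p f + Y p \<sigma> * X p f) + (- g p (X p) (Y p)) * gradient p f)) \<in> tangent_space M p"
    using tangent_lin[OF T(3) S', of 1 1] by simp
  show ?thesis
  proof (rule conf.tangent_field_eqI[OF vector_field_tangent[OF conf.lc_field[OF X Y] p] W U p])
    fix N Z assume N: "openin (mtop M) N" "p \<in> N" "N \<subseteq> U" and Z: "vector_field M N Z"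
    note s = vector_field_subset[OF _ N(1,3)]
    note ZT = vector_field_tangent[OF Z N(2)]
    have "g p (\<lambda>f. lc X Y p f + ((X p \<sigma> * Y p f + Y p \<sigma> * X p f) + (- g p (X p) (Y p)) * gradient p f)) (Z p)
      = g p (lc X Y p) (Z p) + g p (\<lambda>f. (X p \<sigma> * Y p f + Y p \<sigma> * X p f) + (- g p (X p) (Y p)) * gradient p f) (Z p)"
      by (rule metric_add(1)[OF T(3) S' ZT])
    also have "g p (\<lambda>f. (X p \<sigma> * Y p f + Y p \<sigma> * X p f) + (- g p (X p) (Y p)) * gradient p f) (Z p)
      = g p (\<lambda>f. X p \<sigma> * Y p f + Y p \<sigma> * X p f) (Z p) - g p (X p) (Y p) * g p (gradient p) (Z p)"
      using metric_lin[OF S T(4) ZT, of 1 "- g p (X p) (Y p)"] by simp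
    also have "g p (\<lambda>f. X p \<sigma> * Y p f + Y p \<sigma> * X p f) (Z p) = X p \<sigma> * g p (Y p) (Z p) + Y p \<sigma> * g p (X p) (Z p)"
      by (rule metric_lin[OF T(2,1) ZT])
    finally have main: "g p (\<lambda>f. lc X Y p f + ((X p \<sigma> * Y p f + Y p \<sigma> * X p f) + (- g p (X p) (Y p)) * gradient p f)) (Z p)
      = g p (lc X Y p) (Z p) + (X p \<sigma> * g p (Y p) (Z p) + Y p \<sigma> * g p (X p) (Z p)
        - g p (X p) (Y p) * g p (gradient p) (Z p))" .
    show "conformal \<sigma> g p (conf.lc X Y p) (Z p) = conformal \<sigma> g p
        (\<lambda>f. lc X Y p f + ((X p \<sigma> * Y p f + Y p \<sigma> * X p f) + (- g p (X p) (Y p)) * gradient p f)) (Z p)"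
      unfolding conf.lc_koszul[OF s[OF X] s[OF Y] Z N(2)] koszul_conformal[OF s[OF X] s[OF Y] Z N(2)]
      unfolding conformal_def main lc_koszul[OF s[OF X] s[OF Y] Z N(2)] gradient_metric[OF p ZT]
      by (simp add: algebra_simps)
  qed
qed

text \<open>The outer connection also differentiates the coefficients of
  \<open>lc_conformal\<close>. These iterated derivatives of \<sigma> and of the metric stay
  unexpanded here, because in the curvature they combine with connection terms or cancel.\<close>

lemma lc_lc_conformal:
  assumes Z: "vector_field M U Z" and Y: "vector_field M U Y" and X: "vector_field M U X" and p: "p \<in> U"
  shows "conf.lc Z (conf.lc Y X) p f = lc Z (lc Y X) p f
    + (Z p (\<lambda>q. Y q \<sigma>) * X p f + Y p \<sigma> * lc Z X p f)
    + (Z p (\<lambda>q. X q \<sigma>) * Y p f + X p \<sigma> * lc Z Y p f)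
    - (Z p (\<lambda>q. g q (Y q) (X q)) * gradient p f + g p (Y p) (X p) * lc Z gradient p f)
    + (Z p \<sigma> * (lc Y X p f + Y p \<sigma> * X p f + X p \<sigma> * Y p f - g p (Y p) (X p) * gradient p f)
      + (lc Y X p \<sigma> + 2 * Y p \<sigma> * X p \<sigma> - g p (Y p) (X p) * gradient p \<sigma>) * Z p f
      - (g p (Z p) (lc Y X p) + Y p \<sigma> * g p (Z p) (X p) + X p \<sigma> * g p (Z p) (Y p) - g p (Y p) (X p) * Z p \<sigma>)
        * gradient p f)"
proof -
  let ?S = "\<lambda>q f. (Y q \<sigma> * X q f + X q \<sigma> * Y q f) + (- g q (Y q) (X q)) * gradient q f"
  let ?W = "\<lambda>q f. lc Y X q f + ?S q f"
  have \<sigma>: "smooth_near M q \<sigma>" if "q \<in> U" for q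
    by (rule factor_smooth[OF openin_points[OF U that]])
  have sm: "smooth_near M q (\<lambda>q. Y q \<sigma>)" "smooth_near M q (\<lambda>q. X q \<sigma>)" "smooth_near M q (\<lambda>q. - g q (Y q) (X q))"
    if "q \<in> U" for q
    using vector_field_smooth[OF Y that \<sigma>[OF that]] vector_field_smooth[OF X that \<sigma>[OF that]]
      smooth_near_mult[OF smooth_near_const[OF openin_points[OF U that], of "-1"] metric_smooth[OF Y X that]]
    by simp_all
  note YX = vector_field_scale[OF X sm(1)] and XY = vector_field_scale[OF Y sm(2)]
    and gG = vector_field_scale[OF gradient_field sm(3)]
  note YXY = vector_field_add[OF YX XY]
  note S = vector_field_add[OF YXY gG] and D = lc_field[OF Y X]
  note W = vector_field_add[OF D S]
  note T = vector_field_tangent[OF X p] vector_field_tangent[OF Y p] vector_field_tangent[OF Z p]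
    vector_field_tangent[OF gradient_field p] vector_field_tangent[OF D p] vector_field_tangent[OF YXY p]
    vector_field_tangent[OF S p]
  have eq: "conf.lc Y X q = ?W q" if "q \<in> U" for q
    by (rule lc_conformal[OF Y X that])
  have "conf.lc Z (conf.lc Y X) p f = lc Z (conf.lc Y X) p f
    + ((Z p \<sigma> * conf.lc Y X p f + conf.lc Y X p \<sigma> * Z p f) + (- g p (Z p) (conf.lc Y X p)) * gradient p f)"
    by (rule fun_cong[OF lc_conformal[OF Z conf.lc_field[OF Y X] p]])
  also have "lc Z (conf.lc Y X) p = lc Z ?W p"
    by (rule lc_cong[OF Z conf.lc_field[OF Y X] p refl eq])
  also have "lc Z ?W p f = lc Z (lc Y X) p f + (((Z p (\<lambda>q. Y q \<sigma>) * X p f + Y p \<sigma> * lc Z X p f)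
    + (Z p (\<lambda>q. X q \<sigma>) * Y p f + X p \<sigma> * lc Z Y p f))
    + (Z p (\<lambda>q. - g q (Y q) (X q)) * gradient p f + (- g p (Y p) (X p)) * lc Z gradient p f))"
    by (simp only: lc_add2[OF Z D S p] lc_add2[OF Z YXY gG p] lc_add2[OF Z YX XY p]
        lc_scale2[OF Z X p sm(1)] lc_scale2[OF Z Y p sm(2)] lc_scale2[OF Z gradient_field p sm(3)])
  finally have main: "conf.lc Z (conf.lc Y X) p f = lc Z (lc Y X) p f + (((Z p (\<lambda>q. Y q \<sigma>) * X p f + Y p \<sigma> * lc Z X p f)
    + (Z p (\<lambda>q. X q \<sigma>) * Y p f + X p \<sigma> * lc Z Y p f))
    + (Z p (\<lambda>q. - g q (Y q) (X q)) * gradient p f + (- g p (Y p) (X p)) * lc Z gradient p f))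
    + ((Z p \<sigma> * conf.lc Y X p f + conf.lc Y X p \<sigma> * Z p f) + (- g p (Z p) (conf.lc Y X p)) * gradient p f)" .
  have 1: "Z p (\<lambda>q. - g q (Y q) (X q)) = - Z p (\<lambda>q. g q (Y q) (X q))"
    using tvec_cmult[OF T(3) metric_smooth[OF Y X p], of "-1"] by simp
  have 2: "g p (Z p) (conf.lc Y X p) = g p (Z p) (lc Y X p) + Y p \<sigma> * g p (Z p) (X p)
    + X p \<sigma> * g p (Z p) (Y p) - g p (Y p) (X p) * Z p \<sigma>"
  proof -
    have "g p (Z p) (?S p) = g p (Z p) (\<lambda>f. Y p \<sigma> * X p f + X p \<sigma> * Y p f) - g p (Y p) (X p) * g p (Z p) (gradient p)"
      using metric_lin2[OF T(6,4,3), of 1 "- g p (Y p) (X p)"] by simp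
    moreover have "g p (Z p) (gradient p) = Z p \<sigma>"
      using metric_sym[OF T(3,4)] gradient_metric[OF p T(3)] by simp
    moreover have "g p (Z p) (?W p) = g p (Z p) (lc Y X p) + g p (Z p) (?S p)"
      by (rule metric_add(2)[OF T(5,7,3)])
    moreover have "g p (Z p) (\<lambda>f. Y p \<sigma> * X p f + X p \<sigma> * Y p f) = Y p \<sigma> * g p (Z p) (X p) + X p \<sigma> * g p (Z p) (Y p)"
      by (rule metric_lin2[OF T(1,2,3)])
    ultimately show ?thesis
      unfolding eq[OF p] by simp
  qed
  show ?thesis
    unfolding main 1 2 unfolding eq[OF p] by (simp add: algebra_simps)
qed

text \<open>In the difference over \<open>Z\<close> and \<open>Y\<close> and the bracket term,
  derivatives of inner products are resolved by \<open>lc_metric\<close>, and the iterated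
  derivatives of \<sigma> complete to Hessians. Derivatives of the gradient remain as vectors;
  pairing turns them into Hessians too.\<close>

lemma riemann_conformal:
  assumes Z: "vector_field M U Z" and Y: "vector_field M U Y" and X: "vector_field M U X" and p: "p \<in> U"
  shows "riemann M (conformal \<sigma> g) Z Y X p f = riemann M g Z Y X p f
    + (hessian M g \<sigma> Z X p - Z p \<sigma> * X p \<sigma> + g p (Z p) (X p) * gradient p \<sigma>) * Y p f
    - (hessian M g \<sigma> Y X p - Y p \<sigma> * X p \<sigma> + g p (Y p) (X p) * gradient p \<sigma>) * Z p f
    - g p (Y p) (X p) * lc Z gradient p f + g p (Z p) (X p) * lc Y gradient p f
    + (Z p \<sigma> * g p (Y p) (X p) - Y p \<sigma> * g p (Z p) (X p)) * gradient p f"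
proof -
  note B = vector_field_lie_bracket[OF Z Y]
  note tor = lc_torsion[OF Z Y p]
  note T = vector_field_tangent[OF X p] vector_field_tangent[OF Y p] vector_field_tangent[OF Z p]
    vector_field_tangent[OF lc_field[OF Z Y] p] vector_field_tangent[OF lc_field[OF Y Z] p]
    vector_field_tangent[OF lc_field[OF Z X] p] vector_field_tangent[OF lc_field[OF Y X] p]
  have "conf.lc (lie_bracket M Z Y) X p f = lc (lie_bracket M Z Y) X p f
    + ((lie_bracket M Z Y p \<sigma> * X p f + X p \<sigma> * lie_bracket M Z Y p f)
      + (- g p (lie_bracket M Z Y p) (X p)) * gradient p f)"
    by (rule fun_cong[OF lc_conformal[OF B X p]])
  moreover have "lie_bracket M Z Y p \<sigma> = Z p (\<lambda>q. Y q \<sigma>) - Y p (\<lambda>q. Z q \<sigma>)"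
    by (rule lie_bracket_apply[OF factor_smooth[OF openin_points[OF U p]]])
  moreover have "lie_bracket M Z Y p f = lc Z Y p f - lc Y Z p f"
    by (simp only: tor)
  moreover have "g p (lie_bracket M Z Y p) (X p) = g p (lc Z Y p) (X p) - g p (lc Y Z p) (X p)"
    unfolding tor by (rule metric_diff(1)[OF T(4,5,1)])
  moreover have "Z p (\<lambda>q. g q (Y q) (X q)) = g p (lc Z Y p) (X p) + g p (Y p) (lc Z X p)"
    "Y p (\<lambda>q. g q (Z q) (X q)) = g p (lc Y Z p) (X p) + g p (Z p) (lc Y X p)"
    by (rule lc_metric[OF Z Y X p], rule lc_metric[OF Y Z X p])
  moreover have "g p (Z p) (Y p) = g p (Y p) (Z p)"
    by (rule metric_sym[OF T(3,2)])
  ultimately show ?thesis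
    unfolding riemann_def Let_def hessian_def lc_lc_conformal[OF Z Y X p] lc_lc_conformal[OF Y Z X p]
    by (simp add: algebra_simps)
qed

section \<open>Traces with respect to a conformal metric\<close>

lemma hessian_conformal_frame:
  assumes X: "vector_field M U X" and Y: "vector_field M U Y" and p: "p \<in> U"
  shows "hessian M (conformal \<sigma> g) v X Y p = hessian M g v X Y p
    - (X p \<sigma> * Y p v + Y p \<sigma> * X p v - g p (X p) (Y p) * gradient p v)"
  unfolding hessian_def lc_conformal[OF X Y p] by simp

lemma gradient_apply: "p \<in> U \<Longrightarrow> gradient p v = gradient_inner M g \<sigma> v p"
  unfolding gradient_inner_frame[OF U _ E] by (simp add: gradient_def mult.assoc)

text \<open>The factor is written \<open>exp ((-1) * \<sigma> q)\<close> to match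
  \<open>exp_factor_smooth\<close>, which speaks of \<open>exp (c * \<sigma> q)\<close>.\<close>

lemma conformal_frame: "orthonormal_frame M (conformal \<sigma> g) U (\<lambda>i q f. exp ((-1) * \<sigma> q) * E i q f)"
  unfolding orthonormal_frame_def
proof (intro conjI allI impI ballI)
  show "vector_field M U (\<lambda>q f. exp ((-1) * \<sigma> q) * E i q f)" if "i < DIM('e)" for i
    by (intro vector_field_scale orthonormal_frameD(1)[OF E that] exp_factor_smooth openin_points[OF U])
  show "orthonormal_at M (conformal \<sigma> g) q (\<lambda>i f. exp ((-1) * \<sigma> q) * E i q f)" if "q \<in> U" for q
    using conformal_orthonormal_at[OF orthonormal_frameD(2)[OF E that]] by simp
qed

text \<open>The factors \<open>exp (2 * \<sigma> p)\<close> of the metric and \<open>exp (- \<sigma> p)\<close> of the frame vectors cancel.\<close>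

lemma conformal_trace:
  assumes p: "p \<in> U"
    and T: "conf.tensor2 U p T"
  shows "(\<Sum>i<DIM('e). conformal \<sigma> g p (\<lambda>f. exp ((-1) * \<sigma> p) * E i p f) (\<lambda>f. exp ((-1) * \<sigma> p) * E i p f)
      * T (\<lambda>q f. exp ((-1) * \<sigma> q) * E i q f) (\<lambda>q f. exp ((-1) * \<sigma> q) * E i q f))
    = exp (- 2 * \<sigma> p) * (\<Sum>i<DIM('e). g p (E i p) (E i p) * T (E i) (E i))"
proof -
  have "conformal \<sigma> g p (\<lambda>f. exp ((-1) * \<sigma> p) * E i p f) (\<lambda>f. exp ((-1) * \<sigma> p) * E i p f) = g p (E i p) (E i p)"
    "T (\<lambda>q f. exp ((-1) * \<sigma> q) * E i q f) (\<lambda>q f. exp ((-1) * \<sigma> q) * E i q f) = exp (- 2 * \<sigma> p) * T (E i) (E i)"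
    if i: "i < DIM('e)" for i
  proof -
    note Ei = orthonormal_frameD(1)[OF E i]
    note ET = vector_field_tangent[OF Ei p]
    have sm: "smooth_near M q (\<lambda>q. exp ((-1) * \<sigma> q))" "smooth_near M q (\<lambda>q. 0)" if "q \<in> U" for q
      using exp_factor_smooth smooth_near_const openin_points[OF U that] by blast+
    have EE: "exp (- \<sigma> p) * exp (- \<sigma> p) = exp (- 2 * \<sigma> p)" "exp (2 * \<sigma> p) * exp (- 2 * \<sigma> p) = 1"
      by (simp_all flip: exp_add)
    have ET': "(\<lambda>f. exp ((-1) * \<sigma> p) * E i p f) \<in> tangent_space M p"
      using tangent_lin[OF ET ET, of "exp ((-1) * \<sigma> p)" 0] by simp
    have "conformal \<sigma> g p (\<lambda>f. exp ((-1) * \<sigma> p) * E i p f) (\<lambda>f. exp ((-1) * \<sigma> p) * E i p f)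
      = exp (2 * \<sigma> p) * (exp (- \<sigma> p) * exp (- \<sigma> p)) * g p (E i p) (E i p)"
      unfolding conformal_def by (simp only: metric_scale[OF ET ET'] metric_scale[OF ET ET]) simp
    then show "conformal \<sigma> g p (\<lambda>f. exp ((-1) * \<sigma> p) * E i p f) (\<lambda>f. exp ((-1) * \<sigma> p) * E i p f) = g p (E i p) (E i p)"
      unfolding EE by simp
    have sE: "vector_field M U (\<lambda>q f. exp ((-1) * \<sigma> q) * E i q f)"
      by (rule vector_field_scale[OF Ei sm(1)])
    have "T (\<lambda>q f. exp ((-1) * \<sigma> q) * E i q f) (\<lambda>q f. exp ((-1) * \<sigma> q) * E i q f)
      = exp (- \<sigma> p) * (exp (- \<sigma> p) * T (E i) (E i))"
      using conf.tensor2_lin(1)[OF T Ei Ei sE sm] conf.tensor2_lin(2)[OF T Ei Ei Ei sm] by simp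
    then show "T (\<lambda>q f. exp ((-1) * \<sigma> q) * E i q f) (\<lambda>q f. exp ((-1) * \<sigma> q) * E i q f) = exp (- 2 * \<sigma> p) * T (E i) (E i)"
      unfolding EE(1)[symmetric] by (simp only: mult.assoc)
  qed
  then show ?thesis
    by (simp add: sum_distrib_left mult_ac)
qed

lemma gradient_inner_conformal_frame:
  assumes p: "p \<in> U"
  shows "gradient_inner M (conformal \<sigma> g) u v p = exp (- 2 * \<sigma> p) * gradient_inner M g u v p"
  unfolding conf.gradient_inner_frame[OF U p conformal_frame] gradient_inner_frame[OF U p E]
  by (rule conformal_trace[OF p conf.gradient_tensor2[OF p]])

lemma laplacian_conformal_frame:
  assumes p: "p \<in> U" and v: "smooth_near M p v"
  shows "laplacian M (conformal \<sigma> g) v p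
    = exp (- 2 * \<sigma> p) * (laplacian M g v p + (real DIM('e) - 2) * gradient_inner M g \<sigma> v p)"
proof -
  note o = orthonormal_frameD(2)[OF E p]
  have "laplacian M (conformal \<sigma> g) v p = exp (- 2 * \<sigma> p)
    * (\<Sum>i<DIM('e). g p (E i p) (E i p) * hessian M (conformal \<sigma> g) v (E i) (E i) p)"
    unfolding conf.laplacian_frame[OF U p conformal_frame v]
    by (rule conformal_trace[OF p conf.hessian_tensor2[OF p v]])
  \<comment> \<open>The correction of the Hessian has two equal products of derivatives, giving -2,
    and a multiple of the metric, whose trace is the dimension; together they yield the factor n -
    2.\<close>
  also have "(\<Sum>i<DIM('e). g p (E i p) (E i p) * hessian M (conformal \<sigma> g) v (E i) (E i) p)
    = (\<Sum>i<DIM('e). g p (E i p) (E i p) * hessian M g v (E i) (E i) p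
        - 2 * (g p (E i p) (E i p) * (E i p \<sigma> * E i p v))
        + g p (E i p) (E i p) * g p (E i p) (E i p) * gradient p v)"
    by (intro sum.cong refl)
      (simp add: hessian_conformal_frame[OF orthonormal_frameD(1)[OF E] orthonormal_frameD(1)[OF E] p] algebra_simps)
  also have "\<dots> = laplacian M g v p - 2 * gradient_inner M g \<sigma> v p + real DIM('e) * gradient_inner M g \<sigma> v p"
    unfolding laplacian_frame[OF U p E v] gradient_apply[OF p] sum.distrib sum_subtractf
      sum_distrib_left[symmetric] sum_distrib_right[symmetric] sum_sign_one[OF o]
    by (simp add: gradient_inner_frame[OF U p E])
  finally show ?thesis
    by (simp add: algebra_simps)
qed

text \<open>Contraction of \<open>riemann_conformal\<close>. With \<open>h\<close> as below, the
  term along \<open>E i\<close> gives -n \<open>h\<close>, and the remaining correction terms other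
  than the Laplacian add up to 2 \<open>h\<close>; this is the source of n - 2.\<close>

lemma ricci_conformal_frame:
  assumes X: "vector_field M U X" and Y: "vector_field M U Y" and p: "p \<in> U"
  shows "ricci M (conformal \<sigma> g) X Y p = ricci M g X Y p
    - (real DIM('e) - 2) * (hessian M g \<sigma> X Y p - X p \<sigma> * Y p \<sigma>)
    - (laplacian M g \<sigma> p + (real DIM('e) - 2) * gradient_inner M g \<sigma> \<sigma> p) * g p (X p) (Y p)"
proof -
  let ?n = "DIM('e)"
  define s where "s = (\<lambda>i. g p (E i p) (E i p))"
  define h where "h = hessian M g \<sigma> Y X p - Y p \<sigma> * X p \<sigma> + g p (Y p) (X p) * gradient p \<sigma>"
  note o = orthonormal_frameD(2)[OF E p] and F = orthonormal_frameD(1)[OF E]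
  have \<sigma>: "smooth_near M p \<sigma>"
    by (rule factor_smooth[OF openin_points[OF U p]])
  note T = vector_field_tangent[OF X p] vector_field_tangent[OF Y p] vector_field_tangent[OF gradient_field p]
  have ET: "E i p \<in> tangent_space M p" if "i < ?n" for i
    by (rule vector_field_tangent[OF F[OF that] p])
  have comp: "g p (riemann M (conformal \<sigma> g) (E i) Y X p) (E i p) = g p (riemann M g (E i) Y X p) (E i p)
      + (hessian M g \<sigma> (E i) X p - E i p \<sigma> * X p \<sigma> + g p (E i p) (X p) * gradient p \<sigma>) * g p (Y p) (E i p)
      - h * s i - g p (Y p) (X p) * hessian M g \<sigma> (E i) (E i) p + g p (E i p) (X p) * hessian M g \<sigma> Y (E i) p
      + (E i p \<sigma> * g p (Y p) (X p) - Y p \<sigma> * g p (E i p) (X p)) * E i p \<sigma>"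
    if i: "i < ?n" for i
  proof -
    \<comment> \<open>Abbreviating the coefficients, and inserting factors 1 below, makes the vector
      a nested combination of two terms at a time, so that \<open>metric_lin\<close> applies
      literally.\<close>
    define a b c d e where "a = hessian M g \<sigma> (E i) X p - E i p \<sigma> * X p \<sigma> + g p (E i p) (X p) * gradient p \<sigma>"
      and "b = - h" and "c = - g p (Y p) (X p)" and "d = g p (E i p) (X p)"
      and "e = E i p \<sigma> * g p (Y p) (X p) - Y p \<sigma> * g p (E i p) (X p)"
    let ?R = "riemann M g (E i) Y X p" and ?DE = "lc (E i) gradient p" and ?DY = "lc Y gradient p"
    note RT = vector_field_tangent[OF riemann_field[OF F[OF i] Y X] p]
      and DE = vector_field_tangent[OF lc_field[OF F[OF i] gradient_field] p]
      and DY = vector_field_tangent[OF lc_field[OF Y gradient_field] p]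
    have 1: "(\<lambda>f. a * Y p f + b * E i p f) \<in> tangent_space M p"
      and 2: "(\<lambda>f. c * ?DE f + d * ?DY f) \<in> tangent_space M p"
      by (intro tangent_lin T ET[OF i] DE DY)+
    have 3: "(\<lambda>f. 1 * (c * ?DE f + d * ?DY f) + e * gradient p f) \<in> tangent_space M p"
      by (rule tangent_lin[OF 2 T(3)])
    have 4: "(\<lambda>f. 1 * (a * Y p f + b * E i p f) + 1 * (1 * (c * ?DE f + d * ?DY f) + e * gradient p f)) \<in> tangent_space M p"
      by (rule tangent_lin[OF 1 3])
    have "riemann M (conformal \<sigma> g) (E i) Y X p
      = (\<lambda>f. 1 * ?R f + 1 * (1 * (a * Y p f + b * E i p f) + 1 * (1 * (c * ?DE f + d * ?DY f) + e * gradient p f)))"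
      using riemann_conformal[OF F[OF i] Y X p, folded h_def]
      by (intro ext) (simp add: a_def b_def c_def d_def e_def)
    then have "g p (riemann M (conformal \<sigma> g) (E i) Y X p) (E i p) = 1 * g p ?R (E i p)
      + 1 * (1 * (a * g p (Y p) (E i p) + b * g p (E i p) (E i p))
        + 1 * (1 * (c * g p ?DE (E i p) + d * g p ?DY (E i p)) + e * g p (gradient p) (E i p)))"
      by (simp only: metric_lin[OF RT 4 ET[OF i]] metric_lin[OF 1 3 ET[OF i]] metric_lin[OF 2 T(3) ET[OF i]]
          metric_lin[OF T(2) ET[OF i] ET[OF i]] metric_lin[OF DE DY ET[OF i]])
    then show ?thesis
      using gradient_hessian[OF F[OF i] F[OF i] p] gradient_hessian[OF Y F[OF i] p] gradient_metric[OF p ET[OF i]]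
      by (simp add: a_def b_def c_def d_def e_def s_def)
  qed
  \<comment> \<open>Summing against the frame components of a field puts that field back into the
    contracted slot.\<close>
  have contract: "(\<Sum>i<?n. s i * g p (V p) (E i p) * T (E i) W) = T V W"
    if "tensor2 U p T" "vector_field M U V" "vector_field M U W" for T V W
    using tensor2_expand[OF that(1) E that(2,3)] by (simp add: s_def)
  have contract_metric: "(\<Sum>i<?n. s i * g p (X p) (E i p) * g p (Y p) (E i p)) = g p (Y p) (X p)"
    using orthonormal_inner_expand[OF o T(1,2)] metric_sym[OF T(1,2)] metric_sym[OF T(2) ET]
    by (simp add: s_def)
  have "(\<Sum>i<?n. s i * g p (riemann M (conformal \<sigma> g) (E i) Y X p) (E i p))
    = (\<Sum>i<?n. s i * g p (riemann M g (E i) Y X p) (E i p)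
        + s i * g p (Y p) (E i p) * hessian M g \<sigma> (E i) X p
        - s i * g p (Y p) (E i p) * (E i p \<sigma> * X p \<sigma>)
        + s i * g p (X p) (E i p) * g p (Y p) (E i p) * gradient p \<sigma>
        - s i * s i * h
        - g p (Y p) (X p) * (s i * hessian M g \<sigma> (E i) (E i) p)
        + s i * g p (X p) (E i p) * hessian M g \<sigma> Y (E i) p
        + g p (Y p) (X p) * (s i * (E i p \<sigma> * E i p \<sigma>))
        - s i * g p (X p) (E i p) * (E i p \<sigma> * Y p \<sigma>))"
    by (intro sum.cong refl) (simp add: comp metric_sym[OF T(1) ET] algebra_simps)
  also have "\<dots> = ricci M g X Y p + hessian M g \<sigma> Y X p - Y p \<sigma> * X p \<sigma> + g p (Y p) (X p) * gradient p \<sigma>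
      - real ?n * h - g p (Y p) (X p) * laplacian M g \<sigma> p + hessian M g \<sigma> Y X p
      + g p (Y p) (X p) * gradient_inner M g \<sigma> \<sigma> p - X p \<sigma> * Y p \<sigma>"
    unfolding sum.distrib sum_subtractf sum_distrib_left[symmetric] sum_distrib_right[symmetric]
      contract[OF hessian_tensor2[OF p \<sigma>] Y X] contract[OF gradient_tensor2[OF p] Y X]
      contract[OF gradient_tensor2[OF p] X Y] contract_metric
      contract[OF tensor2_swap[OF hessian_tensor2[OF p \<sigma>]] X Y]
      ricci_frame[OF X Y p E] laplacian_frame[OF U p E \<sigma>] gradient_inner_frame[OF U p E]
    using sum_sign_one[OF o] by (simp add: s_def)
  also have "\<dots> = ricci M g X Y p
    - (real DIM('e) - 2) * (hessian M g \<sigma> X Y p - X p \<sigma> * Y p \<sigma>)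
    - (laplacian M g \<sigma> p + (real DIM('e) - 2) * gradient_inner M g \<sigma> \<sigma> p) * g p (X p) (Y p)"
    using gradient_apply[OF p, of \<sigma>] hessian_sym[OF X Y p \<sigma>] metric_sym[OF T(1,2)]
    by (simp add: h_def algebra_simps)
  \<comment> \<open>The conformal frame contributes \<open>exp (- 2 * \<sigma> p)\<close> to the
    trace and the pairing by the conformal metric the inverse factor, so the trace may be taken with
    the original frame and metric.\<close>
  also have "(\<Sum>i<?n. s i * g p (riemann M (conformal \<sigma> g) (E i) Y X p) (E i p)) = ricci M (conformal \<sigma> g) X Y p"
  proof -
    have "ricci M (conformal \<sigma> g) X Y p = exp (- 2 * \<sigma> p)
      * (\<Sum>i<?n. g p (E i p) (E i p) * conformal \<sigma> g p (riemann M (conformal \<sigma> g) (E i) Y X p) (E i p))"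
      unfolding conf.ricci_frame[OF X Y p conformal_frame]
      by (rule conformal_trace[OF p conf.riemann_tensor2[OF Y X p]])
    also have "\<dots> = (exp (- 2 * \<sigma> p) * exp (2 * \<sigma> p))
      * (\<Sum>i<?n. s i * g p (riemann M (conformal \<sigma> g) (E i) Y X p) (E i p))"
      unfolding conformal_def s_def sum_distrib_left by (intro sum.cong refl) simp
    also have "exp (- 2 * \<sigma> p) * exp (2 * \<sigma> p) = 1"
      by (simp flip: exp_add)
    finally show ?thesis
      by simp
  qed
  finally show ?thesis .
qed

end

section \<open>The conformal formulas without a fixed frame\<close>

lemma hessian_conformal:
  assumes X: "vector_field M U X" and Y: "vector_field M U Y" and p: "p \<in> U"
  shows "hessian M (conformal \<sigma> g) v X Y p = hessian M g v X Y p
    - (X p \<sigma> * Y p v + Y p \<sigma> * X p v - g p (X p) (Y p) * gradient_inner M g \<sigma> v p)"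
proof -
  obtain W where W: "openin (mtop M) W" "p \<in> W" "orthonormal_frame M g W (frame_near M g p)"
    using frame_near openin_points[OF vector_field_open[OF X] p] by metis
  have N: "openin (mtop M) (U \<inter> W)" "p \<in> U \<inter> W"
    using W p vector_field_open[OF X] by auto
  note E = orthonormal_frame_subset[OF W(3) N(1) Int_lower2] and s = vector_field_subset[OF _ N(1) Int_lower1]
  show ?thesis
    using hessian_conformal_frame[OF E N(1) s[OF X] s[OF Y] N(2)] gradient_apply[OF E N] by simp
qed

lemma laplacian_conformal:
  assumes v: "smooth_near M p v"
  shows "laplacian M (conformal \<sigma> g) v p
    = exp (- 2 * \<sigma> p) * (laplacian M g v p + (real DIM('e) - 2) * gradient_inner M g \<sigma> v p)"
proof -
  obtain W where W: "openin (mtop M) W" "p \<in> W" "orthonormal_frame M g W (frame_near M g p)"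
    using frame_near smooth_near_points[OF v] by metis
  show ?thesis
    by (rule laplacian_conformal_frame[OF W(3,1,2) v])
qed

lemma gradient_inner_conformal:
  assumes p: "p \<in> points M"
  shows "gradient_inner M (conformal \<sigma> g) u v p = exp (- 2 * \<sigma> p) * gradient_inner M g u v p"
proof -
  obtain W where W: "openin (mtop M) W" "p \<in> W" "orthonormal_frame M g W (frame_near M g p)"
    using frame_near p by metis
  show ?thesis
    by (rule gradient_inner_conformal_frame[OF W(3,1,2)])
qed

lemma ricci_conformal:
  assumes X: "vector_field M U X" and Y: "vector_field M U Y" and p: "p \<in> U"
  shows "ricci M (conformal \<sigma> g) X Y p = ricci M g X Y p
    - (real DIM('e) - 2) * (hessian M g \<sigma> X Y p - X p \<sigma> * Y p \<sigma>)
    - (laplacian M g \<sigma> p + (real DIM('e) - 2) * gradient_inner M g \<sigma> \<sigma> p) * g p (X p) (Y p)"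
proof -
  obtain W where W: "openin (mtop M) W" "p \<in> W" "orthonormal_frame M g W (frame_near M g p)"
    using frame_near openin_points[OF vector_field_open[OF X] p] by metis
  have N: "openin (mtop M) (U \<inter> W)" "p \<in> U \<inter> W"
    using W p vector_field_open[OF X] by auto
  note E = orthonormal_frame_subset[OF W(3) N(1) Int_lower2] and s = vector_field_subset[OF _ N(1) Int_lower1]
  show ?thesis
    by (rule ricci_conformal_frame[OF E N(1) s[OF X] s[OF Y] N(2)])
qed

end

section \<open>Metrics that split along two projections\<close>

text \<open>The properties of \<open>B \<times> F\<close> that determine its curvature. They are symmetric in the two factors,
  so that every result about the first factor holds for the second one as well.\<close>

locale split_mfd = P: metric_mfd P g + N1: metric_mfd N1 g1 + N2: metric_mfd N2 g2
  for P :: "('c, 'd::euclidean_space) mfd" and g :: "'c metric"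
    and N1 :: "('a, 'e::euclidean_space) mfd" and g1 :: "'a metric"
    and N2 :: "('b, 'h::euclidean_space) mfd" and g2 :: "'b metric" +
  fixes \<pi>1 :: "'c \<Rightarrow> 'a" and \<pi>2 :: "'c \<Rightarrow> 'b"
    and lift1 :: "('a \<Rightarrow> 'a tvec) \<Rightarrow> 'c \<Rightarrow> 'c tvec" and lift2 :: "('b \<Rightarrow> 'b tvec) \<Rightarrow> 'c \<Rightarrow> 'c tvec"
  assumes dimension: "DIM('d) = DIM('e) + DIM('h)"
    and preimage1: "openin (mtop N1) U \<Longrightarrow> openin (mtop P) {z \<in> points P. \<pi>1 z \<in> U}"
    and preimage2: "openin (mtop N2) W \<Longrightarrow> openin (mtop P) {z \<in> points P. \<pi>2 z \<in> W}"
    and pullback1: "z \<in> points P \<Longrightarrow> smooth_near N1 (\<pi>1 z) f \<Longrightarrow> smooth_near P z (\<lambda>z. f (\<pi>1 z))"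
    and pullback2: "z \<in> points P \<Longrightarrow> smooth_near N2 (\<pi>2 z) h \<Longrightarrow> smooth_near P z (\<lambda>z. h (\<pi>2 z))"
    and lift1_field: "vector_field N1 U X \<Longrightarrow> vector_field P {z \<in> points P. \<pi>1 z \<in> U} (lift1 X)"
    and lift2_field: "vector_field N2 W V \<Longrightarrow> vector_field P {z \<in> points P. \<pi>2 z \<in> W} (lift2 V)"
    and lift1_apply: "vector_field N1 U X \<Longrightarrow> z \<in> points P \<Longrightarrow> \<pi>1 z \<in> U \<Longrightarrow> smooth_near N1 (\<pi>1 z) f \<Longrightarrow>
      lift1 X z (\<lambda>z. f (\<pi>1 z)) = X (\<pi>1 z) f"
    and lift2_apply: "vector_field N2 W V \<Longrightarrow> z \<in> points P \<Longrightarrow> \<pi>2 z \<in> W \<Longrightarrow> smooth_near N2 (\<pi>2 z) h \<Longrightarrow>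
      lift2 V z (\<lambda>z. h (\<pi>2 z)) = V (\<pi>2 z) h"
    and lift1_cross: "vector_field N1 U X \<Longrightarrow> z \<in> points P \<Longrightarrow> \<pi>1 z \<in> U \<Longrightarrow> smooth_near N2 (\<pi>2 z) h \<Longrightarrow>
      lift1 X z (\<lambda>z. h (\<pi>2 z)) = 0"
    and lift2_cross: "vector_field N2 W V \<Longrightarrow> z \<in> points P \<Longrightarrow> \<pi>2 z \<in> W \<Longrightarrow> smooth_near N1 (\<pi>1 z) f \<Longrightarrow>
      lift2 V z (\<lambda>z. f (\<pi>1 z)) = 0"
    and separation: "v \<in> tangent_space P z \<Longrightarrow> w \<in> tangent_space P z \<Longrightarrow>
      (\<And>f. smooth_near N1 (\<pi>1 z) f \<Longrightarrow> v (\<lambda>z. f (\<pi>1 z)) = w (\<lambda>z. f (\<pi>1 z))) \<Longrightarrow>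
      (\<And>h. smooth_near N2 (\<pi>2 z) h \<Longrightarrow> v (\<lambda>z. h (\<pi>2 z)) = w (\<lambda>z. h (\<pi>2 z))) \<Longrightarrow> v = w"
    and projection1: "z \<in> points P \<Longrightarrow> \<pi>1 z \<in> points N1"
    and projection2: "z \<in> points P \<Longrightarrow> \<pi>2 z \<in> points N2"
    and metric_split: "g z v w = g1 (\<pi>1 z) (tangent_map N1 \<pi>1 z v) (tangent_map N1 \<pi>1 z w)
      + g2 (\<pi>2 z) (tangent_map N2 \<pi>2 z v) (tangent_map N2 \<pi>2 z w)"
begin

lemma swapped: "split_mfd P g N2 g2 N1 g1 \<pi>2 \<pi>1 lift2 lift1"
proof unfold_locales
  show "v = w" if "v \<in> tangent_space P z" "w \<in> tangent_space P z"
    "\<And>f. smooth_near N2 (\<pi>2 z) f \<Longrightarrow> v (\<lambda>z. f (\<pi>2 z)) = w (\<lambda>z. f (\<pi>2 z))"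
    "\<And>h. smooth_near N1 (\<pi>1 z) h \<Longrightarrow> v (\<lambda>z. h (\<pi>1 z)) = w (\<lambda>z. h (\<pi>1 z))" for v z w
    by (rule separation[OF that(1,2,4,3)])
  show "DIM('d) = DIM('h) + DIM('e)"
    by (simp only: dimension add.commute)
  show "g z v w = g2 (\<pi>2 z) (tangent_map N2 \<pi>2 z v) (tangent_map N2 \<pi>2 z w)
    + g1 (\<pi>1 z) (tangent_map N1 \<pi>1 z v) (tangent_map N1 \<pi>1 z w)" for z v w
    by (simp only: metric_split add.commute)
qed (fact preimage1 preimage2 pullback1 pullback2 lift1_field lift2_field lift1_apply lift2_apply
    lift1_cross lift2_cross projection1 projection2)+

text \<open>The domain on which lifts of local fields from both factors exist together; in the
  product manifold it is a rectangle.\<close>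

definition patch :: "'a set \<Rightarrow> 'b set \<Rightarrow> 'c set" where
  "patch U W = {z \<in> points P. \<pi>1 z \<in> U \<and> \<pi>2 z \<in> W}"

lemma patch_open: "openin (mtop N1) U \<Longrightarrow> openin (mtop N2) W \<Longrightarrow> openin (mtop P) (patch U W)"
proof -
  assume "openin (mtop N1) U" "openin (mtop N2) W"
  then have "openin (mtop P) ({z \<in> points P. \<pi>1 z \<in> U} \<inter> {z \<in> points P. \<pi>2 z \<in> W})"
    by (intro openin_Int preimage1 preimage2)
  also have "{z \<in> points P. \<pi>1 z \<in> U} \<inter> {z \<in> points P. \<pi>2 z \<in> W} = patch U W"
    by (auto simp: patch_def)
  finally show ?thesis .
qed

lemma patchD: "z \<in> patch U W \<Longrightarrow> z \<in> points P" "z \<in> patch U W \<Longrightarrow> \<pi>1 z \<in> U" "z \<in> patch U W \<Longrightarrow> \<pi>2 z \<in> W"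
  by (auto simp: patch_def)

lemma patch_swapped: "split_mfd.patch P \<pi>2 \<pi>1 W U = patch U W"
  unfolding split_mfd.patch_def[OF swapped] patch_def by auto

context
  fixes U W
  assumes U: "openin (mtop N1) U" and W: "openin (mtop N2) W"
begin

lemma patch_lift1: "vector_field N1 U X \<Longrightarrow> vector_field P (patch U W) (lift1 X)"
  by (rule P.vector_field_subset[OF lift1_field patch_open[OF U W]]) (auto simp: patch_def)

lemma patch_lift2: "vector_field N2 W V \<Longrightarrow> vector_field P (patch U W) (lift2 V)"
  by (rule P.vector_field_subset[OF lift2_field patch_open[OF U W]]) (auto simp: patch_def)

lemma lift1_tangent: "vector_field N1 U X \<Longrightarrow> z \<in> patch U W \<Longrightarrow> lift1 X z \<in> tangent_space P z"
  by (rule P.vector_field_tangent[OF patch_lift1])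

lemma lift2_tangent: "vector_field N2 W V \<Longrightarrow> z \<in> patch U W \<Longrightarrow> lift2 V z \<in> tangent_space P z"
  by (rule P.vector_field_tangent[OF patch_lift2])

section \<open>Metric, brackets and Koszul terms of lifts\<close>

lemma tangent_map_lift1:
  assumes X: "vector_field N1 U X" and z: "z \<in> patch U W"
  shows "tangent_map N1 \<pi>1 z (lift1 X z) = X (\<pi>1 z)" "tangent_map N2 \<pi>2 z (lift1 X z) = (\<lambda>f. 0)"
proof -
  show "tangent_map N1 \<pi>1 z (lift1 X z) = X (\<pi>1 z)"
    using lift1_apply[OF X patchD(1,2)[OF z]] N1.tvec_nonsmooth[OF N1.vector_field_tangent[OF X patchD(2)[OF z]]]
    by (auto simp: tangent_map_def o_def)
  show "tangent_map N2 \<pi>2 z (lift1 X z) = (\<lambda>f. 0)"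
    using lift1_cross[OF X patchD(1,2)[OF z]] by (auto simp: tangent_map_def o_def)
qed

lemma tangent_map_lift2:
  assumes V: "vector_field N2 W V" and z: "z \<in> patch U W"
  shows "tangent_map N2 \<pi>2 z (lift2 V z) = V (\<pi>2 z)" "tangent_map N1 \<pi>1 z (lift2 V z) = (\<lambda>f. 0)"
proof -
  show "tangent_map N2 \<pi>2 z (lift2 V z) = V (\<pi>2 z)"
    using lift2_apply[OF V patchD(1,3)[OF z]] N2.tvec_nonsmooth[OF N2.vector_field_tangent[OF V patchD(3)[OF z]]]
    by (auto simp: tangent_map_def o_def)
  show "tangent_map N1 \<pi>1 z (lift2 V z) = (\<lambda>f. 0)"
    using lift2_cross[OF V patchD(1,3)[OF z]] by (auto simp: tangent_map_def o_def)
qed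

lemma metric_lift11:
  assumes X: "vector_field N1 U X" and Y: "vector_field N1 U Y" and z: "z \<in> patch U W"
  shows "g z (lift1 X z) (lift1 Y z) = g1 (\<pi>1 z) (X (\<pi>1 z)) (Y (\<pi>1 z))"
  unfolding metric_split tangent_map_lift1[OF X z] tangent_map_lift1[OF Y z]
  using N2.metric_zero[OF N2.tangent_zero[OF projection2[OF patchD(1)[OF z]]]] by simp

lemma metric_lift22:
  assumes X: "vector_field N2 W X" and Y: "vector_field N2 W Y" and z: "z \<in> patch U W"
  shows "g z (lift2 X z) (lift2 Y z) = g2 (\<pi>2 z) (X (\<pi>2 z)) (Y (\<pi>2 z))"
  unfolding metric_split tangent_map_lift2[OF X z] tangent_map_lift2[OF Y z]
  using N1.metric_zero[OF N1.tangent_zero[OF projection1[OF patchD(1)[OF z]]]] by simp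

lemma metric_lift12:
  assumes X: "vector_field N1 U X" and V: "vector_field N2 W V" and z: "z \<in> patch U W"
  shows "g z (lift1 X z) (lift2 V z) = 0" "g z (lift2 V z) (lift1 X z) = 0"
  unfolding metric_split tangent_map_lift1[OF X z] tangent_map_lift2[OF V z]
  using N1.metric_zero[OF N1.vector_field_tangent[OF X patchD(2)[OF z]]]
    N2.metric_zero[OF N2.vector_field_tangent[OF V patchD(3)[OF z]]] by simp_all

lemma patch_cong:
  assumes "v \<in> tangent_space P z" "z \<in> patch U W" "\<And>y. y \<in> patch U W \<Longrightarrow> F y = G y"
  shows "v F = v G"
  by (rule P.tvec_metric_cong[OF assms(1) patch_open[OF U W] assms(2,3)])

lemma patch_zero:
  assumes "v \<in> tangent_space P z" "z \<in> patch U W" "\<And>y. y \<in> patch U W \<Longrightarrow> F y = 0"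
  shows "v F = 0"
  using patch_cong[OF assms(1,2), of F "\<lambda>_. 0"] assms(3) P.tvec_const[OF assms(1)] by simp

text \<open>For second derivatives: the first derivative of a pullback is again a pullback only near
  \<open>z\<close>, since \<open>f\<close> is assumed smooth only near the image of
  \<open>z\<close>. Agreement of germs is enough.\<close>

lemma lift1_iterate:
  assumes X: "vector_field N1 U X" and f: "smooth_near N1 (\<pi>1 z) f" and z: "z \<in> patch U W"
    and eq: "\<forall>\<^sub>F y in nhdsin (mtop P) z. F y = f (\<pi>1 y)"
  shows "lift1 X z F = X (\<pi>1 z) f"
  using P.tvec_cong[OF lift1_tangent[OF X z] eq] lift1_apply[OF X patchD(1,2)[OF z] f] by simp

lemma pullback_eventually1:
  assumes "\<forall>\<^sub>F p in nhdsin (mtop N1) (\<pi>1 z). R p" "z \<in> points P"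
  shows "\<forall>\<^sub>F y in nhdsin (mtop P) z. R (\<pi>1 y)"
proof -
  obtain N where N: "openin (mtop N1) N" "\<pi>1 z \<in> N" "\<forall>p\<in>N. R p"
    using assms(1) projection1[OF assms(2)] unfolding eventually_nhdsin by blast
  have "\<forall>\<^sub>F y in nhdsin (mtop P) z. y \<in> {z \<in> points P. \<pi>1 z \<in> N}"
    by (rule P.eventually_nhdsin_open[OF preimage1[OF N(1)]]) (use N assms in simp)
  then show ?thesis
    by (rule eventually_mono) (use N(3) in simp)
qed

lemma pullback_eventually2:
  assumes "\<forall>\<^sub>F p in nhdsin (mtop N2) (\<pi>2 z). R p" "z \<in> points P"
  shows "\<forall>\<^sub>F y in nhdsin (mtop P) z. R (\<pi>2 y)"
proof -
  obtain N where N: "openin (mtop N2) N" "\<pi>2 z \<in> N" "\<forall>p\<in>N. R p"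
    using assms(1) projection2[OF assms(2)] unfolding eventually_nhdsin by blast
  have "\<forall>\<^sub>F y in nhdsin (mtop P) z. y \<in> {z \<in> points P. \<pi>2 z \<in> N}"
    by (rule P.eventually_nhdsin_open[OF preimage2[OF N(1)]]) (use N assms in simp)
  then show ?thesis
    by (rule eventually_mono) (use N(3) in simp)
qed

lemma patch_eventually:
  assumes "z \<in> patch U W"
  shows "\<forall>\<^sub>F y in nhdsin (mtop P) z. y \<in> patch U W"
  by (rule P.eventually_nhdsin_open[OF patch_open[OF U W] assms])

lemma lift1_function:
  assumes X: "vector_field N1 U X" and z: "z \<in> patch U W" and f: "smooth_near N1 (\<pi>1 z) f"
  shows "\<forall>\<^sub>F y in nhdsin (mtop P) z. lift1 X y (\<lambda>z. f (\<pi>1 z)) = X (\<pi>1 y) f"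
  using pullback_eventually1[OF N1.smooth_near_eventually[OF f] patchD(1)[OF z]] patch_eventually[OF z]
  by eventually_elim (rule lift1_apply[OF X patchD(1,2)])

lemma lift2_function:
  assumes V: "vector_field N2 W V" and z: "z \<in> patch U W" and f: "smooth_near N2 (\<pi>2 z) f"
  shows "\<forall>\<^sub>F y in nhdsin (mtop P) z. lift2 V y (\<lambda>z. f (\<pi>2 z)) = V (\<pi>2 y) f"
  using pullback_eventually2[OF N2.smooth_near_eventually[OF f] patchD(1)[OF z]] patch_eventually[OF z]
  by eventually_elim (rule lift2_apply[OF V patchD(1,3)])

lemma lift1_function_cross:
  assumes X: "vector_field N1 U X" and z: "z \<in> patch U W" and f: "smooth_near N2 (\<pi>2 z) f"
  shows "\<forall>\<^sub>F y in nhdsin (mtop P) z. lift1 X y (\<lambda>z. f (\<pi>2 z)) = 0"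
  using pullback_eventually2[OF N2.smooth_near_eventually[OF f] patchD(1)[OF z]] patch_eventually[OF z]
  by eventually_elim (rule lift1_cross[OF X patchD(1,2)])

lemma lift2_function_cross:
  assumes V: "vector_field N2 W V" and z: "z \<in> patch U W" and f: "smooth_near N1 (\<pi>1 z) f"
  shows "\<forall>\<^sub>F y in nhdsin (mtop P) z. lift2 V y (\<lambda>z. f (\<pi>1 z)) = 0"
  using pullback_eventually1[OF N1.smooth_near_eventually[OF f] patchD(1)[OF z]] patch_eventually[OF z]
  by eventually_elim (rule lift2_cross[OF V patchD(1,3)])

lemma eventually_zero:
  assumes "v \<in> tangent_space P z" "\<forall>\<^sub>F y in nhdsin (mtop P) z. F y = 0"
  shows "v F = 0"
  using P.tvec_cong[OF assms(1), of F "\<lambda>_. 0"] assms(2) P.tvec_const[OF assms(1)] by simp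

text \<open>By \<open>separation\<close> it suffices to test on pullbacks. On those from the first
  factor the bracket is computed there; on those from the second all derivatives vanish.\<close>

lemma lie_bracket_lift11:
  assumes X: "vector_field N1 U X" and Y: "vector_field N1 U Y" and z: "z \<in> patch U W"
  shows "lie_bracket P (lift1 X) (lift1 Y) z = lift1 (lie_bracket N1 X Y) z"
proof (rule separation)
  note B = N1.vector_field_lie_bracket[OF X Y]
  note TX = lift1_tangent[OF X z] and TY = lift1_tangent[OF Y z]
  show "lie_bracket P (lift1 X) (lift1 Y) z \<in> tangent_space P z"
    by (rule P.lie_bracket_tangent[OF patch_lift1[OF X] patch_lift1[OF Y] z])
  show "lift1 (lie_bracket N1 X Y) z \<in> tangent_space P z"
    by (rule lift1_tangent[OF B z])
  show "lie_bracket P (lift1 X) (lift1 Y) z (\<lambda>z. f (\<pi>1 z)) = lift1 (lie_bracket N1 X Y) z (\<lambda>z. f (\<pi>1 z))"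
    if f: "smooth_near N1 (\<pi>1 z) f" for f
    unfolding P.lie_bracket_apply[OF pullback1[OF patchD(1)[OF z] f]]
      lift1_iterate[OF X N1.vector_field_smooth[OF Y patchD(2)[OF z] f] z lift1_function[OF Y z f]]
      lift1_iterate[OF Y N1.vector_field_smooth[OF X patchD(2)[OF z] f] z lift1_function[OF X z f]]
      lift1_apply[OF B patchD(1,2)[OF z] f] N1.lie_bracket_apply[OF f] ..
  show "lie_bracket P (lift1 X) (lift1 Y) z (\<lambda>z. h (\<pi>2 z)) = lift1 (lie_bracket N1 X Y) z (\<lambda>z. h (\<pi>2 z))"
    if h: "smooth_near N2 (\<pi>2 z) h" for h
    unfolding P.lie_bracket_apply[OF pullback2[OF patchD(1)[OF z] h]]
      eventually_zero[OF TX lift1_function_cross[OF Y z h]] eventually_zero[OF TY lift1_function_cross[OF X z h]]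
      lift1_cross[OF B patchD(1,2)[OF z] h] by simp
qed

text \<open>A lift sends pullbacks from its own factor to pullbacks from that factor, and the other
  lift annihilates these. So both iterated derivatives vanish on the functions that separate tangent
  vectors.\<close>

lemma lie_bracket_lift12:
  assumes X: "vector_field N1 U X" and V: "vector_field N2 W V" and z: "z \<in> patch U W"
  shows "lie_bracket P (lift1 X) (lift2 V) z = (\<lambda>f. 0)" "lie_bracket P (lift2 V) (lift1 X) z = (\<lambda>f. 0)"
proof -
  note TX = lift1_tangent[OF X z] and TV = lift2_tangent[OF V z]
  show 1: "lie_bracket P (lift1 X) (lift2 V) z = (\<lambda>f. 0)"
  proof (rule separation)
    show "lie_bracket P (lift1 X) (lift2 V) z \<in> tangent_space P z"
      by (rule P.lie_bracket_tangent[OF patch_lift1[OF X] patch_lift2[OF V] z])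
    show "(\<lambda>f. 0) \<in> tangent_space P z"
      by (rule P.tangent_zero[OF patchD(1)[OF z]])
    show "lie_bracket P (lift1 X) (lift2 V) z (\<lambda>z. f (\<pi>1 z)) = 0" if f: "smooth_near N1 (\<pi>1 z) f" for f
    proof -
      have "lift2 V z (\<lambda>y. lift1 X y (\<lambda>z. f (\<pi>1 z))) = lift2 V z (\<lambda>y. X (\<pi>1 y) f)"
        by (rule P.tvec_cong[OF TV lift1_function[OF X z f]])
      also have "\<dots> = 0"
        by (rule lift2_cross[OF V patchD(1,3)[OF z] N1.vector_field_smooth[OF X patchD(2)[OF z] f]])
      finally show ?thesis
        unfolding P.lie_bracket_apply[OF pullback1[OF patchD(1)[OF z] f]]
          eventually_zero[OF TX lift2_function_cross[OF V z f]] by simp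
    qed
    show "lie_bracket P (lift1 X) (lift2 V) z (\<lambda>z. h (\<pi>2 z)) = 0" if h: "smooth_near N2 (\<pi>2 z) h" for h
    proof -
      have "lift1 X z (\<lambda>y. lift2 V y (\<lambda>z. h (\<pi>2 z))) = lift1 X z (\<lambda>y. V (\<pi>2 y) h)"
        by (rule P.tvec_cong[OF TX lift2_function[OF V z h]])
      also have "\<dots> = 0"
        by (rule lift1_cross[OF X patchD(1,2)[OF z] N2.vector_field_smooth[OF V patchD(3)[OF z] h]])
      finally show ?thesis
        unfolding P.lie_bracket_apply[OF pullback2[OF patchD(1)[OF z] h]]
          eventually_zero[OF TV lift1_function_cross[OF X z h]] by simp
    qed
  qed
  show "lie_bracket P (lift2 V) (lift1 X) z = (\<lambda>f. 0)"
    unfolding P.lie_bracket_antisym[of "lift2 V"] 1 by simp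
qed

lemma lift1_metric_deriv:
  assumes X: "vector_field N1 U X" and Y: "vector_field N1 U Y" and Z: "vector_field N1 U Z" and z: "z \<in> patch U W"
  shows "lift1 X z (\<lambda>y. g y (lift1 Y y) (lift1 Z y)) = X (\<pi>1 z) (\<lambda>p. g1 p (Y p) (Z p))"
  by (rule lift1_iterate[OF X N1.metric_smooth[OF Y Z patchD(2)[OF z]] z
        eventually_mono[OF patch_eventually[OF z] metric_lift11[OF Y Z]]])

lemma lift2_metric_deriv:
  assumes V: "vector_field N2 W V" and Y: "vector_field N1 U Y" and Z: "vector_field N1 U Z" and z: "z \<in> patch U W"
  shows "lift2 V z (\<lambda>y. g y (lift1 Y y) (lift1 Z y)) = 0"
  using P.tvec_cong[OF lift2_tangent[OF V z] eventually_mono[OF patch_eventually[OF z] metric_lift11[OF Y Z]]]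
    lift2_cross[OF V patchD(1,3)[OF z] N1.metric_smooth[OF Y Z patchD(2)[OF z]]] by simp

lemma mixed_metric_deriv:
  assumes v: "v \<in> tangent_space P z" and X: "vector_field N1 U X" and V: "vector_field N2 W V" and z: "z \<in> patch U W"
  shows "v (\<lambda>y. g y (lift1 X y) (lift2 V y)) = 0" "v (\<lambda>y. g y (lift2 V y) (lift1 X y)) = 0"
  by (rule patch_zero[OF v z], rule metric_lift12[OF X V], assumption)+

lemma koszul_lift111:
  assumes X: "vector_field N1 U X" and Y: "vector_field N1 U Y" and Z: "vector_field N1 U Z" and z: "z \<in> patch U W"
  shows "koszul P g (lift1 X) (lift1 Y) (lift1 Z) z = koszul N1 g1 X Y Z (\<pi>1 z)"
  unfolding koszul_def lift1_metric_deriv[OF X Y Z z] lift1_metric_deriv[OF Y Z X z] lift1_metric_deriv[OF Z X Y z]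
    lie_bracket_lift11[OF X Y z] lie_bracket_lift11[OF Y Z z] lie_bracket_lift11[OF Z X z]
    metric_lift11[OF N1.vector_field_lie_bracket[OF X Y] Z z]
    metric_lift11[OF N1.vector_field_lie_bracket[OF Y Z] X z]
    metric_lift11[OF N1.vector_field_lie_bracket[OF Z X] Y z] ..

text \<open>Each term contains a mixed bracket, an inner product of lifts from different factors, or
  a derivative along the second factor of a function pulled back from the first.\<close>

lemma koszul_lift112:
  assumes X: "vector_field N1 U X" and Y: "vector_field N1 U Y" and V: "vector_field N2 W V" and z: "z \<in> patch U W"
  shows "koszul P g (lift1 X) (lift1 Y) (lift2 V) z = 0" "koszul P g (lift1 X) (lift2 V) (lift1 Y) z = 0"
proof -
  note T = lift1_tangent[OF X z] lift1_tangent[OF Y z] lift2_tangent[OF V z]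
  show "koszul P g (lift1 X) (lift1 Y) (lift2 V) z = 0"
    unfolding koszul_def lie_bracket_lift11[OF X Y z] lie_bracket_lift12[OF X V z] lie_bracket_lift12[OF Y V z]
      mixed_metric_deriv[OF T(1) Y V z] mixed_metric_deriv[OF T(2) X V z] lift2_metric_deriv[OF V X Y z]
      metric_lift12[OF N1.vector_field_lie_bracket[OF X Y] V z]
    by (simp add: P.metric_zero T)
  show "koszul P g (lift1 X) (lift2 V) (lift1 Y) z = 0"
    unfolding koszul_def lie_bracket_lift11[OF Y X z] lie_bracket_lift12[OF X V z] lie_bracket_lift12[OF Y V z]
      mixed_metric_deriv[OF T(1) Y V z] mixed_metric_deriv[OF T(2) X V z] lift2_metric_deriv[OF V Y X z]
      metric_lift12[OF N1.vector_field_lie_bracket[OF Y X] V z]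
    by (simp add: P.metric_zero T)
qed

text \<open>As in the preceding case; the two fields from the second factor are treated by the
  statements with the factors exchanged.\<close>

lemma koszul_lift122:
  assumes X: "vector_field N1 U X" and V: "vector_field N2 W V" and V': "vector_field N2 W V'" and z: "z \<in> patch U W"
  shows "koszul P g (lift1 X) (lift2 V) (lift2 V') z = 0"
proof -
  interpret swap: split_mfd P g N2 g2 N1 g1 \<pi>2 \<pi>1 lift2 lift1
    by (rule swapped)
  have z': "z \<in> swap.patch W U"
    using z by (simp add: patch_swapped)
  note T = lift1_tangent[OF X z] lift2_tangent[OF V z] lift2_tangent[OF V' z]
  show ?thesis
    unfolding koszul_def swap.lie_bracket_lift11[OF W U V V' z'] lie_bracket_lift12[OF X V z] lie_bracket_lift12[OF X V' z]
      mixed_metric_deriv[OF T(2) X V' z] mixed_metric_deriv[OF T(3) X V z] swap.lift2_metric_deriv[OF W U X V V' z']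
      metric_lift12[OF X N2.vector_field_lie_bracket[OF V V'] z]
    by (simp add: P.metric_zero T)
qed

end

end

context metric_mfd
begin

lemma lc_zero2:
  assumes X: "vector_field M U X" and p: "p \<in> U"
  shows "lc X (\<lambda>q f. 0) p = (\<lambda>f. 0)"
  using lc_scale2[OF X X p smooth_near_const, of 0] openin_points[OF vector_field_open[OF X]]
    tvec_const[OF vector_field_tangent[OF X p]] by simp

lemma lc_zero1:
  assumes X: "vector_field M U X" and p: "p \<in> U"
  shows "lc (\<lambda>q f. 0) X p = (\<lambda>f. 0)"
  using lc_lin1[OF X X X p smooth_near_const smooth_near_const, of 0 0]
    openin_points[OF vector_field_open[OF X]] by simp

end

section \<open>Connection and curvature of a split metric\<close>

context split_mfd
begin

context
  fixes U W E1 E2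
  assumes U: "openin (mtop N1) U" and W: "openin (mtop N2) W"
    and E1: "orthonormal_frame N1 g1 U E1" and E2: "orthonormal_frame N2 g2 W E2"
begin

private lemma E1_field: "i < DIM('e) \<Longrightarrow> vector_field N1 U (E1 i)"
  by (rule N1.orthonormal_frameD(1)[OF E1])

private lemma E2_field: "i < DIM('h) \<Longrightarrow> vector_field N2 W (E2 i)"
  by (rule N2.orthonormal_frameD(1)[OF E2])

definition split_frame :: "nat \<Rightarrow> 'c \<Rightarrow> 'c tvec" where
  "split_frame i = (if i < DIM('e) then lift1 (E1 i) else lift2 (E2 (i - DIM('e))))"

lemma split_frame: "orthonormal_frame P g (patch U W) split_frame"
  unfolding orthonormal_frame_def orthonormal_at_def
proof (intro conjI allI impI ballI)
  have field: "vector_field P (patch U W) (split_frame i)" if "i < DIM('d)" for i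
    using that dimension patch_lift1[OF U W E1_field] patch_lift2[OF U W E2_field, of "i - DIM('e)"]
    by (simp add: split_frame_def)
  then show "vector_field P (patch U W) (split_frame i)" if "i < DIM('d)" for i
    using that .
  fix z assume z: "z \<in> patch U W"
  show "split_frame i z \<in> tangent_space P z" if "i < DIM('d)" for i
    by (rule P.vector_field_tangent[OF field[OF that] z])
  fix i j assume i: "i < DIM('d)" and j: "j < DIM('d)"
  have o1: "\<bar>g1 (\<pi>1 z) (E1 i (\<pi>1 z)) (E1 j (\<pi>1 z))\<bar> = (if i = j then 1 else 0)" if "i < DIM('e)" "j < DIM('e)" for i j
    using N1.orthonormal_frameD(2)[OF E1 patchD(2)[OF z]] that by (simp add: orthonormal_at_def)
  have o2: "\<bar>g2 (\<pi>2 z) (E2 i (\<pi>2 z)) (E2 j (\<pi>2 z))\<bar> = (if i = j then 1 else 0)" if "i < DIM('h)" "j < DIM('h)" for i j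
    using N2.orthonormal_frameD(2)[OF E2 patchD(3)[OF z]] that by (simp add: orthonormal_at_def)
  have i2: "i - DIM('e) < DIM('h)" if "\<not> i < DIM('e)"
    using that i dimension by simp
  have j2: "j - DIM('e) < DIM('h)" if "\<not> j < DIM('e)"
    using that j dimension by simp
  consider "i < DIM('e)" "j < DIM('e)" | "i < DIM('e)" "\<not> j < DIM('e)" | "\<not> i < DIM('e)" "j < DIM('e)"
    | "\<not> i < DIM('e)" "\<not> j < DIM('e)"
    by blast
  then show "\<bar>g z (split_frame i z) (split_frame j z)\<bar> = (if i = j then 1 else 0)"
  proof cases
    case 1
    then show ?thesis
      using o1 by (simp add: split_frame_def metric_lift11[OF U W E1_field E1_field z])
  next
    case 2
    then show ?thesis
      using metric_lift12(1)[OF U W E1_field[OF 2(1)] E2_field[OF j2[OF 2(2)]] z] by (auto simp: split_frame_def)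
  next
    case 3
    then show ?thesis
      using metric_lift12(2)[OF U W E1_field[OF 3(2)] E2_field[OF i2[OF 3(1)]] z] by (auto simp: split_frame_def)
  next
    case 4
    then have "i - DIM('e) = j - DIM('e) \<longleftrightarrow> i = j"
      by linarith
    then show ?thesis
      using 4 o2[OF i2[OF 4(1)] j2[OF 4(2)]]
      by (simp add: split_frame_def metric_lift22[OF U W E2_field[OF i2] E2_field[OF j2] z])
  qed
qed

lemma sum_split_frame:
  assumes z: "z \<in> patch U W"
  shows "(\<Sum>i<DIM('d). g z (split_frame i z) (split_frame i z) * T (split_frame i))
    = (\<Sum>i<DIM('e). g1 (\<pi>1 z) (E1 i (\<pi>1 z)) (E1 i (\<pi>1 z)) * T (lift1 (E1 i)))
      + (\<Sum>i<DIM('h). g2 (\<pi>2 z) (E2 i (\<pi>2 z)) (E2 i (\<pi>2 z)) * T (lift2 (E2 i)))"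
proof -
  have split: "sum t {..<a + b} = sum t {..<a} + (\<Sum>i<b. t (a + i))" for t :: "nat \<Rightarrow> real" and a b
    by (induction b) simp_all
  show ?thesis
    unfolding dimension split
    by (intro arg_cong2[of _ _ _ _ "(+)"] sum.cong refl)
      (simp_all add: split_frame_def metric_lift11[OF U W E1_field E1_field z] metric_lift22[OF U W E2_field E2_field z])
qed

lemma lift_tangent_eqI:
  assumes z: "z \<in> patch U W" and T: "v \<in> tangent_space P z" "w \<in> tangent_space P z"
    and eq: "\<And>Z. vector_field N1 U Z \<Longrightarrow> g z v (lift1 Z z) = g z w (lift1 Z z)"
      "\<And>V. vector_field N2 W V \<Longrightarrow> g z v (lift2 V z) = g z w (lift2 V z)"
  shows "v = w"
proof (rule P.tangent_eqI[OF P.orthonormal_frameD(2)[OF split_frame z] T])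
  fix i assume "i < DIM('d)"
  then show "g z v (split_frame i z) = g z w (split_frame i z)"
    using dimension eq(1)[OF E1_field, of i] eq(2)[OF E2_field, of "i - DIM('e)"]
    by (simp add: split_frame_def)
qed

lemma lc_lift11:
  assumes X: "vector_field N1 U X" and Y: "vector_field N1 U Y" and z: "z \<in> patch U W"
  shows "P.lc (lift1 X) (lift1 Y) z = lift1 (N1.lc X Y) z"
proof (rule lift_tangent_eqI[OF z])
  note lX = patch_lift1[OF U W X] and lY = patch_lift1[OF U W Y] and D = N1.lc_field[OF X Y]
  show "P.lc (lift1 X) (lift1 Y) z \<in> tangent_space P z" "lift1 (N1.lc X Y) z \<in> tangent_space P z"
    by (rule P.vector_field_tangent[OF P.lc_field[OF lX lY] z], rule lift1_tangent[OF U W D z])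
  show "g z (P.lc (lift1 X) (lift1 Y) z) (lift1 Z z) = g z (lift1 (N1.lc X Y) z) (lift1 Z z)"
    if Z: "vector_field N1 U Z" for Z
    unfolding P.lc_koszul[OF lX lY patch_lift1[OF U W Z] z] koszul_lift111[OF U W X Y Z z]
      metric_lift11[OF U W D Z z] by (rule N1.lc_koszul[OF X Y Z patchD(2)[OF z], symmetric])
  show "g z (P.lc (lift1 X) (lift1 Y) z) (lift2 V z) = g z (lift1 (N1.lc X Y) z) (lift2 V z)"
    if V: "vector_field N2 W V" for V
    unfolding P.lc_koszul[OF lX lY patch_lift2[OF U W V] z] koszul_lift112(1)[OF U W X Y V z]
      metric_lift12(1)[OF U W D V z] ..
qed

text \<open>The Koszul expression vanishes against lifts from either factor: a lift is parallel
  along the other factor. With commuting mixed lifts the same follows in the opposite order.\<close>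

lemma lc_lift12:
  assumes X: "vector_field N1 U X" and V: "vector_field N2 W V" and z: "z \<in> patch U W"
  shows "P.lc (lift1 X) (lift2 V) z = (\<lambda>f. 0)"
proof (rule lift_tangent_eqI[OF z])
  note lX = patch_lift1[OF U W X] and lV = patch_lift2[OF U W V]
  show "P.lc (lift1 X) (lift2 V) z \<in> tangent_space P z"
    by (rule P.vector_field_tangent[OF P.lc_field[OF lX lV] z])
  show "(\<lambda>f. 0) \<in> tangent_space P z"
    by (rule P.tangent_zero[OF patchD(1)[OF z]])
  show "g z (P.lc (lift1 X) (lift2 V) z) (lift1 Z z) = g z (\<lambda>f. 0) (lift1 Z z)"
    if Z: "vector_field N1 U Z" for Z
    unfolding P.lc_koszul[OF lX lV patch_lift1[OF U W Z] z] koszul_lift112(2)[OF U W X Z V z]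
    using P.metric_zero[OF lift1_tangent[OF U W Z z]] by simp
  show "g z (P.lc (lift1 X) (lift2 V) z) (lift2 V' z) = g z (\<lambda>f. 0) (lift2 V' z)"
    if V': "vector_field N2 W V'" for V'
    unfolding P.lc_koszul[OF lX lV patch_lift2[OF U W V'] z] koszul_lift122[OF U W X V V' z]
    using P.metric_zero[OF lift2_tangent[OF U W V' z]] by simp
qed

lemma lc_lift21:
  assumes X: "vector_field N1 U X" and V: "vector_field N2 W V" and z: "z \<in> patch U W"
  shows "P.lc (lift2 V) (lift1 X) z = (\<lambda>f. 0)"
  using P.lc_torsion[OF patch_lift1[OF U W X] patch_lift2[OF U W V] z]
  unfolding lc_lift12[OF X V z] lie_bracket_lift12(1)[OF U W X V z] by (simp add: fun_eq_iff)

text \<open>Linearity of \<open>lift1\<close> is not among the assumptions on the projections, so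
  the three parts of the curvature stay separate lifts until they are paired with a vector.\<close>

lemma riemann_lift111:
  assumes X: "vector_field N1 U X" and Y: "vector_field N1 U Y" and Z: "vector_field N1 U Z" and z: "z \<in> patch U W"
  shows "riemann P g (lift1 X) (lift1 Y) (lift1 Z) z f
    = lift1 (N1.lc X (N1.lc Y Z)) z f - lift1 (N1.lc Y (N1.lc X Z)) z f - lift1 (N1.lc (lie_bracket N1 X Y) Z) z f"
proof -
  note lX = patch_lift1[OF U W X] and lY = patch_lift1[OF U W Y] and lZ = patch_lift1[OF U W Z]
  have "P.lc (lift1 X) (P.lc (lift1 Y) (lift1 Z)) z = P.lc (lift1 X) (lift1 (N1.lc Y Z)) z"
    by (rule P.lc_cong[OF lX P.lc_field[OF lY lZ] z refl lc_lift11[OF Y Z]])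
  moreover have "P.lc (lift1 Y) (P.lc (lift1 X) (lift1 Z)) z = P.lc (lift1 Y) (lift1 (N1.lc X Z)) z"
    by (rule P.lc_cong[OF lY P.lc_field[OF lX lZ] z refl lc_lift11[OF X Z]])
  moreover have "P.lc (lie_bracket P (lift1 X) (lift1 Y)) (lift1 Z) z = P.lc (lift1 (lie_bracket N1 X Y)) (lift1 Z) z"
    by (rule P.lc_cong[OF P.vector_field_lie_bracket[OF lX lY] lZ z lie_bracket_lift11[OF U W X Y] refl])
  ultimately show ?thesis
    by (simp add: riemann_def Let_def lc_lift11[OF X N1.lc_field[OF Y Z] z] lc_lift11[OF Y N1.lc_field[OF X Z] z]
        lc_lift11[OF N1.vector_field_lie_bracket[OF X Y] Z z])
qed

lemma metric_riemann_lift: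
  assumes X: "vector_field N1 U X" and Y: "vector_field N1 U Y" and Z: "vector_field N1 U Z"
    and T: "vector_field N1 U T" and z: "z \<in> patch U W"
  shows "g z (riemann P g (lift1 X) (lift1 Y) (lift1 Z) z) (lift1 T z) = g1 (\<pi>1 z) (riemann N1 g1 X Y Z (\<pi>1 z)) (T (\<pi>1 z))"
proof -
  note a = N1.lc_field[OF X N1.lc_field[OF Y Z]] and b = N1.lc_field[OF Y N1.lc_field[OF X Z]]
    and c = N1.lc_field[OF N1.vector_field_lie_bracket[OF X Y] Z]
  note ta = lift1_tangent[OF U W a z] and tb = lift1_tangent[OF U W b z] and tc = lift1_tangent[OF U W c z]
    and tT = lift1_tangent[OF U W T z]
  note p = patchD(2)[OF z]
  note sa = N1.vector_field_tangent[OF a p] and sb = N1.vector_field_tangent[OF b p]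
    and sc = N1.vector_field_tangent[OF c p] and sT = N1.vector_field_tangent[OF T p]
  have tab: "(\<lambda>f. lift1 (N1.lc X (N1.lc Y Z)) z f - lift1 (N1.lc Y (N1.lc X Z)) z f) \<in> tangent_space P z"
    using P.tangent_lin[OF ta tb, of 1 "-1"] by simp
  have sab: "(\<lambda>f. N1.lc X (N1.lc Y Z) (\<pi>1 z) f - N1.lc Y (N1.lc X Z) (\<pi>1 z) f) \<in> tangent_space N1 (\<pi>1 z)"
    using N1.tangent_lin[OF sa sb, of 1 "-1"] by simp
  show ?thesis
    unfolding riemann_lift111[OF X Y Z z, THEN ext] P.metric_diff(1)[OF tab tc tT] P.metric_diff(1)[OF ta tb tT]
      metric_lift11[OF U W a T z] metric_lift11[OF U W b T z] metric_lift11[OF U W c T z]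
    unfolding riemann_def Let_def N1.metric_diff(1)[OF sab sc sT] N1.metric_diff(1)[OF sa sb sT] ..
qed

text \<open>Each of the three parts vanishes by itself, since it contains a mixed derivative or a
  mixed bracket.\<close>

lemma riemann_lift211:
  assumes X: "vector_field N1 U X" and Y: "vector_field N1 U Y" and V: "vector_field N2 W V" and z: "z \<in> patch U W"
  shows "riemann P g (lift2 V) (lift1 Y) (lift1 X) z = (\<lambda>f. 0)" "riemann P g (lift1 Y) (lift2 V) (lift1 X) z = (\<lambda>f. 0)"
proof -
  note lX = patch_lift1[OF U W X] and lY = patch_lift1[OF U W Y] and lV = patch_lift2[OF U W V]
  have 1: "P.lc (lift2 V) (P.lc (lift1 Y) (lift1 X)) z = (\<lambda>f. 0)"
    using P.lc_cong[OF lV P.lc_field[OF lY lX] z refl lc_lift11[OF Y X]] lc_lift21[OF N1.lc_field[OF Y X] V z] by simp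
  have 2: "P.lc (lift1 Y) (P.lc (lift2 V) (lift1 X)) z = (\<lambda>f. 0)"
    using P.lc_cong[OF lY P.lc_field[OF lV lX] z refl lc_lift21[OF X V]] P.lc_zero2[OF lY z] by simp
  have 3: "P.lc (lie_bracket P (lift2 V) (lift1 Y)) (lift1 X) z = (\<lambda>f. 0)"
    "P.lc (lie_bracket P (lift1 Y) (lift2 V)) (lift1 X) z = (\<lambda>f. 0)"
    using P.lc_cong[OF P.vector_field_lie_bracket[OF lV lY] lX z lie_bracket_lift12(2)[OF U W Y V] refl]
      P.lc_cong[OF P.vector_field_lie_bracket[OF lY lV] lX z lie_bracket_lift12(1)[OF U W Y V] refl]
      P.lc_zero1[OF lX z] by simp_all
  show "riemann P g (lift2 V) (lift1 Y) (lift1 X) z = (\<lambda>f. 0)" "riemann P g (lift1 Y) (lift2 V) (lift1 X) z = (\<lambda>f. 0)"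
    by (simp_all add: riemann_def Let_def 1 2 3)
qed

text \<open>The bracket does not vanish here, but it is a lift from the second factor, along which
  \<open>lift1 X\<close> is parallel.\<close>

lemma riemann_lift221:
  assumes X: "vector_field N1 U X" and V: "vector_field N2 W V" and V': "vector_field N2 W V'" and z: "z \<in> patch U W"
  shows "riemann P g (lift2 V) (lift2 V') (lift1 X) z = (\<lambda>f. 0)"
proof -
  note lX = patch_lift1[OF U W X] and lV = patch_lift2[OF U W V] and lV' = patch_lift2[OF U W V']
  have bracket: "lie_bracket P (lift2 V) (lift2 V') y = lift2 (lie_bracket N2 V V') y" if "y \<in> patch U W" for y
    using split_mfd.lie_bracket_lift11[OF swapped W U V V'] that by (simp add: patch_swapped)
  have 1: "P.lc (lift2 V) (P.lc (lift2 V') (lift1 X)) z = (\<lambda>f. 0)"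
    using P.lc_cong[OF lV P.lc_field[OF lV' lX] z refl lc_lift21[OF X V']] P.lc_zero2[OF lV z] by simp
  have 2: "P.lc (lift2 V') (P.lc (lift2 V) (lift1 X)) z = (\<lambda>f. 0)"
    using P.lc_cong[OF lV' P.lc_field[OF lV lX] z refl lc_lift21[OF X V]] P.lc_zero2[OF lV' z] by simp
  have 3: "P.lc (lie_bracket P (lift2 V) (lift2 V')) (lift1 X) z = (\<lambda>f. 0)"
    using P.lc_cong[OF P.vector_field_lie_bracket[OF lV lV'] lX z bracket refl]
      lc_lift21[OF X N2.vector_field_lie_bracket[OF V V'] z] by simp
  show ?thesis
    by (simp add: riemann_def Let_def 1 2 3)
qed

text \<open>The trace runs over the frames of both factors. The first part is the Ricci trace of the
  first factor, and the second one involves only mixed curvatures, which vanish.\<close>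

lemma ricci_lift11_frame:
  assumes X: "vector_field N1 U X" and Y: "vector_field N1 U Y" and z: "z \<in> patch U W"
  shows "ricci P g (lift1 X) (lift1 Y) z = ricci N1 g1 X Y (\<pi>1 z)"
  unfolding P.ricci_frame[OF patch_lift1[OF U W X] patch_lift1[OF U W Y] z split_frame]
    N1.ricci_frame[OF X Y patchD(2)[OF z] E1]
    sum_split_frame[OF z, of "\<lambda>Z. g z (riemann P g Z (lift1 Y) (lift1 X) z) (Z z)"]
  using P.metric_zero[OF lift2_tangent[OF U W E2_field z]]
  by (simp add: metric_riemann_lift[OF E1_field Y X E1_field z] riemann_lift211[OF X Y E2_field z])

lemma ricci_lift12_frame:
  assumes X: "vector_field N1 U X" and V: "vector_field N2 W V" and z: "z \<in> patch U W"
  shows "ricci P g (lift1 X) (lift2 V) z = 0"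
  unfolding P.ricci_frame[OF patch_lift1[OF U W X] patch_lift2[OF U W V] z split_frame]
    sum_split_frame[OF z, of "\<lambda>Z. g z (riemann P g Z (lift2 V) (lift1 X) z) (Z z)"]
  using P.metric_zero[OF lift2_tangent[OF U W E2_field z]] P.metric_zero[OF lift1_tangent[OF U W E1_field z]]
  by (simp add: riemann_lift211(2)[OF X E1_field V z] riemann_lift221[OF X E2_field V z])

lemma hessian_lift11_frame:
  assumes X: "vector_field N1 U X" and Y: "vector_field N1 U Y" and z: "z \<in> patch U W" and v: "smooth_near N1 (\<pi>1 z) v"
  shows "hessian P g (\<lambda>z. v (\<pi>1 z)) (lift1 X) (lift1 Y) z = hessian N1 g1 v X Y (\<pi>1 z)"
  unfolding hessian_def lc_lift11[OF X Y z] lift1_apply[OF N1.lc_field[OF X Y] patchD(1,2)[OF z] v]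
    lift1_iterate[OF U W X N1.vector_field_smooth[OF Y patchD(2)[OF z] v] z lift1_function[OF U W Y z v]] ..

lemma hessian_lift12_frame:
  assumes X: "vector_field N1 U X" and V: "vector_field N2 W V" and z: "z \<in> patch U W" and v: "smooth_near N1 (\<pi>1 z) v"
  shows "hessian P g (\<lambda>z. v (\<pi>1 z)) (lift1 X) (lift2 V) z = 0"
  unfolding hessian_def lc_lift12[OF X V z]
    eventually_zero[OF U W lift1_tangent[OF U W X z] lift2_function_cross[OF U W V z v]] by simp

text \<open>The pullback of \<open>v\<close> is constant along the second factor, and the connection
  does not leave that direction: the derivative of one lift along another is again a lift from the
  second factor.\<close>

lemma hessian_lift22_frame:
  assumes V: "vector_field N2 W V" and V': "vector_field N2 W V'" and z: "z \<in> patch U W" and v: "smooth_near N1 (\<pi>1 z) v"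
  shows "hessian P g (\<lambda>z. v (\<pi>1 z)) (lift2 V) (lift2 V') z = 0"
proof -
  interpret swap: split_mfd P g N2 g2 N1 g1 \<pi>2 \<pi>1 lift2 lift1
    by (rule swapped)
  have z': "z \<in> swap.patch W U"
    using z by (simp add: patch_swapped)
  show ?thesis
    unfolding hessian_def swap.lc_lift11[OF W U E2 E1 V V' z']
      lift2_cross[OF N2.lc_field[OF V V'] patchD(1,3)[OF z] v]
      eventually_zero[OF U W lift2_tangent[OF U W V z] lift2_function_cross[OF U W V' z v]] by simp
qed

lemma laplacian_lift_frame:
  assumes z: "z \<in> patch U W" and v: "smooth_near N1 (\<pi>1 z) v"
  shows "laplacian P g (\<lambda>z. v (\<pi>1 z)) z = laplacian N1 g1 v (\<pi>1 z)"
  unfolding P.laplacian_frame[OF patch_open[OF U W] z split_frame pullback1[OF patchD(1)[OF z] v]]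
    N1.laplacian_frame[OF U patchD(2)[OF z] E1 v]
    sum_split_frame[OF z, of "\<lambda>Z. hessian P g (\<lambda>z. v (\<pi>1 z)) Z Z z"]
  by (simp add: hessian_lift11_frame[OF E1_field E1_field z v] hessian_lift22_frame[OF E2_field E2_field z v])

lemma gradient_inner_lift_frame:
  assumes z: "z \<in> patch U W" and u: "smooth_near N1 (\<pi>1 z) u" and v: "smooth_near N1 (\<pi>1 z) v"
  shows "gradient_inner P g (\<lambda>z. u (\<pi>1 z)) (\<lambda>z. v (\<pi>1 z)) z = gradient_inner N1 g1 u v (\<pi>1 z)"
  unfolding P.gradient_inner_frame[OF patch_open[OF U W] z split_frame]
    N1.gradient_inner_frame[OF U patchD(2)[OF z] E1]
    sum_split_frame[OF z, of "\<lambda>Z. Z z (\<lambda>z. u (\<pi>1 z)) * Z z (\<lambda>z. v (\<pi>1 z))"]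
  by (simp add: lift1_apply[OF E1_field patchD(1,2)[OF z] u] lift1_apply[OF E1_field patchD(1,2)[OF z] v]
      lift2_cross[OF E2_field patchD(1,3)[OF z] u])

end

section \<open>The formulas for lifts of globally defined fields\<close>

lemma frames_around:
  assumes z: "z \<in> points P"
  obtains U W E1 E2 where "openin (mtop N1) U" "openin (mtop N2) W" "orthonormal_frame N1 g1 U E1"
    "orthonormal_frame N2 g2 W E2" "z \<in> patch U W"
proof -
  obtain E1 U where "openin (mtop N1) U" "\<pi>1 z \<in> U" "orthonormal_frame N1 g1 U E1"
    using N1.frame_exists[OF projection1[OF z]] by blast
  moreover obtain E2 W where "openin (mtop N2) W" "\<pi>2 z \<in> W" "orthonormal_frame N2 g2 W E2"
    using N2.frame_exists[OF projection2[OF z]] by blast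
  ultimately show ?thesis
    using that z by (auto simp: patch_def)
qed

context
  fixes z X Y V V' v
  assumes z: "z \<in> points P"
    and X: "vector_field N1 (points N1) X" and Y: "vector_field N1 (points N1) Y"
    and V: "vector_field N2 (points N2) V" and V': "vector_field N2 (points N2) V'"
    and v: "smooth_near N1 (\<pi>1 z) v"
begin

text \<open>Local frames around \<open>z\<close> are needed for the proofs but do not occur in the
  results, so they are eliminated here by restricting the fields to a patch.\<close>

lemma split_formulas:
  "ricci P g (lift1 X) (lift1 Y) z = ricci N1 g1 X Y (\<pi>1 z)"
  "ricci P g (lift1 X) (lift2 V) z = 0"
  "hessian P g (\<lambda>z. v (\<pi>1 z)) (lift1 X) (lift1 Y) z = hessian N1 g1 v X Y (\<pi>1 z)"
  "hessian P g (\<lambda>z. v (\<pi>1 z)) (lift1 X) (lift2 V) z = 0"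
  "hessian P g (\<lambda>z. v (\<pi>1 z)) (lift2 V) (lift2 V') z = 0"
  "laplacian P g (\<lambda>z. v (\<pi>1 z)) z = laplacian N1 g1 v (\<pi>1 z)"
  "gradient_inner P g (\<lambda>z. v (\<pi>1 z)) (\<lambda>z. v (\<pi>1 z)) z = gradient_inner N1 g1 v v (\<pi>1 z)"
  "g z (lift1 X z) (lift1 Y z) = g1 (\<pi>1 z) (X (\<pi>1 z)) (Y (\<pi>1 z))"
  "g z (lift1 X z) (lift2 V z) = 0"
  "g z (lift2 V z) (lift2 V' z) = g2 (\<pi>2 z) (V (\<pi>2 z)) (V' (\<pi>2 z))"
proof -
  obtain U W E1 E2 where U: "openin (mtop N1) U" and W: "openin (mtop N2) W"
    and E1: "orthonormal_frame N1 g1 U E1" and E2: "orthonormal_frame N2 g2 W E2" and zp: "z \<in> patch U W"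
    using frames_around[OF z] .
  note X' = N1.vector_field_subset[OF X U openin_subset[OF U]]
    and Y' = N1.vector_field_subset[OF Y U openin_subset[OF U]]
    and Vw = N2.vector_field_subset[OF V W openin_subset[OF W]]
    and V'w = N2.vector_field_subset[OF V' W openin_subset[OF W]]
  show "ricci P g (lift1 X) (lift1 Y) z = ricci N1 g1 X Y (\<pi>1 z)"
    by (rule ricci_lift11_frame[OF U W E1 E2 X' Y' zp])
  show "ricci P g (lift1 X) (lift2 V) z = 0"
    by (rule ricci_lift12_frame[OF U W E1 E2 X' Vw zp])
  show "hessian P g (\<lambda>z. v (\<pi>1 z)) (lift1 X) (lift1 Y) z = hessian N1 g1 v X Y (\<pi>1 z)"
    by (rule hessian_lift11_frame[OF U W E1 E2 X' Y' zp v])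
  show "hessian P g (\<lambda>z. v (\<pi>1 z)) (lift1 X) (lift2 V) z = 0"
    by (rule hessian_lift12_frame[OF U W E1 E2 X' Vw zp v])
  show "hessian P g (\<lambda>z. v (\<pi>1 z)) (lift2 V) (lift2 V') z = 0"
    by (rule hessian_lift22_frame[OF U W E1 E2 Vw V'w zp v])
  show "laplacian P g (\<lambda>z. v (\<pi>1 z)) z = laplacian N1 g1 v (\<pi>1 z)"
    by (rule laplacian_lift_frame[OF U W E1 E2 zp v])
  show "gradient_inner P g (\<lambda>z. v (\<pi>1 z)) (\<lambda>z. v (\<pi>1 z)) z = gradient_inner N1 g1 v v (\<pi>1 z)"
    by (rule gradient_inner_lift_frame[OF U W E1 E2 zp v v])
  show "g z (lift1 X z) (lift1 Y z) = g1 (\<pi>1 z) (X (\<pi>1 z)) (Y (\<pi>1 z))"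
    by (rule metric_lift11[OF U W X' Y' zp])
  show "g z (lift1 X z) (lift2 V z) = 0"
    by (rule metric_lift12(1)[OF U W X' Vw zp])
  show "g z (lift2 V z) (lift2 V' z) = g2 (\<pi>2 z) (V (\<pi>2 z)) (V' (\<pi>2 z))"
    by (rule metric_lift22[OF U W Vw V'w zp])
qed

end

end

section \<open>Product manifolds\<close>

lemma second_countable_prod_topology:
  assumes "second_countable X" "second_countable Y"
  shows "second_countable (prod_topology X Y)"
proof -
  obtain A where A: "countable A" "\<forall>V\<in>A. openin X V" "\<forall>U x. openin X U \<and> x \<in> U \<longrightarrow> (\<exists>V\<in>A. x \<in> V \<and> V \<subseteq> U)"
    using assms(1) unfolding second_countable_def by blast
  obtain C where C: "countable C" "\<forall>V\<in>C. openin Y V" "\<forall>U y. openin Y U \<and> y \<in> U \<longrightarrow> (\<exists>V\<in>C. y \<in> V \<and> V \<subseteq> U)"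
    using assms(2) unfolding second_countable_def by blast
  define D where "D = (\<lambda>(V, W). V \<times> W) ` (A \<times> C)"
  have "countable D"
    unfolding D_def using A(1) C(1) by blast
  moreover have "\<forall>V\<in>D. openin (prod_topology X Y) V"
    using A(2) C(2) by (auto simp: D_def openin_prod_Times_iff)
  moreover have "\<exists>V\<in>D. z \<in> V \<and> V \<subseteq> S" if "openin (prod_topology X Y) S" "z \<in> S" for S z
  proof -
    have S: "openin (prod_topology X Y) S" "(fst z, snd z) \<in> S"
      using that by simp_all
    then obtain U W where UW: "openin X U" "openin Y W" "fst z \<in> U" "snd z \<in> W" "U \<times> W \<subseteq> S"
      using S(1)[unfolded openin_prod_topology_alt, rule_format, OF S(2)] by blast
    obtain U' where U': "U' \<in> A" "fst z \<in> U'" "U' \<subseteq> U"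
      using A(3) UW(1,3) by blast
    obtain W' where W': "W' \<in> C" "snd z \<in> W'" "W' \<subseteq> W"
      using C(3) UW(2,4) by blast
    have "z \<in> U' \<times> W'"
      using U' W' by (simp add: mem_Times_iff)
    moreover have "U' \<times> W' \<subseteq> S"
      using U' W' UW(5) by blast
    ultimately show ?thesis
      using U'(1) W'(1) unfolding D_def by (intro bexI[of _ "U' \<times> W'"] conjI image_eqI[of _ _ "(U', W')"]) simp_all
  qed
  ultimately show ?thesis
    unfolding second_countable_def by blast
qed

lemma homeomorphic_map_map_prod:
  assumes "homeomorphic_map X X' f" "homeomorphic_map Y Y' g"
  shows "homeomorphic_map (prod_topology X Y) (prod_topology X' Y') (map_prod f g)"
proof -
  obtain f' g' where "homeomorphic_maps X X' f f'" "homeomorphic_maps Y Y' g g'"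
    using assms homeomorphic_map_maps by metis
  then have "homeomorphic_maps (prod_topology X Y) (prod_topology X' Y') (\<lambda>(x, y). (f x, g y)) (\<lambda>(x, y). (f' x, g' y))"
    by (simp add: homeomorphic_maps_prod)
  then show ?thesis
    unfolding homeomorphic_map_maps map_prod_def by blast
qed

text \<open>The pair is the sum of the images of its components under two bounded linear
  embeddings.\<close>

lemma Cinf_on_Pair:
  assumes f: "Cinf_on S f" and g: "Cinf_on S g"
  shows "Cinf_on S (\<lambda>x. (f x, g x))"
proof -
  have "Cinf_on S (\<lambda>x. (f x, 0) + (0, g x))"
    by (intro Cinf_on_add Cinf_on_linear[OF _ f] Cinf_on_linear[OF _ g])
      (auto intro!: bounded_linear_Pair bounded_linear_ident bounded_linear_zero)
  then show ?thesis
    by simp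
qed

lemma inv_into_map_prod:
  assumes "inj_on \<phi> U" "inj_on \<xi> V" "x \<in> \<phi> ` U" "y \<in> \<xi> ` V"
  shows "inv_into (U \<times> V) (map_prod \<phi> \<xi>) (x, y) = (inv_into U \<phi> x, inv_into V \<xi> y)"
proof (rule inv_into_f_eq)
  show "inj_on (map_prod \<phi> \<xi>) (U \<times> V)"
    using assms(1,2) by (rule map_prod_inj_on)
qed (use assms in \<open>auto simp: inv_into_into f_inv_into_f\<close>)

section \<open>The product atlas\<close>

locale prod_smooth = B: smooth_mfd B + F: smooth_mfd F
  for B :: "('b, 'm::euclidean_space) mfd" and F :: "('f, 'k::euclidean_space) mfd"
begin

abbreviation (input) P where "P \<equiv> prod_mfd B F"

lemma mtop_prod: "mtop P = prod_topology (mtop B) (mtop F)"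
  by (simp add: prod_mfd_def)

lemma points_prod: "points P = points B \<times> points F"
  by (simp add: mtop_prod)

lemma prod_chart: "(U, \<phi>) \<in> atlas B \<Longrightarrow> (V, \<xi>) \<in> atlas F \<Longrightarrow> (U \<times> V, map_prod \<phi> \<xi>) \<in> atlas P"
  by (auto simp: prod_mfd_def)

lemma prod_chartE:
  assumes "c \<in> atlas P"
  obtains U \<phi> V \<xi> where "c = (U \<times> V, map_prod \<phi> \<xi>)" "(U, \<phi>) \<in> atlas B" "(V, \<xi>) \<in> atlas F"
  using assms by (auto simp: prod_mfd_def)

lemma prod_chart_inv:
  assumes "(U, \<phi>) \<in> atlas B" "(V, \<xi>) \<in> atlas F" "x \<in> \<phi> ` U" "y \<in> \<xi> ` V"
  shows "inv_into (U \<times> V) (map_prod \<phi> \<xi>) (x, y) = (inv_into U \<phi> x, inv_into V \<xi> y)"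
  by (rule inv_into_map_prod[OF B.chart_inj[OF assms(1)] F.chart_inj[OF assms(2)] assms(3,4)])

lemma prod_transition:
  assumes 1: "(U, \<phi>) \<in> atlas B" "(V, \<xi>) \<in> atlas F" and 2: "(U', \<phi>') \<in> atlas B" "(V', \<xi>') \<in> atlas F"
  shows "Cinf_on (map_prod \<phi>' \<xi>' ` ((U \<times> V) \<inter> (U' \<times> V'))) (map_prod \<phi> \<xi> \<circ> inv_into (U' \<times> V') (map_prod \<phi>' \<xi>'))"
proof -
  let ?S = "\<phi>' ` (U \<inter> U')" and ?T = "\<xi>' ` (V \<inter> V')"
  have eq: "map_prod \<phi>' \<xi>' ` ((U \<times> V) \<inter> (U' \<times> V')) = ?S \<times> ?T"
    by (simp add: Times_Int_Times map_prod_image)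
  have S: "Cinf_on ?S (\<phi> \<circ> inv_into U' \<phi>')" and T: "Cinf_on ?T (\<xi> \<circ> inv_into V' \<xi>')"
    using B.chart_transition[OF 1(1) 2(1)] F.chart_transition[OF 1(2) 2(2)] by auto
  have ST: "open (?S \<times> ?T)"
    using S T by (intro open_Times Cinf_on_open)
  have "Cinf_on (?S \<times> ?T) (\<lambda>x. ((\<phi> \<circ> inv_into U' \<phi>') (fst x), (\<xi> \<circ> inv_into V' \<xi>') (snd x)))"
    by (intro Cinf_on_Pair Cinf_on_compose[OF Cinf_on_bounded_linear[OF bounded_linear_fst ST] S]
        Cinf_on_compose[OF Cinf_on_bounded_linear[OF bounded_linear_snd ST] T]) auto
  then show ?thesis
    unfolding eq by (rule Cinf_on_cong) (use prod_chart_inv[OF 2] in auto)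
qed

sublocale P: smooth_mfd "prod_mfd B F"
proof
  have B: "Hausdorff_space (mtop B)" "second_countable (mtop B)"
    and F: "Hausdorff_space (mtop F)" "second_countable (mtop F)"
    using B.smooth_manifold F.smooth_manifold by (simp_all add: smooth_manifold_def)
  have "(\<Union>(U, \<phi>)\<in>atlas P. U) = points P"
  proof (intro equalityI subsetI)
    fix z assume "z \<in> (\<Union>(U, \<phi>)\<in>atlas P. U)"
    then obtain c where "c \<in> atlas P" "z \<in> fst c"
      by auto
    then show "z \<in> points P"
      unfolding points_prod by (elim prod_chartE) (use B.chart_points F.chart_points in force)
  next
    fix z assume "z \<in> points P"
    then obtain U \<phi> V \<xi> where "(U, \<phi>) \<in> atlas B" "fst z \<in> U" "(V, \<xi>) \<in> atlas F" "snd z \<in> V"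
      unfolding points_prod using B.chart_exists F.chart_exists by (metis mem_Times_iff)
    then have "(U \<times> V, map_prod \<phi> \<xi>) \<in> atlas P" "z \<in> U \<times> V"
      by (auto simp: prod_chart mem_Times_iff)
    then show "z \<in> (\<Union>(U, \<phi>)\<in>atlas P. U)"
      by blast
  qed
  moreover have "openin (mtop P) C \<and> open (\<kappa> ` C) \<and>
      homeomorphic_map (subtopology (mtop P) C) (top_of_set (\<kappa> ` C)) \<kappa>" if "(C, \<kappa>) \<in> atlas P" for C \<kappa>
    using that
  proof (rule prod_chartE)
    fix U \<phi> V \<xi>
    assume eq: "(C, \<kappa>) = (U \<times> V, map_prod \<phi> \<xi>)" and U: "(U, \<phi>) \<in> atlas B" and V: "(V, \<xi>) \<in> atlas F"
    have "homeomorphic_map (prod_topology (subtopology (mtop B) U) (subtopology (mtop F) V))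
        (prod_topology (top_of_set (\<phi> ` U)) (top_of_set (\<xi> ` V))) (map_prod \<phi> \<xi>)"
      by (rule homeomorphic_map_map_prod[OF B.chart_homeomorphic[OF U] F.chart_homeomorphic[OF V]])
    then show ?thesis
      using eq B.chart_openin[OF U] F.chart_openin[OF V] B.chart_image_open[OF U] F.chart_image_open[OF V]
      by (simp add: mtop_prod openin_prod_Times_iff map_prod_image open_Times subtopology_Times)
  qed
  moreover have "Cinf_on (\<kappa>' ` (C \<inter> C')) (\<kappa> \<circ> inv_into C' \<kappa>')"
    if c: "(C, \<kappa>) \<in> atlas P" and c': "(C', \<kappa>') \<in> atlas P" for C \<kappa> C' \<kappa>'
  proof -
    obtain U \<phi> V \<xi> where "(C, \<kappa>) = (U \<times> V, map_prod \<phi> \<xi>)" "(U, \<phi>) \<in> atlas B" "(V, \<xi>) \<in> atlas F"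
      using prod_chartE[OF c] .
    moreover obtain U' \<phi>' V' \<xi>'
      where "(C', \<kappa>') = (U' \<times> V', map_prod \<phi>' \<xi>')" "(U', \<phi>') \<in> atlas B" "(V', \<xi>') \<in> atlas F"
      using prod_chartE[OF c'] .
    ultimately show ?thesis
      using prod_transition[of U \<phi> V \<xi> U' \<phi>' V' \<xi>'] by simp
  qed
  ultimately show "smooth_manifold P"
    unfolding smooth_manifold_def
    using B F second_countable_prod_topology[OF B(2) F(2)]
    by (auto simp: mtop_prod Hausdorff_space_prod_topology)
qed

section \<open>Projection to the first factor and slices along it\<close>

lemma pullback_fst:
  assumes z: "z \<in> points P" and f: "smooth_near B (fst z) f"
  shows "smooth_near P z (\<lambda>z. f (fst z))"
    and "(U, \<phi>) \<in> atlas B \<Longrightarrow> (V, \<xi>) \<in> atlas F \<Longrightarrow> fst z \<in> U \<Longrightarrow> snd z \<in> V \<Longrightarrow>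
      coord_tvec P (U \<times> V, map_prod \<phi> \<xi>) z u (\<lambda>z. f (fst z)) = coord_tvec B (U, \<phi>) (fst z) (fst u) f"
proof -
  \<comment> \<open>Smoothness needs one product chart around \<open>z\<close>, the formula is
    wanted in all of them. Both follow from the local expression, which is that of \<open>f\<close>
    composed with the linear map \<open>fst\<close>.\<close>
  have *: "smooth_near P z (\<lambda>z. f (fst z)) \<and>
      coord_tvec P (U \<times> V, map_prod \<phi> \<xi>) z u (\<lambda>z. f (fst z)) = coord_tvec B (U, \<phi>) (fst z) (fst u) f"
    if U: "(U, \<phi>) \<in> atlas B" "fst z \<in> U" and V: "(V, \<xi>) \<in> atlas F" "snd z \<in> V" for U \<phi> V \<xi>
  proof
    have c: "(U \<times> V, map_prod \<phi> \<xi>) \<in> atlas P" "z \<in> U \<times> V"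
      using U V by (auto simp: prod_chart mem_Times_iff)
    obtain T where T: "\<phi> (fst z) \<in> T" "T \<subseteq> \<phi> ` U" "Cinf_on T (f \<circ> inv_into U \<phi>)"
      using B.smooth_nearD_chart[OF U f] .
    have TV: "open (T \<times> \<xi> ` V)" "map_prod \<phi> \<xi> z \<in> T \<times> \<xi> ` V"
      using T U V F.chart_image_open Cinf_on_open by (auto intro!: open_Times simp: map_prod_def split: prod.split)
    have fst_smooth: "Cinf_on (T \<times> \<xi> ` V) fst"
      by (rule Cinf_on_bounded_linear[OF bounded_linear_fst TV(1)])
    have eq: "(f \<circ> inv_into U \<phi>) (fst x) = ((\<lambda>z. f (fst z)) \<circ> inv_into (U \<times> V) (map_prod \<phi> \<xi>)) x"
      if "x \<in> T \<times> \<xi> ` V" for x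
      using prod_chart_inv[OF U(1) V(1), of "fst x" "snd x"] that T(2) by auto
    have "Cinf_on (T \<times> \<xi> ` V) (\<lambda>x. (f \<circ> inv_into U \<phi>) (fst x))"
      by (rule Cinf_on_compose[OF fst_smooth T(3)]) auto
    then have "Cinf_on (T \<times> \<xi> ` V) ((\<lambda>z. f (fst z)) \<circ> inv_into (U \<times> V) (map_prod \<phi> \<xi>))"
      by (rule Cinf_on_cong) (rule eq)
    then show smooth: "smooth_near P z (\<lambda>z. f (fst z))"
      by (rule P.smooth_nearI_chart[OF c TV(2)])
    have "((\<lambda>x. (f \<circ> inv_into U \<phi>) (fst x)) has_derivative (\<lambda>u. coord_tvec B (U, \<phi>) (fst z) (fst u) f)) (at (map_prod \<phi> \<xi> z))"
      by (rule has_derivative_compose[OF bounded_linear_imp_has_derivative[OF bounded_linear_fst]])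
        (use B.coord_tvec_has_derivative[OF U f] in \<open>simp add: o_def\<close>)
    then have "((\<lambda>z. f (fst z)) \<circ> inv_into (U \<times> V) (map_prod \<phi> \<xi>) has_derivative
        (\<lambda>u. coord_tvec B (U, \<phi>) (fst z) (fst u) f)) (at (map_prod \<phi> \<xi> z))"
      by (rule has_derivative_transform_within_open[OF _ TV]) (rule eq)
    then show "coord_tvec P (U \<times> V, map_prod \<phi> \<xi>) z u (\<lambda>z. f (fst z)) = coord_tvec B (U, \<phi>) (fst z) (fst u) f"
      by (rule P.coord_tvec_eqI[OF c smooth])
  qed
  obtain U' \<phi>' V' \<xi>' where "(U', \<phi>') \<in> atlas B" "fst z \<in> U'" "(V', \<xi>') \<in> atlas F" "snd z \<in> V'"
    using z unfolding points_prod using B.chart_exists F.chart_exists by (metis mem_Times_iff)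
  with * show "smooth_near P z (\<lambda>z. f (fst z))"
    by blast
  show "coord_tvec P (U \<times> V, map_prod \<phi> \<xi>) z u (\<lambda>z. f (fst z)) = coord_tvec B (U, \<phi>) (fst z) (fst u) f"
    if "(U, \<phi>) \<in> atlas B" "(V, \<xi>) \<in> atlas F" "fst z \<in> U" "snd z \<in> V"
    using * that by blast
qed

text \<open>In product charts the slice through \<open>q\<close> is the affine map sending
  \<open>x\<close> to \<open>(x, \<xi> q)\<close>, whose derivative inserts \<open>a\<close> in the
  first component; the rest is the chain rule.\<close>

lemma slice_fst:
  assumes U: "(U, \<phi>) \<in> atlas B" "p \<in> U" and V: "(V, \<xi>) \<in> atlas F" "q \<in> V" and f: "smooth_near P (p, q) f"
  shows "smooth_near B p (\<lambda>x. f (x, q))"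
    and "coord_tvec B (U, \<phi>) p a (\<lambda>x. f (x, q)) = coord_tvec P (U \<times> V, map_prod \<phi> \<xi>) (p, q) (a, 0) f"
proof -
  let ?G = "f \<circ> inv_into (U \<times> V) (map_prod \<phi> \<xi>)"
  have c: "(U \<times> V, map_prod \<phi> \<xi>) \<in> atlas P" "(p, q) \<in> U \<times> V"
    using U V by (auto simp: prod_chart)
  obtain T where T: "map_prod \<phi> \<xi> (p, q) \<in> T" "T \<subseteq> map_prod \<phi> \<xi> ` (U \<times> V)" "Cinf_on T ?G"
    using P.smooth_nearD_chart[OF c f] .
  define S where "S = (\<lambda>x. (x, \<xi> q)) -` T"
  have S: "open S" "\<phi> p \<in> S"
    unfolding S_def using T(1) Cinf_on_open[OF T(3)]
    by (auto intro!: open_vimage continuous_intros)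
  have slice: "Cinf_on S (\<lambda>x. (x, \<xi> q))"
    by (intro Cinf_on_Pair Cinf_on_ident Cinf_on_const S(1))
  have eq: "?G (x, \<xi> q) = ((\<lambda>x. f (x, q)) \<circ> inv_into U \<phi>) x" if "x \<in> S" for x
  proof -
    have "x \<in> \<phi> ` U"
      using that T(2) by (auto simp: S_def map_prod_image)
    then show ?thesis
      using prod_chart_inv[OF U(1) V(1), of x "\<xi> q"] V F.chart_inv[OF V] by simp
  qed
  have "Cinf_on S (\<lambda>x. ?G (x, \<xi> q))"
    by (rule Cinf_on_compose[OF slice T(3)]) (auto simp: S_def)
  then have "Cinf_on S ((\<lambda>x. f (x, q)) \<circ> inv_into U \<phi>)"
    by (rule Cinf_on_cong) (rule eq)
  then show smooth: "smooth_near B p (\<lambda>x. f (x, q))"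
    by (rule B.smooth_nearI_chart[OF U S(2)])
  have "((\<lambda>x. ?G (x, \<xi> q)) has_derivative (\<lambda>a. coord_tvec P (U \<times> V, map_prod \<phi> \<xi>) (p, q) (a, 0) f)) (at (\<phi> p))"
  proof -
    have 1: "((\<lambda>x. (x, \<xi> q)) has_derivative (\<lambda>a. (a, 0))) (at (\<phi> p))"
      by (auto intro!: derivative_eq_intros)
    have 2: "(?G has_derivative (\<lambda>u. coord_tvec P (U \<times> V, map_prod \<phi> \<xi>) (p, q) u f)) (at (\<phi> p, \<xi> q))"
      using P.coord_tvec_has_derivative[OF c f] by simp
    show ?thesis
      using has_derivative_compose[OF 1 2] .
  qed
  then have "((\<lambda>x. f (x, q)) \<circ> inv_into U \<phi> has_derivative
      (\<lambda>a. coord_tvec P (U \<times> V, map_prod \<phi> \<xi>) (p, q) (a, 0) f)) (at (\<phi> p))"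
    by (rule has_derivative_transform_within_open[OF _ S]) (rule eq)
  then show "coord_tvec B (U, \<phi>) p a (\<lambda>x. f (x, q)) = coord_tvec P (U \<times> V, map_prod \<phi> \<xi>) (p, q) (a, 0) f"
    by (rule B.coord_tvec_eqI[OF U smooth])
qed

lemma tangent_map_slice_fst:
  assumes U: "(U, \<phi>) \<in> atlas B" "p \<in> U" and V: "(V, \<xi>) \<in> atlas F" "q \<in> V"
  shows "tangent_map P (\<lambda>x. (x, q)) p (coord_tvec B (U, \<phi>) p a) = coord_tvec P (U \<times> V, map_prod \<phi> \<xi>) (p, q) (a, 0)"
proof
  fix f
  show "tangent_map P (\<lambda>x. (x, q)) p (coord_tvec B (U, \<phi>) p a) f
    = coord_tvec P (U \<times> V, map_prod \<phi> \<xi>) (p, q) (a, 0) f"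
    using slice_fst(2)[OF U V, of f a] by (simp add: tangent_map_def o_def P.coord_tvec_nonsmooth)
qed

lemma tangent_map_fst:
  assumes U: "(U, \<phi>) \<in> atlas B" "fst z \<in> U" and V: "(V, \<xi>) \<in> atlas F" "snd z \<in> V"
  shows "tangent_map B fst z (coord_tvec P (U \<times> V, map_prod \<phi> \<xi>) z u) = coord_tvec B (U, \<phi>) (fst z) (fst u)"
proof
  fix f
  have "z \<in> points P"
    unfolding points_prod using B.chart_points[OF U] F.chart_points[OF V] by (simp add: mem_Times_iff)
  then show "tangent_map B fst z (coord_tvec P (U \<times> V, map_prod \<phi> \<xi>) z u) f = coord_tvec B (U, \<phi>) (fst z) (fst u) f"
    using pullback_fst(2)[OF _ _ U(1) V(1) U(2) V(2)]
    by (simp add: tangent_map_def o_def B.coord_tvec_nonsmooth)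
qed

lemma tangent_map_fst_tangent:
  assumes v: "v \<in> tangent_space P z"
  shows "tangent_map B fst z v \<in> tangent_space B (fst z)"
proof -
  obtain U \<phi> V \<xi> where c: "(U, \<phi>) \<in> atlas B" "fst z \<in> U" "(V, \<xi>) \<in> atlas F" "snd z \<in> V"
    using P.tangent_space_points[OF v] unfolding points_prod
    using B.chart_exists F.chart_exists by (metis mem_Times_iff)
  obtain u where "v = coord_tvec P (U \<times> V, map_prod \<phi> \<xi>) z u"
    using v P.tangent_space_chart[OF prod_chart[OF c(1,3)], of z] c(2,4) by (auto simp: mem_Times_iff)
  then show ?thesis
    using tangent_map_fst[OF c] B.tangent_space_chart[OF c(1,2)] by auto
qed

lemma tangent_map_slice_fst_tangent:
  assumes v: "v \<in> tangent_space B p" and q: "q \<in> points F"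
  shows "tangent_map P (\<lambda>x. (x, q)) p v \<in> tangent_space P (p, q)"
proof -
  obtain U \<phi> a where U: "(U, \<phi>) \<in> atlas B" "p \<in> U" "v = coord_tvec B (U, \<phi>) p a"
    using B.tangent_spaceE[OF v] .
  obtain V \<xi> where V: "(V, \<xi>) \<in> atlas F" "q \<in> V"
    using F.chart_exists[OF q] by blast
  show ?thesis
    unfolding U(3) tangent_map_slice_fst[OF U(1,2) V]
    using P.tangent_space_chart[OF prod_chart[OF U(1) V(1)]] U(2) V(2) by blast
qed

lemma slice_fst_apply:
  assumes v: "v \<in> tangent_space B p" and q: "q \<in> points F"
  shows "smooth_near B p f \<Longrightarrow> tangent_map P (\<lambda>x. (x, q)) p v (\<lambda>z. f (fst z)) = v f"
    and "smooth_near F q h \<Longrightarrow> tangent_map P (\<lambda>x. (x, q)) p v (\<lambda>z. h (snd z)) = 0"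
proof -
  have z: "(p, q) \<in> points P"
    using B.tangent_space_points[OF v] q by (simp add: points_prod)
  show "smooth_near B p f \<Longrightarrow> tangent_map P (\<lambda>x. (x, q)) p v (\<lambda>z. f (fst z)) = v f"
    using pullback_fst(1)[OF z, of f] by (simp add: tangent_map_def o_def)
  show "smooth_near F q h \<Longrightarrow> tangent_map P (\<lambda>x. (x, q)) p v (\<lambda>z. h (snd z)) = 0"
    using B.tvec_const[OF v] by (simp add: tangent_map_def o_def)
qed

text \<open>The definition by slices shows no joint regularity in both variables. Expanding
  \<open>X\<close> in a chart of the base writes the lift as pulled back components times coordinate
  fields of the product chart, both of which act smoothly.\<close>

lemma vector_field_lift_fst:
  assumes X: "vector_field B S X"
  shows "vector_field P {z \<in> points P. fst z \<in> S} (lift_fst B F X)"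
proof (rule P.vector_fieldI)
  have "{z \<in> points P. fst z \<in> S} = S \<times> points F"
    using openin_subset[OF B.vector_field_open[OF X]] by (auto simp: points_prod)
  then show "openin (mtop P) {z \<in> points P. fst z \<in> S}"
    using B.vector_field_open[OF X] by (simp add: mtop_prod openin_prod_Times_iff)
  fix z assume "z \<in> {z \<in> points P. fst z \<in> S}"
  then obtain p q where z: "z = (p, q)" "p \<in> S" "q \<in> points F" "(p, q) \<in> points P"
    by (cases z) (auto simp: points_prod)
  show "lift_fst B F X z \<in> tangent_space P z"
    using tangent_map_slice_fst_tangent[OF B.vector_field_tangent[OF X z(2)] z(3)] by (simp add: z(1) lift_fst_def)
  fix f assume f: "smooth_near P z f"
  obtain U \<phi> where U: "(U, \<phi>) \<in> atlas B" "p \<in> U"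
    using B.chart_exists[OF B.openin_points[OF B.vector_field_open[OF X] z(2)]] by blast
  obtain V \<xi> where V: "(V, \<xi>) \<in> atlas F" "q \<in> V"
    using F.chart_exists[OF z(3)] by blast
  let ?d = "coord_tvec P (U \<times> V, map_prod \<phi> \<xi>)"
  have c: "(U \<times> V, map_prod \<phi> \<xi>) \<in> atlas P"
    by (rule prod_chart[OF U(1) V(1)])
  have "smooth_near P z (\<lambda>y. \<Sum>i\<in>Basis. X (fst y) (\<lambda>x. \<phi> x \<bullet> i) * ?d y (i, 0) f)"
  proof (intro P.smooth_near_sum P.smooth_near_mult P.smooth_near_points[OF f])
    fix i
    show "smooth_near P z (\<lambda>y. X (fst y) (\<lambda>x. \<phi> x \<bullet> i))"
      using z B.vector_field_smooth[OF X z(2) B.smooth_near_coord[OF U]]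
      by (intro pullback_fst(1)) auto
    show "smooth_near P z (\<lambda>y. ?d y (i, 0) f)"
      by (rule P.vector_field_smooth[OF P.vector_field_coord[OF c] _ f]) (use z U V in auto)
  qed
  moreover have "\<forall>\<^sub>F y in nhdsin (mtop P) z. (\<Sum>i\<in>Basis. X (fst y) (\<lambda>x. \<phi> x \<bullet> i) * ?d y (i, 0) f) = lift_fst B F X y f"
  proof -
    have "openin (mtop P) ((S \<inter> U) \<times> V)" "z \<in> (S \<inter> U) \<times> V"
      using B.vector_field_open[OF X] B.chart_openin[OF U(1)] F.chart_openin[OF V(1)] z U V
      by (auto simp: mtop_prod openin_prod_Times_iff)
    then have "\<forall>\<^sub>F y in nhdsin (mtop P) z. y \<in> (S \<inter> U) \<times> V"
      by (rule P.eventually_nhdsin_open)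
    then show ?thesis
      using P.smooth_near_eventually[OF f]
    proof eventually_elim
      case (elim y)
      obtain x w where y: "y = (x, w)" "x \<in> S" "x \<in> U" "w \<in> V"
        using elim(1) by auto
      have "lift_fst B F X y f = X x (\<lambda>x. f (x, w))"
        using elim(2) by (simp add: y(1) lift_fst_def tangent_map_def o_def)
      also have "\<dots> = (\<Sum>i\<in>Basis. X x (\<lambda>x. \<phi> x \<bullet> i) * coord_tvec B (U, \<phi>) x i (\<lambda>x. f (x, w)))"
        by (rule B.vector_field_expand[OF X U(1) y(2,3)])
      also have "\<dots> = (\<Sum>i\<in>Basis. X (fst y) (\<lambda>x. \<phi> x \<bullet> i) * ?d y (i, 0) f)"
        using slice_fst(2)[OF U(1) y(3) V(1) y(4)] elim(2) by (simp add: y(1))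
      finally show ?case ..
    qed
  qed
  ultimately show "smooth_near P z (\<lambda>y. lift_fst B F X y f)"
    by (rule P.smooth_near_cong)
qed

section \<open>Projection to the second factor and slices along it, symmetric to the first\<close>

lemma pullback_snd:
  assumes z: "z \<in> points P" and f: "smooth_near F (snd z) f"
  shows "smooth_near P z (\<lambda>z. f (snd z))"
    and "(V, \<xi>) \<in> atlas F \<Longrightarrow> (U, \<phi>) \<in> atlas B \<Longrightarrow> snd z \<in> V \<Longrightarrow> fst z \<in> U \<Longrightarrow>
      coord_tvec P (U \<times> V, map_prod \<phi> \<xi>) z u (\<lambda>z. f (snd z)) = coord_tvec F (V, \<xi>) (snd z) (snd u) f"
proof -
  have *: "smooth_near P z (\<lambda>z. f (snd z)) \<and>
      coord_tvec P (U \<times> V, map_prod \<phi> \<xi>) z u (\<lambda>z. f (snd z)) = coord_tvec F (V, \<xi>) (snd z) (snd u) f"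
    if V: "(V, \<xi>) \<in> atlas F" "snd z \<in> V" and U: "(U, \<phi>) \<in> atlas B" "fst z \<in> U" for V \<xi> U \<phi>
  proof
    have c: "(U \<times> V, map_prod \<phi> \<xi>) \<in> atlas P" "z \<in> U \<times> V"
      using V U by (auto simp: prod_chart mem_Times_iff)
    obtain T where T: "\<xi> (snd z) \<in> T" "T \<subseteq> \<xi> ` V" "Cinf_on T (f \<circ> inv_into V \<xi>)"
      using F.smooth_nearD_chart[OF V f] .
    have TV: "open (\<phi> ` U \<times> T)" "map_prod \<phi> \<xi> z \<in> \<phi> ` U \<times> T"
      using T V U B.chart_image_open Cinf_on_open by (auto intro!: open_Times simp: map_prod_def split: prod.split)
    have snd_smooth: "Cinf_on (\<phi> ` U \<times> T) snd"
      by (rule Cinf_on_bounded_linear[OF bounded_linear_snd TV(1)])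
    have eq: "(f \<circ> inv_into V \<xi>) (snd x) = ((\<lambda>z. f (snd z)) \<circ> inv_into (U \<times> V) (map_prod \<phi> \<xi>)) x"
      if "x \<in> \<phi> ` U \<times> T" for x
      using prod_chart_inv[OF U(1) V(1), of "fst x" "snd x"] that T(2) by auto
    have "Cinf_on (\<phi> ` U \<times> T) (\<lambda>x. (f \<circ> inv_into V \<xi>) (snd x))"
      by (rule Cinf_on_compose[OF snd_smooth T(3)]) auto
    then have "Cinf_on (\<phi> ` U \<times> T) ((\<lambda>z. f (snd z)) \<circ> inv_into (U \<times> V) (map_prod \<phi> \<xi>))"
      by (rule Cinf_on_cong) (rule eq)
    then show smooth: "smooth_near P z (\<lambda>z. f (snd z))"
      by (rule P.smooth_nearI_chart[OF c TV(2)])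
    have "((\<lambda>x. (f \<circ> inv_into V \<xi>) (snd x)) has_derivative (\<lambda>u. coord_tvec F (V, \<xi>) (snd z) (snd u) f)) (at (map_prod \<phi> \<xi> z))"
      by (rule has_derivative_compose[OF bounded_linear_imp_has_derivative[OF bounded_linear_snd]])
        (use F.coord_tvec_has_derivative[OF V f] in \<open>simp add: o_def\<close>)
    then have "((\<lambda>z. f (snd z)) \<circ> inv_into (U \<times> V) (map_prod \<phi> \<xi>) has_derivative
        (\<lambda>u. coord_tvec F (V, \<xi>) (snd z) (snd u) f)) (at (map_prod \<phi> \<xi> z))"
      by (rule has_derivative_transform_within_open[OF _ TV]) (rule eq)
    then show "coord_tvec P (U \<times> V, map_prod \<phi> \<xi>) z u (\<lambda>z. f (snd z)) = coord_tvec F (V, \<xi>) (snd z) (snd u) f"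
      by (rule P.coord_tvec_eqI[OF c smooth])
  qed
  obtain V' \<xi>' U' \<phi>' where "(V', \<xi>') \<in> atlas F" "snd z \<in> V'" "(U', \<phi>') \<in> atlas B" "fst z \<in> U'"
    using z unfolding points_prod using F.chart_exists B.chart_exists by (metis mem_Times_iff)
  with * show "smooth_near P z (\<lambda>z. f (snd z))"
    by blast
  show "coord_tvec P (U \<times> V, map_prod \<phi> \<xi>) z u (\<lambda>z. f (snd z)) = coord_tvec F (V, \<xi>) (snd z) (snd u) f"
    if "(V, \<xi>) \<in> atlas F" "(U, \<phi>) \<in> atlas B" "snd z \<in> V" "fst z \<in> U"
    using * that by blast
qed

lemma slice_snd:
  assumes V: "(V, \<xi>) \<in> atlas F" "q \<in> V" and U: "(U, \<phi>) \<in> atlas B" "p \<in> U" and f: "smooth_near P (p, q) f"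
  shows "smooth_near F q (\<lambda>x. f (p, x))"
    and "coord_tvec F (V, \<xi>) q a (\<lambda>x. f (p, x)) = coord_tvec P (U \<times> V, map_prod \<phi> \<xi>) (p, q) (0, a) f"
proof -
  let ?G = "f \<circ> inv_into (U \<times> V) (map_prod \<phi> \<xi>)"
  have c: "(U \<times> V, map_prod \<phi> \<xi>) \<in> atlas P" "(p, q) \<in> U \<times> V"
    using V U by (auto simp: prod_chart)
  obtain T where T: "map_prod \<phi> \<xi> (p, q) \<in> T" "T \<subseteq> map_prod \<phi> \<xi> ` (U \<times> V)" "Cinf_on T ?G"
    using P.smooth_nearD_chart[OF c f] .
  define S where "S = (\<lambda>x. (\<phi> p, x)) -` T"
  have S: "open S" "\<xi> q \<in> S"
    unfolding S_def using T(1) Cinf_on_open[OF T(3)]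
    by (auto intro!: open_vimage continuous_intros)
  have slice: "Cinf_on S (\<lambda>x. (\<phi> p, x))"
    by (intro Cinf_on_Pair Cinf_on_ident Cinf_on_const S(1))
  have eq: "?G (\<phi> p, x) = ((\<lambda>x. f (p, x)) \<circ> inv_into V \<xi>) x" if "x \<in> S" for x
  proof -
    have "x \<in> \<xi> ` V"
      using that T(2) by (auto simp: S_def map_prod_image)
    then show ?thesis
      using prod_chart_inv[OF U(1) V(1), of "\<phi> p" x] U B.chart_inv[OF U] by simp
  qed
  have "Cinf_on S (\<lambda>x. ?G (\<phi> p, x))"
    by (rule Cinf_on_compose[OF slice T(3)]) (auto simp: S_def)
  then have "Cinf_on S ((\<lambda>x. f (p, x)) \<circ> inv_into V \<xi>)"
    by (rule Cinf_on_cong) (rule eq)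
  then show smooth: "smooth_near F q (\<lambda>x. f (p, x))"
    by (rule F.smooth_nearI_chart[OF V S(2)])
  have "((\<lambda>x. ?G (\<phi> p, x)) has_derivative (\<lambda>a. coord_tvec P (U \<times> V, map_prod \<phi> \<xi>) (p, q) (0, a) f)) (at (\<xi> q))"
  proof -
    have 1: "((\<lambda>x. (\<phi> p, x)) has_derivative (\<lambda>a. (0, a))) (at (\<xi> q))"
      by (auto intro!: derivative_eq_intros)
    have 2: "(?G has_derivative (\<lambda>u. coord_tvec P (U \<times> V, map_prod \<phi> \<xi>) (p, q) u f)) (at (\<phi> p, \<xi> q))"
      using P.coord_tvec_has_derivative[OF c f] by simp
    show ?thesis
      using has_derivative_compose[OF 1 2] .
  qed
  then have "((\<lambda>x. f (p, x)) \<circ> inv_into V \<xi> has_derivative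
      (\<lambda>a. coord_tvec P (U \<times> V, map_prod \<phi> \<xi>) (p, q) (0, a) f)) (at (\<xi> q))"
    by (rule has_derivative_transform_within_open[OF _ S]) (rule eq)
  then show "coord_tvec F (V, \<xi>) q a (\<lambda>x. f (p, x)) = coord_tvec P (U \<times> V, map_prod \<phi> \<xi>) (p, q) (0, a) f"
    by (rule F.coord_tvec_eqI[OF V smooth])
qed

lemma tangent_map_slice_snd:
  assumes V: "(V, \<xi>) \<in> atlas F" "q \<in> V" and U: "(U, \<phi>) \<in> atlas B" "p \<in> U"
  shows "tangent_map P (\<lambda>x. (p, x)) q (coord_tvec F (V, \<xi>) q a) = coord_tvec P (U \<times> V, map_prod \<phi> \<xi>) (p, q) (0, a)"
proof
  fix f
  show "tangent_map P (\<lambda>x. (p, x)) q (coord_tvec F (V, \<xi>) q a) f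
    = coord_tvec P (U \<times> V, map_prod \<phi> \<xi>) (p, q) (0, a) f"
    using slice_snd(2)[OF V U, of f a] by (simp add: tangent_map_def o_def P.coord_tvec_nonsmooth)
qed

lemma tangent_map_snd:
  assumes V: "(V, \<xi>) \<in> atlas F" "snd z \<in> V" and U: "(U, \<phi>) \<in> atlas B" "fst z \<in> U"
  shows "tangent_map F snd z (coord_tvec P (U \<times> V, map_prod \<phi> \<xi>) z u) = coord_tvec F (V, \<xi>) (snd z) (snd u)"
proof
  fix f
  have "z \<in> points P"
    unfolding points_prod using F.chart_points[OF V] B.chart_points[OF U] by (simp add: mem_Times_iff)
  then show "tangent_map F snd z (coord_tvec P (U \<times> V, map_prod \<phi> \<xi>) z u) f = coord_tvec F (V, \<xi>) (snd z) (snd u) f"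
    using pullback_snd(2)[OF _ _ V(1) U(1) V(2) U(2)]
    by (simp add: tangent_map_def o_def F.coord_tvec_nonsmooth)
qed

lemma tangent_map_snd_tangent:
  assumes v: "v \<in> tangent_space P z"
  shows "tangent_map F snd z v \<in> tangent_space F (snd z)"
proof -
  obtain V \<xi> U \<phi> where c: "(V, \<xi>) \<in> atlas F" "snd z \<in> V" "(U, \<phi>) \<in> atlas B" "fst z \<in> U"
    using P.tangent_space_points[OF v] unfolding points_prod
    using F.chart_exists B.chart_exists by (metis mem_Times_iff)
  obtain u where "v = coord_tvec P (U \<times> V, map_prod \<phi> \<xi>) z u"
    using v P.tangent_space_chart[OF prod_chart[OF c(3,1)], of z] c(2,4) by (auto simp: mem_Times_iff)
  then show ?thesis
    using tangent_map_snd[OF c] F.tangent_space_chart[OF c(1,2)] by auto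
qed

lemma tangent_map_slice_snd_tangent:
  assumes v: "v \<in> tangent_space F q" and p: "p \<in> points B"
  shows "tangent_map P (\<lambda>x. (p, x)) q v \<in> tangent_space P (p, q)"
proof -
  obtain V \<xi> a where V: "(V, \<xi>) \<in> atlas F" "q \<in> V" "v = coord_tvec F (V, \<xi>) q a"
    using F.tangent_spaceE[OF v] .
  obtain U \<phi> where U: "(U, \<phi>) \<in> atlas B" "p \<in> U"
    using B.chart_exists[OF p] by blast
  show ?thesis
    unfolding V(3) tangent_map_slice_snd[OF V(1,2) U]
    using P.tangent_space_chart[OF prod_chart[OF U(1) V(1)]] V(2) U(2) by blast
qed

lemma slice_snd_apply:
  assumes v: "v \<in> tangent_space F q" and p: "p \<in> points B"
  shows "smooth_near F q f \<Longrightarrow> tangent_map P (\<lambda>x. (p, x)) q v (\<lambda>z. f (snd z)) = v f"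
    and "smooth_near B p h \<Longrightarrow> tangent_map P (\<lambda>x. (p, x)) q v (\<lambda>z. h (fst z)) = 0"
proof -
  have z: "(p, q) \<in> points P"
    using F.tangent_space_points[OF v] p by (simp add: points_prod)
  show "smooth_near F q f \<Longrightarrow> tangent_map P (\<lambda>x. (p, x)) q v (\<lambda>z. f (snd z)) = v f"
    using pullback_snd(1)[OF z, of f] by (simp add: tangent_map_def o_def)
  show "smooth_near B p h \<Longrightarrow> tangent_map P (\<lambda>x. (p, x)) q v (\<lambda>z. h (fst z)) = 0"
    using F.tvec_const[OF v] by (simp add: tangent_map_def o_def)
qed

lemma vector_field_lift_snd:
  assumes X: "vector_field F S X"
  shows "vector_field P {z \<in> points P. snd z \<in> S} (lift_snd B F X)"
proof (rule P.vector_fieldI)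
  have "{z \<in> points P. snd z \<in> S} = points B \<times> S"
    using openin_subset[OF F.vector_field_open[OF X]] by (auto simp: points_prod)
  then show "openin (mtop P) {z \<in> points P. snd z \<in> S}"
    using F.vector_field_open[OF X] by (simp add: mtop_prod openin_prod_Times_iff)
  fix z assume "z \<in> {z \<in> points P. snd z \<in> S}"
  then obtain q p where z: "z = (p, q)" "q \<in> S" "p \<in> points B" "(p, q) \<in> points P"
    by (cases z) (auto simp: points_prod)
  show "lift_snd B F X z \<in> tangent_space P z"
    using tangent_map_slice_snd_tangent[OF F.vector_field_tangent[OF X z(2)] z(3)] by (simp add: z(1) lift_snd_def)
  fix f assume f: "smooth_near P z f"
  obtain V \<xi> where V: "(V, \<xi>) \<in> atlas F" "q \<in> V"
    using F.chart_exists[OF F.openin_points[OF F.vector_field_open[OF X] z(2)]] by blast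
  obtain U \<phi> where U: "(U, \<phi>) \<in> atlas B" "p \<in> U"
    using B.chart_exists[OF z(3)] by blast
  let ?d = "coord_tvec P (U \<times> V, map_prod \<phi> \<xi>)"
  have c: "(U \<times> V, map_prod \<phi> \<xi>) \<in> atlas P"
    by (rule prod_chart[OF U(1) V(1)])
  have "smooth_near P z (\<lambda>y. \<Sum>i\<in>Basis. X (snd y) (\<lambda>x. \<xi> x \<bullet> i) * ?d y (0, i) f)"
  proof (intro P.smooth_near_sum P.smooth_near_mult P.smooth_near_points[OF f])
    fix i
    show "smooth_near P z (\<lambda>y. X (snd y) (\<lambda>x. \<xi> x \<bullet> i))"
      using z F.vector_field_smooth[OF X z(2) F.smooth_near_coord[OF V]]
      by (intro pullback_snd(1)) auto
    show "smooth_near P z (\<lambda>y. ?d y (0, i) f)"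
      by (rule P.vector_field_smooth[OF P.vector_field_coord[OF c] _ f]) (use z V U in auto)
  qed
  moreover have "\<forall>\<^sub>F y in nhdsin (mtop P) z. (\<Sum>i\<in>Basis. X (snd y) (\<lambda>x. \<xi> x \<bullet> i) * ?d y (0, i) f) = lift_snd B F X y f"
  proof -
    have "openin (mtop P) (U \<times> (S \<inter> V))" "z \<in> U \<times> (S \<inter> V)"
      using F.vector_field_open[OF X] F.chart_openin[OF V(1)] B.chart_openin[OF U(1)] z V U
      by (auto simp: mtop_prod openin_prod_Times_iff)
    then have "\<forall>\<^sub>F y in nhdsin (mtop P) z. y \<in> U \<times> (S \<inter> V)"
      by (rule P.eventually_nhdsin_open)
    then show ?thesis
      using P.smooth_near_eventually[OF f]
    proof eventually_elim
      case (elim y)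
      obtain x w where y: "y = (w, x)" "x \<in> S" "x \<in> V" "w \<in> U"
        using elim(1) by auto
      have "lift_snd B F X y f = X x (\<lambda>x. f (w, x))"
        using elim(2) by (simp add: y(1) lift_snd_def tangent_map_def o_def)
      also have "\<dots> = (\<Sum>i\<in>Basis. X x (\<lambda>x. \<xi> x \<bullet> i) * coord_tvec F (V, \<xi>) x i (\<lambda>x. f (w, x)))"
        by (rule F.vector_field_expand[OF X V(1) y(2,3)])
      also have "\<dots> = (\<Sum>i\<in>Basis. X (snd y) (\<lambda>x. \<xi> x \<bullet> i) * ?d y (0, i) f)"
        using slice_snd(2)[OF V(1) y(3) U(1) y(4)] elim(2) by (simp add: y(1))
      finally show ?case ..
    qed
  qed
  ultimately show "smooth_near P z (\<lambda>y. lift_snd B F X y f)"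
    by (rule P.smooth_near_cong)
qed

section \<open>The product metric\<close>

definition prod_metric :: "'b metric \<Rightarrow> 'f metric \<Rightarrow> ('b \<times> 'f) metric" where
  "prod_metric gB gF = (\<lambda>z v w. gB (fst z) (tangent_map B fst z v) (tangent_map B fst z w)
     + gF (snd z) (tangent_map F snd z v) (tangent_map F snd z w))"

text \<open>A tangent vector is determined by its values on coordinate functions, and each
  coordinate of a product chart is the pullback of a coordinate of one factor.\<close>

lemma prod_separation:
  assumes v: "v \<in> tangent_space P z" and w: "w \<in> tangent_space P z"
    and 1: "\<And>f. smooth_near B (fst z) f \<Longrightarrow> v (\<lambda>z. f (fst z)) = w (\<lambda>z. f (fst z))"
    and 2: "\<And>h. smooth_near F (snd z) h \<Longrightarrow> v (\<lambda>z. h (snd z)) = w (\<lambda>z. h (snd z))"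
  shows "v = w"
proof
  fix f
  obtain U \<phi> V \<xi> where U: "(U, \<phi>) \<in> atlas B" "fst z \<in> U" and V: "(V, \<xi>) \<in> atlas F" "snd z \<in> V"
    using P.tangent_space_points[OF v] unfolding points_prod
    using B.chart_exists F.chart_exists by (metis mem_Times_iff)
  have c: "(U \<times> V, map_prod \<phi> \<xi>) \<in> atlas P" "z \<in> U \<times> V"
    using U V by (auto simp: prod_chart mem_Times_iff)
  have "v (\<lambda>z. map_prod \<phi> \<xi> z \<bullet> k) = w (\<lambda>z. map_prod \<phi> \<xi> z \<bullet> k)" if "k \<in> Basis" for k
  proof -
    from that consider i where "i \<in> Basis" "k = (i, 0)" | j where "j \<in> Basis" "k = (0, j)"
      unfolding Basis_prod_def by blast
    then show ?thesis
    proof cases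
      case 1
      then show ?thesis
        using assms(3)[OF B.smooth_near_coord[OF U, of i]]
        by (simp add: inner_prod_def map_prod_def case_prod_beta)
    next
      case 2
      then show ?thesis
        using assms(4)[OF F.smooth_near_coord[OF V, of j]]
        by (simp add: inner_prod_def map_prod_def case_prod_beta)
    qed
  qed
  then show "v f = w f"
    unfolding P.tvec_expand[OF v c, of f] P.tvec_expand[OF w c, of f] by (intro sum.cong) auto
qed

lemma tangent_map_slices:
  assumes v: "v \<in> tangent_space B p" and w: "w \<in> tangent_space F q"
  shows "tangent_map B fst (p, q) (tangent_map P (\<lambda>x. (x, q)) p v) = v"
    and "tangent_map F snd (p, q) (tangent_map P (\<lambda>x. (x, q)) p v) = (\<lambda>f. 0)"
    and "tangent_map F snd (p, q) (tangent_map P (\<lambda>x. (p, x)) q w) = w"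
    and "tangent_map B fst (p, q) (tangent_map P (\<lambda>x. (p, x)) q w) = (\<lambda>f. 0)"
  using slice_fst_apply[OF v F.tangent_space_points[OF w]] slice_snd_apply[OF w B.tangent_space_points[OF v]]
    B.tvec_nonsmooth[OF v] F.tvec_nonsmooth[OF w]
  by (auto simp: tangent_map_def[of B] tangent_map_def[of F] o_def)

text \<open>The projection of a field depends on the point of the product and is in general no field
  on the base, so smoothness of \<open>gB\<close> does not apply directly. It is applied to
  coordinate fields of the base and pulled back; the components are smooth on the product.\<close>

lemma metric_tangent_map_smooth:
  assumes gB: "metric_mfd B gB" and X: "vector_field P S X" and Y: "vector_field P S Y" and z: "z \<in> S"
  shows "smooth_near P z (\<lambda>z. gB (fst z) (tangent_map B fst z (X z)) (tangent_map B fst z (Y z)))"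
proof -
  interpret gB: metric_mfd B gB
    by (rule gB)
  have zP: "z \<in> points P"
    by (rule P.openin_points[OF P.vector_field_open[OF X] z])
  obtain U \<phi> V \<xi> where U: "(U, \<phi>) \<in> atlas B" "fst z \<in> U" and V: "(V, \<xi>) \<in> atlas F" "snd z \<in> V"
    using zP unfolding points_prod using B.chart_exists F.chart_exists by (metis mem_Times_iff)
  \<comment> \<open>The index runs over the basis of the product space; for directions of the fibre
    \<open>fst k\<close> is 0, so those terms vanish and need no separate treatment.\<close>
  let ?x = "\<lambda>k z. map_prod \<phi> \<xi> z \<bullet> k" and ?d = "\<lambda>k p. coord_tvec B (U, \<phi>) p (fst k)"
  have c: "(U \<times> V, map_prod \<phi> \<xi>) \<in> atlas P" "z \<in> U \<times> V"
    using U V by (auto simp: prod_chart mem_Times_iff)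
  have T: "?d k p \<in> tangent_space B p" if "p \<in> U" for k p
    using B.tangent_space_chart[OF U(1) that] by blast
  have expand: "tangent_map B fst y (Z y) = (\<lambda>f. \<Sum>k\<in>Basis. Z y (?x k) * ?d k (fst y) f)"
    if Z: "vector_field P S Z" and y: "y \<in> S" "y \<in> U \<times> V" for Z y
  proof
    fix f
    have yU: "fst y \<in> U" "snd y \<in> V" and yP: "y \<in> points P"
      using y P.chart_points[OF c(1)] by auto
    show "tangent_map B fst y (Z y) f = (\<Sum>k\<in>Basis. Z y (?x k) * ?d k (fst y) f)"
    proof (cases "smooth_near B (fst y) f")
      case True
      then show ?thesis
        using P.vector_field_expand[OF Z c(1) y, of "\<lambda>z. f (fst z)"]
        by (simp add: tangent_map_def o_def pullback_fst(2)[OF yP True U(1) V(1) yU])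
    qed (simp add: tangent_map_def B.coord_tvec_nonsmooth)
  qed
  have sum2: "gB p (\<lambda>f. \<Sum>k\<in>Basis. a k * ?d k p f) (\<lambda>f. \<Sum>k\<in>Basis. b k * ?d k p f)
    = (\<Sum>k\<in>Basis. \<Sum>l\<in>Basis. a k * (b l * gB p (?d l p) (?d k p)))"
    if p: "p \<in> U" for p and a b :: "'m \<times> 'k \<Rightarrow> real"
  proof -
    have S: "(\<lambda>f. \<Sum>k\<in>Basis. b k * ?d k p f) \<in> tangent_space B p"
      by (rule B.tangent_sum[OF B.chart_points[OF U(1) p] T[OF p]])
    have "gB p (\<lambda>f. \<Sum>k\<in>Basis. a k * ?d k p f) (\<lambda>f. \<Sum>k\<in>Basis. b k * ?d k p f)
      = (\<Sum>k\<in>Basis. a k * gB p (?d k p) (\<lambda>f. \<Sum>k\<in>Basis. b k * ?d k p f))"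
      by (rule gB.metric_sum[OF S T[OF p]])
    also have "\<dots> = (\<Sum>k\<in>Basis. a k * gB p (\<lambda>f. \<Sum>k\<in>Basis. b k * ?d k p f) (?d k p))"
      by (simp only: gB.metric_sym[OF T[OF p] S])
    also have "\<dots> = (\<Sum>k\<in>Basis. a k * (\<Sum>l\<in>Basis. b l * gB p (?d l p) (?d k p)))"
      by (intro sum.cong refl arg_cong2[of _ _ _ _ "(*)"] gB.metric_sum T[OF p])
    finally show ?thesis
      by (simp add: sum_distrib_left)
  qed
  have "smooth_near P z (\<lambda>y. \<Sum>k\<in>Basis. \<Sum>l\<in>Basis. X y (?x k) * (Y y (?x l) * gB (fst y) (?d l (fst y)) (?d k (fst y))))"
    by (intro P.smooth_near_sum P.smooth_near_mult zP P.vector_field_smooth[OF X z] P.vector_field_smooth[OF Y z]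
        P.smooth_near_coord[OF c] pullback_fst(1)[OF zP] gB.metric_smooth[OF B.vector_field_coord B.vector_field_coord] U)
  moreover have "\<forall>\<^sub>F y in nhdsin (mtop P) z.
    (\<Sum>k\<in>Basis. \<Sum>l\<in>Basis. X y (?x k) * (Y y (?x l) * gB (fst y) (?d l (fst y)) (?d k (fst y))))
      = gB (fst y) (tangent_map B fst y (X y)) (tangent_map B fst y (Y y))"
  proof -
    have "\<forall>\<^sub>F y in nhdsin (mtop P) z. y \<in> S \<inter> U \<times> V"
      using z c P.vector_field_open[OF X] P.chart_openin[OF c(1)] by (intro P.eventually_nhdsin_open) auto
    then show ?thesis
    proof (rule eventually_mono)
      fix y assume y: "y \<in> S \<inter> U \<times> V"
      then have "fst y \<in> U"
        by auto
      then show "(\<Sum>k\<in>Basis. \<Sum>l\<in>Basis. X y (?x k) * (Y y (?x l) * gB (fst y) (?d l (fst y)) (?d k (fst y))))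
          = gB (fst y) (tangent_map B fst y (X y)) (tangent_map B fst y (Y y))"
        using expand[OF X] expand[OF Y] y sum2[OF \<open>fst y \<in> U\<close>] by simp
    qed
  qed
  ultimately show ?thesis
    by (rule P.smooth_near_cong)
qed

lemma metric_tangent_map_smooth_snd:
  assumes gF: "metric_mfd F gF" and X: "vector_field P S X" and Y: "vector_field P S Y" and z: "z \<in> S"
  shows "smooth_near P z (\<lambda>z. gF (snd z) (tangent_map F snd z (X z)) (tangent_map F snd z (Y z)))"
proof -
  interpret gF: metric_mfd F gF
    by (rule gF)
  have zP: "z \<in> points P"
    by (rule P.openin_points[OF P.vector_field_open[OF X] z])
  obtain V \<xi> U \<phi> where V: "(V, \<xi>) \<in> atlas F" "snd z \<in> V" and U: "(U, \<phi>) \<in> atlas B" "fst z \<in> U"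
    using zP unfolding points_prod using F.chart_exists B.chart_exists by (metis mem_Times_iff)
  let ?x = "\<lambda>k z. map_prod \<phi> \<xi> z \<bullet> k" and ?d = "\<lambda>k p. coord_tvec F (V, \<xi>) p (snd k)"
  have c: "(U \<times> V, map_prod \<phi> \<xi>) \<in> atlas P" "z \<in> U \<times> V"
    using V U by (auto simp: prod_chart mem_Times_iff)
  have T: "?d k p \<in> tangent_space F p" if "p \<in> V" for k p
    using F.tangent_space_chart[OF V(1) that] by blast
  have expand: "tangent_map F snd y (Z y) = (\<lambda>f. \<Sum>k\<in>Basis. Z y (?x k) * ?d k (snd y) f)"
    if Z: "vector_field P S Z" and y: "y \<in> S" "y \<in> U \<times> V" for Z y
  proof
    fix f
    have yU: "snd y \<in> V" "fst y \<in> U" and yP: "y \<in> points P"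
      using y P.chart_points[OF c(1)] by auto
    show "tangent_map F snd y (Z y) f = (\<Sum>k\<in>Basis. Z y (?x k) * ?d k (snd y) f)"
    proof (cases "smooth_near F (snd y) f")
      case True
      then show ?thesis
        using P.vector_field_expand[OF Z c(1) y, of "\<lambda>z. f (snd z)"]
        by (simp add: tangent_map_def o_def pullback_snd(2)[OF yP True V(1) U(1) yU])
    qed (simp add: tangent_map_def F.coord_tvec_nonsmooth)
  qed
  have sum2: "gF p (\<lambda>f. \<Sum>k\<in>Basis. a k * ?d k p f) (\<lambda>f. \<Sum>k\<in>Basis. b k * ?d k p f)
    = (\<Sum>k\<in>Basis. \<Sum>l\<in>Basis. a k * (b l * gF p (?d l p) (?d k p)))"
    if p: "p \<in> V" for p and a b :: "'m \<times> 'k \<Rightarrow> real"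
  proof -
    have S: "(\<lambda>f. \<Sum>k\<in>Basis. b k * ?d k p f) \<in> tangent_space F p"
      by (rule F.tangent_sum[OF F.chart_points[OF V(1) p] T[OF p]])
    have "gF p (\<lambda>f. \<Sum>k\<in>Basis. a k * ?d k p f) (\<lambda>f. \<Sum>k\<in>Basis. b k * ?d k p f)
      = (\<Sum>k\<in>Basis. a k * gF p (?d k p) (\<lambda>f. \<Sum>k\<in>Basis. b k * ?d k p f))"
      by (rule gF.metric_sum[OF S T[OF p]])
    also have "\<dots> = (\<Sum>k\<in>Basis. a k * gF p (\<lambda>f. \<Sum>k\<in>Basis. b k * ?d k p f) (?d k p))"
      by (simp only: gF.metric_sym[OF T[OF p] S])
    also have "\<dots> = (\<Sum>k\<in>Basis. a k * (\<Sum>l\<in>Basis. b l * gF p (?d l p) (?d k p)))"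
      by (intro sum.cong refl arg_cong2[of _ _ _ _ "(*)"] gF.metric_sum T[OF p])
    finally show ?thesis
      by (simp add: sum_distrib_left)
  qed
  have "smooth_near P z (\<lambda>y. \<Sum>k\<in>Basis. \<Sum>l\<in>Basis. X y (?x k) * (Y y (?x l) * gF (snd y) (?d l (snd y)) (?d k (snd y))))"
    by (intro P.smooth_near_sum P.smooth_near_mult zP P.vector_field_smooth[OF X z] P.vector_field_smooth[OF Y z]
        P.smooth_near_coord[OF c] pullback_snd(1)[OF zP] gF.metric_smooth[OF F.vector_field_coord F.vector_field_coord] V)
  moreover have "\<forall>\<^sub>F y in nhdsin (mtop P) z.
    (\<Sum>k\<in>Basis. \<Sum>l\<in>Basis. X y (?x k) * (Y y (?x l) * gF (snd y) (?d l (snd y)) (?d k (snd y))))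
      = gF (snd y) (tangent_map F snd y (X y)) (tangent_map F snd y (Y y))"
  proof -
    have "\<forall>\<^sub>F y in nhdsin (mtop P) z. y \<in> S \<inter> U \<times> V"
      using z c P.vector_field_open[OF X] P.chart_openin[OF c(1)] by (intro P.eventually_nhdsin_open) auto
    then show ?thesis
    proof (rule eventually_mono)
      fix y assume y: "y \<in> S \<inter> U \<times> V"
      then have "snd y \<in> V"
        by auto
      then show "(\<Sum>k\<in>Basis. \<Sum>l\<in>Basis. X y (?x k) * (Y y (?x l) * gF (snd y) (?d l (snd y)) (?d k (snd y))))
          = gF (snd y) (tangent_map F snd y (X y)) (tangent_map F snd y (Y y))"
        using expand[OF X] expand[OF Y] y sum2[OF \<open>snd y \<in> V\<close>] by simp
    qed
  qed
  ultimately show ?thesis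
    by (rule P.smooth_near_cong)
qed

text \<open>The frames of the factors are placed on the slices through the point; indices from
  \<open>DIM('m)\<close> on are shifted down to those of the fibre.\<close>

lemma prod_orthonormal_at:
  assumes gB: "metric_mfd B gB" and gF: "metric_mfd F gF"
    and e: "orthonormal_at B gB p e" and e': "orthonormal_at F gF q e'" and pq: "p \<in> points B" "q \<in> points F"
  shows "orthonormal_at P (prod_metric gB gF) (p, q) (\<lambda>i. if i < DIM('m)
    then tangent_map P (\<lambda>x. (x, q)) p (e i) else tangent_map P (\<lambda>x. (p, x)) q (e' (i - DIM('m))))"
  unfolding orthonormal_at_def
proof (intro conjI allI impI)
  interpret gB: metric_mfd B gB by (rule gB)
  interpret gF: metric_mfd F gF by (rule gF)
  let ?E = "\<lambda>i. if i < DIM('m) then tangent_map P (\<lambda>x. (x, q)) p (e i)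
    else tangent_map P (\<lambda>x. (p, x)) q (e' (i - DIM('m)))"
  note T = gB.orthonormal_atD(1)[OF e] and T' = gF.orthonormal_atD(1)[OF e']
  note o = e[unfolded orthonormal_at_def, THEN conjunct2, rule_format]
    and o' = e'[unfolded orthonormal_at_def, THEN conjunct2, rule_format]
  show "?E i \<in> tangent_space P (p, q)" if "i < DIM('m \<times> 'k)" for i
    using that T T' tangent_map_slice_fst_tangent tangent_map_slice_snd_tangent pq by simp
  fix i j assume i: "i < DIM('m \<times> 'k)" and j: "j < DIM('m \<times> 'k)"
  have proj: "tangent_map B fst (p, q) (?E i) = (if i < DIM('m) then e i else (\<lambda>f. 0))"
    "tangent_map F snd (p, q) (?E i) = (if i < DIM('m) then (\<lambda>f. 0) else e' (i - DIM('m)))"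
    if "i < DIM('m \<times> 'k)" for i
    using that tangent_map_slices(1,2)[OF T F.tangent_zero[OF pq(2)], of i]
      tangent_map_slices(3,4)[OF B.tangent_zero[OF pq(1)] T', of "i - DIM('m)"] by auto
  have zero: "gB p (\<lambda>f. 0) (\<lambda>f. 0) = 0" "gF q (\<lambda>f. 0) (\<lambda>f. 0) = 0"
    using gB.metric_zero[OF B.tangent_zero[OF pq(1)]] gF.metric_zero[OF F.tangent_zero[OF pq(2)]] by simp_all
  have shift: "i - DIM('m) = j - DIM('m) \<longleftrightarrow> i = j" if "\<not> i < DIM('m)" "\<not> j < DIM('m)"
    using that by linarith
  show "\<bar>prod_metric gB gF (p, q) (?E i) (?E j)\<bar> = (if i = j then 1 else 0)"
    unfolding prod_metric_def fst_conv snd_conv proj[OF i] proj[OF j]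
    using i j zero o[of i j] o'[of "i - DIM('m)" "j - DIM('m)"] gB.metric_zero[OF T] gF.metric_zero[OF T'] shift
    by (auto split: if_splits)
qed

lemma prod_metric_mfd:
  assumes gB: "metric_mfd B gB" and gF: "metric_mfd F gF"
  shows "metric_mfd P (prod_metric gB gF)"
proof unfold_locales
  interpret gB: metric_mfd B gB by (rule gB)
  interpret gF: metric_mfd F gF by (rule gF)
  show "prod_metric gB gF p (\<lambda>f. a * u f + b * v f) w = a * prod_metric gB gF p u w + b * prod_metric gB gF p v w"
    if "u \<in> tangent_space P p" "v \<in> tangent_space P p" "w \<in> tangent_space P p" for u p v w a b
  proof -
    have "tangent_map B fst p (\<lambda>f. a * u f + b * v f) = (\<lambda>f. a * tangent_map B fst p u f + b * tangent_map B fst p v f)"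
      "tangent_map F snd p (\<lambda>f. a * u f + b * v f) = (\<lambda>f. a * tangent_map F snd p u f + b * tangent_map F snd p v f)"
      by (auto simp: tangent_map_def)
    then show ?thesis
      using gB.metric_lin[OF that[THEN tangent_map_fst_tangent], of a b]
        gF.metric_lin[OF that[THEN tangent_map_snd_tangent], of a b]
      by (simp add: prod_metric_def algebra_simps)
  qed
  show "prod_metric gB gF p u v = prod_metric gB gF p v u"
    if "u \<in> tangent_space P p" "v \<in> tangent_space P p" for u p v
    using gB.metric_sym[OF that[THEN tangent_map_fst_tangent]] gF.metric_sym[OF that[THEN tangent_map_snd_tangent]]
    by (simp add: prod_metric_def)
  show "smooth_near P p (\<lambda>q. prod_metric gB gF q (X q) (Y q))"
    if "vector_field P U X" "vector_field P U Y" "p \<in> U" for U X Y p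
    unfolding prod_metric_def
    by (intro P.smooth_near_add metric_tangent_map_smooth[OF gB that] metric_tangent_map_smooth_snd[OF gF that])
  show "\<exists>e. orthonormal_at P (prod_metric gB gF) z e" if "z \<in> points P" for z
  proof -
    have z: "fst z \<in> points B" "snd z \<in> points F"
      using that by (auto simp: points_prod)
    show ?thesis
      using prod_orthonormal_at[OF gB gF _ _ z] gB.metric_orthonormal[OF z(1)] gF.metric_orthonormal[OF z(2)]
      by (metis prod.collapse)
  qed
qed

lemma prod_split_mfd:
  assumes gB: "metric_mfd B gB" and gF: "metric_mfd F gF"
  shows "split_mfd P (prod_metric gB gF) B gB F gF fst snd (lift_fst B F) (lift_snd B F)"
proof (intro split_mfd.intro gB gF prod_metric_mfd, unfold_locales)
  show "DIM('m \<times> 'k) = DIM('m) + DIM('k)"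
    by simp
  show "openin (mtop P) {z \<in> points P. fst z \<in> U}" if "openin (mtop B) U" for U
    using openin_continuous_map_preimage[OF continuous_map_fst that] by (simp add: mtop_prod)
  show "openin (mtop P) {z \<in> points P. snd z \<in> W}" if "openin (mtop F) W" for W
    using openin_continuous_map_preimage[OF continuous_map_snd that] by (simp add: mtop_prod)
  show "smooth_near P z (\<lambda>z. f (fst z))" if "z \<in> points P" "smooth_near B (fst z) f" for z f
    by (rule pullback_fst(1)[OF that])
  show "smooth_near P z (\<lambda>z. h (snd z))" if "z \<in> points P" "smooth_near F (snd z) h" for z h
    by (rule pullback_snd(1)[OF that])
  show "vector_field P {z \<in> points P. fst z \<in> U} (lift_fst B F X)" if "vector_field B U X" for U X
    by (rule vector_field_lift_fst[OF that])
  show "vector_field P {z \<in> points P. snd z \<in> W} (lift_snd B F V)" if "vector_field F W V" for W V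
    by (rule vector_field_lift_snd[OF that])
  fix z assume "z \<in> points P"
  then obtain p q where z: "z = (p, q)" "p \<in> points B" "q \<in> points F"
    by (auto simp: points_prod)
  show "fst z \<in> points B" "snd z \<in> points F"
    using z by simp_all
  show "lift_fst B F X z (\<lambda>z. f (fst z)) = X (fst z) f"
    if "vector_field B U X" "fst z \<in> U" "smooth_near B (fst z) f" for U X f
    using slice_fst_apply(1)[OF B.vector_field_tangent[OF that(1,2)] z(3)] that(3) by (simp add: z(1) lift_fst_def)
  show "lift_fst B F X z (\<lambda>z. h (snd z)) = 0"
    if "vector_field B U X" "fst z \<in> U" "smooth_near F (snd z) h" for U X h
    using slice_fst_apply(2)[OF B.vector_field_tangent[OF that(1,2)] z(3)] that(3) z by (simp add: lift_fst_def)
  show "lift_snd B F V z (\<lambda>z. h (snd z)) = V (snd z) h"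
    if "vector_field F W V" "snd z \<in> W" "smooth_near F (snd z) h" for W V h
    using slice_snd_apply(1)[OF F.vector_field_tangent[OF that(1,2)] z(2)] that(3) by (simp add: z(1) lift_snd_def)
  show "lift_snd B F V z (\<lambda>z. f (fst z)) = 0"
    if "vector_field F W V" "snd z \<in> W" "smooth_near B (fst z) f" for W V f
    using slice_snd_apply(2)[OF F.vector_field_tangent[OF that(1,2)] z(2)] that(3) z by (simp add: lift_snd_def)
next
  show "v = w" if "v \<in> tangent_space P z" "w \<in> tangent_space P z"
    "\<And>f. smooth_near B (fst z) f \<Longrightarrow> v (\<lambda>z. f (fst z)) = w (\<lambda>z. f (fst z))"
    "\<And>h. smooth_near F (snd z) h \<Longrightarrow> v (\<lambda>z. h (snd z)) = w (\<lambda>z. h (snd z))" for v w z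
    by (rule prod_separation[OF that])
  show "prod_metric gB gF z v w = gB (fst z) (tangent_map B fst z v) (tangent_map B fst z w)
    + gF (snd z) (tangent_map F snd z v) (tangent_map F snd z w)" for z v w
    by (simp add: prod_metric_def)
qed

end

section \<open>The Ricci tensor of the warped product\<close>

context smooth_mfd
begin

text \<open>Off the manifold the metrics may differ, also inside the function that
  \<open>X p\<close> differentiates; there only the germ at \<open>p\<close> matters.\<close>

lemma is_levi_civita_cong:
  assumes eq: "\<And>p. p \<in> points M \<Longrightarrow> g p = g' p"
  shows "is_levi_civita M g D \<longleftrightarrow> is_levi_civita M g' D"
proof -
  have "X p (\<lambda>q. g q (Y q) (Z q)) = g p (D X Y p) (Z p) + g p (Y p) (D X Z p) \<longleftrightarrow>
      X p (\<lambda>q. g' q (Y q) (Z q)) = g' p (D X Y p) (Z p) + g' p (Y p) (D X Z p)"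
    if X: "vector_field M U X" and p: "p \<in> U" for U X Y Z p
  proof -
    have "X p (\<lambda>q. g q (Y q) (Z q)) = X p (\<lambda>q. g' q (Y q) (Z q))"
      by (rule tvec_cong[OF vector_field_tangent[OF X p]
            eventually_mono[OF eventually_nhdsin_open[OF vector_field_open[OF X] p]]])
        (use eq openin_points[OF vector_field_open[OF X]] in simp)
    then show ?thesis
      using eq[OF openin_points[OF vector_field_open[OF X] p]] by simp
  qed
  then show ?thesis
    unfolding is_levi_civita_def
    by (intro conj_cong refl all_cong1 imp_cong ball_cong) auto
qed

text \<open>Connection and frame are picked by choice operators. Since the two metrics satisfy the
  same defining predicates, the operators return the same objects, and no uniqueness argument is
  required.\<close>

lemma ricci_cong:
  assumes eq: "\<And>p. p \<in> points M \<Longrightarrow> g p = g' p" and p: "p \<in> points M"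
  shows "ricci M g X Y p = ricci M g' X Y p"
proof -
  have "levi_civita M g = levi_civita M g'"
    using is_levi_civita_cong[of g g'] eq by (simp add: levi_civita_def)
  then have R: "riemann M g = riemann M g'"
    by (intro ext) (simp add: riemann_def Let_def)
  have "orthonormal_at M g q e \<longleftrightarrow> orthonormal_at M g' q e" if "q \<in> points M" for q e
    using eq[OF that] by (simp add: orthonormal_at_def)
  then have "orthonormal_frame M g U E \<longleftrightarrow> orthonormal_frame M g' U E" if "openin (mtop M) U" for U E
    unfolding orthonormal_frame_def using openin_points[OF that] by blast
  then have "frame_near M g p = frame_near M g' p"
    unfolding frame_near_def by (intro arg_cong[of _ _ Eps] ext) blast
  then show ?thesis
    using eq[OF p] R by (simp add: ricci_def Let_def)
qed

end

section \<open>Hessian, Laplacian and gradient of multiples and exponentials\<close>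

context metric_mfd
begin

lemma hessian_cmult:
  assumes X: "vector_field M U X" and Y: "vector_field M U Y" and p: "p \<in> U"
    and v: "\<And>q. q \<in> U \<Longrightarrow> smooth_near M q v"
  shows "hessian M g (\<lambda>q. c * v q) X Y p = c * hessian M g v X Y p"
proof -
  have "X p (\<lambda>q. Y q (\<lambda>q. c * v q)) = X p (\<lambda>q. c * Y q v)"
    by (rule tvec_metric_cong[OF vector_field_tangent[OF X p] vector_field_open[OF X] p])
      (rule tvec_cmult[OF vector_field_tangent[OF Y] v])
  also have "\<dots> = c * X p (\<lambda>q. Y q v)"
    by (rule tvec_cmult[OF vector_field_tangent[OF X p] vector_field_smooth[OF Y p v[OF p]]])
  finally show ?thesis
    using tvec_cmult[OF vector_field_tangent[OF lc_field[OF X Y] p] v[OF p]]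
    by (simp add: hessian_def algebra_simps)
qed

lemma laplacian_cmult:
  assumes p: "p \<in> points M" and v: "\<And>q. q \<in> points M \<Longrightarrow> smooth_near M q v"
  shows "laplacian M g (\<lambda>q. c * v q) p = c * laplacian M g v p"
proof -
  obtain U where U: "openin (mtop M) U" "p \<in> U" "orthonormal_frame M g U (frame_near M g p)"
    using frame_near[OF p] .
  note F = orthonormal_frameD(1)[OF U(3)]
  have "hessian M g (\<lambda>q. c * v q) (frame_near M g p i) (frame_near M g p i) p
    = c * hessian M g v (frame_near M g p i) (frame_near M g p i) p" if "i < DIM('e)" for i
    by (rule hessian_cmult[OF F[OF that] F[OF that] U(2)]) (use v openin_points[OF U(1)] in blast)
  then show ?thesis
    by (simp add: laplacian_def Let_def sum_distrib_left mult_ac)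
qed

lemma laplacian_fun_cong:
  assumes p: "p \<in> points M" and eq: "\<And>q. q \<in> points M \<Longrightarrow> v q = w q"
  shows "laplacian M g v p = laplacian M g w p"
proof -
  obtain U where U: "openin (mtop M) U" "p \<in> U" "orthonormal_frame M g U (frame_near M g p)"
    using frame_near[OF p] .
  note F = orthonormal_frameD(1)[OF U(3)]
  have "hessian M g v (frame_near M g p i) (frame_near M g p i) p
    = hessian M g w (frame_near M g p i) (frame_near M g p i) p" if "i < DIM('e)" for i
    by (rule hessian_fun_cong[OF F[OF that] F[OF that] U(2)]) (use eq openin_points[OF U(1)] in blast)
  then show ?thesis
    by (simp add: laplacian_def Let_def)
qed

lemma gradient_inner_cmult:
  assumes p: "p \<in> points M" and v: "smooth_near M p v"
  shows "gradient_inner M g (\<lambda>q. c * v q) w p = c * gradient_inner M g v w p"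
proof -
  obtain U where U: "openin (mtop M) U" "p \<in> U" "orthonormal_frame M g U (frame_near M g p)"
    using frame_near[OF p] .
  have "frame_near M g p i p (\<lambda>q. c * v q) = c * frame_near M g p i p v" if "i < DIM('e)" for i
    by (rule tvec_cmult[OF vector_field_tangent[OF orthonormal_frameD(1)[OF U(3) that] U(2)] v])
  then show ?thesis
    by (simp add: gradient_inner_def Let_def sum_distrib_left mult_ac)
qed

lemma gradient_inner_commute: "gradient_inner M g v w p = gradient_inner M g w v p"
  by (simp add: gradient_inner_def Let_def mult_ac)

end

context conformal_mfd
begin

text \<open>The first derivative carries the exponential as a factor, and differentiating that
  factor once more produces the quadratic term.\<close>

lemma hessian_exp:
  assumes X: "vector_field M U X" and Y: "vector_field M U Y" and p: "p \<in> U"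
  shows "hessian M g (\<lambda>q. exp (c * \<sigma> q)) X Y p
    = exp (c * \<sigma> p) * (c * hessian M g \<sigma> X Y p + c\<^sup>2 * (X p \<sigma> * Y p \<sigma>))"
proof -
  note U = vector_field_open[OF X]
  note TX = vector_field_tangent[OF X p]
  have \<sigma>: "smooth_near M p \<sigma>" and pM: "p \<in> points M"
    using factor_smooth openin_points[OF U p] by blast+
  note Y\<sigma> = vector_field_smooth[OF Y p \<sigma>]
  have "X p (\<lambda>q. Y q (\<lambda>q. exp (c * \<sigma> q))) = X p (\<lambda>q. exp (c * \<sigma> q) * (c * Y q \<sigma>))"
    by (rule tvec_metric_cong[OF TX U p]) (rule exp_factor_deriv[OF vector_field_tangent[OF Y]])
  also have "\<dots> = exp (c * \<sigma> p) * (c * X p \<sigma>) * (c * Y p \<sigma>) + exp (c * \<sigma> p) * (c * X p (\<lambda>q. Y q \<sigma>))"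
    unfolding tvec_mult[OF TX exp_factor_smooth[OF pM] smooth_near_mult[OF smooth_near_const[OF pM] Y\<sigma>]]
      exp_factor_deriv[OF TX] tvec_cmult[OF TX Y\<sigma>] ..
  finally show ?thesis
    using exp_factor_deriv[OF vector_field_tangent[OF lc_field[OF X Y] p], of c]
    by (simp add: hessian_def power2_eq_square algebra_simps)
qed

lemma laplacian_exp:
  assumes p: "p \<in> points M"
  shows "laplacian M g (\<lambda>q. exp (c * \<sigma> q)) p
    = exp (c * \<sigma> p) * (c * laplacian M g \<sigma> p + c\<^sup>2 * gradient_inner M g \<sigma> \<sigma> p)"
proof -
  obtain U where U: "openin (mtop M) U" "p \<in> U" "orthonormal_frame M g U (frame_near M g p)"
    using frame_near[OF p] .
  note F = orthonormal_frameD(1)[OF U(3)]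
  let ?E = "frame_near M g p"
  have "laplacian M g (\<lambda>q. exp (c * \<sigma> q)) p = (\<Sum>i<DIM('e). exp (c * \<sigma> p) *
    (c * (g p (?E i p) (?E i p) * hessian M g \<sigma> (?E i) (?E i) p)
      + c\<^sup>2 * (g p (?E i p) (?E i p) * (?E i p \<sigma> * ?E i p \<sigma>))))"
    unfolding laplacian_def Let_def
    by (intro sum.cong refl) (simp add: hessian_exp[OF F F U(2)] algebra_simps)
  then show ?thesis
    by (simp only: laplacian_def gradient_inner_def Let_def sum.distrib sum_distrib_left[symmetric])
qed

end

section \<open>The warped product as a conformal change of a direct product\<close>

locale warped_product = B: metric_mfd B gB + F: metric_mfd F gF
  for B :: "('b, 'm::euclidean_space) mfd" and gB :: "'b metric"
    and F :: "('f, 'k::euclidean_space) mfd" and gF :: "'f metric" +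
  fixes \<psi> :: "'b \<Rightarrow> real" and \<mu> :: real
  assumes \<psi>_smooth: "p \<in> points B \<Longrightarrow> smooth_near B p \<psi>" and \<psi>_pos: "p \<in> points B \<Longrightarrow> \<psi> p > 0"
begin

definition L :: "'b \<Rightarrow> real" where "L p = ln (\<psi> p)"

lemma L_smooth: "p \<in> points B \<Longrightarrow> smooth_near B p L"
  unfolding L_def using \<psi>_pos by (intro B.smooth_near_compose[OF \<psi>_smooth Cinf_on_ln]) auto

lemma powr_eq_exp: "p \<in> points B \<Longrightarrow> \<psi> p powr a = exp (a * L p)"
  using \<psi>_pos[of p] by (simp add: powr_def L_def)

text \<open>This interpretation serves to apply \<open>hessian_exp\<close> and
  \<open>laplacian_exp\<close> to the powers of \<psi>, which are exponentials of multiples of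
  \<open>L\<close>; the metric that it rescales by \<open>L\<close> does not occur.\<close>

sublocale BL: conformal_mfd B gB L
  by unfold_locales (rule L_smooth)

definition base_factor :: "'b \<Rightarrow> real" where "base_factor p = (\<mu> - 1) * L p"

sublocale Bc: conformal_mfd B gB base_factor
  unfolding base_factor_def
  by unfold_locales (intro B.smooth_near_mult B.smooth_near_const L_smooth)

sublocale prod_smooth B F ..

sublocale split: split_mfd "prod_mfd B F" "prod_metric (conformal base_factor gB) gF" B "conformal base_factor gB"
  F gF fst snd "lift_fst B F" "lift_snd B F"
  by (rule prod_split_mfd) unfold_locales

sublocale Pc: conformal_mfd "prod_mfd B F" "prod_metric (conformal base_factor gB) gF" "\<lambda>z. L (fst z)"
proof unfold_locales
  show "smooth_near (prod_mfd B F) z (\<lambda>z. L (fst z))" if "z \<in> points (prod_mfd B F)" for z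
    using split.pullback1[OF that L_smooth[OF split.projection1[OF that]]] .
qed

lemma warped_metric_conformal:
  assumes z: "z \<in> points (prod_mfd B F)"
  shows "warped_metric B gB F gF \<psi> \<mu> z
    = conformal (\<lambda>z. L (fst z)) (prod_metric (conformal base_factor gB) gF) z"
proof (intro ext)
  fix v w
  have p: "fst z \<in> points B"
    by (rule split.projection1[OF z])
  have "\<psi> (fst z) powr (2 * \<mu>) = exp (2 * L (fst z)) * exp (2 * base_factor (fst z))"
    unfolding powr_eq_exp[OF p] exp_add[symmetric] base_factor_def by (simp add: algebra_simps)
  moreover have "(\<psi> (fst z))\<^sup>2 = exp (2 * L (fst z))"
    using \<psi>_pos[OF p] by (simp add: L_def exp_double)
  ultimately show "warped_metric B gB F gF \<psi> \<mu> z v w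
    = conformal (\<lambda>z. L (fst z)) (prod_metric (conformal base_factor gB) gF) z v w"
    by (simp add: warped_metric_def conformal_def prod_metric_def algebra_simps)
qed

lemma ricci_warped: "z \<in> points (prod_mfd B F) \<Longrightarrow> ricci (prod_mfd B F) (warped_metric B gB F gF \<psi> \<mu>) X Y z
    = ricci (prod_mfd B F) (conformal (\<lambda>z. L (fst z)) (prod_metric (conformal base_factor gB) gF)) X Y z"
  by (rule P.ricci_cong[OF warped_metric_conformal])

context
  fixes p q X Y V W
  assumes p: "p \<in> points B" and q: "q \<in> points F"
    and X: "vector_field B (points B) X" and Y: "vector_field B (points B) Y"
    and V: "vector_field F (points F) V" and W: "vector_field F (points F) W"
begin

abbreviation (input) "lap_L \<equiv> laplacian B gB L p"
abbreviation (input) "grad_L \<equiv> gradient_inner B gB L L p"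

private lemma z: "(p, q) \<in> points (prod_mfd B F)"
  using p q by (simp add: points_prod)

private lemma Lp: "smooth_near B (fst (p, q)) L"
  using L_smooth[OF p] by simp

private lemma lifts:
  "vector_field (prod_mfd B F) (points (prod_mfd B F)) (lift_fst B F X)"
  "vector_field (prod_mfd B F) (points (prod_mfd B F)) (lift_fst B F Y)"
  "vector_field (prod_mfd B F) (points (prod_mfd B F)) (lift_snd B F V)"
  "vector_field (prod_mfd B F) (points (prod_mfd B F)) (lift_snd B F W)"
proof -
  have "{z \<in> points (prod_mfd B F). fst z \<in> points B} = points (prod_mfd B F)"
    "{z \<in> points (prod_mfd B F). snd z \<in> points F} = points (prod_mfd B F)"
    by (auto simp: points_prod)
  then show "vector_field (prod_mfd B F) (points (prod_mfd B F)) (lift_fst B F X)"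
    "vector_field (prod_mfd B F) (points (prod_mfd B F)) (lift_fst B F Y)"
    "vector_field (prod_mfd B F) (points (prod_mfd B F)) (lift_snd B F V)"
    "vector_field (prod_mfd B F) (points (prod_mfd B F)) (lift_snd B F W)"
    using split.lift1_field[OF X] split.lift1_field[OF Y] split.lift2_field[OF V] split.lift2_field[OF W]
    by simp_all
qed

private lemma lift_L: "lift_fst B F X (p, q) (\<lambda>z. L (fst z)) = X p L" "lift_fst B F Y (p, q) (\<lambda>z. L (fst z)) = Y p L"
  "lift_snd B F V (p, q) (\<lambda>z. L (fst z)) = 0" "lift_snd B F W (p, q) (\<lambda>z. L (fst z)) = 0"
  using split.lift1_apply[OF X z _ Lp] split.lift1_apply[OF Y z _ Lp] split.lift2_cross[OF V z _ Lp]
    split.lift2_cross[OF W z _ Lp] p q by simp_all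

private lemma base_factor_eqs:
  "X p base_factor = (\<mu> - 1) * X p L" "Y p base_factor = (\<mu> - 1) * Y p L"
  "hessian B gB base_factor X Y p = (\<mu> - 1) * hessian B gB L X Y p"
  "laplacian B gB base_factor p = (\<mu> - 1) * lap_L"
  "gradient_inner B gB base_factor L p = (\<mu> - 1) * grad_L"
  "gradient_inner B gB base_factor base_factor p = (\<mu> - 1) * ((\<mu> - 1) * grad_L)"
proof -
  have eq: "base_factor = (\<lambda>p. (\<mu> - 1) * L p)"
    by (simp add: fun_eq_iff base_factor_def)
  note L = L_smooth[OF p]
  show "X p base_factor = (\<mu> - 1) * X p L" "Y p base_factor = (\<mu> - 1) * Y p L"
    unfolding eq by (rule B.tvec_cmult[OF B.vector_field_tangent[OF _ p] L], fact)+
  show "hessian B gB base_factor X Y p = (\<mu> - 1) * hessian B gB L X Y p"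
    unfolding eq by (rule B.hessian_cmult[OF X Y p L_smooth])
  show "laplacian B gB base_factor p = (\<mu> - 1) * lap_L"
    unfolding eq by (rule B.laplacian_cmult[OF p L_smooth])
  show inner: "gradient_inner B gB base_factor L p = (\<mu> - 1) * grad_L"
    unfolding eq by (rule B.gradient_inner_cmult[OF p L])
  show "gradient_inner B gB base_factor base_factor p = (\<mu> - 1) * ((\<mu> - 1) * grad_L)"
    unfolding inner[symmetric] B.gradient_inner_commute[of base_factor L]
    unfolding eq by (rule B.gradient_inner_cmult[OF p L])
qed

private lemmas split_eqs = split.split_formulas[OF z X Y V W Lp, unfolded fst_conv snd_conv]

private lemma laplacian_base: "laplacian B (conformal base_factor gB) L p
    = exp (- 2 * base_factor p) * (lap_L + (real DIM('m) - 2) * ((\<mu> - 1) * grad_L))"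
  using Bc.laplacian_conformal[OF L_smooth[OF p]] base_factor_eqs(5) by simp

private lemma gradient_base: "gradient_inner B (conformal base_factor gB) L L p = exp (- 2 * base_factor p) * grad_L"
  by (rule Bc.gradient_inner_conformal[OF p])

private lemma dimension: "real DIM('m \<times> 'k) = real DIM('m) + real DIM('k)"
  by simp

text \<open>The coefficients arise by adding the two conformal changes, in dimensions m and m + k.
  For the Hessian, (m - 2) (\<mu> - 1) + (m + k - 2) = (m - 2) \<mu> + k. For dL dL, (m - 2) (\<mu>
  - 1)^2 + (m + k - 2) (2 \<mu> - 1), where 2 (\<mu> - 1) comes from the change of the Hessian of L
  on the base.\<close>

lemma ricci_warped_base:
  "ricci (prod_mfd B F) (warped_metric B gB F gF \<psi> \<mu>) (lift_fst B F X) (lift_fst B F Y) (p, q)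
    = ricci B gB X Y p - ((real DIM('m) - 2) * \<mu> + real DIM('k)) * hessian B gB L X Y p
      + (\<mu> * ((real DIM('m) - 2) * \<mu> + real DIM('k)) + real DIM('k) * (\<mu> - 1)) * (X p L * Y p L)
      - \<mu> * (lap_L + ((real DIM('m) - 2) * \<mu> + real DIM('k)) * grad_L) * gB p (X p) (Y p)"
proof -
  have c: "conformal base_factor gB p (X p) (Y p) = exp (2 * base_factor p) * gB p (X p) (Y p)"
    by (simp add: conformal_def)
  \<comment> \<open>Laplacian and squared gradient on the rescaled base carry the inverse of the
    factor that its metric carries, so on base directions nothing of it remains.\<close>
  have e: "exp (- 2 * base_factor p) * a * (exp (2 * base_factor p) * b) = a * b" for a b
    by (simp add: exp_minus)
  have "ricci (prod_mfd B F) (warped_metric B gB F gF \<psi> \<mu>) (lift_fst B F X) (lift_fst B F Y) (p, q)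
    = ricci B (conformal base_factor gB) X Y p
      - (real DIM('m) + real DIM('k) - 2) * (hessian B (conformal base_factor gB) L X Y p - X p L * Y p L)
      - exp (- 2 * base_factor p) * (lap_L + (real DIM('m) - 2) * ((\<mu> - 1) * grad_L)
          + (real DIM('m) + real DIM('k) - 2) * grad_L) * (exp (2 * base_factor p) * gB p (X p) (Y p))"
    unfolding ricci_warped[OF z] Pc.ricci_conformal[OF lifts(1,2) z] split_eqs lift_L laplacian_base gradient_base
      dimension c by (simp add: algebra_simps)
  also have "\<dots> = ricci B (conformal base_factor gB) X Y p
      - (real DIM('m) + real DIM('k) - 2) * (hessian B (conformal base_factor gB) L X Y p - X p L * Y p L)
      - (lap_L + (real DIM('m) - 2) * ((\<mu> - 1) * grad_L)
          + (real DIM('m) + real DIM('k) - 2) * grad_L) * gB p (X p) (Y p)"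
    unfolding e ..
  finally show ?thesis
    unfolding Bc.ricci_conformal[OF X Y p] Bc.hessian_conformal[OF X Y p] base_factor_eqs
    by (simp add: algebra_simps)
qed

text \<open>Every term of the conformal formula vanishes: Ricci tensor, Hessian and metric of the
  direct product are zero on mixed pairs, and fibre directions annihilate L.\<close>

lemma ricci_warped_mixed:
  "ricci (prod_mfd B F) (warped_metric B gB F gF \<psi> \<mu>) (lift_fst B F X) (lift_snd B F V) (p, q) = 0"
  unfolding ricci_warped[OF z] Pc.ricci_conformal[OF lifts(1,3) z] split_eqs lift_L by simp

text \<open>Here the factor of the rescaled base survives, because the metric of the fibre is not
  rescaled in the direct product; it is the power of \<psi> with exponent -2 (\<mu> - 1).\<close>

lemma ricci_warped_fiber:
  "ricci (prod_mfd B F) (warped_metric B gB F gF \<psi> \<mu>) (lift_snd B F V) (lift_snd B F W) (p, q)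
    = ricci F gF V W q - exp (- 2 * base_factor p)
        * (lap_L + ((real DIM('m) - 2) * \<mu> + real DIM('k)) * grad_L) * gF q (V q) (W q)"
proof -
  \<comment> \<open>The formula for the first factor with the factors exchanged; a constant serves
    as the function on the fibre that it asks for.\<close>
  have fiber: "ricci (prod_mfd B F) (prod_metric (conformal base_factor gB) gF) (lift_snd B F V) (lift_snd B F W) (p, q)
      = ricci F gF V W q"
    using split_mfd.split_formulas(1)[OF split.swapped z V W X Y F.smooth_near_const] q by simp
  show ?thesis
    unfolding ricci_warped[OF z] Pc.ricci_conformal[OF lifts(3,4) z] split_eqs lift_L laplacian_base gradient_base
      dimension fiber by (simp add: algebra_simps)
qed

end

end

theorem theorem4p1:
  fixes B :: "('b, 'm::euclidean_space) mfd" and gB :: "'b metric"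
    and F :: "('f, 'k::euclidean_space) mfd" and gF :: "'f metric"
    and m k :: nat
    and \<mu> \<mu>bar \<mu>bar_plus \<mu>bar_minus \<alpha>\<Delta> \<beta>\<Delta> \<alpha>H \<beta>H :: real
    and \<psi> :: "'b \<Rightarrow> real" and g :: "('b \<times> 'f) metric"
  assumes "pseudo_riemannian_manifold B gB" and "m = DIM('m)" and "m \<ge> 3"
    and "pseudo_riemannian_manifold F gF" and "k = DIM('k)" and "k \<ge> 1"
    and "\<mu>bar = - (real k / (real m - 2))"
    and "\<mu>bar_plus = \<mu>bar + sqrt (\<mu>bar\<^sup>2 - \<mu>bar)"
    and "\<mu>bar_minus = \<mu>bar - sqrt (\<mu>bar\<^sup>2 - \<mu>bar)"
    and "\<mu> \<notin> {0, 1, \<mu>bar, \<mu>bar_plus, \<mu>bar_minus}"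
    and "smooth_fun B (points B) \<psi>" and "\<forall>p\<in>points B. \<psi> p > 0"
    and "g = warped_metric B gB F gF \<psi> \<mu>"
    and "\<alpha>\<Delta> = 1 / ((real m - 2) * \<mu> + real k)"
    and "\<beta>\<Delta> = \<mu> / ((real m - 2) * \<mu> + real k)"
    and "\<alpha>H = - ((real m - 2) * \<mu> + real k) /
               (\<mu> * ((real m - 2) * \<mu> + real k) + real k * (\<mu> - 1))"
    and "\<beta>H = ((real m - 2) * \<mu> + real k)\<^sup>2 /
               (\<mu> * ((real m - 2) * \<mu> + real k) + real k * (\<mu> - 1))"
  shows "(\<forall>X Y. vector_field B (points B) X \<and> vector_field B (points B) Y \<longrightarrow>
            (\<forall>p\<in>points B. \<forall>q\<in>points F.
              ricci (prod_mfd B F) g (lift_fst B F X) (lift_fst B F Y) (p, q) =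
                ricci B gB X Y p
                + \<beta>H * (1 / \<psi> p powr (1 / \<alpha>H)) * hessian B gB (\<lambda>x. \<psi> x powr (1 / \<alpha>H)) X Y p
                - \<beta>\<Delta> * (1 / \<psi> p powr (1 / \<alpha>\<Delta>)) * laplacian B gB (\<lambda>x. \<psi> x powr (1 / \<alpha>\<Delta>)) p
                    * gB p (X p) (Y p))) \<and>
         (\<forall>X V. vector_field B (points B) X \<and> vector_field F (points F) V \<longrightarrow>
            (\<forall>p\<in>points B. \<forall>q\<in>points F.
              ricci (prod_mfd B F) g (lift_fst B F X) (lift_snd B F V) (p, q) = 0)) \<and>
         (\<forall>V W. vector_field F (points F) V \<and> vector_field F (points F) W \<longrightarrow>
            (\<forall>p\<in>points B. \<forall>q\<in>points F.
              ricci (prod_mfd B F) g (lift_snd B F V) (lift_snd B F W) (p, q) =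
                ricci F gF V W q
                - (1 / \<psi> p powr (2 * (\<mu> - 1))) * (\<beta>\<Delta> / \<mu>) * (1 / \<psi> p powr (1 / \<alpha>\<Delta>))
                    * laplacian B gB (\<lambda>x. \<psi> x powr (1 / \<alpha>\<Delta>)) p * gF q (V q) (W q)))"
proof -
  interpret B: metric_mfd B gB
    by (rule pseudo_riemannian_metric_mfd[OF assms(1)])
  interpret F: metric_mfd F gF
    by (rule pseudo_riemannian_metric_mfd[OF assms(4)])
  interpret warped_product B gB F gF \<psi> \<mu>
    by unfold_locales (use assms(11,12) in \<open>auto simp: B.smooth_fun_iff\<close>)
  \<comment> \<open>The reciprocal of \<open>\<alpha>\<Delta>\<close>, which is the Hessian
    coefficient up to sign; \<open>D\<close> is the coefficient of the quadratic term. All four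
    constants of the statement are expressed through them and \<mu>.\<close>
  define A where "A = (real m - 2) * \<mu> + real k"
  define D where "D = \<mu> * A + real k * (\<mu> - 1)"
  have m2: "real m - 2 > 0"
    using assms(3) by simp
  have \<mu>: "\<mu> \<noteq> 0" "\<mu> \<noteq> \<mu>bar" "\<mu> \<noteq> \<mu>bar_plus" "\<mu> \<noteq> \<mu>bar_minus"
    using assms(10) by auto
  have k\<mu>: "real k = - \<mu>bar * (real m - 2)"
    using m2 assms(7) by simp
  \<comment> \<open>Since k = -\<mu>bar (m - 2), the excluded value \<mu>bar is exactly the zero of
    \<open>A\<close>.\<close>
  have "A = (real m - 2) * (\<mu> - \<mu>bar)"
    by (simp add: A_def k\<mu> algebra_simps)
  then have A0: "A \<noteq> 0"
    using \<mu>(2) m2 by simp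
  \<comment> \<open>Completing the square, a zero of \<open>D\<close> has distance
    \<open>sqrt (\<mu>bar\<^sup>2 - \<mu>bar)\<close> from \<mu>bar, so it is one of the two
    excluded values. The root is meaningful in this case because its argument is then a
    square.\<close>
  have D0: "D \<noteq> 0"
  proof
    assume "D = 0"
    moreover have "D = (real m - 2) * (\<mu>\<^sup>2 - 2 * \<mu>bar * \<mu> + \<mu>bar)"
      unfolding D_def A_def k\<mu> by (simp add: algebra_simps power2_eq_square)
    ultimately have "\<mu>\<^sup>2 - 2 * \<mu>bar * \<mu> + \<mu>bar = 0"
      using m2 by simp
    then have "(\<mu> - \<mu>bar)\<^sup>2 = \<mu>bar\<^sup>2 - \<mu>bar"
      by (simp add: power2_eq_square algebra_simps)
    then have "\<bar>\<mu> - \<mu>bar\<bar> = sqrt (\<mu>bar\<^sup>2 - \<mu>bar)"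
      by (metis real_sqrt_abs)
    then show False
      using \<mu>(3,4) assms(8,9) by linarith
  qed
  have \<Delta>: "1 / \<alpha>\<Delta> = A" "\<beta>\<Delta> = \<mu> / A"
    using assms(14,15) by (simp_all add: A_def)
  have "\<alpha>H = - A / D"
    using assms(16) by (simp only: A_def D_def)
  moreover have "\<beta>H = A\<^sup>2 / D"
    using assms(17) by (simp only: A_def D_def)
  ultimately have H: "1 / \<alpha>H = - (D / A)" "\<beta>H = A\<^sup>2 / D"
    by simp_all
  \<comment> \<open>With exponent \<open>A\<close> the quadratic term gets the weight
    \<open>A\<close> relative to the Laplacian of L, as in the Ricci formulas; the outer factor
    \<open>A\<close> cancels the denominator of \<open>\<beta>\<Delta>\<close>.\<close>
  have lap: "1 / \<psi> p powr (1 / \<alpha>\<Delta>) * laplacian B gB (\<lambda>x. \<psi> x powr (1 / \<alpha>\<Delta>)) p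
      = A * (laplacian B gB L p + A * gradient_inner B gB L L p)" if p: "p \<in> points B" for p
  proof -
    have "laplacian B gB (\<lambda>x. \<psi> x powr A) p = laplacian B gB (\<lambda>x. exp (A * L x)) p"
      by (rule B.laplacian_fun_cong[OF p powr_eq_exp])
    then show ?thesis
      unfolding \<Delta> powr_eq_exp[OF p] by (simp add: BL.laplacian_exp[OF p] power2_eq_square algebra_simps)
  qed
  \<comment> \<open>The exponent s = -D / A and the weight A^2 / D are the solution of weight * s =
    -A and weight * s^2 = D, the two coefficients required on the base.\<close>
  have hess: "\<beta>H * (1 / \<psi> p powr (1 / \<alpha>H)) * hessian B gB (\<lambda>x. \<psi> x powr (1 / \<alpha>H)) X Y p
      = D * (X p L * Y p L) - A * hessian B gB L X Y p"
    if X: "vector_field B (points B) X" and Y: "vector_field B (points B) Y" and p: "p \<in> points B" for X Y p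
  proof -
    have "hessian B gB (\<lambda>x. \<psi> x powr (- (D / A))) X Y p = hessian B gB (\<lambda>x. exp (- (D / A) * L x)) X Y p"
      by (rule B.hessian_fun_cong[OF X Y p powr_eq_exp])
    then have "\<beta>H * (1 / \<psi> p powr (1 / \<alpha>H)) * hessian B gB (\<lambda>x. \<psi> x powr (1 / \<alpha>H)) X Y p
      = A\<^sup>2 / D * (- (D / A) * hessian B gB L X Y p + (- (D / A))\<^sup>2 * (X p L * Y p L))"
      unfolding H powr_eq_exp[OF p] BL.hessian_exp[OF X Y p, symmetric] by (simp only: BL.hessian_exp[OF X Y p]) simp
    also have "\<dots> = A\<^sup>2 / D * (- (D / A)) * hessian B gB L X Y p + A\<^sup>2 / D * (- (D / A))\<^sup>2 * (X p L * Y p L)"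
      by (simp only: distrib_left mult.assoc)
    also have "A\<^sup>2 / D * (- (D / A)) = - A"
      using A0 D0 by (simp add: power2_eq_square)
    also have "A\<^sup>2 / D * (- (D / A))\<^sup>2 = D"
      using A0 D0 by (simp add: power2_eq_square)
    finally show ?thesis
      by simp
  qed
  show ?thesis
  proof (intro conjI allI impI ballI; elim conjE)
    fix X Y p q
    assume X: "vector_field B (points B) X" and Y: "vector_field B (points B) Y" and p: "p \<in> points B" and q: "q \<in> points F"
    \<comment> \<open>The warped formulas are stated for fields on both factors at once; the zero
      field stands in for those on the fibre.\<close>
    have zero: "vector_field F (points F) (\<lambda>q f. 0)"
      by (intro F.vector_field_zero) simp
    have "\<beta>\<Delta> * (1 / \<psi> p powr (1 / \<alpha>\<Delta>)) * laplacian B gB (\<lambda>x. \<psi> x powr (1 / \<alpha>\<Delta>)) p * gB p (X p) (Y p)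
      = \<beta>\<Delta> * A * (laplacian B gB L p + A * gradient_inner B gB L L p) * gB p (X p) (Y p)"
      unfolding mult.assoc[of \<beta>\<Delta>] lap[OF p] ..
    also have "\<beta>\<Delta> * A = \<mu>"
      using A0 \<Delta>(2) by simp
    finally show "ricci (prod_mfd B F) g (lift_fst B F X) (lift_fst B F Y) (p, q) =
        ricci B gB X Y p
        + \<beta>H * (1 / \<psi> p powr (1 / \<alpha>H)) * hessian B gB (\<lambda>x. \<psi> x powr (1 / \<alpha>H)) X Y p
        - \<beta>\<Delta> * (1 / \<psi> p powr (1 / \<alpha>\<Delta>)) * laplacian B gB (\<lambda>x. \<psi> x powr (1 / \<alpha>\<Delta>)) p * gB p (X p) (Y p)"
      using ricci_warped_base[OF p q X Y zero zero] hess[OF X Y p] unfolding assms(13)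
      by (simp add: A_def D_def assms(2,5))
  next
    fix X V p q
    assume X: "vector_field B (points B) X" and V: "vector_field F (points F) V" and p: "p \<in> points B" and q: "q \<in> points F"
    show "ricci (prod_mfd B F) g (lift_fst B F X) (lift_snd B F V) (p, q) = 0"
      unfolding assms(13) by (rule ricci_warped_mixed[OF p q X X V V])
  next
    fix V W p q
    assume V: "vector_field F (points F) V" and W: "vector_field F (points F) W" and p: "p \<in> points B" and q: "q \<in> points F"
    have zero: "vector_field B (points B) (\<lambda>q f. 0)"
      by (intro B.vector_field_zero) simp
    have "1 / \<psi> p powr (2 * (\<mu> - 1)) * (\<beta>\<Delta> / \<mu>) * (1 / \<psi> p powr (1 / \<alpha>\<Delta>))
        * laplacian B gB (\<lambda>x. \<psi> x powr (1 / \<alpha>\<Delta>)) p * gF q (V q) (W q)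
      = 1 / \<psi> p powr (2 * (\<mu> - 1)) * (\<beta>\<Delta> / \<mu> * A) * (laplacian B gB L p + A * gradient_inner B gB L L p) * gF q (V q) (W q)"
      unfolding mult.assoc[of "1 / \<psi> p powr (2 * (\<mu> - 1)) * (\<beta>\<Delta> / \<mu>)"] lap[OF p] by (simp only: mult.assoc)
    also have "\<beta>\<Delta> / \<mu> * A = 1"
      using A0 \<mu>(1) \<Delta>(2) by simp
    finally have eq: "1 / \<psi> p powr (2 * (\<mu> - 1)) * (\<beta>\<Delta> / \<mu>) * (1 / \<psi> p powr (1 / \<alpha>\<Delta>))
        * laplacian B gB (\<lambda>x. \<psi> x powr (1 / \<alpha>\<Delta>)) p * gF q (V q) (W q)
      = 1 / \<psi> p powr (2 * (\<mu> - 1)) * 1 * (laplacian B gB L p + A * gradient_inner B gB L L p) * gF q (V q) (W q)" .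
    \<comment> \<open>The power of \<psi> in the fibre formula is the inverse of the factor by which
      the base was rescaled.\<close>
    have factor: "1 / \<psi> p powr (2 * (\<mu> - 1)) = exp (- 2 * base_factor p)"
      unfolding powr_eq_exp[OF p] by (simp add: base_factor_def exp_minus inverse_eq_divide mult.assoc)
    show "ricci (prod_mfd B F) g (lift_snd B F V) (lift_snd B F W) (p, q) =
        ricci F gF V W q
        - (1 / \<psi> p powr (2 * (\<mu> - 1))) * (\<beta>\<Delta> / \<mu>) * (1 / \<psi> p powr (1 / \<alpha>\<Delta>))
            * laplacian B gB (\<lambda>x. \<psi> x powr (1 / \<alpha>\<Delta>)) p * gF q (V q) (W q)"
      unfolding assms(13) eq unfolding factor ricci_warped_fiber[OF p q zero zero V W] by (simp add: A_def assms(2,5))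
  qed
qed

end
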